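(* Let $\mathbb{F}$ be a field of characteristic $0$, let $G$ be an additive subgroup of $\mathbb{F}$, and let $\succ$ be a total order on $G$ compatible with its group structure. Let $\mathcal{B}(G)$ be the Lie algebra of Block type and, for $\Lambda\in\mathcal{B}(G)_0^*$, let $M(\Lambda,\succ)$ be the Verma $\mathcal{B}(G)$-module with highest weight vector $v_\Lambda$, all as defined in the context. Then: (1) An irreducible highest weight $\mathcal{B}(\mathbb{Z})$-module (with respect to the usual order on $\mathbb{Z}$) is quasifinite if and only if it is a proper quotient of a Verma module, i.e. isomorphic to $M(\Lambda,>)/N$ for some $\Lambda\in\mathcal{B}(\mathbb{Z})_0^*$ and some nonzero submodule $N$. (2) Suppose the order $\succ$ on $G$ is dense, and let $\Lambda\in\mathcal{B}(G)_0^*$. Then $M(\Lambda,\succ)$ is an irreducible $\mathcal{B}(G)$-module if and only if $\Lambda\neq 0$. Moreover, in the case $\Lambda=0$, set $$M'(0,\succ)=\sum_{k>0,\ \alpha_1,\dots,\alpha_k\in G_+,\ i_1,\dots,i_k\ge -1}\mathbb{F}\,L_{-\alpha_1,i_1}\cdots L_{-\alpha_k,i_k}v_0 .$$ Then $M'(0,\succ)$ is an irreducible submodule of $M(0,\succ)$ if and only if for all $x,y\in G_+$ there exists a positive integer $n$ such that $nx\succ y$. (3) Suppose the order $\succ$ on $G$ is discrete, and let $a\in G_+$ be such that $\{\beta\in G\mid 0\prec\beta\prec a\}=\emptyset$. Let $\Lambda\in\mathcal{B}(G)_0^*$. Then $M(\Lambda,\succ)$ is an irreducible $\mathcal{B}(G)$-module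 if and only if $M_a(\Lambda,\succ)$ is an irreducible $\mathcal{B}(a\mathbb{Z})$-module.
   Context: Lie algebra: for an additive subgroup $G$ of $\mathbb{F}$, $\mathcal{B}(G)$ is the Lie algebra over $\mathbb{F}$ with basis $\{L_{\alpha,i},\,c\mid \alpha\in G,\ i\in\mathbb{Z},\ i\ge -1\}$ and relations $$[L_{\alpha,i},L_{\beta,j}]=((i+1)\beta-(j+1)\alpha)L_{\alpha+\beta,i+j}+\alpha\,\delta_{\alpha,-\beta}\,\delta_{i+j,-2}\,c,\qquad [c,L_{\alpha,i}]=0$$ (when $i=j=-1$ the coefficient of $L_{\alpha+\beta,-2}$ is $0$, and that term is read as $0$). It is $G$-graded: $\mathcal{B}(G)=\bigoplus_{\alpha\in G}\mathcal{B}(G)_\alpha$ with $\mathcal{B}(G)_\alpha=\mathrm{span}\{L_{\alpha,i}\mid i\ge -1\}+\delta_{\alpha,0}\mathbb{F}c$. The subalgebra $\mathcal{B}(G)_0=\mathrm{span}\{L_{0,i}\mid i\ge-1\}\oplus\mathbb{F}c$ is commutative, and $\mathcal{B}(G)_0^*$ is its dual space. $\mathcal{B}(\mathbb{Z})$ is the case $G=\mathbb{Z}\subset\mathbb{F}$. Orders: $G_+=\{x\in G\mid x\succ 0\}$. For $\alpha\in G_+$ put $B(\alpha)=\{\beta\in G\mid 0\prec\beta\prec\alpha\}$. The order $\succ$ is dense if $B(\alpha)$ is infinite for all $\alpha\in G_+$; it is discrete if $B(a)=\emptyset$ for some $a\in G_+$. Verma modules: let $U$ be the universal enveloping algebra of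 $\mathcal{B}(G)$. For $\Lambda\in\mathcal{B}(G)_0^*$, let $I(\Lambda,\succ)$ be the left ideal of $U$ generated by $\{L_{\alpha,i}\mid\alpha\succ 0,\ i\ge -1\}\cup\{h-\Lambda(h)\cdot 1\mid h\in\mathcal{B}(G)_0\}$. The Verma module is $M(\Lambda,\succ)=U/I(\Lambda,\succ)$, and $v_\Lambda$ denotes the coset of $1$ (so $v_0$ is the highest weight vector for $\Lambda=0$). Highest weight modules: a highest weight $\mathcal{B}(G)$-module of weight $\Lambda$ is a module generated by a nonzero vector $v$ with $L_{\alpha,i}v=0$ for all $\alpha\succ0$, $i\ge-1$, and $hv=\Lambda(h)v$ for all $h\in\mathcal{B}(G)_0$. Quasifinite: a $\mathcal{B}(G)$-module $V$ is quasifinite if it is finitely $G$-graded, i.e. $V=\bigoplus_{\alpha\in G}V_\alpha$ with $\mathcal{B}(G)_\alpha V_\beta\subset V_{\alpha+\beta}$ and $\dim V_\alpha<\infty$ for all $\alpha,\beta\in G$. For $a\in G$: $\mathcal{B}(a\mathbb{Z})=\mathrm{span}\{L_{na,k},\,c\mid n\in\mathbb{Z},\ k\ge-1\}$, a subalgebra of $\mathcal{B}(G)$; $M_a(\Lambda,\succ)$ is the $\mathcal{B}(a\mathbb{Z})$-submodule of $M(\Lambda,\succ)$ generated by $v_\Lambda$.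
   Formalization: In part (2) the group G is assumed to be nonzero: for G = {0} the order is vacuously dense, M(0) is one-dimensional and hence irreducible, and M'(0) = 0 is not irreducible, so both equivalences fail there. *)

theory Defs
  imports
    "HOL-Library.Poly_Mapping"
    "HOL-Library.FuncSet"
    "HOL-Algebra.Module"
    "HOL-Algebra.QuotRing"
    "HOL-Algebra.Algebraic_Closure_Type"
begin

text \<open>The ground field is a type \<open>'f\<close> of class \<^class>\<open>field_char_0\<close>; this is the same field as a
  carrier-based ring, so that vector spaces over it are modules in the sense of HOL-Algebra.\<close>

abbreviation base_field :: "'f::field_char_0 ring" where
  "base_field \<equiv> ring_of_type_algebra"


section \<open>Ordered subgroups\<close>

definition compatible_order :: "'f::field_char_0 set \<Rightarrow> ('f \<Rightarrow> 'f \<Rightarrow> bool) \<Rightarrow> bool" where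
  "compatible_order G gt \<longleftrightarrow>
     irreflp_on G gt \<and> transp_on G gt \<and> totalp_on G gt \<and>
     (\<forall>x\<in>G. \<forall>y\<in>G. \<forall>z\<in>G. gt x y \<longrightarrow> gt (x + z) (y + z))"

definition pos_part :: "'f::field_char_0 set \<Rightarrow> ('f \<Rightarrow> 'f \<Rightarrow> bool) \<Rightarrow> 'f set" where
  "pos_part G gt = {x \<in> G. gt x 0}"

definition pos_below :: "'f::field_char_0 set \<Rightarrow> ('f \<Rightarrow> 'f \<Rightarrow> bool) \<Rightarrow> 'f \<Rightarrow> 'f set" where
  "pos_below G gt \<alpha> = {\<beta> \<in> G. gt \<beta> 0 \<and> gt \<alpha> \<beta>}"

definition dense_order :: "'f::field_char_0 set \<Rightarrow> ('f \<Rightarrow> 'f \<Rightarrow> bool) \<Rightarrow> bool" where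
  "dense_order G gt \<longleftrightarrow> (\<forall>\<alpha>\<in>pos_part G gt. infinite (pos_below G gt \<alpha>))"

text \<open>The usual order on \<open>\<int>\<close>, where \<open>\<int>\<close> is viewed inside the ground field.\<close>

definition int_gt :: "'f::field_char_0 \<Rightarrow> 'f \<Rightarrow> bool" where
  "int_gt x y \<longleftrightarrow> (\<exists>m n :: int. x = of_int m \<and> y = of_int n \<and> m > n)"

definition int_multiples :: "'f::field_char_0 \<Rightarrow> 'f set" where
  "int_multiples a = {of_int n * a | n. True}"


section \<open>The Lie algebras of Block type\<close>

datatype 'f block_basis = L 'f int | C

text \<open>The Lie algebra \<open>\<B>(G)\<close> is the set \<open>block_algebra G\<close> of those finite linear combinations that
  involve only \<open>C\<close> and the \<open>L \<alpha> i\<close> with \<open>\<alpha> \<in> G\<close> and \<open>i \<ge> -1\<close>. One bracket serves all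
  \<open>G\<close>; in particular \<open>block_algebra (int_multiples a)\<close> is literally a subalgebra of
  \<open>block_algebra G\<close> when \<open>a \<in> G\<close>.\<close>

type_synonym 'f block_vec = "'f block_basis \<Rightarrow>\<^sub>0 'f"

definition block_index :: "'f::field_char_0 set \<Rightarrow> 'f block_basis set" where
  "block_index G = {L \<alpha> i | \<alpha> i. \<alpha> \<in> G \<and> i \<ge> -1} \<union> {C}"

definition block_algebra :: "'f::field_char_0 set \<Rightarrow> 'f block_vec set" where
  "block_algebra G = {x. Poly_Mapping.keys x \<subseteq> block_index G}"

abbreviation pm_scale :: "'f::field_char_0 \<Rightarrow> ('b \<Rightarrow>\<^sub>0 'f) \<Rightarrow> ('b \<Rightarrow>\<^sub>0 'f)" where
  "pm_scale a x \<equiv> Poly_Mapping.map ((*) a) x"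

abbreviation basis_L :: "'f::field_char_0 \<Rightarrow> int \<Rightarrow> 'f block_vec" where
  "basis_L \<alpha> i \<equiv> Poly_Mapping.single (L \<alpha> i) 1"

text \<open>For \<open>i = j = -1\<close> the coefficient of \<open>L (\<alpha> + \<beta>) (-2)\<close> is \<open>0\<close>, so \<open>block_algebra G\<close> is closed
  under the bracket.\<close>

fun basis_bracket :: "'f::field_char_0 block_basis \<Rightarrow> 'f block_basis \<Rightarrow> 'f block_vec" where
  "basis_bracket (L \<alpha> i) (L \<beta> j) =
     Poly_Mapping.single (L (\<alpha> + \<beta>) (i + j)) (of_int (i + 1) * \<beta> - of_int (j + 1) * \<alpha>) +
     Poly_Mapping.single C (if \<alpha> = - \<beta> \<and> i + j = -2 then \<alpha> else 0)"
| "basis_bracket C _ = 0"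
| "basis_bracket _ C = 0"

definition bracket :: "'f::field_char_0 block_vec \<Rightarrow> 'f block_vec \<Rightarrow> 'f block_vec" where
  "bracket x y = (\<Sum>s\<in>Poly_Mapping.keys x. \<Sum>t\<in>Poly_Mapping.keys y.
     pm_scale (Poly_Mapping.lookup x s * Poly_Mapping.lookup y t) (basis_bracket s t))"

text \<open>\<open>block_grade \<alpha>\<close> is the homogeneous component \<open>\<B>(G)\<^sub>\<alpha>\<close> for every \<open>G\<close> containing \<open>\<alpha>\<close>.\<close>

definition block_grade :: "'f::field_char_0 \<Rightarrow> 'f block_vec set" where
  "block_grade \<alpha> =
     {x. Poly_Mapping.keys x \<subseteq> {L \<alpha> i | i. i \<ge> -1} \<union> (if \<alpha> = 0 then {C} else {})}"

text \<open>A functional on \<open>\<B>(G)\<^sub>0\<close> is a function that is linear on \<open>block_grade 0\<close>; its values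
  elsewhere are never used.\<close>

definition weights :: "('f::field_char_0 block_vec \<Rightarrow> 'f) set" where
  "weights = {\<Lambda>. (\<forall>x\<in>block_grade 0. \<forall>y\<in>block_grade 0. \<Lambda> (x + y) = \<Lambda> x + \<Lambda> y) \<and>
                  (\<forall>a. \<forall>x\<in>block_grade 0. \<Lambda> (pm_scale a x) = a * \<Lambda> x)}"


section \<open>Modules\<close>

record ('l, 'f, 'v) lie_module = "('f, 'v) module" +
  act :: "'l \<Rightarrow> 'v \<Rightarrow> 'v"

type_synonym ('f, 'v, 'm) block_mod_scheme = "('f block_vec, 'f, 'v, 'm) lie_module_scheme"
type_synonym ('f, 'v) block_mod = "('f block_vec, 'f, 'v) lie_module"

locale block_module = module base_field V
  for G :: "'f::field_char_0 set" and V :: "('f, 'v, 'm) block_mod_scheme" (structure) +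
  assumes act_closed: "\<lbrakk>x \<in> block_algebra G; v \<in> carrier V\<rbrakk> \<Longrightarrow> act V x v \<in> carrier V"
    and act_add_left: "\<lbrakk>x \<in> block_algebra G; y \<in> block_algebra G; v \<in> carrier V\<rbrakk> \<Longrightarrow>
      act V (x + y) v = act V x v \<oplus> act V y v"
    and act_scale_left: "\<lbrakk>x \<in> block_algebra G; v \<in> carrier V\<rbrakk> \<Longrightarrow>
      act V (pm_scale a x) v = a \<odot> act V x v"
    and act_add_right: "\<lbrakk>x \<in> block_algebra G; v \<in> carrier V; w \<in> carrier V\<rbrakk> \<Longrightarrow>
      act V x (v \<oplus> w) = act V x v \<oplus> act V x w"
    and act_scale_right: "\<lbrakk>x \<in> block_algebra G; v \<in> carrier V\<rbrakk> \<Longrightarrow>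
      act V x (a \<odot> v) = a \<odot> act V x v"
    and act_bracket: "\<lbrakk>x \<in> block_algebra G; y \<in> block_algebra G; v \<in> carrier V\<rbrakk> \<Longrightarrow>
      act V (bracket x y) v = act V x (act V y v) \<ominus> act V y (act V x v)"

definition block_submodule ::
    "'f::field_char_0 set \<Rightarrow> 'v set \<Rightarrow> ('f, 'v, 'm) block_mod_scheme \<Rightarrow> bool" where
  "block_submodule G N V \<longleftrightarrow>
     submodule N base_field V \<and> (\<forall>x\<in>block_algebra G. \<forall>v\<in>N. act V x v \<in> N)"

definition generated_submodule ::
    "'f::field_char_0 set \<Rightarrow> ('f, 'v, 'm) block_mod_scheme \<Rightarrow> 'v set \<Rightarrow> 'v set" where
  "generated_submodule G V S = \<Inter>{N. block_submodule G N V \<and> S \<subseteq> N}"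

definition linear_span :: "('f::field_char_0, 'v, 'm) block_mod_scheme \<Rightarrow> 'v set \<Rightarrow> 'v set" where
  "linear_span V S = \<Inter>{N. submodule N base_field V \<and> S \<subseteq> N}"

definition irreducible_module ::
    "'f::field_char_0 set \<Rightarrow> ('f, 'v, 'm) block_mod_scheme \<Rightarrow> bool" where
  "irreducible_module G V \<longleftrightarrow>
     block_module G V \<and> carrier V \<noteq> {\<zero>\<^bsub>V\<^esub>} \<and>
     (\<forall>N. block_submodule G N V \<longrightarrow> N = {\<zero>\<^bsub>V\<^esub>} \<or> N = carrier V)"

definition isomorphic_modules ::
    "'f::field_char_0 set \<Rightarrow> ('f, 'v, 'm) block_mod_scheme \<Rightarrow> ('f, 'w, 'n) block_mod_scheme \<Rightarrow> bool"
  where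
  "isomorphic_modules G V W \<longleftrightarrow>
     (\<exists>\<phi>. bij_betw \<phi> (carrier V) (carrier W) \<and>
       (\<forall>u\<in>carrier V. \<forall>v\<in>carrier V. \<phi> (u \<oplus>\<^bsub>V\<^esub> v) = \<phi> u \<oplus>\<^bsub>W\<^esub> \<phi> v) \<and>
       (\<forall>a. \<forall>v\<in>carrier V. \<phi> (a \<odot>\<^bsub>V\<^esub> v) = a \<odot>\<^bsub>W\<^esub> \<phi> v) \<and>
       (\<forall>x\<in>block_algebra G. \<forall>v\<in>carrier V. \<phi> (act V x v) = act W x (\<phi> v)))"

text \<open>The fields \<open>mult\<close> and \<open>one\<close>, inherited from the ring record underlying HOL-Algebra's modules,
  carry no information for a module.\<close>

definition quotient_module ::
    "('f::field_char_0, 'v, 'm) block_mod_scheme \<Rightarrow> 'v set \<Rightarrow> ('f, 'v set) block_mod" where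
  "quotient_module V N =
     \<lparr>carrier = a_rcosets\<^bsub>V\<^esub> N, monoid.mult = undefined, one = undefined, zero = N, add = set_add V,
      module.smult = (\<lambda>a A. \<Union>v\<in>A. N +>\<^bsub>V\<^esub> (a \<odot>\<^bsub>V\<^esub> v)),
      act = (\<lambda>x A. \<Union>v\<in>A. N +>\<^bsub>V\<^esub> act V x v)\<rparr>"

definition highest_weight_module ::
    "'f::field_char_0 set \<Rightarrow> ('f \<Rightarrow> 'f \<Rightarrow> bool) \<Rightarrow> ('f block_vec \<Rightarrow> 'f) \<Rightarrow>
     ('f, 'v, 'm) block_mod_scheme \<Rightarrow> bool" where
  "highest_weight_module G gt \<Lambda> V \<longleftrightarrow>
     block_module G V \<and>
     (\<exists>v\<in>carrier V. v \<noteq> \<zero>\<^bsub>V\<^esub> \<and> generated_submodule G V {v} = carrier V \<and>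
        (\<forall>\<alpha>\<in>pos_part G gt. \<forall>i\<ge>-1. act V (basis_L \<alpha> i) v = \<zero>\<^bsub>V\<^esub>) \<and>
        (\<forall>h\<in>block_grade 0. act V h v = \<Lambda> h \<odot>\<^bsub>V\<^esub> v))"

text \<open>The grading is arbitrary, not necessarily by weights. Directness of the sum is expressed by
  unique decomposition into finitely many nonzero components.\<close>

definition quasifinite ::
    "'f::field_char_0 set \<Rightarrow> ('f, 'v, 'm) block_mod_scheme \<Rightarrow> bool" where
  "quasifinite G V \<longleftrightarrow>
     block_module G V \<and>
     (\<exists>W :: 'f \<Rightarrow> 'v set.
        (\<forall>\<alpha>\<in>G. submodule (W \<alpha>) base_field V) \<and>
        (\<forall>v\<in>carrier V. \<exists>!w. w \<in> Pi\<^sub>E G W \<and> finite {\<alpha>\<in>G. w \<alpha> \<noteq> \<zero>\<^bsub>V\<^esub>} \<and>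
           v = (\<Oplus>\<^bsub>V\<^esub>\<alpha>\<in>{\<alpha>\<in>G. w \<alpha> \<noteq> \<zero>\<^bsub>V\<^esub>}. w \<alpha>)) \<and>
        (\<forall>\<alpha>\<in>G. \<forall>\<beta>\<in>G. \<forall>x\<in>block_grade \<alpha>. \<forall>v\<in>W \<beta>. act V x v \<in> W (\<alpha> + \<beta>)) \<and>
        (\<forall>\<alpha>\<in>G. \<exists>S. finite S \<and> S \<subseteq> W \<alpha> \<and> linear_span V S = W \<alpha>))"


section \<open>The universal enveloping algebra\<close>

instantiation list :: (type) monoid_add
begin

definition zero_list :: "'a list" where "zero_list = []"

definition plus_list :: "'a list \<Rightarrow> 'a list \<Rightarrow> 'a list" where "plus_list = (@)"

instance
  by standard (simp_all add: zero_list_def plus_list_def)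

end

text \<open>With concatenation as addition on lists, \<^typ>\<open>'b list \<Rightarrow>\<^sub>0 'f\<close> is the monoid algebra of the
  free monoid, i.e. the free associative algebra, and multiplication is concatenation of words.
  The words over a basis form a basis of the tensor algebra of the vector space in question.\<close>

definition block_tensor_algebra ::
    "'f::field_char_0 set \<Rightarrow> ('f block_basis list \<Rightarrow>\<^sub>0 'f) ring" where
  "block_tensor_algebra G =
     \<lparr>carrier = {p. \<forall>w\<in>Poly_Mapping.keys p. set w \<subseteq> block_index G},
      monoid.mult = (*), one = 1, zero = 0, add = (+)\<rparr>"

definition tensor_emb :: "'f::field_char_0 block_vec \<Rightarrow> ('f block_basis list \<Rightarrow>\<^sub>0 'f)" where
  "tensor_emb x = (\<Sum>b\<in>Poly_Mapping.keys x. Poly_Mapping.single [b] (Poly_Mapping.lookup x b))"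

definition env_ideal :: "'f::field_char_0 set \<Rightarrow> ('f block_basis list \<Rightarrow>\<^sub>0 'f) set" where
  "env_ideal G = Idl\<^bsub>block_tensor_algebra G\<^esub>
     {tensor_emb x * tensor_emb y - tensor_emb y * tensor_emb x - tensor_emb (bracket x y) | x y.
        x \<in> block_algebra G \<and> y \<in> block_algebra G}"

definition env_algebra :: "'f::field_char_0 set \<Rightarrow> ('f block_basis list \<Rightarrow>\<^sub>0 'f) set ring" where
  "env_algebra G = block_tensor_algebra G Quot env_ideal G"

definition env_emb ::
    "'f::field_char_0 set \<Rightarrow> 'f block_vec \<Rightarrow> ('f block_basis list \<Rightarrow>\<^sub>0 'f) set" where
  "env_emb G x = env_ideal G +>\<^bsub>block_tensor_algebra G\<^esub> tensor_emb x"

definition env_scalar ::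
    "'f::field_char_0 set \<Rightarrow> 'f \<Rightarrow> ('f block_basis list \<Rightarrow>\<^sub>0 'f) set" where
  "env_scalar G a = env_ideal G +>\<^bsub>block_tensor_algebra G\<^esub> Poly_Mapping.single [] a"

text \<open>The left regular module of the enveloping algebra.\<close>

definition env_module ::
    "'f::field_char_0 set \<Rightarrow> ('f, ('f block_basis list \<Rightarrow>\<^sub>0 'f) set) block_mod" where
  "env_module G =
     \<lparr>carrier = carrier (env_algebra G), monoid.mult = monoid.mult (env_algebra G), one = one (env_algebra G),
      zero = zero (env_algebra G), add = add (env_algebra G),
      module.smult = (\<lambda>a u. env_scalar G a \<otimes>\<^bsub>env_algebra G\<^esub> u),
      act = (\<lambda>x u. env_emb G x \<otimes>\<^bsub>env_algebra G\<^esub> u)\<rparr>"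


section \<open>Verma modules\<close>

locale left_ideal = additive_subgroup I R + ring R for I and R (structure) +
  assumes left_closed: "\<lbrakk>a \<in> I; x \<in> carrier R\<rbrakk> \<Longrightarrow> x \<otimes> a \<in> I"

definition generated_left_ideal :: "('a, 'm) ring_scheme \<Rightarrow> 'a set \<Rightarrow> 'a set" where
  "generated_left_ideal R S = \<Inter>{I. left_ideal I R \<and> S \<subseteq> I}"

definition verma_ideal ::
    "'f::field_char_0 set \<Rightarrow> ('f \<Rightarrow> 'f \<Rightarrow> bool) \<Rightarrow> ('f block_vec \<Rightarrow> 'f) \<Rightarrow>
     ('f block_basis list \<Rightarrow>\<^sub>0 'f) set set" where
  "verma_ideal G gt \<Lambda> = generated_left_ideal (env_algebra G)
     ({env_emb G (basis_L \<alpha> i) | \<alpha> i. \<alpha> \<in> pos_part G gt \<and> i \<ge> -1} \<union>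
      {env_emb G h \<ominus>\<^bsub>env_algebra G\<^esub> env_scalar G (\<Lambda> h) | h. h \<in> block_grade 0})"

definition verma ::
    "'f::field_char_0 set \<Rightarrow> ('f \<Rightarrow> 'f \<Rightarrow> bool) \<Rightarrow> ('f block_vec \<Rightarrow> 'f) \<Rightarrow>
     ('f, ('f block_basis list \<Rightarrow>\<^sub>0 'f) set set) block_mod" where
  "verma G gt \<Lambda> = quotient_module (env_module G) (verma_ideal G gt \<Lambda>)"

definition verma_vec ::
    "'f::field_char_0 set \<Rightarrow> ('f \<Rightarrow> 'f \<Rightarrow> bool) \<Rightarrow> ('f block_vec \<Rightarrow> 'f) \<Rightarrow>
     ('f block_basis list \<Rightarrow>\<^sub>0 'f) set set" where
  "verma_vec G gt \<Lambda> = verma_ideal G gt \<Lambda> +>\<^bsub>env_module G\<^esub> \<one>\<^bsub>env_module G\<^esub>"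

text \<open>The subspace \<open>M'(0, \<succ>)\<close> of \<open>M(0, \<succ>)\<close>.\<close>

definition verma0_prime ::
    "'f::field_char_0 set \<Rightarrow> ('f \<Rightarrow> 'f \<Rightarrow> bool) \<Rightarrow> ('f block_basis list \<Rightarrow>\<^sub>0 'f) set set set" where
  "verma0_prime G gt = linear_span (verma G gt (\<lambda>_. 0))
     {foldr (\<lambda>(\<alpha>, i). act (verma G gt (\<lambda>_. 0)) (basis_L (- \<alpha>) i)) xs (verma_vec G gt (\<lambda>_. 0)) | xs.
        xs \<noteq> [] \<and> (\<forall>(\<alpha>, i)\<in>set xs. \<alpha> \<in> pos_part G gt \<and> i \<ge> -1)}"

text \<open>The \<open>\<B>(a\<int>)\<close>-module \<open>M\<^sub>a(\<Lambda>, \<succ>)\<close>; the ambient module is still \<open>M(\<Lambda>, \<succ>)\<close>.\<close>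

definition verma_sub ::
    "'f::field_char_0 set \<Rightarrow> ('f \<Rightarrow> 'f \<Rightarrow> bool) \<Rightarrow> 'f \<Rightarrow> ('f block_vec \<Rightarrow> 'f) \<Rightarrow>
     ('f, ('f block_basis list \<Rightarrow>\<^sub>0 'f) set set) block_mod" where
  "verma_sub G gt a \<Lambda> = (verma G gt \<Lambda>)
     \<lparr>carrier := generated_submodule (int_multiples a) (verma G gt \<Lambda>) {verma_vec G gt \<Lambda>}\<rparr>"

end

theory Submission
  imports Defs "HOL-Computational_Algebra.Polynomial"
begin

text \<open>Everything happens in an explicit model of the Verma module. Words in the basis letters
  are rewritten by x y = y x + [x, y] until the letters of negative grade stand in front in a fixed
  order; a letter of non-negative grade at the right end is replaced by the scalar by which it acts
  on the highest weight vector. The Jacobi identity makes the result independent of the choices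
  (\<open>exchange\<close>). So the monomials in the negative letters are a basis of a module, and
  this module is M(\<Lambda>, \<succ>) (\<open>univ_map_inj\<close>, \<open>univ_map_surj\<close>).
  Submodules become \<open>stable\<close> subspaces. They are sums of their weight parts, because
  \<open>L 0 0\<close> acts as a constant plus the weight (\<open>comp_stable\<close>). Up to
  monomials with fewer letters, a positive letter acts as a derivation that moves one letter at a
  time (\<open>nf_cons_leading\<close>); the reductions below all compare leading monomials.

  Dense order: raising letters chosen with respect to a very small \<delta> turn a nonzero element
  of a submodule into one with a single monomial of top degree, all of whose indices are -1
  (\<open>dense_reduction\<close>). A letter \<open>L \<beta> j\<close> that leaves room for only
  one letter then gives an element of degree one. Its coefficients are polynomials in
  \<open>j\<close>, and the relevant one has the full degree, so some \<open>j\<close> gives a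
  nonzero result (\<open>dense_lowering\<close>). A second reduction yields
  \<open>L (-\<delta>) (-1)\<close> v in the submodule. Applying the \<open>L \<delta> j\<close> to
  it produces nonzero multiples of all values of \<Lambda>, so v is reached unless \<Lambda> = 0.
  For \<Lambda> = 0 the vectors without constant term form M'. From
  \<open>L (-\<delta>) (-1)\<close> v one gets all \<open>L (-x) i\<close> v with x up to any
  multiple of \<delta>, which is everything in the archimedean case
  (\<open>archimedean_aug\<close>). If x is infinitely small against y, inducing from a larger
  subalgebra that contains the \<open>L (-x) i\<close> gives a quotient that kills
  \<open>L (-x) (-1)\<close> v but not \<open>L (-y) (-1)\<close> v
  (\<open>nonarchimedean_aug\<close>).

  Discrete order: the letters of top degree can all be moved to grade -a
  (\<open>discrete_reduction\<close>). The weight is then a multiple of a, and convexity of these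
  multiples places the whole element in M_a. Conversely a submodule of M_a is stable under all
  non-negative letters, induces a submodule of M(\<Lambda>), and is recovered from it by projection.

  Quasifiniteness: let K be the kernel of the map from the model onto the irreducible module. If K =
  0, then v is homogeneous for any admissible grading and the independent vectors
  \<open>L (-1) i\<close> v lie in one piece (\<open>not_quasifinite_if_injective\<close>). If K is
  not 0, comparing coefficients in \<open>L 1 j\<close> u for all large \<open>j\<close> yields a
  nonzero vector of weight -1 in K (\<open>weight_minus_one_exists\<close>), that is, a polynomial f
  whose coefficients combine the \<open>L (-1) (n - 1)\<close> v. The polynomials giving vectors of
  K in grade -m form an ideal, and these ideals multiply (\<open>gen_step\<close>), so the m-th one
  contains the power f^m. Division by f^m makes the \<open>L (-m) i\<close> v finite-dimensional
  modulo K, and this spreads to all weight spaces (\<open>weight_space_finite\<close>).\<close>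

section \<open>Linear extension of maps on a basis\<close>

abbreviation pm_scale_infix (infixr \<open>\<cdot>\<close> 75) where
  "a \<cdot> x \<equiv> pm_scale a x"

lemma lookup_pm_scale [simp]:
  "Poly_Mapping.lookup (a \<cdot> x) k = a * Poly_Mapping.lookup x k" for a :: "'f::field_char_0"
  by (simp add: Poly_Mapping.map.rep_eq when_def)

interpretation pm: vector_space "pm_scale :: 'f::field_char_0 \<Rightarrow> ('b \<Rightarrow>\<^sub>0 'f) \<Rightarrow> _"
  by standard (auto intro!: poly_mapping_eqI simp: lookup_add algebra_simps)

lemma keys_pm_scale: "Poly_Mapping.keys (a \<cdot> x) \<subseteq> Poly_Mapping.keys x" for a :: "'f::field_char_0"
  by (auto simp: in_keys_iff)

definition lin :: "('a \<Rightarrow> 'b \<Rightarrow>\<^sub>0 'f) \<Rightarrow> ('a \<Rightarrow>\<^sub>0 'f::field_char_0) \<Rightarrow> 'b \<Rightarrow>\<^sub>0 'f" where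
  "lin f u = (\<Sum>z\<in>Poly_Mapping.keys u. Poly_Mapping.lookup u z \<cdot> f z)"

lemma lin_superset:
  assumes "finite A" "Poly_Mapping.keys u \<subseteq> A"
  shows "lin f u = (\<Sum>z\<in>A. Poly_Mapping.lookup u z \<cdot> f z)"
  unfolding lin_def by (rule sum.mono_neutral_left) (use assms in \<open>auto simp: in_keys_iff\<close>)

lemma lin_zero [simp]: "lin f 0 = 0"
  by (simp add: lin_def)

lemma lin_add: "lin f (u + v) = lin f u + lin f v"
proof -
  let ?A = "Poly_Mapping.keys u \<union> Poly_Mapping.keys v"
  have "Poly_Mapping.keys (u + v) \<subseteq> ?A" by (rule keys_add)
  then show ?thesis
    by (simp add: lin_superset[of ?A] lookup_add pm.scale_left_distrib sum.distrib)
qed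

lemma lin_scale: "lin f (a \<cdot> u) = a \<cdot> lin f u"
  by (simp add: lin_superset[of "Poly_Mapping.keys u" "a \<cdot> u"] keys_pm_scale)
     (simp add: lin_def pm.scale_sum_right)

lemma lin_uminus: "lin f (- u) = - lin f u"
  using lin_add[of f u "- u"] by (simp add: eq_neg_iff_add_eq_0 add.commute)

lemma lin_diff: "lin f (u - v) = lin f u - lin f v"
  using lin_add[of f u "- v"] by (simp add: lin_uminus)

lemma lin_sum: "lin f (\<Sum>i\<in>I. u i) = (\<Sum>i\<in>I. lin f (u i))"
  by (induction I rule: infinite_finite_induct) (simp_all add: lin_add)

lemma lin_single [simp]: "lin f (Poly_Mapping.single z a) = a \<cdot> f z"
  by (simp add: lin_def)

lemma lin_cong: "(\<And>z. z \<in> Poly_Mapping.keys u \<Longrightarrow> f z = g z) \<Longrightarrow> lin f u = lin g u"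
  by (simp add: lin_def)

lemma lin_fun_add: "lin (\<lambda>z. f z + g z) u = lin f u + lin g u"
  by (simp add: lin_def pm.scale_right_distrib sum.distrib)

lemma lin_fun_diff: "lin (\<lambda>z. f z - g z) u = lin f u - lin g u"
  by (simp add: lin_def pm.scale_right_diff_distrib sum_subtractf)

lemma lin_fun_scale: "lin (\<lambda>z. a \<cdot> f z) u = a \<cdot> lin f u"
  by (simp add: lin_def pm.scale_sum_right mult.commute)

lemma lin_fun_zero [simp]: "lin (\<lambda>z. 0) u = 0"
  by (simp add: lin_def)

lemma lin_lin: "lin f (lin g u) = lin (\<lambda>z. lin f (g z)) u"
  by (simp add: lin_def[of g] lin_def[of _ u] lin_sum lin_scale)

lemma lin_swap: "lin (\<lambda>x. lin (h x) v) u = lin (\<lambda>y. lin (\<lambda>x. h x y) u) v"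
proof -
  have "lin (\<lambda>x. lin (h x) v) u = (\<Sum>x\<in>Poly_Mapping.keys u. \<Sum>y\<in>Poly_Mapping.keys v.
      (Poly_Mapping.lookup u x * Poly_Mapping.lookup v y) \<cdot> h x y)"
    by (simp add: lin_def pm.scale_sum_right)
  also have "\<dots> = (\<Sum>y\<in>Poly_Mapping.keys v. \<Sum>x\<in>Poly_Mapping.keys u.
      (Poly_Mapping.lookup v y * Poly_Mapping.lookup u x) \<cdot> h x y)"
    by (subst sum.swap) (simp add: mult.commute)
  finally show ?thesis by (simp add: lin_def pm.scale_sum_right)
qed

lemma lin_id [simp]: "lin (\<lambda>z. Poly_Mapping.single z 1) u = u"
  by (rule poly_mapping_eqI)
     (simp add: lin_def lookup_sum lookup_single when_def in_keys_iff)

lemma lookup_lin: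
  "Poly_Mapping.lookup (lin f u) k = (\<Sum>z\<in>Poly_Mapping.keys u. Poly_Mapping.lookup u z * Poly_Mapping.lookup (f z) k)"
  by (simp add: lin_def lookup_sum)

lemma lin_closed:
  "pm.subspace W \<Longrightarrow> (\<And>z. z \<in> Poly_Mapping.keys u \<Longrightarrow> f z \<in> W) \<Longrightarrow> lin f u \<in> W"
  unfolding lin_def by (intro pm.subspace_sum pm.subspace_scale) auto

lemma keys_lin: "Poly_Mapping.keys (lin f u) \<subseteq> (\<Union>z\<in>Poly_Mapping.keys u. Poly_Mapping.keys (f z))"
  unfolding lin_def by (rule order_trans[OF keys_sum]) (use keys_pm_scale in fast)

lemma pm_induct [consumes 1, case_names zero add single]:
  fixes u :: "'a \<Rightarrow>\<^sub>0 'f::field_char_0"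
  assumes "Poly_Mapping.keys u \<subseteq> A" "P 0"
    "\<And>u v. Poly_Mapping.keys u \<subseteq> A \<Longrightarrow> Poly_Mapping.keys v \<subseteq> A \<Longrightarrow> P u \<Longrightarrow> P v \<Longrightarrow> P (u + v)"
    "\<And>z a. z \<in> A \<Longrightarrow> P (Poly_Mapping.single z a)"
  shows "P u"
proof -
  have "P (\<Sum>z\<in>Z. a z \<cdot> Poly_Mapping.single z 1) \<and> Poly_Mapping.keys (\<Sum>z\<in>Z. a z \<cdot> Poly_Mapping.single z 1) \<subseteq> A"
    if "finite Z" "Z \<subseteq> A" for Z and a :: "'a \<Rightarrow> 'f"
    using that
  proof (induction Z rule: finite_induct)
    case (insert z Z)
    have "Poly_Mapping.keys (Poly_Mapping.single z (a z)) \<subseteq> A" using insert.prems by auto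
    moreover have "Poly_Mapping.keys (Poly_Mapping.single z (a z) + (\<Sum>z\<in>Z. a z \<cdot> Poly_Mapping.single z 1)) \<subseteq> A"
      using insert keys_add[of "Poly_Mapping.single z (a z)" "\<Sum>z\<in>Z. a z \<cdot> Poly_Mapping.single z 1"] \<open>Poly_Mapping.keys (Poly_Mapping.single z (a z)) \<subseteq> A\<close>
      by auto
    ultimately show ?case using insert assms(3,4) by simp
  qed (use assms(2) in simp)
  from this[of "Poly_Mapping.keys u" "Poly_Mapping.lookup u"] assms(1)
  have "P (lin (\<lambda>z. Poly_Mapping.single z 1) u)" by (simp only: lin_def finite_keys)
  then show ?thesis by simp
qed

section \<open>Uniqueness of normal forms by the diamond lemma\<close>

section \<open>Rewriting words to normal form\<close>

text \<open>The module induced from a one-dimensional representation \<open>\<chi>\<close> of the subalgebra spanned by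
  \<open>T\<close>: words act on a generator \<open>v\<close> with \<open>t v = \<chi> t v\<close> for \<open>t \<in> T\<close>, and letters outside \<open>T\<close>
  are sorted before those in \<open>T\<close>.\<close>

locale pbw =
  fixes S T :: "'x set" and br :: "'x \<Rightarrow> 'x \<Rightarrow> 'x \<Rightarrow>\<^sub>0 'f::field_char_0" and \<chi> :: "'x \<Rightarrow> 'f"
  assumes T_subset: "T \<subseteq> S"
    and br_S: "x \<in> S \<Longrightarrow> y \<in> S \<Longrightarrow> Poly_Mapping.keys (br x y) \<subseteq> S"
    and br_T: "x \<in> T \<Longrightarrow> y \<in> T \<Longrightarrow> Poly_Mapping.keys (br x y) \<subseteq> T"
    and br_anti: "br x y = - br y x"
    and br_jacobi: "lin (\<lambda>z. br z w) (br x y) + lin (\<lambda>z. br z x) (br y w) + lin (\<lambda>z. br z y) (br w x) = 0"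
    and chi_br: "x \<in> T \<Longrightarrow> y \<in> T \<Longrightarrow>
      (\<Sum>z\<in>Poly_Mapping.keys (br x y). Poly_Mapping.lookup (br x y) z * \<chi> z) = 0"
begin

text \<open>Letters outside \<open>T\<close> come before those of \<open>T\<close>, so that sorting
  carries the letters that act by scalars to the right end. Within each class any linear order will
  do; one is taken from a chosen well-order.\<close>

definition lt :: "'x \<Rightarrow> 'x \<Rightarrow> bool" where
  "lt x y \<longleftrightarrow> (if x \<in> T \<longleftrightarrow> y \<in> T then (x, y) \<in> (SOME r. well_order_on UNIV r) \<and> x \<noteq> y else y \<in> T)"

definition le :: "'x \<Rightarrow> 'x \<Rightarrow> bool" where
  "le x y \<longleftrightarrow> lt x y \<or> x = y"

lemma linorder_le: "class.linorder le lt"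
proof -
  define r :: "'x rel" where "r = (SOME r. well_order_on UNIV r)"
  have "well_order_on UNIV r" using someI_ex[OF well_order_on] by (auto simp: r_def)
  then have "trans r" "antisym r" "total r"
    by (auto simp: well_order_on_def linear_order_on_def partial_order_on_def preorder_on_def)
  then show ?thesis
    by unfold_locales
       (auto simp: le_def lt_def r_def[symmetric] antisym_def trans_def total_on_def split: if_splits)
qed

definition descent :: "'x list \<Rightarrow> 'x list \<times> 'x \<times> 'x \<times> 'x list \<Rightarrow> bool" where
  "descent w d \<longleftrightarrow> (case d of (u, x, y, v) \<Rightarrow> w = u @ x # y # v \<and> lt y x)"

fun inversions :: "'x list \<Rightarrow> nat" where
  "inversions [] = 0"
| "inversions (x # w) = length (filter (\<lambda>y. lt y x) w) + inversions w"

lemma lt_irrefl [simp]: "\<not> lt x x"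
  by (simp add: lt_def)

lemma lt_asym: "lt x y \<Longrightarrow> \<not> lt y x"
proof -
  interpret linorder le lt by (rule linorder_le)
  show "lt x y \<Longrightarrow> \<not> lt y x" using less_asym by blast
qed

lemma lt_trans: "lt x y \<Longrightarrow> lt y z \<Longrightarrow> lt x z"
proof -
  interpret linorder le lt by (rule linorder_le)
  show "lt x y \<Longrightarrow> lt y z \<Longrightarrow> lt x z" by (rule less_trans)
qed

lemma lt_total: "lt x y \<or> x = y \<or> lt y x"
  using linorder.less_linear[OF linorder_le] by blast

lemma lt_T: "lt y x \<Longrightarrow> y \<in> T \<Longrightarrow> x \<in> T"
  by (auto simp: lt_def split: if_splits)

lemma inversions_swap:
  assumes "lt y x"
  shows "inversions (u @ x # y # v) = Suc (inversions (u @ y # x # v))"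
  using assms lt_asym[OF assms] by (induction u) auto

lemma descent_measure:
  assumes "(u, x, y, v) = d" "descent w d"
  shows "length (u @ y # x # v) = length w \<and> inversions (u @ y # x # v) < inversions w \<and>
    (\<forall>z. length (u @ z # v) < length w)"
  using assms inversions_swap[of y x u v] by (auto simp: descent_def)

text \<open>Which descent is resolved is left to \<open>SOME\<close>; that the value does not depend
  on it is the content of \<open>exchange\<close>. A letter of \<open>T\<close> at the right end
  meets the generator and becomes a scalar. A swap keeps the length and lowers the inversions, and a
  bracket term is shorter, whence termination.\<close>

function nf :: "'x list \<Rightarrow> 'x multiset \<Rightarrow>\<^sub>0 'f" where
  "nf w =
    (if w = [] then Poly_Mapping.single {#} 1
     else if last w \<in> T then \<chi> (last w) \<cdot> nf (butlast w)
     else if \<exists>d. descent w d then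
       (case SOME d. descent w d of (u, x, y, v) \<Rightarrow>
          nf (u @ y # x # v) +
          (\<Sum>z\<in>Poly_Mapping.keys (br x y). Poly_Mapping.lookup (br x y) z \<cdot> nf (u @ z # v)))
     else Poly_Mapping.single (mset w) 1)"
  by pat_completeness auto
termination
proof (relation "measures [length, inversions]", goal_cases)
  case 3
  then show ?case
    using someI_ex[OF 3(3)] by (auto dest!: descent_measure)
next
  case 4
  then show ?case
    using someI_ex[OF 4(3)] by (auto dest!: descent_measure)
qed simp_all

declare nf.simps [simp del]

lemma nf_Nil [simp]: "nf [] = Poly_Mapping.single {#} 1"
  by (simp add: nf.simps)

lemma nf_snoc_T [simp]: "t \<in> T \<Longrightarrow> nf (w @ [t]) = \<chi> t \<cdot> nf w"
  by (simp add: nf.simps[of "w @ [t]"])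

text \<open>The rewriting rule at one position. By its definition \<open>nf\<close> obeys it only at
  the descent that was chosen.\<close>

definition exch :: "'x list \<Rightarrow> 'x \<Rightarrow> 'x \<Rightarrow> 'x list \<Rightarrow> bool" where
  "exch u x y v \<longleftrightarrow> nf (u @ x # y # v) = nf (u @ y # x # v) + lin (\<lambda>z. nf (u @ z # v)) (br x y)"

lemma br_self [simp]: "br x x = 0"
proof (rule poly_mapping_eqI)
  fix k
  have "Poly_Mapping.lookup (br x x) k = - Poly_Mapping.lookup (br x x) k"
    by (subst br_anti) simp
  then show "Poly_Mapping.lookup (br x x) k = Poly_Mapping.lookup 0 k" by simp
qed

lemma exch_refl: "exch u x x v"
  by (simp add: exch_def)

lemma exch_sym: "exch u x y v \<Longrightarrow> exch u y x v"
  using br_anti[of y x] by (simp add: exch_def lin_uminus)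

lemma nf_descent:
  assumes "last w \<notin> T" "descent w d"
  obtains u x y v where "descent w (u, x, y, v)" "exch u x y v"
proof -
  have ex: "\<exists>d. descent w d" using assms by blast
  obtain u x y v where d: "(SOME d. descent w d) = (u, x, y, v)" by (metis prod_cases4)
  have "descent w (u, x, y, v)" using someI_ex[OF ex] d by simp
  moreover have "w \<noteq> []" using assms(2) by (auto simp: descent_def)
  moreover have "nf w = nf (u @ y # x # v) + lin (\<lambda>z. nf (u @ z # v)) (br x y)"
    unfolding lin_def by (subst nf.simps) (simp only: ex d assms(1) \<open>w \<noteq> []\<close> if_True if_False prod.case simp_thms)
  ultimately show thesis
    using that[of u x y v] unfolding exch_def by (auto simp: descent_def)
qed

lemma exchD: "exch u x y v \<Longrightarrow> nf (u @ x # y # v) = nf (u @ y # x # v) + lin (\<lambda>z. nf (u @ z # v)) (br x y)"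
  by (simp add: exch_def)

text \<open>The overlap ambiguity of a b c: both ways of reversing it end in c b a. Once the shorter
  words have been exchanged, the two results differ by the image of the Jacobi sum, which is
  zero.\<close>

lemma exch_overlap:
  assumes short: "\<And>u' x y v'. length u' + length v' < Suc (length u + length v) \<Longrightarrow> exch u' x y v'"
    and 1: "exch (u @ [b]) a c v" "exch u b c (a # v)"
    and 2: "exch (u @ [c]) a b v" "exch u a c (b # v)"
  shows "exch u a b (c # v) \<longleftrightarrow> exch (u @ [a]) b c v"
proof -
  \<comment> \<open>In the shorter words \<open>z\<close> and \<open>e\<close> may be exchanged,
    which turns the differences into double brackets, the terms of the Jacobi identity.\<close>
  have c: "lin (\<lambda>z. nf (u @ z # e # v)) f - lin (\<lambda>z. nf (u @ e # z # v)) f =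
      lin (\<lambda>s. nf (u @ s # v)) (lin (\<lambda>z. br z e) f)" for e f
  proof -
    have "nf (u @ z # e # v) - nf (u @ e # z # v) = lin (\<lambda>s. nf (u @ s # v)) (br z e)" for z
      using short[of u v z e] by (simp add: exch_def)
    then show ?thesis by (simp add: lin_fun_diff[symmetric] lin_lin)
  qed
  have "lin (\<lambda>s. nf (u @ s # v)) (lin (\<lambda>z. br z c) (br a b) + lin (\<lambda>z. br z a) (br b c) + lin (\<lambda>z. br z b) (br c a)) = 0"
    using br_jacobi[of c a b] by simp
  then have j: "(lin (\<lambda>z. nf (u @ z # c # v)) (br a b) - lin (\<lambda>z. nf (u @ c # z # v)) (br a b))
    + (lin (\<lambda>z. nf (u @ z # a # v)) (br b c) - lin (\<lambda>z. nf (u @ a # z # v)) (br b c))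
    - (lin (\<lambda>z. nf (u @ z # b # v)) (br a c) - lin (\<lambda>z. nf (u @ b # z # v)) (br a c)) = 0"
    unfolding c using br_anti[of c a] by (simp add: lin_add[symmetric] lin_diff[symmetric] lin_uminus)
  show ?thesis
    using j exchD[OF 1(1)] exchD[OF 1(2)] exchD[OF 2(1)] exchD[OF 2(2)]
    by (simp add: exch_def) (auto simp: algebra_simps)
qed

text \<open>The diamond lemma, by induction on length and inversions. The chosen descent obeys the
  rule by definition. Any other descent is either disjoint from it, so that both can be resolved in
  either order, or shares one letter with it, which is \<open>exch_overlap\<close>.\<close>

lemma exch_descent: "descent w (u, x, y, v) \<Longrightarrow> exch u x y v"
proof (induction w arbitrary: u x y v rule: wf_induct_rule[OF wf_measures[of "[length, inversions]"]])
  case (1 w)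
  have w: "w = u @ x # y # v" and yx: "lt y x" using 1(2) by (auto simp: descent_def)
  have IH: "exch u' x' y' v'"
    if "length (u' @ x' # y' # v') < length w \<or> length (u' @ x' # y' # v') = length w \<and> inversions (u' @ x' # y' # v') < inversions w"
       "lt y' x'" for u' x' y' v'
    using 1(1)[of "u' @ x' # y' # v'" u' x' y' v'] that by (auto simp: descent_def)
  have short: "exch u' x' y' v'" if "length u' + length v' + 2 < length w" for u' x' y' v'
  proof -
    consider "lt y' x'" | "x' = y'" | "lt x' y'" using lt_total by blast
    then show ?thesis
      using IH[of u' x' y' v'] IH[of u' y' x' v'] that by cases (auto intro: exch_refl exch_sym)
  qed
  show ?case
  proof (cases "last w \<in> T")
    case True
    show ?thesis
    proof (cases v rule: rev_cases)
      \<comment> \<open>The descent is at the right end, so \<open>y\<close> and hence also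
        \<open>x\<close> lie in \<open>T\<close>. Both orders give the same product of scalars, and
        the bracket term vanishes because \<chi> does so on brackets.\<close>
      case Nil
      then have y: "y \<in> T" using True w by simp
      then have x: "x \<in> T" using yx lt_T by blast
      have "lin (\<lambda>z. nf (u @ [z])) (br x y) = (\<Sum>z\<in>Poly_Mapping.keys (br x y). (Poly_Mapping.lookup (br x y) z * \<chi> z) \<cdot> nf u)"
        unfolding lin_def using br_T[OF x y] by (intro sum.cong) auto
      also have "\<dots> = 0"
        using chi_br[OF x y] by (simp add: pm.scale_sum_left[symmetric])
      finally have "lin (\<lambda>z. nf (u @ [z])) (br x y) = 0" .
      then show ?thesis
        using Nil nf_snoc_T[OF y, of "u @ [x]"] nf_snoc_T[OF x, of "u @ [y]"] x y
        by (simp add: exch_def mult.commute)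
    next
      case (snoc v' t)
      then have t: "t \<in> T" using True w by simp
      have "exch u x y v'" using short[of u v'] w snoc by simp
      moreover have "nf (u @ a # b # v' @ [t]) = \<chi> t \<cdot> nf (u @ a # b # v')"
        "nf (u @ a # v' @ [t]) = \<chi> t \<cdot> nf (u @ a # v')" for a b
        using nf_snoc_T[OF t, of "u @ a # b # v'"] nf_snoc_T[OF t, of "u @ a # v'"] by simp_all
      ultimately show ?thesis
        by (simp add: exch_def snoc lin_fun_scale pm.scale_right_distrib)
    qed
  next
    case False
    obtain u' a b v' where d: "descent w (u', a, b, v')" and e: "exch u' a b v'"
      using nf_descent[OF False 1(2)] by blast
    have w': "w = u' @ a # b # v'" and ba: "lt b a" using d by (auto simp: descent_def)
    \<comment> \<open>Either order of resolving leads to the word with both pairs swapped, the two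
      words with one bracket and the double bracket; \<open>lin_swap\<close> identifies the double
      brackets.\<close>
    have disjoint: "exch p1 a1 b1 (q @ a2 # b2 # r) \<longleftrightarrow> exch (p1 @ a1 # b1 # q) a2 b2 r"
      if w2: "w = p1 @ a1 # b1 # q @ a2 # b2 # r" and l: "lt b1 a1" "lt b2 a2" for p1 a1 b1 q a2 b2 r
    proof -
      have "inversions (p1 @ b1 # a1 # q @ a2 # b2 # r) < inversions w"
        using inversions_swap[OF l(1), of p1 "q @ a2 # b2 # r"] w2 by simp
      from IH[of "p1 @ b1 # a1 # q" a2 b2 r] this l w2
      have A: "exch (p1 @ b1 # a1 # q) a2 b2 r" by simp
      have "inversions (p1 @ a1 # b1 # q @ b2 # a2 # r) < inversions w"
        using inversions_swap[OF l(2), of "p1 @ a1 # b1 # q" r] w2 by simp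
      from IH[of p1 a1 b1 "q @ b2 # a2 # r"] this l w2
      have B: "exch p1 a1 b1 (q @ b2 # a2 # r)" by simp
      have C: "nf (p1 @ z # q @ a2 # b2 # r) = nf (p1 @ z # q @ b2 # a2 # r) +
          lin (\<lambda>z'. nf (p1 @ z # q @ z' # r)) (br a2 b2)" for z
        using short[of "p1 @ z # q" r a2 b2] w2 by (simp add: exch_def)
      have D: "nf (p1 @ a1 # b1 # q @ z # r) = nf (p1 @ b1 # a1 # q @ z # r) +
          lin (\<lambda>z'. nf (p1 @ z' # q @ z # r)) (br a1 b1)" for z
        using short[of p1 "q @ z # r" a1 b1] w2 by (simp add: exch_def)
      have E: "lin (\<lambda>z. nf (p1 @ z # q @ a2 # b2 # r)) (br a1 b1) =
        lin (\<lambda>z. nf (p1 @ z # q @ b2 # a2 # r)) (br a1 b1) +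
        lin (\<lambda>z. lin (\<lambda>z'. nf (p1 @ z # q @ z' # r)) (br a2 b2)) (br a1 b1)"
        by (subst C) (rule lin_fun_add)
      have F: "lin (\<lambda>z. nf (p1 @ a1 # b1 # q @ z # r)) (br a2 b2) =
        lin (\<lambda>z. nf (p1 @ b1 # a1 # q @ z # r)) (br a2 b2) +
        lin (\<lambda>z. lin (\<lambda>z'. nf (p1 @ z # q @ z' # r)) (br a2 b2)) (br a1 b1)"
        by (subst D) (simp only: lin_fun_add lin_swap[where v = "br a1 b1" and u = "br a2 b2"])
      show ?thesis
        using A B E F unfolding exch_def by (auto simp: algebra_simps)
    qed
    have overlap: "exch p a1 b1 (c1 # r) \<longleftrightarrow> exch (p @ [a1]) b1 c1 r"
      if w2: "w = p @ a1 # b1 # c1 # r" and l: "lt b1 a1" "lt c1 b1" for p a1 b1 c1 r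
    proof (rule exch_overlap)
      have l3: "lt c1 a1" using l lt_trans by blast
      note i = inversions_swap[OF l(1), of p "c1 # r"] inversions_swap[OF l(2), of "p @ [a1]" r]
        inversions_swap[OF l3, of "p @ [b1]" r] inversions_swap[OF l3, of "p" "b1 # r"]
      show "exch u' x y v'" if "length u' + length v' < Suc (length p + length r)" for u' x y v'
        using short that w2 by simp
      show "exch (p @ [b1]) a1 c1 r" using IH[of "p @ [b1]" a1 c1 r] l3 w2 i by simp
      show "exch p b1 c1 (a1 # r)" using IH[of "p" b1 c1 "a1 # r"] l w2 i by simp
      show "exch (p @ [c1]) a1 b1 r"
        using IH[of "p @ [c1]" a1 b1 r] l w2 i by simp
      show "exch p a1 c1 (b1 # r)" using IH[of "p" a1 c1 "b1 # r"] l3 w2 i by simp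
    qed
    have "u @ x # y # v = u' @ a # b # v'" using w w' by simp
    then consider "u = u' \<and> x = a \<and> y = b \<and> v = v'"
      | "u' = u @ [x]" "a = y" "v = b # v'"
      | "u = u' @ [a]" "b = x" "v' = y # v"
      | q where "u' = u @ x # y # q" "v = q @ a # b # v'"
      | q where "u = u' @ a # b # q" "v' = q @ x # y # v"
      by (auto simp: append_eq_append_conv2 append_eq_Cons_conv Cons_eq_append_conv)
    then show ?thesis
    proof cases
      case 1 then show ?thesis using e by simp
    next
      case 2
      then have "w = u @ x # y # b # v'" "exch (u @ [x]) y b v'" "lt b y" using e w ba by simp_all
      with overlap[of u x y b v'] yx 2 show ?thesis by blast
    next
      case 3
      then have "w = u' @ a # x # y # v" "exch u' a x (y # v)" "lt x a" using e w' ba by simp_all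
      with overlap[of u' a x y v] yx 3 show ?thesis by blast
    next
      case (4 q)
      then have "w = u @ x # y # q @ a # b # v'" "exch (u @ x # y # q) a b v'" using e w by simp_all
      with disjoint[of u x y q a b v'] yx ba 4 show ?thesis by blast
    next
      case (5 q)
      then have "w = u' @ a # b # q @ x # y # v" "exch u' a b (q @ x # y # v)" using e w' by simp_all
      with disjoint[of u' a b q x y v] yx ba 5 show ?thesis by blast
    qed
  qed
qed

text \<open>The rule for any two neighbours: ascending pairs are reduced to descents by
  antisymmetry.\<close>

lemma exchange: "nf (u @ x # y # v) = nf (u @ y # x # v) + lin (\<lambda>z. nf (u @ z # v)) (br x y)"
proof -
  have "exch u x y v"
    using lt_total[of x y] exch_descent[of _ u x y v] exch_descent[of _ u y x v]
    by (auto simp: descent_def intro: exch_refl exch_sym)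
  then show ?thesis by (rule exchD)
qed

end

section \<open>The induced module on monomials, with its grading and its degree filtration\<close>

section \<open>Modules induced from one-dimensional representations\<close>

context pbw
begin

abbreviation sorted_word :: "'x list \<Rightarrow> bool" where
  "sorted_word \<equiv> sorted_wrt le"

lemma sorted_word_if_no_descent:
  assumes "\<nexists>d. descent w d"
  shows "sorted_word w"
  using assms
proof (induction w)
  case (Cons x w)
  have "\<nexists>d. descent w d"
  proof
    assume "\<exists>d. descent w d"
    then obtain u a b v where "descent w (u, a, b, v)" by (metis prod_cases4)
    then have "descent (x # w) (x # u, a, b, v)" by (simp add: descent_def)
    with Cons.prems show False by blast
  qed
  then have s: "sorted_word w" by (rule Cons.IH)
  show ?case
  proof (cases w)
    case (Cons y v)
    have "\<not> lt y x"
    proof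
      assume "lt y x"
      then have "descent (x # w) ([], x, y, v)" using Cons by (simp add: descent_def)
      with Cons.prems show False by blast
    qed
    then have "le x y" using lt_total by (auto simp: le_def)
    then show ?thesis using s Cons lt_trans unfolding le_def by auto
  qed simp
qed simp

text \<open>Induction along the rewriting. When no case of a trailing letter of \<open>T\<close> or
  of a descent applies, the word is sorted with last letter outside \<open>T\<close>; since
  \<open>T\<close> comes last in the order, all its letters are outside \<open>T\<close>.\<close>

lemma word_induct [consumes 1, case_names snoc sorted descent]:
  assumes "set w \<subseteq> S"
    and snoc: "\<And>w t. set w \<subseteq> S \<Longrightarrow> t \<in> T \<Longrightarrow> P w \<Longrightarrow> P (w @ [t])"
    and sorted: "\<And>w. set w \<subseteq> S - T \<Longrightarrow> sorted_word w \<Longrightarrow> P w"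
    and descent: "\<And>u x y v. set (u @ x # y # v) \<subseteq> S \<Longrightarrow> lt y x \<Longrightarrow> P (u @ y # x # v) \<Longrightarrow>
      (\<And>z. z \<in> Poly_Mapping.keys (br x y) \<Longrightarrow> P (u @ z # v)) \<Longrightarrow> P (u @ x # y # v)"
  shows "P w"
  using assms(1)
proof (induction w rule: wf_induct_rule[OF wf_measures[of "[length, inversions]"]])
  case (1 w)
  consider "w = []" | "w \<noteq> []" "last w \<in> T" | "\<exists>d. descent w d" | "w \<noteq> []" "last w \<notin> T" "\<nexists>d. descent w d"
    by blast
  then show ?case
  proof cases
    case 1 then show ?thesis by (auto intro: sorted)
  next
    case 2
    then obtain w' t where "w = w' @ [t]" "t \<in> T" by (metis append_butlast_last_id)
    then show ?thesis using 1 snoc[of w' t] by simp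
  next
    case 3
    then obtain u x y v where d: "descent w (u, x, y, v)" by (metis prod_cases4)
    then have w: "w = u @ x # y # v" and l: "lt y x" by (auto simp: descent_def)
    have "P (u @ z # v)" if "z \<in> Poly_Mapping.keys (br x y)" for z
      using 1 w br_S[of x y] that by auto
    then show ?thesis
      using 1 w l descent[of u x y v] inversions_swap[OF l, of u v] by simp
  next
    case 4
    then have s: "sorted_word w" using sorted_word_if_no_descent by blast
    have "x \<notin> T" if "x \<in> set w" for x
    proof -
      obtain w' where w': "w = w' @ [last w]" using 4 by (metis append_butlast_last_id)
      then have "x = last w \<or> le x (last w)"
        using s that sorted_wrt_append[of le w' "[last w]"] by (metis Un_iff list.set_intros(1) set_ConsD set_append empty_iff list.set(1))
      then show ?thesis using 4 lt_T by (auto simp: le_def)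
    qed
    then show ?thesis using sorted[OF _ s] 1 by blast
  qed
qed

lemma nf_sorted:
  assumes "set w \<subseteq> S - T" "sorted_word w"
  shows "nf w = Poly_Mapping.single (mset w) 1"
proof -
  have "\<not> descent w d" for d
  proof
    assume "descent w d"
    then obtain u x y v where "w = u @ x # y # v" "lt y x" by (auto simp: descent_def)
    then show False using assms(2) lt_asym by (auto simp: sorted_wrt_append le_def)
  qed
  moreover have "w \<noteq> [] \<Longrightarrow> last w \<notin> T" using assms(1) last_in_set by blast
  ultimately show ?thesis by (simp add: nf.simps[of w])
qed

definition word :: "'x multiset \<Rightarrow> 'x list" where
  "word m = (THE w. mset w = m \<and> sorted_word w)"

lemma word_unique: "\<exists>!w. mset w = m \<and> sorted_word w"
proof -
  interpret linorder le lt by (rule linorder_le)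
  show ?thesis
  proof (rule ex_ex1I)
    obtain w where "mset w = m" using ex_mset by blast
    then show "\<exists>w. mset w = m \<and> sorted_word w"
      by (intro exI[of _ "sort w"]) simp
    fix w w' assume "mset w = m \<and> sorted_word w" "mset w' = m \<and> sorted_word w'"
    then show "w = w'" using properties_for_sort by metis
  qed
qed

lemma mset_word [simp]: "mset (word m) = m" and sorted_word_word: "sorted_word (word m)"
  using theI'[OF word_unique[of m]] by (simp_all add: word_def)

lemma word_mset: "sorted_word w \<Longrightarrow> word (mset w) = w"
  using word_unique[of "mset w"] mset_word sorted_word_word by blast

lemma set_word [simp]: "set (word m) = set_mset m"
  using mset_word set_mset_mset by metis

lemma word_empty [simp]: "word {#} = []"
  using mset_word[of "{#}"] by (simp del: mset_word)

lemma length_word [simp]: "length (word m) = size m"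
  by (metis mset_word size_mset)

lemma nf_word: "set_mset m \<subseteq> S - T \<Longrightarrow> nf (word m) = Poly_Mapping.single m 1"
  using nf_sorted[of "word m"] sorted_word_word by simp

text \<open>Normalizing a suffix first does not change the result. Hence prefixing a letter is well
  defined on normal forms, which is what makes \<open>act1\<close> an action.\<close>

lemma nf_append:
  assumes "set w \<subseteq> S"
  shows "nf (u @ w) = lin (\<lambda>m. nf (u @ word m)) (nf w)"
  using assms
proof (induction w rule: word_induct)
  case (snoc w t)
  then show ?case using nf_snoc_T[of t "u @ w"] by (simp add: lin_scale)
next
  case (sorted w)
  then show ?case by (simp add: nf_sorted word_mset)
next
  case (descent p x y v)
  then show ?case
    using exchange[of "u @ p" x y v]
    unfolding exchange[of p x y v] by (simp add: lin_add lin_lin cong: lin_cong)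
qed

definition carr :: "('x multiset \<Rightarrow>\<^sub>0 'f) set" where
  "carr = {p. \<forall>m\<in>Poly_Mapping.keys p. set_mset m \<subseteq> S - T}"

lemma subspace_keys: "pm.subspace {p. \<forall>m\<in>Poly_Mapping.keys p. Q m}"
  by (rule pm.subspaceI) (use keys_add keys_pm_scale in \<open>fastforce+\<close>)

lemma subspace_carr: "pm.subspace carr"
  unfolding carr_def by (rule subspace_keys)

lemma single_carr [simp]: "set_mset m \<subseteq> S - T \<Longrightarrow> Poly_Mapping.single m a \<in> carr"
  by (auto simp: carr_def)

lemma nf_carr: "set w \<subseteq> S \<Longrightarrow> nf w \<in> carr"
proof (induction w rule: word_induct)
  case (snoc w t)
  then show ?case by (simp add: pm.subspace_scale[OF subspace_carr])
next
  case (sorted w)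
  then show ?case by (simp add: nf_sorted)
next
  case (descent u x y v)
  then show ?case
    unfolding exchange[of u x y v]
    by (intro pm.subspace_add[OF subspace_carr] lin_closed[OF subspace_carr])
qed

definition act1 :: "'x \<Rightarrow> ('x multiset \<Rightarrow>\<^sub>0 'f) \<Rightarrow> ('x multiset \<Rightarrow>\<^sub>0 'f)" where
  "act1 x p = lin (\<lambda>m. nf (x # word m)) p"

lemma act1_add: "act1 x (p + q) = act1 x p + act1 x q"
  and act1_scale: "act1 x (a \<cdot> p) = a \<cdot> act1 x p"
  and act1_zero [simp]: "act1 x 0 = 0"
  and act1_lin: "act1 x (lin f u) = lin (\<lambda>z. act1 x (f z)) u"
  and act1_diff: "act1 x (p - q) = act1 x p - act1 x q"
  and act1_sum: "act1 x (\<Sum>i\<in>I. g i) = (\<Sum>i\<in>I. act1 x (g i))"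
  by (simp_all add: act1_def lin_add lin_scale lin_lin lin_diff lin_sum)

lemma act1_nf: "set w \<subseteq> S \<Longrightarrow> act1 x (nf w) = nf (x # w)"
  using nf_append[of w "[x]"] by (simp add: act1_def)

lemma act1_single: "act1 x (Poly_Mapping.single m a) = a \<cdot> nf (x # word m)"
  by (simp add: act1_def)

lemma carr_subset: "p \<in> carr \<Longrightarrow> m \<in> Poly_Mapping.keys p \<Longrightarrow> set_mset m \<subseteq> S - T"
  by (auto simp: carr_def)

lemma carr_induct [consumes 1, case_names zero add nf]:
  assumes "p \<in> carr" "P 0" "\<And>p q. p \<in> carr \<Longrightarrow> q \<in> carr \<Longrightarrow> P p \<Longrightarrow> P q \<Longrightarrow> P (p + q)"
    "\<And>w a. set w \<subseteq> S - T \<Longrightarrow> P (a \<cdot> nf w)"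
  shows "P p"
proof (rule pm_induct[of p "{m. set_mset m \<subseteq> S - T}" P])
  show "P (Poly_Mapping.single m a)" if "m \<in> {m. set_mset m \<subseteq> S - T}" for m a
    using assms(4)[of "word m" a] that by (simp add: nf_word)
  show "P (u + v)" if "Poly_Mapping.keys u \<subseteq> {m. set_mset m \<subseteq> S - T}"
    "Poly_Mapping.keys v \<subseteq> {m. set_mset m \<subseteq> S - T}" "P u" "P v" for u v
    using that assms(3)[of u v] by (auto simp: carr_def)
qed (use assms in \<open>auto simp: carr_def\<close>)

lemma act1_carr: "x \<in> S \<Longrightarrow> p \<in> carr \<Longrightarrow> act1 x p \<in> carr"
  unfolding act1_def
  by (rule lin_closed[OF subspace_carr], rule nf_carr) (auto dest: carr_subset)

text \<open>The module law is \<open>exchange\<close> at the front of a word.\<close>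

lemma act1_br:
  assumes "p \<in> carr" "x \<in> S" "y \<in> S"
  shows "act1 x (act1 y p) = act1 y (act1 x p) + lin (\<lambda>z. act1 z p) (br x y)"
  using assms(1)
proof (induction rule: carr_induct)
  case zero
  then show ?case by simp
next
  case (add p q)
  then show ?case by (simp add: act1_add lin_fun_add)
next
  case (nf w a)
  then have "set w \<subseteq> S" by auto
  then show ?case
    using exchange[of "[]" x y w] assms(2,3) by (simp add: act1_nf act1_scale lin_fun_scale pm.scale_right_distrib)
qed

text \<open>The letters of a normal form stay in any bracket-closed set of letters.\<close>

lemma nf_closed:
  assumes "set w \<subseteq> U" "U \<subseteq> S" "\<And>x y. x \<in> U \<Longrightarrow> y \<in> U \<Longrightarrow> Poly_Mapping.keys (br x y) \<subseteq> U"
    "m \<in> Poly_Mapping.keys (nf w)"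
  shows "set_mset m \<subseteq> U"
proof -
  have "set w \<subseteq> S" using assms by blast
  then have "set w \<subseteq> U \<longrightarrow> nf w \<in> {p. \<forall>m\<in>Poly_Mapping.keys p. set_mset m \<subseteq> U}" (is "_ \<longrightarrow> _ \<in> ?W")
  proof (induction w rule: word_induct)
    case (snoc w t)
    then show ?case using pm.subspace_scale[OF subspace_keys, of "nf w" "\<lambda>m. set_mset m \<subseteq> U"] by auto
  next
    case (sorted w)
    then show ?case by (simp add: nf_sorted)
  next
    case (descent u x y v)
    have W: "pm.subspace ?W" by (rule subspace_keys)
    show ?case
    proof
      assume U: "set (u @ x # y # v) \<subseteq> U"
      then have "nf (u @ z # v) \<in> ?W" if "z \<in> Poly_Mapping.keys (br x y)" for z
        using descent.IH(2)[OF that] assms(3)[of x y] that by auto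
      moreover have "nf (u @ y # x # v) \<in> ?W" using U descent.IH(1) by auto
      ultimately show "nf (u @ x # y # v) \<in> ?W"
        unfolding exchange[of u x y v] by (intro pm.subspace_add[OF W] lin_closed[OF W])
    qed
  qed
  then show ?thesis using assms by blast
qed

text \<open>Every rewriting step keeps the total weight: brackets add weights, and a letter of
  \<open>T\<close> is replaced by a nonzero scalar only if its own weight is zero.\<close>

lemma nf_weight:
  fixes wt :: "'x \<Rightarrow> 'f"
  assumes "set w \<subseteq> S" "m \<in> Poly_Mapping.keys (nf w)"
    and br: "\<And>x y z. z \<in> Poly_Mapping.keys (br x y) \<Longrightarrow> wt z = wt x + wt y"
    and chi: "\<And>t. t \<in> T \<Longrightarrow> \<chi> t \<noteq> 0 \<Longrightarrow> wt t = 0"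
  shows "(\<Sum>x\<in>#m. wt x) = (\<Sum>x\<leftarrow>w. wt x)"
proof -
  have "nf w \<in> {p. \<forall>m\<in>Poly_Mapping.keys p. (\<Sum>x\<in>#m. wt x) = (\<Sum>x\<leftarrow>w. wt x)}"
    using assms(1)
  proof (induction w rule: word_induct)
    case (snoc w t)
    show ?case
    proof (cases "\<chi> t = 0")
      case False
      then have "wt t = 0" using chi snoc by blast
      then show ?thesis using snoc keys_pm_scale[of "\<chi> t" "nf w"] by auto
    qed (use snoc in simp)
  next
    case (sorted w)
    then show ?case by (simp add: nf_sorted flip: sum_mset_sum_list)
  next
    case (descent u x y v)
    let ?W = "{p. \<forall>m\<in>Poly_Mapping.keys p. (\<Sum>x\<in>#m. wt x) = (\<Sum>x\<leftarrow>u @ x # y # v. wt x)} :: ('x multiset \<Rightarrow>\<^sub>0 'f) set"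
    have W: "pm.subspace ?W" by (rule subspace_keys)
    have "nf (u @ y # x # v) \<in> ?W" using descent(3) by (auto simp: add_ac)
    moreover have "nf (u @ z # v) \<in> ?W" if "z \<in> Poly_Mapping.keys (br x y)" for z
      using descent(4)[OF that] br[OF that] by (auto simp: add_ac)
    ultimately show ?case
      unfolding exchange[of u x y v] by (intro pm.subspace_add[OF W] lin_closed[OF W])
  qed
  then show ?thesis using assms(2) by blast
qed

text \<open>The filtration by the number of letters. The inequality is strict so that
  \<open>lower n\<close> is the space of remainders for a leading term of degree
  \<open>n\<close>.\<close>

definition lower :: "nat \<Rightarrow> ('x multiset \<Rightarrow>\<^sub>0 'f) set" where
  "lower n = {p. \<forall>m\<in>Poly_Mapping.keys p. set_mset m \<subseteq> S - T \<and> size m < n}"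

lemma subspace_lower: "pm.subspace (lower n)"
  unfolding lower_def by (rule subspace_keys)

lemma lower_mono: "n \<le> k \<Longrightarrow> p \<in> lower n \<Longrightarrow> p \<in> lower k"
  by (auto simp: lower_def)

text \<open>Rewriting never increases the number of letters outside \<open>T\<close>. If
  \<open>y\<close> is in \<open>T\<close>, then so are \<open>x\<close> and the letters of the
  bracket; otherwise \<open>y\<close> is given up and at most one letter outside \<open>T\<close>
  comes in.\<close>

lemma nf_lower:
  assumes "set w \<subseteq> S" "length (filter (\<lambda>x. x \<notin> T) w) < n"
  shows "nf w \<in> lower n"
  using assms
proof (induction w rule: word_induct)
  case (snoc w t)
  then show ?case by (simp add: pm.subspace_scale[OF subspace_lower])
next
  case (sorted w)
  then have "filter (\<lambda>x. x \<notin> T) w = w" by (auto simp: filter_id_conv)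
  then show ?case using sorted by (auto simp: nf_sorted lower_def)
next
  case (descent u x y v)
  have "nf (u @ z # v) \<in> lower n" if z: "z \<in> Poly_Mapping.keys (br x y)" for z
    using descent(4)[OF z] descent(2,5) lt_T[of y x] br_T[of x y] z by (auto split: if_splits)
  then show ?case
    unfolding exchange[of u x y v] using descent
    by (intro pm.subspace_add[OF subspace_lower] lin_closed[OF subspace_lower]) (auto split: if_splits)
qed

text \<open>Sorting costs only brackets, which are shorter words. So in the associated graded space
  the letters outside \<open>T\<close> commute.\<close>

lemma nf_leading:
  assumes "set w \<subseteq> S - T"
  shows "nf w - Poly_Mapping.single (mset w) 1 \<in> lower (length w)"
proof -
  have "set w \<subseteq> S" using assms by auto
  then have "set w \<subseteq> S - T \<longrightarrow> nf w - Poly_Mapping.single (mset w) 1 \<in> lower (length w)"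
  proof (induction w rule: word_induct)
    case (snoc w t)
    then show ?case by auto
  next
    case (sorted w)
    then show ?case by (simp add: nf_sorted pm.subspace_0[OF subspace_lower])
  next
    case (descent u x y v)
    show ?case
    proof
      assume Y: "set (u @ x # y # v) \<subseteq> S - T"
      have "nf (u @ z # v) \<in> lower (length (u @ x # y # v))" if z: "z \<in> Poly_Mapping.keys (br x y)" for z
      proof (rule nf_lower)
        show "set (u @ z # v) \<subseteq> S" using descent(1) br_S[of x y] z by auto
        have "length (filter (\<lambda>x. x \<notin> T) (u @ z # v)) \<le> length (u @ z # v)" by (rule length_filter_le)
        then show "length (filter (\<lambda>x. x \<notin> T) (u @ z # v)) < length (u @ x # y # v)" by simp
      qed
      then have A: "lin (\<lambda>z. nf (u @ z # v)) (br x y) \<in> lower (length (u @ x # y # v))"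
        by (rule lin_closed[OF subspace_lower])
      have "set (u @ y # x # v) \<subseteq> S - T" using Y by auto
      with descent(3) have "nf (u @ y # x # v) - Poly_Mapping.single (mset (u @ y # x # v)) 1 \<in> lower (length (u @ y # x # v))"
        by blast
      then have B: "nf (u @ y # x # v) - Poly_Mapping.single (mset (u @ x # y # v)) 1 \<in> lower (length (u @ x # y # v))"
        by (simp add: add_mset_commute)
      from pm.subspace_add[OF subspace_lower B A]
      show "nf (u @ x # y # v) - Poly_Mapping.single (mset (u @ x # y # v)) 1 \<in> lower (length (u @ x # y # v))"
        unfolding exchange[of u x y v] by (simp add: algebra_simps)
    qed
  qed
  then show ?thesis using assms by blast
qed

lemma act1_Y_single:
  assumes "y \<in> S - T" "set_mset m \<subseteq> S - T"
  shows "act1 y (Poly_Mapping.single m a) - Poly_Mapping.single (add_mset y m) a \<in> lower (Suc (size m))"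
proof -
  have "set (y # word m) \<subseteq> S - T" using assms by simp
  from nf_leading[OF this] have "nf (y # word m) - Poly_Mapping.single (add_mset y m) 1 \<in> lower (Suc (size m))"
    by simp
  from pm.subspace_scale[OF subspace_lower this, of a] show ?thesis
    by (simp add: act1_single pm.scale_right_diff_distrib)
qed

lemma act1_lower:
  assumes "x \<in> S" "p \<in> lower n"
  shows "act1 x p \<in> lower (if x \<in> T then n else Suc n)"
  unfolding act1_def
proof (rule lin_closed[OF subspace_lower])
  fix m assume "m \<in> Poly_Mapping.keys p"
  then have m: "set_mset m \<subseteq> S - T" "size m < n" using assms by (auto simp: lower_def)
  then have "filter (\<lambda>x. x \<notin> T) (word m) = word m" by (auto simp: filter_id_conv)
  then show "nf (x # word m) \<in> lower (if x \<in> T then n else Suc n)"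
    using m assms(1) by (intro nf_lower) auto
qed

text \<open>On the associated graded space \<open>T\<close> acts by derivations, through the bracket modulo \<open>T\<close>.\<close>

definition deriv :: "'x \<Rightarrow> 'x multiset \<Rightarrow> 'x multiset \<Rightarrow>\<^sub>0 'f" where
  "deriv x m = (\<Sum>y\<in>#m. lin (\<lambda>z. if z \<in> T then 0 else Poly_Mapping.single (add_mset z (m - {#y#})) 1) (br x y))"

lemma sum_mset_closed:
  "pm.subspace W \<Longrightarrow> (\<And>y. y \<in># m \<Longrightarrow> f y \<in> W) \<Longrightarrow> (\<Sum>y\<in>#m. f y) \<in> W"
  by (induction m) (auto simp: pm.subspace_0 pm.subspace_add)

text \<open>On its way to the right end, where it becomes the scalar \<chi> x, the letter
  \<open>x\<close> is bracketed once with each letter; everything else has lower degree.\<close>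

lemma nf_cons_leading:
  assumes "x \<in> T" "set w \<subseteq> S - T"
  shows "nf (x # w) - \<chi> x \<cdot> Poly_Mapping.single (mset w) 1 - deriv x (mset w) \<in> lower (length w)"
  using assms(2)
proof (induction w)
  case Nil
  have "nf [x] = \<chi> x \<cdot> nf []" using nf_snoc_T[OF assms(1), of "[]"] by simp
  then show ?case by (simp add: deriv_def pm.subspace_0[OF subspace_lower])
next
  case (Cons y w)
  let ?m = "mset w" and ?n = "Suc (length w)"
  have xS: "x \<in> S" using assms(1) T_subset by blast
  have w: "set w \<subseteq> S" "set w \<subseteq> S - T" and y: "y \<in> S - T" using Cons.prems by auto
  let ?g = "\<lambda>m z. if z \<in> T then 0 else Poly_Mapping.single (add_mset z m) (1::'f)"
  note L = subspace_lower[of ?n]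
  define r where "r = nf (x # w) - \<chi> x \<cdot> Poly_Mapping.single ?m 1 - deriv x ?m"
  have r: "r \<in> lower (length w)" using Cons by (simp add: r_def)
  have "nf (y # x # w) = act1 y (nf (x # w))" using act1_nf[of "x # w" y] w xS by simp
  also have "nf (x # w) = r + Poly_Mapping.single ?m (\<chi> x) + deriv x ?m" by (simp add: r_def)
  finally have e1: "nf (y # x # w) = act1 y r + act1 y (Poly_Mapping.single ?m (\<chi> x)) + act1 y (deriv x ?m)"
    by (simp add: act1_add)
  have a1: "act1 y r \<in> lower ?n" using act1_lower[OF _ r, of y] y by auto
  \<comment> \<open>The remainder has four sources: \<open>y\<close> applied to the old remainder,
    to the scalar term and to the derivation term, and the bracket of \<open>x\<close> with
    \<open>y\<close> itself.\<close>
  have a2: "act1 y (Poly_Mapping.single ?m (\<chi> x)) - Poly_Mapping.single (add_mset y ?m) (\<chi> x) \<in> lower ?n"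
    using act1_Y_single[of y ?m] y w by simp
  have a3: "act1 y (deriv x ?m) - (\<Sum>y'\<in>#?m. lin (?g (add_mset y ?m - {#y'#})) (br x y')) \<in> lower ?n"
  proof -
    have "act1 y (\<Sum>y'\<in>#M. f y') = (\<Sum>y'\<in>#M. act1 y (f y'))" for M and f :: "'x \<Rightarrow> 'x multiset \<Rightarrow>\<^sub>0 'f"
      by (induction M) (auto simp: act1_add)
    moreover have "(\<Sum>y'\<in>#M. f y' - g y') = (\<Sum>y'\<in>#M. f y') - (\<Sum>y'\<in>#M. g y')"
      for M and f g :: "'x \<Rightarrow> 'x multiset \<Rightarrow>\<^sub>0 'f"
      by (induction M) auto
    ultimately have "act1 y (deriv x ?m) - (\<Sum>y'\<in>#?m. lin (?g (add_mset y ?m - {#y'#})) (br x y')) =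
      (\<Sum>y'\<in>#?m. act1 y (lin (?g (?m - {#y'#})) (br x y')) - lin (?g (add_mset y ?m - {#y'#})) (br x y'))"
      by (simp only: deriv_def)
    also have "\<dots> = (\<Sum>y'\<in>#?m. lin (\<lambda>z. act1 y (?g (?m - {#y'#}) z) - ?g (add_mset y ?m - {#y'#}) z) (br x y'))"
      by (simp add: act1_lin lin_fun_diff)
    also have "\<dots> \<in> lower ?n"
    proof (intro sum_mset_closed[OF L] lin_closed[OF L])
      fix y' z assume y': "y' \<in># ?m" and z: "z \<in> Poly_Mapping.keys (br x y')"
      have y'S: "y' \<in> S" and zS: "z \<in> S" using y' w z xS br_S[of x y'] by auto
      have e: "add_mset y ?m - {#y'#} = add_mset y (?m - {#y'#})" "Suc (size (?m - {#y'#})) = length w"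
        using y' by (cases w; auto simp: size_Diff_singleton)+
      have "set_mset (add_mset z (?m - {#y'#})) \<subseteq> S - T" if "z \<notin> T"
        using that zS w in_diffD[of _ ?m "{#y'#}"] by fastforce
      from act1_Y_single[OF y this, of 1]
      show "act1 y (?g (?m - {#y'#}) z) - ?g (add_mset y ?m - {#y'#}) z \<in> lower ?n"
        using e by (auto simp: pm.subspace_0[OF L] add_mset_commute)
    qed
    finally show ?thesis .
  qed
  have a4: "lin (\<lambda>z. nf (z # w)) (br x y) - lin (?g ?m) (br x y) \<in> lower ?n"
    unfolding lin_fun_diff[symmetric]
  proof (rule lin_closed[OF L])
    fix z assume "z \<in> Poly_Mapping.keys (br x y)"
    then have zS: "z \<in> S" using br_S[of x y] xS y by auto
    have "filter (\<lambda>x. x \<notin> T) w = w" using w by (auto simp: filter_id_conv)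
    then show "nf (z # w) - ?g ?m z \<in> lower ?n"
      using nf_leading[of "z # w"] nf_lower[of "z # w" ?n] zS w by auto
  qed
  have d: "deriv x (mset (y # w)) = lin (?g ?m) (br x y) + (\<Sum>y'\<in>#?m. lin (?g (add_mset y ?m - {#y'#})) (br x y'))"
    by (simp add: deriv_def cong: if_cong)
  have "nf (x # y # w) - \<chi> x \<cdot> Poly_Mapping.single (mset (y # w)) 1 - deriv x (mset (y # w)) =
     act1 y r + (act1 y (Poly_Mapping.single ?m (\<chi> x)) - Poly_Mapping.single (add_mset y ?m) (\<chi> x)) +
     (act1 y (deriv x ?m) - (\<Sum>y'\<in>#?m. lin (?g (add_mset y ?m - {#y'#})) (br x y'))) +
     (lin (\<lambda>z. nf (z # w)) (br x y) - lin (?g ?m) (br x y))"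
    unfolding d using exchange[of "[]" x y w] e1 by (simp add: algebra_simps)
  also have "\<dots> \<in> lower ?n" by (intro pm.subspace_add[OF L] a1 a2 a3 a4)
  finally show ?case by simp
qed

definition act_word :: "'x list \<Rightarrow> ('x multiset \<Rightarrow>\<^sub>0 'f) \<Rightarrow> ('x multiset \<Rightarrow>\<^sub>0 'f)" where
  "act_word w p = foldr act1 w p"

lemma act_word_simps [simp]: "act_word [] p = p" "act_word (x # w) p = act1 x (act_word w p)"
  by (simp_all add: act_word_def)

lemma act_word_nf: "set w \<subseteq> S \<Longrightarrow> set v \<subseteq> S \<Longrightarrow> act_word w (nf v) = nf (w @ v)"
  by (induction w) (auto simp: act1_nf)

lemma act_word_carr: "set w \<subseteq> S \<Longrightarrow> p \<in> carr \<Longrightarrow> act_word w p \<in> carr"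
  by (induction w) (auto simp: act1_carr)

text \<open>If \<open>U\<close> consists of the basis letters of a subalgebra, these are the
  submodules over that subalgebra; see \<open>block_submodule_model\<close>.\<close>

definition stable :: "'x set \<Rightarrow> ('x multiset \<Rightarrow>\<^sub>0 'f) set \<Rightarrow> bool" where
  "stable U W \<longleftrightarrow> pm.subspace W \<and> W \<subseteq> carr \<and> (\<forall>x\<in>U. \<forall>p\<in>W. act1 x p \<in> W)"

lemma stableD:
  assumes "stable U W"
  shows "pm.subspace W" "W \<subseteq> carr" "x \<in> U \<Longrightarrow> p \<in> W \<Longrightarrow> act1 x p \<in> W"
  using assms by (auto simp: stable_def)

lemma act_word_stable: "stable U W \<Longrightarrow> set w \<subseteq> U \<Longrightarrow> p \<in> W \<Longrightarrow> act_word w p \<in> W"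
  by (induction w) (auto simp: stable_def)

lemma stable_carr: "stable S carr"
  by (simp add: stable_def subspace_carr act1_carr)

definition induced :: "('x multiset \<Rightarrow>\<^sub>0 'f) set \<Rightarrow> ('x multiset \<Rightarrow>\<^sub>0 'f) set" where
  "induced W = pm.span {act_word w p | w p. set w \<subseteq> S - T \<and> p \<in> W}"

lemma span_act1_closed:
  assumes "\<And>p. p \<in> A \<Longrightarrow> act1 x p \<in> pm.span B" "p \<in> pm.span A"
  shows "act1 x p \<in> pm.span B"
  using assms(2)
proof (induction rule: pm.span_induct_alt)
  case (step c p q)
  then show ?case
    by (auto simp: act1_add act1_scale intro: pm.span_add pm.span_scale assms(1))
qed (simp add: pm.span_zero)

lemma induced_superset: "W \<subseteq> induced W"
  unfolding induced_def by (rule subsetI, rule pm.span_base) (auto intro!: exI[of _ "[]"])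

text \<open>Letters of \<open>T\<close> can be commuted to the right through the words until they
  act inside \<open>W\<close>. So for a \<open>T\<close>-stable \<open>W\<close> the induced
  subspace is the submodule that \<open>W\<close> generates.\<close>

lemma stable_induced:
  assumes "stable T W"
  shows "stable S (induced W)"
proof -
  let ?A = "{act_word w p | w p. set w \<subseteq> S - T \<and> p \<in> W}"
  have W: "W \<subseteq> carr" using assms by (simp add: stable_def)
  have Y: "act1 y p \<in> induced W" if "y \<in> S - T" "p \<in> induced W" for y p
    using that(2) unfolding induced_def
  proof (rule span_act1_closed[rotated])
    fix p assume "p \<in> ?A"
    then obtain w q where "p = act_word w q" "set w \<subseteq> S - T" "q \<in> W" by blast
    then have "act1 y p \<in> ?A" using that(1) by (auto intro!: exI[of _ "y # w"])
    then show "act1 y p \<in> pm.span ?A" by (rule pm.span_base)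
  qed
  \<comment> \<open>Induction on the word: \<open>x\<close> is commuted past the first letter, and
    the bracket term applies single letters to the shorter word.\<close>
  have X: "\<forall>x\<in>S. act1 x (act_word w p) \<in> induced W" if "set w \<subseteq> S - T" "p \<in> W" for w p
    using that(1)
  proof (induction w)
    case Nil
    show ?case
    proof
      fix x assume x: "x \<in> S"
      show "act1 x (act_word [] p) \<in> induced W"
      proof (cases "x \<in> T")
        case True
        then have "act1 x p \<in> W" using assms that(2) by (simp add: stable_def)
        then show ?thesis using induced_superset by auto
      next
        case False
        then show ?thesis using Y[of x p] x that(2) induced_superset by auto
      qed
    qed
  next
    case (Cons y w)
    let ?q = "act_word w p"
    have q: "?q \<in> carr" using Cons.prems that W by (intro act_word_carr) auto
    have y: "y \<in> S - T" using Cons.prems by simp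
    show ?case
    proof
      fix x assume x: "x \<in> S"
      have "act1 x (act1 y ?q) = act1 y (act1 x ?q) + lin (\<lambda>z. act1 z ?q) (br x y)"
        using act1_br[OF q x] y by simp
      moreover have "act1 y (act1 x ?q) \<in> induced W" using Y[OF y] Cons x by simp
      moreover have "lin (\<lambda>z. act1 z ?q) (br x y) \<in> induced W"
        using Cons br_S[OF x] y unfolding induced_def
        by (intro lin_closed[OF pm.subspace_span]) auto
      ultimately show "act1 x (act_word (y # w) p) \<in> induced W"
        by (simp add: induced_def pm.span_add)
    qed
  qed
  have "act1 x p \<in> induced W" if "x \<in> S" "p \<in> induced W" for x p
    using that X unfolding induced_def
    by (intro span_act1_closed[of ?A x ?A p]) auto
  moreover have "induced W \<subseteq> carr"
    unfolding induced_def using W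
    by (intro pm.span_minimal subspace_carr) (auto intro!: act_word_carr)
  ultimately show ?thesis by (simp add: stable_def induced_def)
qed

end

declare Poly_Mapping.single_one [simp del]

section \<open>The Block bracket as a Lie bracket on basis letters\<close>

section \<open>The bracket\<close>

lemma bracket_lin: "bracket x y = lin (\<lambda>s. lin (\<lambda>t. basis_bracket s t) y) x"
  by (simp add: bracket_def lin_def pm.scale_sum_right)

lemma bracket_single [simp]:
  "bracket (Poly_Mapping.single s 1) (Poly_Mapping.single t 1) = basis_bracket s t"
  by (simp add: bracket_lin)

lemma basis_bracket_C [simp]: "basis_bracket x C = 0"
  by (cases x) simp_all

lemma basis_bracket_anti: "basis_bracket x y = - basis_bracket y x"
proof (cases x; cases y)
  fix \<alpha> \<beta> :: 'a and i j :: int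
  assume "x = L \<alpha> i" "y = L \<beta> j"
  then show ?thesis
    by (auto simp: add.commute minus_equation_iff[of \<alpha>] eq_commute[of "- \<beta>"] algebra_simps
        single_uminus[symmetric] single_add[symmetric] intro!: poly_mapping_eqI)
qed simp_all

text \<open>Two identities: \<open>s1\<close> for the part along \<open>L\<close>, where all three
  terms hit the same letter, and \<open>s2\<close> for the central cocycle, which contributes only
  if the grades sum to 0 and the indices to -2.\<close>

lemma basis_bracket_jacobi:
  "lin (\<lambda>z. basis_bracket z w) (basis_bracket x y) + lin (\<lambda>z. basis_bracket z x) (basis_bracket y w) +
   lin (\<lambda>z. basis_bracket z y) (basis_bracket w x) = 0"
proof (cases x; cases y; cases w)
  fix \<alpha> \<beta> \<gamma> :: 'a and i j k :: int
  assume xyz: "x = L \<alpha> i" "y = L \<beta> j" "w = L \<gamma> k"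
  have a: "\<beta> + \<gamma> + \<alpha> = \<alpha> + \<beta> + \<gamma>" "\<gamma> + \<alpha> + \<beta> = \<alpha> + \<beta> + \<gamma>" "j + k + i = i + j + k" "k + i + j = i + j + k"
    by simp_all
  have c: "(\<alpha> + \<beta> = - \<gamma> \<and> i + j + k = -2) = (\<alpha> + \<beta> + \<gamma> = 0 \<and> i + j + k = -2)"
    "(\<beta> + \<gamma> = - \<alpha> \<and> i + j + k = -2) = (\<alpha> + \<beta> + \<gamma> = 0 \<and> i + j + k = -2)"
    "(\<gamma> + \<alpha> = - \<beta> \<and> i + j + k = -2) = (\<alpha> + \<beta> + \<gamma> = 0 \<and> i + j + k = -2)"
    by (auto simp: eq_neg_iff_add_eq_0 add_ac)
  define A B D where "A = of_int (i + 1) * \<beta> - of_int (j + 1) * \<alpha>"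
    and "B = of_int (j + 1) * \<gamma> - of_int (k + 1) * \<beta>"
    and "D = of_int (k + 1) * \<alpha> - of_int (i + 1) * \<gamma>"
  have s1: "A * (of_int (i + j + 1) * \<gamma> - of_int (k + 1) * (\<alpha> + \<beta>)) +
    B * (of_int (j + k + 1) * \<alpha> - of_int (i + 1) * (\<beta> + \<gamma>)) +
    D * (of_int (k + i + 1) * \<beta> - of_int (j + 1) * (\<gamma> + \<alpha>)) = 0"
    unfolding A_def B_def D_def by (simp add: algebra_simps)
  have s2: "A * (\<alpha> + \<beta>) + B * (\<beta> + \<gamma>) + D * (\<gamma> + \<alpha>) = 0" if "\<alpha> + \<beta> + \<gamma> = 0" "i + j + k = -2"
  proof -
    have g: "\<gamma> = - \<alpha> - \<beta>" using that(1) by (simp add: eq_neg_iff_add_eq_0 algebra_simps)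
    show ?thesis unfolding A_def B_def D_def g by (simp add: algebra_simps)
  qed
  have AB: "basis_bracket x y = Poly_Mapping.single (L (\<alpha> + \<beta>) (i + j)) A + Poly_Mapping.single C (if \<alpha> = - \<beta> \<and> i + j = -2 then \<alpha> else 0)"
    "basis_bracket y w = Poly_Mapping.single (L (\<beta> + \<gamma>) (j + k)) B + Poly_Mapping.single C (if \<beta> = - \<gamma> \<and> j + k = -2 then \<beta> else 0)"
    "basis_bracket w x = Poly_Mapping.single (L (\<gamma> + \<alpha>) (k + i)) D + Poly_Mapping.single C (if \<gamma> = - \<alpha> \<and> k + i = -2 then \<gamma> else 0)"
    by (simp_all add: xyz A_def B_def D_def)
  show ?thesis
    unfolding AB unfolding xyz
  proof (rule poly_mapping_eqI)
    fix t
    show "Poly_Mapping.lookup (lin (\<lambda>z. basis_bracket z (L \<gamma> k)) (Poly_Mapping.single (L (\<alpha> + \<beta>) (i + j)) A + Poly_Mapping.single C (if \<alpha> = - \<beta> \<and> i + j = -2 then \<alpha> else 0)) +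
      lin (\<lambda>z. basis_bracket z (L \<alpha> i)) (Poly_Mapping.single (L (\<beta> + \<gamma>) (j + k)) B + Poly_Mapping.single C (if \<beta> = - \<gamma> \<and> j + k = -2 then \<beta> else 0)) +
      lin (\<lambda>z. basis_bracket z (L \<beta> j)) (Poly_Mapping.single (L (\<gamma> + \<alpha>) (k + i)) D + Poly_Mapping.single C (if \<gamma> = - \<alpha> \<and> k + i = -2 then \<gamma> else 0))) t =
      Poly_Mapping.lookup 0 t"
      unfolding lin_add lin_single basis_bracket.simps a c pm.scale_zero_right add_0_right
      using s1 s2 by (simp add: lookup_add lookup_single when_def a)
  qed
qed simp_all

lemma keys_basis_bracket:
  "z \<in> Poly_Mapping.keys (basis_bracket (L \<alpha> i) (L \<beta> j)) \<Longrightarrow>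
   z = L (\<alpha> + \<beta>) (i + j) \<and> of_int (i + 1) * \<beta> - of_int (j + 1) * \<alpha> \<noteq> 0 \<or>
   z = C \<and> \<alpha> = - \<beta> \<and> i + j = -2 \<and> \<alpha> \<noteq> 0"
  by (auto simp: in_keys_iff lookup_add lookup_single when_def split: if_splits)

text \<open>The index -2 could arise only from two indices -1, and there the coefficient is
  zero.\<close>

lemma basis_bracket_index:
  assumes "additive_subgroup G base_field" "x \<in> block_index G" "y \<in> block_index G"
  shows "Poly_Mapping.keys (basis_bracket x y) \<subseteq> block_index G"
proof -
  have add: "a + b \<in> G" if "a \<in> G" "b \<in> G" for a b
    using additive_subgroup.a_closed[OF assms(1) that] by (simp add: ring_of_type_algebra_def)
  show ?thesis
  proof (cases x; cases y)
    fix \<alpha> i \<beta> j assume xy: "x = L \<alpha> i" "y = L \<beta> j"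
    then have i: "\<alpha> \<in> G" "i \<ge> -1" "\<beta> \<in> G" "j \<ge> -1" using assms by (auto simp: block_index_def)
    show ?thesis
    proof
      fix z assume "z \<in> Poly_Mapping.keys (basis_bracket x y)"
      from keys_basis_bracket[OF this[unfolded xy]] show "z \<in> block_index G"
      proof
        assume z: "z = L (\<alpha> + \<beta>) (i + j) \<and> of_int (i + 1) * \<beta> - of_int (j + 1) * \<alpha> \<noteq> 0"
        then have "\<not> (i = -1 \<and> j = -1)" by auto
        then show ?thesis using z i add by (auto simp: block_index_def)
      qed (simp add: block_index_def)
    qed
  qed simp_all
qed

lemma C_index [simp]: "C \<in> block_index G"
  by (simp add: block_index_def)

lemma L_index [simp]: "L \<alpha> i \<in> block_index G \<longleftrightarrow> \<alpha> \<in> G \<and> i \<ge> -1"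
  by (auto simp: block_index_def)

lemma single_block_algebra [simp]: "x \<in> block_index G \<Longrightarrow> Poly_Mapping.single x a \<in> block_algebra G"
  by (auto simp: block_algebra_def)

lemma block_algebra_add: "x \<in> block_algebra G \<Longrightarrow> y \<in> block_algebra G \<Longrightarrow> x + y \<in> block_algebra G"
  and block_algebra_scale: "x \<in> block_algebra G \<Longrightarrow> a \<cdot> x \<in> block_algebra G"
  and block_algebra_zero [simp]: "0 \<in> block_algebra G"
  using keys_add[of x y] keys_pm_scale[of a x] by (auto simp: block_algebra_def)

lemma block_algebra_lin:
  "(\<And>z. z \<in> Poly_Mapping.keys u \<Longrightarrow> f z \<in> block_algebra G) \<Longrightarrow> lin f u \<in> block_algebra G"
  using keys_lin[of f u] by (fastforce simp: block_algebra_def)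

lemma bracket_closed:
  "additive_subgroup G base_field \<Longrightarrow> x \<in> block_algebra G \<Longrightarrow> y \<in> block_algebra G \<Longrightarrow> bracket x y \<in> block_algebra G"
  unfolding bracket_lin
  by (intro block_algebra_lin) (use basis_bracket_index[of G] in \<open>unfold block_algebra_def, blast\<close>)

section \<open>Linear combinations and basis letters in carrier-based modules\<close>

section \<open>Linear algebra in abstract modules\<close>

lemma base_field_simps [simp]:
  "carrier (base_field :: 'f::field_char_0 ring) = UNIV"
  "add (base_field :: 'f ring) = (+)" "monoid.mult (base_field :: 'f ring) = (*)"
  "zero (base_field :: 'f ring) = 0" "one (base_field :: 'f ring) = 1"
  by (simp_all add: ring_of_type_algebra_def)

lemma base_field_a_inv [simp]: "a_inv (base_field :: 'f::field_char_0 ring) a = - a"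
proof -
  interpret cring "base_field :: 'f ring" by (rule cring_from_type_algebra)
  show ?thesis using minus_equality[of "- a" a] by simp
qed

lemma additive_subgroup_base_field:
  fixes G :: "'f::field_char_0 set"
  shows "additive_subgroup G base_field \<longleftrightarrow> 0 \<in> G \<and> (\<forall>x\<in>G. \<forall>y\<in>G. x + y \<in> G) \<and> (\<forall>x\<in>G. - x \<in> G)"
proof -
  interpret cring "base_field :: 'f ring" by (rule cring_from_type_algebra)
  have "m_inv (add_monoid (base_field :: 'f ring)) a = - a" for a :: 'f
    using base_field_a_inv[of a] unfolding a_inv_def .
  then show ?thesis
    by (auto simp: additive_subgroup_def subgroup_def)
qed

lemma pm_induct_all [case_names zero add single]:
  fixes u :: "'a \<Rightarrow>\<^sub>0 'f::field_char_0"
  assumes "P 0" "\<And>u v. P u \<Longrightarrow> P v \<Longrightarrow> P (u + v)" "\<And>z a. P (Poly_Mapping.single z a)"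
  shows "P u"
  using pm_induct[of u UNIV P] assms by blast

context block_module
begin

lemma smult_simps [simp]:
  "v \<in> carrier V \<Longrightarrow> a \<odot> v \<in> carrier V"
  "v \<in> carrier V \<Longrightarrow> (1 :: 'f) \<odot> v = v" "v \<in> carrier V \<Longrightarrow> 0 \<odot> v = \<zero>"
  "a \<odot> \<zero> = \<zero>"
  using smult_closed[of a v] smult_one[of v] smult_l_null[of v] smult_r_null[of a] by simp_all

lemma smult_distribs:
  "v \<in> carrier V \<Longrightarrow> (a + b) \<odot> v = a \<odot> v \<oplus> b \<odot> v"
  "v \<in> carrier V \<Longrightarrow> w \<in> carrier V \<Longrightarrow> a \<odot> (v \<oplus> w) = a \<odot> v \<oplus> a \<odot> w"
  "v \<in> carrier V \<Longrightarrow> (a * b) \<odot> v = a \<odot> (b \<odot> v)"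
  using smult_l_distr[of a b v] smult_r_distr[of a v w] smult_assoc1[of a b v] by simp_all

definition vlin :: "('z \<Rightarrow> 'v) \<Rightarrow> ('z \<Rightarrow>\<^sub>0 'f) \<Rightarrow> 'v" where
  "vlin g u = (\<Oplus>z\<in>Poly_Mapping.keys u. Poly_Mapping.lookup u z \<odot> g z)"

lemma vlin_closed [simp]: "range g \<subseteq> carrier V \<Longrightarrow> vlin g u \<in> carrier V"
  by (auto simp: vlin_def image_subset_iff intro!: M.finsum_closed)

lemma vlin_superset:
  assumes "range g \<subseteq> carrier V" "finite A" "Poly_Mapping.keys u \<subseteq> A"
  shows "vlin g u = (\<Oplus>z\<in>A. Poly_Mapping.lookup u z \<odot> g z)"
proof -
  have g: "g z \<in> carrier V" for z using assms(1) by auto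
  show ?thesis
    unfolding vlin_def
    by (rule M.add.finprod_mono_neutral_cong_left) (use assms(2,3) g in \<open>auto simp: in_keys_iff\<close>)
qed

lemma vlin_add:
  assumes "range g \<subseteq> carrier V"
  shows "vlin g (u + w) = vlin g u \<oplus> vlin g w"
proof -
  let ?A = "Poly_Mapping.keys u \<union> Poly_Mapping.keys w"
  have g: "g z \<in> carrier V" for z using assms by auto
  have "vlin g (u + w) = (\<Oplus>z\<in>?A. Poly_Mapping.lookup u z \<odot> g z \<oplus> Poly_Mapping.lookup w z \<odot> g z)"
    using vlin_superset[OF assms, of ?A "u + w"] keys_add[of u w] g by (simp add: lookup_add smult_distribs)
  also have "\<dots> = vlin g u \<oplus> vlin g w"
    using vlin_superset[OF assms, of ?A] g by (simp add: M.finsum_addf)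
  finally show ?thesis .
qed

lemma vlin_zero [simp]: "vlin g 0 = \<zero>"
  by (simp add: vlin_def)

lemma vlin_single [simp]: "range g \<subseteq> carrier V \<Longrightarrow> vlin g (Poly_Mapping.single z a) = a \<odot> g z"
  using vlin_superset[of g "{z}" "Poly_Mapping.single z a"] by (auto simp: subset_iff)

lemma vlin_scale: "range g \<subseteq> carrier V \<Longrightarrow> vlin g (a \<cdot> u) = a \<odot> vlin g u"
proof (induction u rule: pm_induct_all)
  case (add u w)
  then show ?case by (simp add: pm.scale_right_distrib vlin_add smult_distribs)
next
  case (single z b)
  then have "g z \<in> carrier V" by auto
  then show ?case using single by (simp add: smult_distribs)
qed simp_all

lemma vlin_lin:
  assumes "range g \<subseteq> carrier V"
  shows "vlin g (lin f u) = vlin (\<lambda>z. vlin g (f z)) u"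
proof (induction u rule: pm_induct_all)
  case (add u w)
  then show ?case using assms by (simp add: lin_add vlin_add image_subset_iff)
next
  case (single z a)
  then show ?case using assms by (simp add: vlin_scale image_subset_iff)
qed simp_all

lemma vlin_map:
  assumes "range g \<subseteq> carrier V" "range (\<lambda>z. h (g z)) \<subseteq> carrier V" "h \<zero> = \<zero>"
    "\<And>v w. v \<in> carrier V \<Longrightarrow> w \<in> carrier V \<Longrightarrow> h (v \<oplus> w) = h v \<oplus> h w"
    "\<And>a v. v \<in> carrier V \<Longrightarrow> h (a \<odot> v) = a \<odot> h v"
  shows "h (vlin g u) = vlin (\<lambda>z. h (g z)) u"
proof (induction u rule: pm_induct_all)
  case (add u w)
  then show ?case using assms by (simp add: vlin_add)
next
  case (single z a)
  have "g z \<in> carrier V" using assms(1) by auto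
  then show ?case using assms by simp
qed (use assms in simp_all)

lemma vlin_cong: "range g \<subseteq> carrier V \<Longrightarrow> (\<And>z. z \<in> Poly_Mapping.keys u \<Longrightarrow> f z = g z) \<Longrightarrow> vlin f u = vlin g u"
  unfolding vlin_def by (rule M.finsum_cong') (auto simp: image_subset_iff)

lemma act_zero_right [simp]: "x \<in> block_algebra G \<Longrightarrow> act V x \<zero> = \<zero>"
  using act_scale_right[of x "\<zero>" 0] act_closed[of x "\<zero>"] by simp

lemma act_zero_left [simp]: "v \<in> carrier V \<Longrightarrow> act V 0 v = \<zero>"
  using act_scale_left[of 0 v 0] act_closed[of 0 v] by simp

text \<open>Made total with default value zero, so that it can be fed to \<open>vlin\<close>, whose
  laws want the whole range of the function inside the carrier.\<close>

definition act_basis :: "'f block_basis \<Rightarrow> 'v \<Rightarrow> 'v" where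
  "act_basis x v = (if x \<in> block_index G \<and> v \<in> carrier V then act V (Poly_Mapping.single x 1) v else \<zero>)"

lemma act_basis_closed [simp]: "act_basis x v \<in> carrier V"
  by (simp add: act_basis_def act_closed)

lemma act_vlin:
  assumes "u \<in> block_algebra G" "v \<in> carrier V"
  shows "act V u v = vlin (\<lambda>x. act_basis x v) u"
proof -
  have "Poly_Mapping.keys u \<subseteq> block_index G" using assms by (simp add: block_algebra_def)
  then show ?thesis
  proof (induction u rule: pm_induct)
    case zero
    then show ?case using assms by simp
  next
    case (add u w)
    then show ?case using assms act_add_left[of u w v] by (simp add: block_algebra_def vlin_add image_subset_iff)
  next
    case (single z a)
    then show ?case using assms act_scale_left[of "Poly_Mapping.single z 1" v a]
      by (simp add: image_subset_iff) (simp add: act_basis_def)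
  qed
qed

lemma act_basis_add: "v \<in> carrier V \<Longrightarrow> w \<in> carrier V \<Longrightarrow> act_basis x (v \<oplus> w) = act_basis x v \<oplus> act_basis x w"
  and act_basis_scale: "v \<in> carrier V \<Longrightarrow> act_basis x (a \<odot> v) = a \<odot> act_basis x v"
  and act_basis_zero [simp]: "act_basis x \<zero> = \<zero>"
  by (auto simp: act_basis_def act_add_right act_scale_right)

lemma act_basis_vlin:
  "range g \<subseteq> carrier V \<Longrightarrow> act_basis x (vlin g u) = vlin (\<lambda>z. act_basis x (g z)) u"
  by (rule vlin_map) (auto simp: act_basis_add act_basis_scale)

lemma act_basis_bracket:
  assumes G: "additive_subgroup G base_field" and "x \<in> block_index G" "y \<in> block_index G" "v \<in> carrier V"
  shows "act_basis x (act_basis y v) = act_basis y (act_basis x v) \<oplus> vlin (\<lambda>z. act_basis z v) (basis_bracket x y)"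
proof -
  have "basis_bracket x y \<in> block_algebra G"
    using basis_bracket_index[OF assms(1-3)] by (simp add: block_algebra_def)
  then have "vlin (\<lambda>z. act_basis z v) (basis_bracket x y) = act V (basis_bracket x y) v"
    using act_vlin assms by simp
  also have "\<dots> = act_basis x (act_basis y v) \<ominus> act_basis y (act_basis x v)"
    using act_bracket[of "Poly_Mapping.single x 1" "Poly_Mapping.single y 1" v] assms
      by (simp add: act_basis_def act_closed)
  finally have e: "vlin (\<lambda>z. act_basis z v) (basis_bracket x y) = act_basis x (act_basis y v) \<ominus> act_basis y (act_basis x v)" .
  show ?thesis
    unfolding e using M.a_lcomm[of "act_basis y (act_basis x v)" "act_basis x (act_basis y v)"]
    by (simp add: M.minus_eq M.r_neg)
qed

end

section \<open>The concrete induced module and its universal property\<close>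

section \<open>Induced modules of Block type Lie algebras\<close>

definition block_hom ::
    "'f::field_char_0 set \<Rightarrow> ('f, 'v, 'm) block_mod_scheme \<Rightarrow> ('f, 'w, 'n) block_mod_scheme \<Rightarrow> ('v \<Rightarrow> 'w) \<Rightarrow> bool" where
  "block_hom G V W \<phi> \<longleftrightarrow> \<phi> \<in> carrier V \<rightarrow> carrier W \<and>
     (\<forall>u\<in>carrier V. \<forall>v\<in>carrier V. \<phi> (u \<oplus>\<^bsub>V\<^esub> v) = \<phi> u \<oplus>\<^bsub>W\<^esub> \<phi> v) \<and>
     (\<forall>a. \<forall>v\<in>carrier V. \<phi> (a \<odot>\<^bsub>V\<^esub> v) = a \<odot>\<^bsub>W\<^esub> \<phi> v) \<and>
     (\<forall>x\<in>block_algebra G. \<forall>v\<in>carrier V. \<phi> (act V x v) = act W x (\<phi> v))"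

locale block_pbw =
  fixes G :: "'f::field_char_0 set" and T :: "'f block_basis set" and \<chi> :: "'f block_basis \<Rightarrow> 'f"
  assumes G: "additive_subgroup G base_field"
    and T_index: "T \<subseteq> block_index G"
    and T_closed: "x \<in> T \<Longrightarrow> y \<in> T \<Longrightarrow> Poly_Mapping.keys (basis_bracket x y) \<subseteq> T"
    and chi_bracket: "x \<in> T \<Longrightarrow> y \<in> T \<Longrightarrow>
      (\<Sum>z\<in>Poly_Mapping.keys (basis_bracket x y). Poly_Mapping.lookup (basis_bracket x y) z * \<chi> z) = 0"
begin

sublocale pbw "block_index G" T basis_bracket \<chi>
  by (rule pbw.intro)
     (fact T_index, fact basis_bracket_index[OF G], fact T_closed, fact basis_bracket_anti,
      fact basis_bracket_jacobi, fact chi_bracket)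

definition model :: "('f, 'f block_basis multiset \<Rightarrow>\<^sub>0 'f) block_mod" where
  "model = \<lparr>carrier = carr, monoid.mult = undefined, one = undefined, zero = 0, add = (+),
     module.smult = pm_scale, act = (\<lambda>u p. lin (\<lambda>x. act1 x p) u)\<rparr>"

lemma model_simps [simp]:
  "carrier model = carr" "zero model = 0" "add model = (+)" "module.smult model = pm_scale"
  "act model = (\<lambda>u p. lin (\<lambda>x. act1 x p) u)"
  by (simp_all add: model_def)

lemma model_act_closed: "u \<in> block_algebra G \<Longrightarrow> p \<in> carr \<Longrightarrow> lin (\<lambda>x. act1 x p) u \<in> carr"
  by (rule lin_closed[OF subspace_carr]) (auto simp: block_algebra_def intro!: act1_carr)

lemma model_module: "module base_field model"
proof (rule moduleI)
  show "cring (base_field :: 'f ring)" by (rule cring_from_type_algebra)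
  show "abelian_group model"
  proof (rule abelian_groupI)
    fix p assume "p \<in> carrier model"
    then show "\<exists>q\<in>carrier model. q \<oplus>\<^bsub>model\<^esub> p = \<zero>\<^bsub>model\<^esub>"
      using pm.subspace_neg[OF subspace_carr] by (intro bexI[of _ "- p"]) auto
  qed (auto simp: subspace_carr pm.subspace_add pm.subspace_0 add_ac)
qed (auto simp: subspace_carr pm.subspace_scale pm.scale_left_distrib pm.scale_right_distrib)

lemma model_a_inv: "p \<in> carr \<Longrightarrow> a_inv model p = - p"
proof -
  assume p: "p \<in> carr"
  interpret module base_field model by (rule model_module)
  show ?thesis using M.minus_equality[of "- p" p] p pm.subspace_neg[OF subspace_carr, of p] by simp
qed

lemma block_module_model: "block_module G model"
proof -
  interpret module base_field model by (rule model_module)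
  have br: "lin (\<lambda>s. act1 s p) (bracket x y) = lin (\<lambda>s. act1 s (lin (\<lambda>t. act1 t p) y)) x - lin (\<lambda>t. act1 t (lin (\<lambda>s. act1 s p) x)) y"
    if "x \<in> block_algebra G" "y \<in> block_algebra G" "p \<in> carr" for x y p
  proof -
    have "lin (\<lambda>t. act1 s (act1 t p)) y = lin (\<lambda>t. act1 t (act1 s p)) y + lin (\<lambda>z. act1 z p) (lin (basis_bracket s) y)"
      if "s \<in> Poly_Mapping.keys x" for s
    proof -
      have "lin (\<lambda>t. act1 s (act1 t p)) y = lin (\<lambda>t. act1 t (act1 s p) + lin (\<lambda>z. act1 z p) (basis_bracket s t)) y"
        using that \<open>x \<in> _\<close> \<open>y \<in> _\<close> \<open>p \<in> _\<close> by (intro lin_cong act1_br) (auto simp: block_algebra_def)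
      then show ?thesis by (simp only: lin_fun_add lin_lin)
    qed
    then have "lin (\<lambda>s. lin (\<lambda>t. act1 s (act1 t p)) y) x = lin (\<lambda>s. lin (\<lambda>t. act1 t (act1 s p)) y) x + lin (\<lambda>s. act1 s p) (bracket x y)"
      unfolding bracket_lin lin_lin lin_fun_add[symmetric] by (rule lin_cong)
    then show ?thesis
      by (simp add: act1_lin lin_swap[where u = y and v = x])
  qed
  show ?thesis
  proof (rule block_module.intro[OF model_module], unfold_locales, goal_cases)
    case (6 x y p)
    then show ?case using br[of x y p] model_act_closed
      by (simp add: a_minus_def model_a_inv)
  qed (simp_all add: model_act_closed lin_add lin_scale act1_add act1_scale lin_fun_add lin_fun_scale)
qed

lemma model_submodule: "submodule N base_field model \<longleftrightarrow> pm.subspace N \<and> N \<subseteq> carr"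
proof -
  interpret module base_field model by (rule model_module)
  show ?thesis
  proof
    assume N: "submodule N base_field model"
    from submoduleE[OF N] submodule.axioms(1)[OF N, THEN subgroup.one_closed]
    show "pm.subspace N \<and> N \<subseteq> carr" by (auto simp: pm.subspace_def)
  next
    assume "pm.subspace N \<and> N \<subseteq> carr"
    then show "submodule N base_field model"
      by (intro submoduleI)
         (auto simp: pm.subspace_0 pm.subspace_add pm.subspace_scale subset_iff model_a_inv intro: pm.subspace_neg)
  qed
qed

text \<open>Allowing a smaller \<open>G'\<close> covers the submodules over the subalgebra belonging
  to the multiples of one element.\<close>

lemma block_submodule_model:
  assumes "G' \<subseteq> G"
  shows "block_submodule G' N model \<longleftrightarrow> stable (block_index G') N"
proof
  assume N: "block_submodule G' N model"
  have "act1 x p \<in> N" if "x \<in> block_index G'" "p \<in> N" for x p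
  proof -
    have "act model (Poly_Mapping.single x 1) p \<in> N"
      using N that unfolding block_submodule_def by (blast intro: single_block_algebra)
    then show ?thesis by simp
  qed
  then show "stable (block_index G') N"
    using N unfolding stable_def block_submodule_def model_submodule by blast
next
  assume N: "stable (block_index G') N"
  have "lin (\<lambda>x. act1 x p) u \<in> N" if "u \<in> block_algebra G'" "p \<in> N" for u p
    using that stableD[OF N] by (intro lin_closed) (auto simp: block_algebra_def)
  then show "block_submodule G' N model"
    using stableD(1,2)[OF N] unfolding block_submodule_def model_submodule by simp
qed

abbreviation vac :: "'f block_basis multiset \<Rightarrow>\<^sub>0 'f" where
  "vac \<equiv> Poly_Mapping.single {#} 1"

lemma vac_carr: "vac \<in> carr"
  by simp

lemma act1_vac_T: "t \<in> T \<Longrightarrow> act1 t vac = \<chi> t \<cdot> vac"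
  using nf_snoc_T[of t "[]"] act1_single[of t "{#}" 1] by simp

end

text \<open>The universal property of induced modules.\<close>

locale block_pbw_target = block_pbw G T \<chi> + V: block_module G V
  for G :: "'f::field_char_0 set" and T \<chi> and V :: "('f, 'v, 'm) block_mod_scheme" (structure) +
  fixes v
  assumes v_carrier: "v \<in> carrier V"
    and v_eigen: "t \<in> T \<Longrightarrow> act V (Poly_Mapping.single t 1) v = \<chi> t \<odot> v"
begin

definition word_vec :: "'f block_basis list \<Rightarrow> 'v" where
  "word_vec w = foldr V.act_basis w v"

lemma word_vec_carrier [simp]: "word_vec w \<in> carrier V"
  by (cases w) (simp_all add: word_vec_def v_carrier)

lemma range_word_vec: "range (\<lambda>m. word_vec (word m)) \<subseteq> carrier V" "range (\<lambda>z. word_vec (f z)) \<subseteq> carrier V"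
  by auto

definition univ_map :: "('f block_basis multiset \<Rightarrow>\<^sub>0 'f) \<Rightarrow> 'v" where
  "univ_map p = V.vlin (\<lambda>m. word_vec (word m)) p"

lemma univ_map_closed [simp]: "univ_map p \<in> carrier V"
  by (simp add: univ_map_def image_subset_iff)

lemma univ_map_add: "univ_map (p + q) = univ_map p \<oplus> univ_map q"
  and univ_map_scale: "univ_map (a \<cdot> p) = a \<odot> univ_map p"
  and univ_map_zero: "univ_map 0 = \<zero>"
  using V.vlin_add[OF range_word_vec(1)] V.vlin_scale[OF range_word_vec(1)] by (simp_all add: univ_map_def)

text \<open>Each rewriting step is a valid identity in \<open>V\<close>, so the vector that a word
  produces from \<open>v\<close> depends only on its normal form.\<close>

lemma univ_map_nf: "set w \<subseteq> block_index G \<Longrightarrow> univ_map (nf w) = word_vec w"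
proof (induction w rule: word_induct)
  case (snoc w t)
  have "foldr V.act_basis w (a \<odot> v) = a \<odot> foldr V.act_basis w v \<and> foldr V.act_basis w v \<in> carrier V" for a
    by (induction w) (auto simp: v_carrier V.act_basis_scale)
  moreover have "V.act_basis t v = \<chi> t \<odot> v"
    using snoc v_eigen T_index v_carrier by (auto simp: V.act_basis_def)
  ultimately show ?case using snoc by (simp add: univ_map_scale word_vec_def)
next
  case (sorted w)
  then show ?case
    using V.vlin_single[OF range_word_vec(1)] by (simp add: nf_sorted univ_map_def word_mset)
next
  case (descent u x y w)
  have w: "foldr V.act_basis w v \<in> carrier V" using word_vec_carrier[of w] by (simp add: word_vec_def)
  have *: "foldr V.act_basis u (a \<oplus> b) = foldr V.act_basis u a \<oplus> foldr V.act_basis u b \<and>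
      foldr V.act_basis u a \<in> carrier V \<and> foldr V.act_basis u b \<in> carrier V"
    if "a \<in> carrier V" "b \<in> carrier V" for a b
    using that by (induction u) (auto simp: V.act_basis_add)
  have **: "foldr V.act_basis u (V.vlin g f) = V.vlin (\<lambda>z. foldr V.act_basis u (g z)) f \<and>
      range (\<lambda>z. foldr V.act_basis u (g z)) \<subseteq> carrier V"
    if "range g \<subseteq> carrier V" for g :: "'f block_basis \<Rightarrow> 'v" and f
    using that by (induction u) (auto simp: V.act_basis_vlin)
  have "univ_map (lin (\<lambda>z. nf (u @ z # w)) (basis_bracket x y)) =
      V.vlin (\<lambda>z. univ_map (nf (u @ z # w))) (basis_bracket x y)"
    using V.vlin_lin[OF range_word_vec(1)] by (simp add: univ_map_def)
  also have "\<dots> = V.vlin (\<lambda>z. word_vec (u @ z # w)) (basis_bracket x y)"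
    using descent by (intro V.vlin_cong) auto
  also have "\<dots> = foldr V.act_basis u (V.vlin (\<lambda>z. V.act_basis z (foldr V.act_basis w v)) (basis_bracket x y))"
    using ** by (simp add: word_vec_def image_subset_iff)
  finally have 1: "univ_map (lin (\<lambda>z. nf (u @ z # w)) (basis_bracket x y)) = \<dots>" .
  have "word_vec (u @ x # y # w) = foldr V.act_basis u (V.act_basis x (V.act_basis y (foldr V.act_basis w v)))"
    by (simp add: word_vec_def)
  also have "V.act_basis x (V.act_basis y (foldr V.act_basis w v)) =
      V.act_basis y (V.act_basis x (foldr V.act_basis w v)) \<oplus> V.vlin (\<lambda>z. V.act_basis z (foldr V.act_basis w v)) (basis_bracket x y)"
    using descent by (intro V.act_basis_bracket[OF G _ _ w]) auto
  finally show ?case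
    using descent 1 * exchange[of u x y w]
    by (simp add: univ_map_add image_subset_iff) (simp add: word_vec_def)
qed

lemma univ_map_vac: "univ_map vac = v"
  using univ_map_nf[of "[]"] by (simp add: word_vec_def)

lemma univ_map_act1: "p \<in> carr \<Longrightarrow> x \<in> block_index G \<Longrightarrow> univ_map (act1 x p) = V.act_basis x (univ_map p)"
proof (induction p rule: carr_induct)
  case (nf w a)
  then have "set w \<subseteq> block_index G" by auto
  then show ?case using nf univ_map_nf[of w] univ_map_nf[of "x # w"]
    by (simp add: act1_nf act1_scale univ_map_scale V.act_basis_scale) (simp add: word_vec_def)
qed (simp_all add: act1_add univ_map_add univ_map_zero V.act_basis_add)

lemma univ_map_hom: "block_hom G model V univ_map"
proof -
  have "univ_map (lin (\<lambda>x. act1 x p) u) = act V u (univ_map p)"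
    if u: "u \<in> block_algebra G" and p: "p \<in> carr" for u p
  proof -
    have "univ_map (lin (\<lambda>x. act1 x p) u) = V.vlin (\<lambda>x. univ_map (act1 x p)) u"
      using V.vlin_lin[OF range_word_vec(1)] by (simp add: univ_map_def)
    also have "\<dots> = V.vlin (\<lambda>x. V.act_basis x (univ_map p)) u"
      using u p by (intro V.vlin_cong) (auto simp: block_algebra_def univ_map_act1)
    finally show ?thesis using V.act_vlin[OF u] by simp
  qed
  then show ?thesis by (simp add: block_hom_def univ_map_add univ_map_scale)
qed

end

section \<open>Submodules, images and quotients of modules\<close>

section \<open>Homomorphisms, submodules and quotients\<close>

lemma (in module) restricted_submodule:
  assumes A: "submodule A R M"
  shows "submodule N R (M\<lparr>carrier := A\<rparr>) \<longleftrightarrow> submodule N R M \<and> N \<subseteq> A"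
proof -
  have mA: "module R (M\<lparr>carrier := A\<rparr>)" by (rule submodule.submodule_is_module[OF A module_axioms])
  have A': "A \<subseteq> carrier M" by (rule submoduleE(1)[OF A])
  show ?thesis
  proof
    assume N: "submodule N R (M\<lparr>carrier := A\<rparr>)"
    have "N \<subseteq> A" using module.submoduleE(1)[OF mA N] by simp
    moreover have "module R (M\<lparr>carrier := N\<rparr>)" using submodule.submodule_is_module[OF N mA] by simp
    ultimately show "submodule N R M \<and> N \<subseteq> A" using module_incl_imp_submodule A' by blast
  next
    assume N: "submodule N R M \<and> N \<subseteq> A"
    then have "module R (M\<lparr>carrier := A, carrier := N\<rparr>)"
      using submodule.submodule_is_module[OF _ module_axioms] by simp
    then show "submodule N R (M\<lparr>carrier := A\<rparr>)"
      using N module.module_incl_imp_submodule[OF mA, of N] by simp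
  qed
qed

lemma submodule_zero: "submodule N R M \<Longrightarrow> \<zero>\<^bsub>M\<^esub> \<in> N"
  using subgroup.one_closed submodule.axioms(1) by fastforce

context block_module
begin

lemma block_submoduleD:
  assumes "block_submodule G' N V"
  shows "N \<subseteq> carrier V" "\<zero> \<in> N" "v \<in> N \<Longrightarrow> w \<in> N \<Longrightarrow> v \<oplus> w \<in> N" "v \<in> N \<Longrightarrow> \<ominus> v \<in> N"
    "v \<in> N \<Longrightarrow> a \<odot> v \<in> N" "x \<in> block_algebra G' \<Longrightarrow> v \<in> N \<Longrightarrow> act V x v \<in> N"
  using assms submoduleE[of N] submodule_zero[of N base_field V] by (auto simp: block_submodule_def)

lemma block_submoduleI:
  assumes "N \<subseteq> carrier V" "\<zero> \<in> N" "\<And>v w. v \<in> N \<Longrightarrow> w \<in> N \<Longrightarrow> v \<oplus> w \<in> N"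
    "\<And>a v. v \<in> N \<Longrightarrow> a \<odot> v \<in> N" "\<And>x v. x \<in> block_algebra G' \<Longrightarrow> v \<in> N \<Longrightarrow> act V x v \<in> N"
  shows "block_submodule G' N V"
proof -
  have "\<ominus> v \<in> N" if "v \<in> N" for v
  proof -
    have "v \<in> carrier V" using that assms(1) by blast
    then have "\<ominus> v = (-1) \<odot> v" using smult_l_minus[of 1 v] by simp
    then show ?thesis using assms(4) that by simp
  qed
  then show ?thesis unfolding block_submodule_def using assms by (auto intro!: submoduleI)
qed

lemma smult_minus_one: "v \<in> carrier V \<Longrightarrow> \<ominus> v = (-1) \<odot> v"
  using smult_l_minus[of 1 v] by simp

lemma eq_if_minus_zero:
  assumes "u \<in> carrier V" "v \<in> carrier V" "u \<ominus> v = \<zero>"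
  shows "u = v"
proof -
  have "u = (u \<ominus> v) \<oplus> v" using assms(1,2) by (simp add: M.minus_eq M.a_assoc M.l_neg)
  then show ?thesis using assms by simp
qed

lemma submodule_carrier: "block_submodule G (carrier V) V"
  by (rule block_submoduleI) (auto simp: act_closed)

lemma block_module_mono:
  assumes "G' \<subseteq> G"
  shows "block_module G' V"
proof -
  have sub: "x \<in> block_algebra G" if "x \<in> block_algebra G'" for x
    using that assms by (auto simp: block_algebra_def block_index_def)
  show ?thesis
    by (rule block_module.intro[OF module_axioms], unfold_locales)
       (simp_all add: sub act_closed act_add_left act_scale_left act_add_right act_scale_right act_bracket)
qed

lemma block_module_restrict:
  assumes A: "block_submodule G A V"
  shows "block_module G (V\<lparr>carrier := A\<rparr>)"
proof -
  have sA: "submodule A base_field V" using A by (simp add: block_submodule_def)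
  have m: "module base_field (V\<lparr>carrier := A\<rparr>)"
    by (rule submodule.submodule_is_module[OF sA module_axioms])
  have A': "A \<subseteq> carrier V" by (rule block_submoduleD(1)[OF A])
  have inv: "\<ominus>\<^bsub>V\<lparr>carrier := A\<rparr>\<^esub> v = \<ominus> v" if "v \<in> A" for v
  proof -
    interpret A: module base_field "V\<lparr>carrier := A\<rparr>" by (rule m)
    have "\<ominus>\<^bsub>V\<lparr>carrier := A\<rparr>\<^esub> v = (-1) \<odot> v" using A.smult_l_minus[of 1 v] that A.smult_one[of v] by simp
    then show ?thesis using smult_minus_one that A' by auto
  qed
  show ?thesis
  proof (rule block_module.intro[OF m], unfold_locales, goal_cases)
    case (6 x y v)
    then show ?case
      using A' inv block_submoduleD(6)[OF A] by (auto simp: act_bracket a_minus_def subset_iff)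
  qed (use A' block_submoduleD(6)[OF A] in \<open>auto simp: act_add_left act_scale_left act_add_right act_scale_right subset_iff\<close>)
qed

lemma restricted_block_submodule:
  assumes "block_submodule G A V"
  shows "block_submodule G N (V\<lparr>carrier := A\<rparr>) \<longleftrightarrow> block_submodule G N V \<and> N \<subseteq> A"
  using assms restricted_submodule[of A N] by (auto simp: block_submodule_def)

lemma irreducible_restrict:
  assumes A: "block_submodule G A V"
  shows "irreducible_module G (V\<lparr>carrier := A\<rparr>) \<longleftrightarrow>
    A \<noteq> {\<zero>} \<and> (\<forall>N. block_submodule G N V \<and> N \<subseteq> A \<longrightarrow> N = {\<zero>} \<or> N = A)"
  using block_module_restrict[OF A] restricted_block_submodule[OF A]
  by (auto simp: irreducible_module_def)

lemma generated_submodule_least: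
  "block_submodule G' N V \<Longrightarrow> S \<subseteq> N \<Longrightarrow> generated_submodule G' V S \<subseteq> N"
  by (auto simp: generated_submodule_def)

lemma zero_submodule: "block_submodule G {\<zero>} V"
  by (rule block_submoduleI) auto

end

locale block_homomorphism = V: block_module G V + W: block_module G W
  for G :: "'f::field_char_0 set" and V :: "('f, 'v, 'm) block_mod_scheme" and W :: "('f, 'w, 'n) block_mod_scheme" +
  fixes \<phi>
  assumes hom: "block_hom G V W \<phi>"
begin

lemma hom_simps:
  "v \<in> carrier V \<Longrightarrow> \<phi> v \<in> carrier W"
  "u \<in> carrier V \<Longrightarrow> v \<in> carrier V \<Longrightarrow> \<phi> (u \<oplus>\<^bsub>V\<^esub> v) = \<phi> u \<oplus>\<^bsub>W\<^esub> \<phi> v"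
  "v \<in> carrier V \<Longrightarrow> \<phi> (a \<odot>\<^bsub>V\<^esub> v) = a \<odot>\<^bsub>W\<^esub> \<phi> v"
  "x \<in> block_algebra G \<Longrightarrow> v \<in> carrier V \<Longrightarrow> \<phi> (act V x v) = act W x (\<phi> v)"
  using hom by (auto simp: block_hom_def)

lemma hom_zero: "\<phi> \<zero>\<^bsub>V\<^esub> = \<zero>\<^bsub>W\<^esub>"
  using hom_simps(3)[of "\<zero>\<^bsub>V\<^esub>" 0] hom_simps(1)[of "\<zero>\<^bsub>V\<^esub>"] by simp

lemma hom_minus: "u \<in> carrier V \<Longrightarrow> v \<in> carrier V \<Longrightarrow> \<phi> (u \<ominus>\<^bsub>V\<^esub> v) = \<phi> u \<ominus>\<^bsub>W\<^esub> \<phi> v"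
  using V.smult_minus_one W.smult_minus_one hom_simps by (simp add: a_minus_def)

lemma image_submodule:
  assumes N: "block_submodule G' N V" and "G' \<subseteq> G"
  shows "block_submodule G' (\<phi> ` N) W"
proof -
  note ND = V.block_submoduleD[OF N]
  have sub: "x \<in> block_algebra G" if "x \<in> block_algebra G'" for x
    using that assms by (auto simp: block_algebra_def block_index_def)
  have N': "v \<in> carrier V" if "v \<in> N" for v using ND(1) that by blast
  show ?thesis
  proof (rule W.block_submoduleI)
    show "\<phi> ` N \<subseteq> carrier W" using N' hom_simps(1) by blast
    show "\<zero>\<^bsub>W\<^esub> \<in> \<phi> ` N" using ND(2) hom_zero by (metis image_eqI)
    fix v w a x assume v: "v \<in> \<phi> ` N"
    then obtain v' where v': "v' \<in> N" "v = \<phi> v'" by blast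
    show "a \<odot>\<^bsub>W\<^esub> v \<in> \<phi> ` N" using v' ND(5)[of v' a] hom_simps(3)[OF N'] by (metis image_eqI)
    show "act W x v \<in> \<phi> ` N" if "x \<in> block_algebra G'"
      using v' ND(6)[of x v'] hom_simps(4)[OF sub N'] that by (metis image_eqI)
    show "v \<oplus>\<^bsub>W\<^esub> w \<in> \<phi> ` N" if "w \<in> \<phi> ` N"
      using that v' ND(3) hom_simps(2) N' by (auto simp: image_iff) metis
  qed
qed

lemma vimage_submodule:
  assumes N: "block_submodule G' N W" and "G' \<subseteq> G"
  shows "block_submodule G' {v \<in> carrier V. \<phi> v \<in> N} V"
proof -
  note ND = W.block_submoduleD[OF N]
  have sub: "x \<in> block_algebra G" if "x \<in> block_algebra G'" for x
    using that assms by (auto simp: block_algebra_def block_index_def)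
  show ?thesis
    by (rule V.block_submoduleI) (use ND sub in \<open>auto simp: hom_zero hom_simps V.act_closed\<close>)
qed

lemma kernel_submodule: "block_submodule G {v \<in> carrier V. \<phi> v = \<zero>\<^bsub>W\<^esub>} V"
  using vimage_submodule[OF W.zero_submodule] by simp

lemma inj_if_kernel:
  assumes "\<And>v. v \<in> carrier V \<Longrightarrow> \<phi> v = \<zero>\<^bsub>W\<^esub> \<Longrightarrow> v = \<zero>\<^bsub>V\<^esub>"
  shows "inj_on \<phi> (carrier V)"
proof (rule inj_onI)
  fix u v assume uv: "u \<in> carrier V" "v \<in> carrier V" "\<phi> u = \<phi> v"
  then have "\<phi> (u \<ominus>\<^bsub>V\<^esub> v) = \<zero>\<^bsub>W\<^esub>" using hom_minus[of u v] hom_simps(1) by (simp add: W.M.minus_eq W.M.r_neg)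
  then show "u = v" using assms[of "u \<ominus>\<^bsub>V\<^esub> v"] uv V.eq_if_minus_zero[of u v] by simp
qed

end

text \<open>No module axiom of \<open>W\<close> is presupposed: all are carried over from
  \<open>V\<close> along the surjection. This is how quotients are recognized as modules.\<close>

lemma hom_image_block_module:
  assumes G: "additive_subgroup G base_field" and "block_module G V" and surj: "carrier W = \<phi> ` carrier V" and zero_W: "\<zero>\<^bsub>W\<^esub> = \<phi> \<zero>\<^bsub>V\<^esub>"
    and hom: "block_hom G V W \<phi>"
  shows "block_module G W"
proof -
  interpret block_module G V by fact
  have h: "\<phi> u \<oplus>\<^bsub>W\<^esub> \<phi> v = \<phi> (u \<oplus>\<^bsub>V\<^esub> v)" "a \<odot>\<^bsub>W\<^esub> \<phi> v = \<phi> (a \<odot>\<^bsub>V\<^esub> v)"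
    "x \<in> block_algebra G \<Longrightarrow> act W x (\<phi> v) = \<phi> (act V x v)"
    if "u \<in> carrier V" "v \<in> carrier V" for u v a x
    using hom that by (auto simp: block_hom_def)
  have m: "module base_field W"
  proof (rule moduleI)
    show "cring (base_field :: 'a ring)" by (rule cring_from_type_algebra)
    show "abelian_group W"
    proof (rule abelian_groupI, goal_cases)
      case (6 x)
      then obtain v where v: "v \<in> carrier V" "x = \<phi> v" using surj by blast
      then have "\<phi> (\<ominus>\<^bsub>V\<^esub> v) \<oplus>\<^bsub>W\<^esub> x = \<zero>\<^bsub>W\<^esub>" using h(1)[of "\<ominus>\<^bsub>V\<^esub> v" v] by (simp add: M.l_neg zero_W)
      then show ?case using v surj by (intro bexI[of _ "\<phi> (\<ominus>\<^bsub>V\<^esub> v)"]) auto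
    qed (auto simp: surj h M.a_ac zero_W)
  qed (auto simp: surj h smult_distribs)
  interpret W: module base_field W by fact
  have inv: "\<ominus>\<^bsub>W\<^esub> (\<phi> v) = \<phi> (\<ominus>\<^bsub>V\<^esub> v)" if "v \<in> carrier V" for v
    by (rule W.M.minus_equality) (use that surj h(1)[of "\<ominus>\<^bsub>V\<^esub> v" v] in \<open>auto simp: M.l_neg zero_W\<close>)
  show ?thesis
  proof (rule block_module.intro[OF m], unfold_locales, goal_cases)
    case (6 x y v)
    then obtain v' where v: "v' \<in> carrier V" "v = \<phi> v'" using surj by blast
    then show ?case using 6 act_closed bracket_closed[OF G, of x y] act_bracket[of x y v']
      by (simp add: a_minus_def h inv)
  qed (auto simp: surj h act_closed block_algebra_add block_algebra_scale act_add_left act_scale_left act_add_right act_scale_right)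
qed

context block_module
begin

lemma submodule_abelian_subgroup:
  assumes "block_submodule G N V"
  shows "abelian_subgroup N V"
proof -
  have "subgroup N (add_monoid V)" using assms by (simp add: block_submodule_def submodule_def)
  then show ?thesis
    using M.abelian_group_axioms by (intro abelian_subgroupI3) (simp_all add: additive_subgroup_def)
qed

lemma coset_eq_iff:
  assumes N: "block_submodule G N V" and "v \<in> carrier V" "w \<in> carrier V"
  shows "N +>\<^bsub>V\<^esub> v = N +>\<^bsub>V\<^esub> w \<longleftrightarrow> v \<ominus> w \<in> N"
proof -
  interpret S: abelian_subgroup N V by (rule submodule_abelian_subgroup[OF N])
  show ?thesis
    using assms S.a_rcos_module[of w v] S.a_rcos_self[of v] S.a_repr_independence'[of v w] by (auto simp: M.minus_eq)
qed

text \<open>Well-definedness of the operations of \<open>quotient_module\<close>, which are unions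
  over all representatives of a coset.\<close>

lemma coset_UN:
  assumes N: "block_submodule G N V" and v: "v \<in> carrier V"
    and f: "\<And>u. u \<in> carrier V \<Longrightarrow> f u \<in> carrier V" "\<And>u. u \<in> N \<Longrightarrow> f u \<in> N"
      "\<And>u w. u \<in> carrier V \<Longrightarrow> w \<in> carrier V \<Longrightarrow> f (u \<oplus> w) = f u \<oplus> f w"
  shows "(\<Union>u\<in>N +>\<^bsub>V\<^esub> v. N +>\<^bsub>V\<^esub> f u) = N +>\<^bsub>V\<^esub> f v"
proof -
  interpret S: abelian_subgroup N V by (rule submodule_abelian_subgroup[OF N])
  have "N +>\<^bsub>V\<^esub> f u = N +>\<^bsub>V\<^esub> f v" if "u \<in> N +>\<^bsub>V\<^esub> v" for u
  proof -
    obtain n where n: "n \<in> N" "u = n \<oplus> v" using \<open>u \<in> N +>\<^bsub>V\<^esub> v\<close> by (auto simp: a_r_coset_def')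
    have nc: "n \<in> carrier V" using n block_submoduleD(1)[OF N] by blast
    have "f u \<ominus> f v = f n"
      using f nc v n(2) by (simp add: M.minus_eq M.a_assoc M.r_neg)
    then show ?thesis using coset_eq_iff[OF N, of "f u" "f v"] f n nc v by simp
  qed
  moreover have "v \<in> N +>\<^bsub>V\<^esub> v" by (rule S.a_rcos_self[OF v])
  ultimately show ?thesis by blast
qed

lemma quotient_hom:
  assumes N: "block_submodule G N V"
  shows "block_hom G V (quotient_module V N) (\<lambda>v. N +>\<^bsub>V\<^esub> v)"
    and "carrier (quotient_module V N) = (\<lambda>v. N +>\<^bsub>V\<^esub> v) ` carrier V"
    and "\<zero>\<^bsub>quotient_module V N\<^esub> = N +>\<^bsub>V\<^esub> \<zero>"
proof -
  interpret S: abelian_subgroup N V by (rule submodule_abelian_subgroup[OF N])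
  note ND = block_submoduleD[OF N]
  show 1: "block_hom G V (quotient_module V N) (\<lambda>v. N +>\<^bsub>V\<^esub> v)"
    unfolding block_hom_def
  proof (intro conjI ballI allI Pi_I)
    fix u v assume uv: "u \<in> carrier V" "v \<in> carrier V"
    show "N +>\<^bsub>V\<^esub> u \<oplus> v = (N +>\<^bsub>V\<^esub> u) \<oplus>\<^bsub>quotient_module V N\<^esub> (N +>\<^bsub>V\<^esub> v)"
      using S.a_rcos_sum[OF uv] by (simp add: quotient_module_def)
  next
    fix v assume v: "v \<in> carrier V"
    show "N +>\<^bsub>V\<^esub> v \<in> carrier (quotient_module V N)"
      using v by (auto simp: quotient_module_def A_RCOSETS_def')
    show "N +>\<^bsub>V\<^esub> a \<odot> v = a \<odot>\<^bsub>quotient_module V N\<^esub> (N +>\<^bsub>V\<^esub> v)" for a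
      using coset_UN[OF N v, of "\<lambda>v. a \<odot> v"] ND by (simp add: quotient_module_def smult_distribs)
    show "N +>\<^bsub>V\<^esub> act V x v = act (quotient_module V N) x (N +>\<^bsub>V\<^esub> v)" if "x \<in> block_algebra G" for x
      using coset_UN[OF N v, of "act V x"] ND that by (simp add: quotient_module_def act_closed act_add_right)
  qed
  show 2: "carrier (quotient_module V N) = (\<lambda>v. N +>\<^bsub>V\<^esub> v) ` carrier V"
    by (auto simp: quotient_module_def A_RCOSETS_def')
  have "N +>\<^bsub>V\<^esub> \<zero> = N" using S.a_subset by (rule M.a_coset_add_zero)
  then show 3: "\<zero>\<^bsub>quotient_module V N\<^esub> = N +>\<^bsub>V\<^esub> \<zero>" by (simp add: quotient_module_def)
qed

lemma quotient_block_module: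
  assumes "additive_subgroup G base_field" "block_submodule G N V"
  shows "block_module G (quotient_module V N)"
  by (rule hom_image_block_module[OF assms(1) block_module_axioms]) (rule quotient_hom[OF assms(2)])+

lemma quotient_zero_iff:
  assumes N: "block_submodule G N V" and v: "v \<in> carrier V"
  shows "N +>\<^bsub>V\<^esub> v = \<zero>\<^bsub>quotient_module V N\<^esub> \<longleftrightarrow> v \<in> N"
  unfolding quotient_hom(3)[OF N] using coset_eq_iff[OF N v, of \<zero>] v smult_minus_one[of \<zero>] by (simp add: M.minus_eq)

end

section \<open>The enveloping algebra as a left module over the Lie algebra\<close>

section \<open>The enveloping algebra\<close>

lemma tensor_emb_lin: "tensor_emb x = lin (\<lambda>b. Poly_Mapping.single [b] 1) x"
  by (simp add: tensor_emb_def lin_def)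

lemma list_plus [simp]: "(u :: 'b list) + v = u @ v" and list_zero: "(0 :: 'b list) = []"
  by (simp_all add: plus_list_def zero_list_def)

lemma times_lin:
  "p * q = lin (\<lambda>s. lin (\<lambda>t. Poly_Mapping.single (s @ t) 1) q) p" for p q :: "'b list \<Rightarrow>\<^sub>0 'f::field_char_0"
proof (induction p rule: pm_induct_all)
  case (single s a)
  show ?case
    by (induction q rule: pm_induct_all) (simp_all add: distrib_left lin_add pm.scale_right_distrib mult_single)
qed (simp_all add: distrib_right lin_add)

lemma lin_times: "lin f (p * q) = lin (\<lambda>s. lin (\<lambda>t. f (s @ t)) q) p" for p q :: "'b list \<Rightarrow>\<^sub>0 'f::field_char_0"
  by (simp add: times_lin lin_lin)

lemma lin_single_scale [simp]: "lin (\<lambda>s. Poly_Mapping.single s a) p = a \<cdot> p" for a :: "'f::field_char_0"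
  using lin_fun_scale[of a "\<lambda>s. Poly_Mapping.single s 1" p] by simp

lemma single_Nil_times: "Poly_Mapping.single [] a * p = a \<cdot> p" "p * Poly_Mapping.single [] a = a \<cdot> p"
  for p :: "'b list \<Rightarrow>\<^sub>0 'f::field_char_0"
  by (simp_all add: times_lin lin_fun_scale)

lemma scale_times: "(a \<cdot> p) * q = a \<cdot> (p * q)" "p * (a \<cdot> q) = a \<cdot> (p * q)"
  for p q :: "'b list \<Rightarrow>\<^sub>0 'f::field_char_0"
  by (simp_all add: times_lin lin_scale lin_fun_scale)

lemma tensor_emb_add: "tensor_emb (x + y) = tensor_emb x + tensor_emb y"
  and tensor_emb_scale: "tensor_emb (a \<cdot> x) = a \<cdot> tensor_emb x"
  by (simp_all add: tensor_emb_lin lin_add lin_scale)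

lemma tensor_one: "(1 :: 'b list \<Rightarrow>\<^sub>0 'f::field_char_0) = Poly_Mapping.single [] 1"
  by (simp add: list_zero flip: Poly_Mapping.single_one)

locale block_envelope =
  fixes G :: "'f::field_char_0 set"
  assumes G: "additive_subgroup G base_field"
begin

abbreviation "TA \<equiv> block_tensor_algebra G"
abbreviation "EI \<equiv> env_ideal G"
abbreviation "E \<equiv> env_algebra G"

lemma TA_carrier: "carrier TA = {p. \<forall>w\<in>Poly_Mapping.keys p. set w \<subseteq> block_index G}"
  by (simp add: block_tensor_algebra_def)

lemma TA_simps [simp]:
  "monoid.mult TA = (*)" "one TA = 1" "zero TA = 0" "add TA = (+)"
  by (simp_all add: block_tensor_algebra_def)

lemma subspace_TA: "pm.subspace (carrier TA)"
  unfolding TA_carrier by (rule pm.subspaceI) (use keys_add keys_pm_scale in \<open>fastforce+\<close>)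

lemma TA_single [simp]: "set w \<subseteq> block_index G \<Longrightarrow> Poly_Mapping.single w a \<in> carrier TA"
  by (simp add: TA_carrier)

lemma TA_mult: "p \<in> carrier TA \<Longrightarrow> q \<in> carrier TA \<Longrightarrow> p * q \<in> carrier TA"
  unfolding times_lin by (intro lin_closed[OF subspace_TA] TA_single) (auto simp: TA_carrier)

lemma TA_closed [simp]: "p \<in> carrier TA \<Longrightarrow> a \<cdot> p \<in> carrier TA"
  "p \<in> carrier TA \<Longrightarrow> q \<in> carrier TA \<Longrightarrow> p + q \<in> carrier TA"
  "p \<in> carrier TA \<Longrightarrow> q \<in> carrier TA \<Longrightarrow> p - q \<in> carrier TA"
  "p \<in> carrier TA \<Longrightarrow> q \<in> carrier TA \<Longrightarrow> p * q \<in> carrier TA"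
  "0 \<in> carrier TA" "1 \<in> carrier TA" "p \<in> carrier TA \<Longrightarrow> - p \<in> carrier TA"
  using pm.subspace_scale[OF subspace_TA] pm.subspace_add[OF subspace_TA] pm.subspace_diff[OF subspace_TA]
    TA_mult pm.subspace_0[OF subspace_TA] pm.subspace_neg[OF subspace_TA] TA_single[of "[]" 1]
  by (simp_all add: tensor_one)

lemma TA_ring: "ring TA"
proof (rule ringI)
  show "abelian_group TA"
  proof (rule abelian_groupI)
    fix p assume "p \<in> carrier TA"
    then show "\<exists>q\<in>carrier TA. q \<oplus>\<^bsub>TA\<^esub> p = \<zero>\<^bsub>TA\<^esub>"
      by (intro bexI[of _ "- p"]) simp_all
  qed (simp_all add: add_ac)
  show "monoid TA"
    by (rule monoidI) (simp_all add: mult.assoc)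
qed (simp_all add: distrib_left distrib_right)

lemma TA_a_inv: "p \<in> carrier TA \<Longrightarrow> \<ominus>\<^bsub>TA\<^esub> p = - p"
proof -
  assume p: "p \<in> carrier TA"
  interpret ring TA by (rule TA_ring)
  show ?thesis using minus_equality[of "- p" p] p by simp
qed

definition rels :: "('f block_basis list \<Rightarrow>\<^sub>0 'f) set" where
  "rels = {tensor_emb x * tensor_emb y - tensor_emb y * tensor_emb x - tensor_emb (bracket x y) | x y.
        x \<in> block_algebra G \<and> y \<in> block_algebra G}"

lemma tensor_emb_closed: "x \<in> block_algebra G \<Longrightarrow> tensor_emb x \<in> carrier TA"
  unfolding tensor_emb_lin by (rule lin_closed[OF subspace_TA], rule TA_single) (auto simp: block_algebra_def)

lemma rels_closed: "rels \<subseteq> carrier TA"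
  by (auto simp: rels_def tensor_emb_closed bracket_closed[OF G])

lemma EI_def: "EI = Idl\<^bsub>TA\<^esub> rels"
  by (simp add: env_ideal_def rels_def)

lemma EI_ideal: "ideal EI TA"
  unfolding EI_def by (rule ring.genideal_ideal[OF TA_ring rels_closed])

lemma E_ring: "ring E"
  unfolding env_algebra_def by (rule ideal.quotient_is_ring[OF EI_ideal])

definition cls :: "('f block_basis list \<Rightarrow>\<^sub>0 'f) \<Rightarrow> ('f block_basis list \<Rightarrow>\<^sub>0 'f) set" where
  "cls p = EI +>\<^bsub>TA\<^esub> p"

lemma cls_simps:
  "carrier E = cls ` carrier TA"
  "p \<in> carrier TA \<Longrightarrow> q \<in> carrier TA \<Longrightarrow> cls p \<oplus>\<^bsub>E\<^esub> cls q = cls (p + q)"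
  "p \<in> carrier TA \<Longrightarrow> q \<in> carrier TA \<Longrightarrow> cls p \<otimes>\<^bsub>E\<^esub> cls q = cls (p * q)"
  "\<one>\<^bsub>E\<^esub> = cls 1" "\<zero>\<^bsub>E\<^esub> = cls 0"
proof -
  interpret ideal EI TA by (rule EI_ideal)
  show "carrier E = cls ` carrier TA"
    by (auto simp: env_algebra_def FactRing_def A_RCOSETS_def' cls_def)
  show "cls p \<oplus>\<^bsub>E\<^esub> cls q = cls (p + q)" if "p \<in> carrier TA" "q \<in> carrier TA"
    using a_rcos_sum[OF that] by (simp add: env_algebra_def FactRing_def cls_def)
  show "cls p \<otimes>\<^bsub>E\<^esub> cls q = cls (p * q)" if "p \<in> carrier TA" "q \<in> carrier TA"
    using rcoset_mult_add[OF that] by (simp add: env_algebra_def FactRing_def cls_def)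
  show "\<one>\<^bsub>E\<^esub> = cls 1" by (simp add: env_algebra_def FactRing_def cls_def)
  have "cls 0 = EI" using a_coset_add_zero[OF a_subset] by (simp add: cls_def)
  then show "\<zero>\<^bsub>E\<^esub> = cls 0" by (simp add: env_algebra_def FactRing_def)
qed

lemma cls_eq_iff: "p \<in> carrier TA \<Longrightarrow> q \<in> carrier TA \<Longrightarrow> cls p = cls q \<longleftrightarrow> p - q \<in> EI"
proof -
  assume pq: "p \<in> carrier TA" "q \<in> carrier TA"
  have "p \<ominus>\<^bsub>TA\<^esub> q = p - q" using TA_a_inv[OF pq(2)] by (simp add: a_minus_def)
  then show ?thesis
    using ring.quotient_eq_iff_same_a_r_cos[OF TA_ring EI_ideal pq] by (simp add: cls_def)
qed

lemma cls_closed: "p \<in> carrier TA \<Longrightarrow> cls p \<in> carrier E"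
  using cls_simps(1) by blast

lemma env_emb_cls: "env_emb G x = cls (tensor_emb x)" and env_scalar_cls: "env_scalar G a = cls (Poly_Mapping.single [] a)"
  by (simp_all add: env_emb_def env_scalar_def cls_def)

lemma cls_inv: "p \<in> carrier TA \<Longrightarrow> \<ominus>\<^bsub>E\<^esub> cls p = cls (- p)"
proof -
  assume p: "p \<in> carrier TA"
  then have q: "- p \<in> carrier TA" by simp
  interpret ring E by (rule E_ring)
  show ?thesis using minus_equality[of "cls (- p)" "cls p"] p q cls_closed[OF p] cls_closed[OF q] cls_simps(2)[OF q p]
    by (simp add: cls_simps(5))
qed

lemma env_module_simps [simp]:
  "carrier (env_module G) = carrier E" "zero (env_module G) = zero E" "add (env_module G) = add E"
  "one (env_module G) = one E"
  by (simp_all add: env_module_def)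

lemma env_module_smult:
  "p \<in> carrier TA \<Longrightarrow> a \<odot>\<^bsub>env_module G\<^esub> cls p = cls (a \<cdot> p)"
  using cls_simps(3)[of "Poly_Mapping.single [] a" p] by (simp add: env_module_def env_scalar_cls single_Nil_times)

lemma env_module_act:
  "p \<in> carrier TA \<Longrightarrow> x \<in> block_algebra G \<Longrightarrow> act (env_module G) x (cls p) = cls (tensor_emb x * p)"
  using cls_simps(3)[OF tensor_emb_closed, of x p] by (simp add: env_module_def env_emb_cls)

lemma abelian_group_env: "abelian_group (env_module G)"
proof -
  interpret ring E by (rule E_ring)
  show ?thesis
  proof (rule abelian_groupI, goal_cases)
    case (6 u)
    then show ?case by (intro bexI[of _ "\<ominus>\<^bsub>E\<^esub> u"]) (simp_all add: l_neg)
  qed (simp_all add: a_ac)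
qed

lemma env_a_inv: "p \<in> carrier TA \<Longrightarrow> \<ominus>\<^bsub>env_module G\<^esub> cls p = cls (- p)"
  using cls_simps(2)[of "- p" p] cls_closed[of p] cls_closed[of "- p"]
    abelian_group.minus_equality[OF abelian_group_env, of "cls (- p)" "cls p"]
  by (simp add: cls_simps(5))

lemma block_module_env: "block_module G (env_module G)"
proof -
  have m: "module base_field (env_module G)"
  proof (rule moduleI)
    show "cring (base_field :: 'f ring)" by (rule cring_from_type_algebra)
    show "abelian_group (env_module G)" by (rule abelian_group_env)
  qed (auto simp: cls_simps(1,2) env_module_smult pm.scale_left_distrib pm.scale_right_distrib)
  show ?thesis
  proof (rule block_module.intro[OF m], unfold_locales, goal_cases)
    case (6 x y v)
    then obtain p where p: "p \<in> carrier TA" "v = cls p" using cls_simps(1) by auto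
    have c: "tensor_emb x \<in> carrier TA" "tensor_emb y \<in> carrier TA" "tensor_emb (bracket x y) \<in> carrier TA"
      using 6 tensor_emb_closed bracket_closed[OF G] by auto
    note c' = TA_mult[OF c(1) TA_mult[OF c(2) p(1)]] TA_mult[OF c(2) TA_mult[OF c(1) p(1)]] TA_mult[OF c(3) p(1)]
    \<comment> \<open>The bracket law is the defining relation of the ideal, multiplied by
      \<open>p\<close> on the right.\<close>
    let ?r = "tensor_emb x * tensor_emb y - tensor_emb y * tensor_emb x - tensor_emb (bracket x y)"
    have "?r \<in> rels" using 6 by (auto simp: rels_def)
    then have "?r \<in> EI" unfolding EI_def using ring.genideal_self[OF TA_ring rels_closed] by blast
    then have "?r * p \<in> EI" using ideal.I_r_closed[OF EI_ideal, of ?r p] p by simp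
    then have "- 1 \<cdot> (?r * p) \<in> EI"
      using ideal.I_l_closed[OF EI_ideal, of "?r * p" "Poly_Mapping.single [] (-1)"] by (simp add: single_Nil_times)
    moreover have "- 1 \<cdot> (?r * p) = tensor_emb (bracket x y) * p - (tensor_emb x * (tensor_emb y * p) - tensor_emb y * (tensor_emb x * p))"
      by (simp add: algebra_simps)
    ultimately have "cls (tensor_emb (bracket x y) * p) = cls (tensor_emb x * (tensor_emb y * p) - tensor_emb y * (tensor_emb x * p))"
      using cls_eq_iff[OF c'(3) TA_closed(3)[OF c'(1,2)]] by simp
    moreover have "act (env_module G) x (act (env_module G) y v) \<ominus>\<^bsub>env_module G\<^esub> act (env_module G) y (act (env_module G) x v) =
      cls (tensor_emb x * (tensor_emb y * p) - tensor_emb y * (tensor_emb x * p))"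
      using 6 p c c' env_module_act env_a_inv[OF c'(2)] cls_simps(2)[OF c'(1), of "- (tensor_emb y * (tensor_emb x * p))"]
        TA_mult[OF c(1) p(1)] TA_mult[OF c(2) p(1)]
      by (simp add: a_minus_def)
    ultimately show ?case using 6 p env_module_act[of p "bracket x y"] bracket_closed[OF G] by simp
  qed (auto simp: cls_simps(1,2) env_module_act env_module_smult block_algebra_add
       block_algebra_scale TA_mult tensor_emb_closed tensor_emb_add tensor_emb_scale scale_times distrib_left distrib_right)
qed

end

section \<open>Verma modules and their identification with the model\<close>

section \<open>Verma modules\<close>

locale block_order =
  fixes G :: "'f::field_char_0 set" and gt :: "'f \<Rightarrow> 'f \<Rightarrow> bool"
  assumes G: "additive_subgroup G base_field" and compatible: "compatible_order G gt"
begin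

lemma G_closed [simp]:
  "0 \<in> G" "x \<in> G \<Longrightarrow> y \<in> G \<Longrightarrow> x + y \<in> G" "x \<in> G \<Longrightarrow> - x \<in> G" "x \<in> G \<Longrightarrow> y \<in> G \<Longrightarrow> x - y \<in> G"
  using G unfolding additive_subgroup_base_field by (blast, blast, blast, metis add_uminus_conv_diff)

abbreviation "P \<equiv> pos_part G gt"

lemma P_G: "x \<in> P \<Longrightarrow> x \<in> G"
  by (simp add: pos_part_def)

lemma gt_irrefl: "x \<in> G \<Longrightarrow> \<not> gt x x"
  using compatible by (auto simp: compatible_order_def irreflp_on_def)

lemma gt_trans: "x \<in> G \<Longrightarrow> y \<in> G \<Longrightarrow> z \<in> G \<Longrightarrow> gt x y \<Longrightarrow> gt y z \<Longrightarrow> gt x z"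
  using compatible unfolding compatible_order_def transp_on_def by blast

lemma gt_total: "x \<in> G \<Longrightarrow> y \<in> G \<Longrightarrow> gt x y \<or> x = y \<or> gt y x"
  using compatible unfolding compatible_order_def totalp_on_def by blast

lemma gt_add: "x \<in> G \<Longrightarrow> y \<in> G \<Longrightarrow> z \<in> G \<Longrightarrow> gt x y \<Longrightarrow> gt (x + z) (y + z)"
  using compatible unfolding compatible_order_def by blast

lemma gt_iff_P: "x \<in> G \<Longrightarrow> y \<in> G \<Longrightarrow> gt x y \<longleftrightarrow> x - y \<in> P"
  using gt_add[of x y "- y"] gt_add[of "x - y" 0 y] by (auto simp: pos_part_def)

lemma P_0 [simp]: "0 \<notin> P"
  by (simp add: pos_part_def gt_irrefl)

lemma P_add: "x \<in> P \<Longrightarrow> y \<in> P \<Longrightarrow> x + y \<in> P"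
  using gt_add[of x 0 y] gt_trans[of "x + y" y 0] by (auto simp: pos_part_def)

lemma P_total: "x \<in> G \<Longrightarrow> x \<in> P \<or> x = 0 \<or> - x \<in> P"
  using gt_total[of x 0] gt_add[of 0 x "- x"] by (auto simp: pos_part_def)

lemma P_neg: "x \<in> P \<Longrightarrow> - x \<notin> P"
  using P_add[of x "- x"] by auto

lemma P_scale: "x \<in> P \<Longrightarrow> 0 < n \<Longrightarrow> of_nat n * x \<in> P"
proof (induction n)
  case (Suc n)
  then show ?case using P_add[of x "of_nat n * x"] by (cases "n = 0") (auto simp: algebra_simps)
qed simp

lemma P_scale_int: "x \<in> P \<Longrightarrow> 0 < n \<Longrightarrow> of_int n * x \<in> P"
  using P_scale[of x "nat n"] by simp

lemma P_sum_mset: "(\<And>x. x \<in># m \<Longrightarrow> f x \<in> P) \<Longrightarrow> m \<noteq> {#} \<Longrightarrow> (\<Sum>x\<in>#m. f x) \<in> P"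
proof (induction m)
  case (add x m)
  then show ?case using P_add[of "f x"] by (cases "m = {#}") auto
qed simp

lemma G_sum_mset: "(\<And>x. x \<in># m \<Longrightarrow> f x \<in> G) \<Longrightarrow> (\<Sum>x\<in>#m. f x) \<in> G"
  by (induction m) auto

end

fun grade :: "'f::field_char_0 block_basis \<Rightarrow> 'f" where
  "grade (L \<alpha> i) = \<alpha>"
| "grade C = 0"

lemma grade_bracket: "z \<in> Poly_Mapping.keys (basis_bracket x y) \<Longrightarrow> grade z = grade x + grade y"
  using keys_basis_bracket by (cases x; cases y) fastforce+

lemma grade_index: "0 \<in> G \<Longrightarrow> x \<in> block_index G \<Longrightarrow> grade x \<in> G"
  by (auto simp: block_index_def)

text \<open>Letter by letter, the character by which the non-negative part acts on the highest
  weight vector.\<close>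

fun eigenvalue :: "('f::field_char_0 block_vec \<Rightarrow> 'f) \<Rightarrow> 'f block_basis \<Rightarrow> 'f" where
  "eigenvalue \<Lambda> (L \<alpha> i) = (if \<alpha> = 0 then \<Lambda> (basis_L 0 i) else 0)"
| "eigenvalue \<Lambda> C = \<Lambda> (Poly_Mapping.single C 1)"

lemma eigenvalue_grade: "eigenvalue \<Lambda> x \<noteq> 0 \<Longrightarrow> grade x = 0"
  by (cases x) (auto split: if_splits)

lemma block_grade_0: "block_grade 0 = {x. Poly_Mapping.keys x \<subseteq> {L 0 i | i. i \<ge> -1} \<union> {C}}"
  by (simp add: block_grade_def)

lemma weight_expand:
  assumes "\<Lambda> \<in> weights" "h \<in> block_grade 0"
  shows "\<Lambda> h = (\<Sum>b\<in>Poly_Mapping.keys h. Poly_Mapping.lookup h b * eigenvalue \<Lambda> b)"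
proof -
  have zero: "\<Lambda> 0 = 0"
    using assms(1) by (auto simp: weights_def block_grade_def) (metis (no_types, lifting) empty_subsetI keys_zero mem_Collect_eq pm.scale_zero_left mult_zero_left)
  have "Poly_Mapping.keys h \<subseteq> {L 0 i | i. i \<ge> -1} \<union> {C}" using assms(2) by (simp add: block_grade_0)
  then have "\<Lambda> h = Poly_Mapping.lookup (lin (\<lambda>b. Poly_Mapping.single () (eigenvalue \<Lambda> b)) h) ()"
  proof (induction h rule: pm_induct)
    case (add u v)
    then have "\<Lambda> (u + v) = \<Lambda> u + \<Lambda> v" using assms(1) by (auto simp: weights_def block_grade_0)
    then show ?case using add by (simp add: lin_add lookup_add)
  next
    case (single z a)
    have "\<Lambda> (a \<cdot> x) = a * \<Lambda> x" if "x \<in> block_grade 0" for x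
      using assms(1) that unfolding weights_def by blast
    from this[of "Poly_Mapping.single z 1"] show ?case using single by (auto simp: block_grade_0)
  qed (simp add: zero)
  then show ?thesis by (simp add: lookup_lin)
qed

lemma keys_bracket_sum_zero:
  fixes \<chi> :: "'b \<Rightarrow> 'f::field_char_0"
  shows "(\<And>z. z \<in> Poly_Mapping.keys u \<Longrightarrow> \<chi> z = 0) \<Longrightarrow> (\<Sum>z\<in>Poly_Mapping.keys u. Poly_Mapping.lookup u z * \<chi> z) = 0"
  by (rule sum.neutral) simp

locale verma_weight = block_order G gt for G :: "'f::field_char_0 set" and gt +
  fixes \<Lambda> :: "'f block_vec \<Rightarrow> 'f"
  assumes weights: "\<Lambda> \<in> weights"
begin

definition borel :: "'f block_basis set" where
  "borel = {x \<in> block_index G. grade x = 0 \<or> grade x \<in> P}"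

text \<open>For letters of non-negative grade a bracket of grade zero needs two letters of grade
  zero, and these commute.\<close>

lemma eigenvalue_bracket:
  assumes "x \<in> borel" "y \<in> borel" "z \<in> Poly_Mapping.keys (basis_bracket x y)"
  shows "eigenvalue \<Lambda> z = 0"
proof (rule ccontr)
  assume "eigenvalue \<Lambda> z \<noteq> 0"
  then have "grade x + grade y = 0" using eigenvalue_grade grade_bracket[OF assms(3)] by metis
  then have "grade x = 0" "grade y = 0"
    using assms(1,2) P_add[of "grade x" "grade y"] by (auto simp: borel_def)
  then have "Poly_Mapping.keys (basis_bracket x y) = {}" by (cases x; cases y) auto
  then show False using assms(3) by simp
qed

sublocale block_pbw G borel "eigenvalue \<Lambda>"
proof (rule block_pbw.intro[OF G])
  show "Poly_Mapping.keys (basis_bracket x y) \<subseteq> borel" if "x \<in> borel" "y \<in> borel" for x y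
    using that basis_bracket_index[OF G, of x y] grade_bracket[of _ x y] P_add
    by (fastforce simp: borel_def)
  show "(\<Sum>z\<in>Poly_Mapping.keys (basis_bracket x y). Poly_Mapping.lookup (basis_bracket x y) z * eigenvalue \<Lambda> z) = 0"
    if "x \<in> borel" "y \<in> borel" for x y
    using eigenvalue_bracket[OF that] by (rule keys_bracket_sum_zero)
qed (auto simp: borel_def)

sublocale block_envelope G
  by (rule block_envelope.intro[OF G])

text \<open>The relations that define the enveloping algebra are instances of
  \<open>exchange\<close>. Hence normal forms can be taken of classes in the enveloping
  algebra.\<close>

lemma env_ideal_nf:
  assumes "q \<in> EI" "set u \<subseteq> block_index G" "set v \<subseteq> block_index G"
  shows "lin (\<lambda>w. nf (u @ w @ v)) q = 0"
proof -
  \<comment> \<open>Quantifying over a prefix and a suffix is what makes \<open>Z\<close> a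
    two-sided ideal.\<close>
  define Z where "Z = {q \<in> carrier TA. \<forall>u v. set u \<subseteq> block_index G \<and> set v \<subseteq> block_index G \<longrightarrow>
    lin (\<lambda>w. nf (u @ w @ v)) q = 0}"
  have Z: "pm.subspace Z"
    unfolding Z_def by (rule pm.subspaceI) (auto simp: lin_add lin_scale)
  have "ideal Z TA"
  proof (rule idealI[OF TA_ring])
    interpret TA: ring TA by (rule TA_ring)
    show "subgroup Z (add_monoid TA)"
      by (rule TA.add.subgroupI)
         (use Z TA_a_inv in \<open>auto simp: Z_def a_inv_def lin_uminus lin_add pm.subspace_0 intro!: exI[of _ 0]\<close>)
    fix a x assume a: "a \<in> Z" and x: "x \<in> carrier TA"
    have aT: "a \<in> carrier TA" using a by (simp add: Z_def)
    have xw: "set w \<subseteq> block_index G" if "w \<in> Poly_Mapping.keys x" for w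
      using x that by (auto simp: TA_carrier)
    show "x \<otimes>\<^bsub>TA\<^esub> a \<in> Z"
      unfolding Z_def
    proof (safe)
      show "x \<otimes>\<^bsub>TA\<^esub> a \<in> carrier TA" using aT x by simp
      fix u v assume uv: "set u \<subseteq> block_index G" "set v \<subseteq> block_index G"
      have "lin (\<lambda>t. nf (u @ (s @ t) @ v)) a = 0" if "s \<in> Poly_Mapping.keys x" for s
        using a uv xw[OF that] unfolding Z_def by (auto dest: spec[of _ "u @ s"])
      then have "lin (\<lambda>s. lin (\<lambda>t. nf (u @ (s @ t) @ v)) a) x = lin (\<lambda>s. 0) x" by (rule lin_cong)
      then show "lin (\<lambda>w. nf (u @ w @ v)) (x \<otimes>\<^bsub>TA\<^esub> a) = 0"
        unfolding TA_simps lin_times by simp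
    qed
    show "a \<otimes>\<^bsub>TA\<^esub> x \<in> Z"
      unfolding Z_def
    proof (safe)
      show "a \<otimes>\<^bsub>TA\<^esub> x \<in> carrier TA" using aT x by simp
      fix u v assume uv: "set u \<subseteq> block_index G" "set v \<subseteq> block_index G"
      have "lin (\<lambda>t. nf (u @ (t @ s) @ v)) a = 0" if "s \<in> Poly_Mapping.keys x" for s
        using a uv xw[OF that] unfolding Z_def by (auto dest: spec[of _ "u"])
      then have "lin (\<lambda>s. lin (\<lambda>t. nf (u @ (t @ s) @ v)) a) x = lin (\<lambda>s. 0) x" by (rule lin_cong)
      then show "lin (\<lambda>w. nf (u @ w @ v)) (a \<otimes>\<^bsub>TA\<^esub> x) = 0"
        unfolding TA_simps lin_times lin_swap[where u = a] by simp
    qed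
  qed
  moreover have "rels \<subseteq> Z"
  proof
    fix r assume r: "r \<in> rels"
    then obtain x y where xy: "r = tensor_emb x * tensor_emb y - tensor_emb y * tensor_emb x - tensor_emb (bracket x y)"
      "x \<in> block_algebra G" "y \<in> block_algebra G" by (auto simp: rels_def)
    have "lin (\<lambda>w. nf (u @ w @ v)) r = 0" for u v
    proof -
      have "lin (\<lambda>w. nf (u @ w @ v)) (tensor_emb x * tensor_emb y) = lin (\<lambda>s. lin (\<lambda>t. nf (u @ s # t # v)) y) x" for x y
        by (simp add: lin_times tensor_emb_lin lin_lin)
      moreover have "lin (\<lambda>w. nf (u @ w @ v)) (tensor_emb (bracket x y)) = lin (\<lambda>s. lin (\<lambda>t. lin (\<lambda>z. nf (u @ z # v)) (basis_bracket s t)) y) x"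
        by (simp add: tensor_emb_lin lin_lin bracket_lin)
      moreover have "lin (\<lambda>s. lin (\<lambda>t. nf (u @ s # t # v)) y) x =
          lin (\<lambda>s. lin (\<lambda>t. nf (u @ t # s # v)) y) x + lin (\<lambda>s. lin (\<lambda>t. lin (\<lambda>z. nf (u @ z # v)) (basis_bracket s t)) y) x"
        by (simp only: exchange[of u _ _ v, symmetric] lin_fun_add[symmetric])
      moreover have "lin (\<lambda>t. lin (\<lambda>s. nf (u @ t # s # v)) x) y = lin (\<lambda>s. lin (\<lambda>t. nf (u @ t # s # v)) y) x"
        by (rule lin_swap)
      ultimately show ?thesis by (simp add: xy(1) lin_diff)
    qed
    then show "r \<in> Z" using r rels_closed by (auto simp: Z_def)
  qed
  ultimately have "EI \<subseteq> Z" unfolding EI_def by (rule ring.genideal_minimal[OF TA_ring])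
  then show ?thesis using assms by (auto simp: Z_def)
qed

lemma nf_lin_act_word:
  assumes "q \<in> carrier TA" "set s \<subseteq> block_index G"
  shows "lin (\<lambda>w. nf (s @ w)) q = act_word s (lin nf q)"
proof -
  have "act_word s (lin f q) = lin (\<lambda>w. act_word s (f w)) q" for f :: "'f block_basis list \<Rightarrow> _"
    by (induction s) (simp_all add: act1_lin)
  moreover have "nf (s @ w) = act_word s (nf w)" if "w \<in> Poly_Mapping.keys q" for w
    using act_word_nf[of s w] assms that by (auto simp: TA_carrier)
  ultimately show ?thesis by (simp cong: lin_cong)
qed

abbreviation "VI \<equiv> verma_ideal G gt \<Lambda>"

text \<open>The annihilator of the generator of the model. It is a left ideal that contains the
  generators of the Verma ideal.\<close>

definition nf_kernel :: "('f block_basis list \<Rightarrow>\<^sub>0 'f) set set" where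
  "nf_kernel = cls ` {q \<in> carrier TA. lin nf q = 0}"

lemma verma_gen_cls:
  "h \<in> block_grade 0 \<Longrightarrow>
    env_emb G h \<ominus>\<^bsub>E\<^esub> env_scalar G (\<Lambda> h) = cls (tensor_emb h - Poly_Mapping.single [] (\<Lambda> h))"
  "h \<in> block_grade 0 \<Longrightarrow> tensor_emb h \<in> carrier TA"
proof -
  assume h: "h \<in> block_grade 0"
  then have "h \<in> block_algebra G" by (fastforce simp: block_grade_0 block_algebra_def)
  then show c: "tensor_emb h \<in> carrier TA" by (rule tensor_emb_closed)
  have d: "Poly_Mapping.single [] (\<Lambda> h) \<in> carrier TA" by simp
  show "env_emb G h \<ominus>\<^bsub>E\<^esub> env_scalar G (\<Lambda> h) = cls (tensor_emb h - Poly_Mapping.single [] (\<Lambda> h))"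
    using cls_simps(2)[OF c, of "- Poly_Mapping.single [] (\<Lambda> h)"] cls_inv[OF d] d
    by (simp add: a_minus_def env_emb_cls env_scalar_cls)
qed

abbreviation "verma_gens \<equiv> {env_emb G (basis_L \<alpha> i) | \<alpha> i. \<alpha> \<in> P \<and> i \<ge> -1} \<union>
      {env_emb G h \<ominus>\<^bsub>E\<^esub> env_scalar G (\<Lambda> h) | h. h \<in> block_grade 0}"

lemma verma_gens_closed: "verma_gens \<subseteq> carrier E"
  using verma_gen_cls by (auto simp: env_emb_cls tensor_emb_lin P_G intro!: cls_closed)

lemma left_ideal_nf_kernel: "left_ideal nf_kernel E"
proof -
  interpret E: ring E by (rule E_ring)
  have "subgroup nf_kernel (add_monoid E)"
  proof (rule E.add.subgroupI)
    show "nf_kernel \<subseteq> carrier E" by (auto simp: nf_kernel_def intro: cls_closed)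
    have "cls 0 \<in> nf_kernel" by (auto simp: nf_kernel_def)
    then show "nf_kernel \<noteq> {}" by blast
    show "\<ominus>\<^bsub>E\<^esub> a \<in> nf_kernel" if "a \<in> nf_kernel" for a
    proof -
      obtain q where q: "q \<in> carrier TA" "lin nf q = 0" "a = cls q" using \<open>a \<in> nf_kernel\<close> by (auto simp: nf_kernel_def)
      then have "\<ominus>\<^bsub>E\<^esub> a = cls (- q)" "- q \<in> {q \<in> carrier TA. lin nf q = 0}" using cls_inv by (simp_all add: lin_uminus)
      then show ?thesis unfolding nf_kernel_def by blast
    qed
    show "a \<oplus>\<^bsub>E\<^esub> b \<in> nf_kernel" if "a \<in> nf_kernel" "b \<in> nf_kernel" for a b
    proof -
      obtain q r where q: "q \<in> carrier TA" "lin nf q = 0" "a = cls q" "r \<in> carrier TA" "lin nf r = 0" "b = cls r"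
        using \<open>a \<in> nf_kernel\<close> \<open>b \<in> nf_kernel\<close> by (auto simp: nf_kernel_def)
      then have "a \<oplus>\<^bsub>E\<^esub> b = cls (q + r)" "q + r \<in> {q \<in> carrier TA. lin nf q = 0}" using cls_simps(2) by (simp_all add: lin_add)
      then show ?thesis unfolding nf_kernel_def by blast
    qed
  qed
  then show ?thesis
  proof (intro left_ideal.intro additive_subgroup.intro E_ring left_ideal_axioms.intro)
    fix a x assume a: "a \<in> nf_kernel" and x: "x \<in> carrier E"
    obtain q where q: "q \<in> carrier TA" "lin nf q = 0" "a = cls q" using a by (auto simp: nf_kernel_def)
    obtain p where p: "p \<in> carrier TA" "x = cls p" using x by (auto simp: cls_simps(1))
    have "lin (\<lambda>t. nf (s @ t)) q = 0" if "s \<in> Poly_Mapping.keys p" for s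
    proof -
      have "set s \<subseteq> block_index G" using p that by (auto simp: TA_carrier)
      moreover have "act_word s 0 = 0" by (induction s) simp_all
      ultimately show ?thesis using nf_lin_act_word[OF q(1)] q(2) by simp
    qed
    then have "lin nf (p * q) = 0" by (simp add: lin_times cong: lin_cong)
    then have "x \<otimes>\<^bsub>E\<^esub> a = cls (p * q)" "p * q \<in> {q \<in> carrier TA. lin nf q = 0}" using p q cls_simps(3) by simp_all
    then show "x \<otimes>\<^bsub>E\<^esub> a \<in> nf_kernel" unfolding nf_kernel_def by blast
  qed
qed

lemma nf_T: "t \<in> borel \<Longrightarrow> nf [t] = eigenvalue \<Lambda> t \<cdot> vac"
  using nf_snoc_T[of t "[]"] by simp

lemma verma_gens_nf_kernel: "verma_gens \<subseteq> nf_kernel"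
proof (intro Un_least subsetI)
  fix e assume "e \<in> {env_emb G (basis_L \<alpha> i) | \<alpha> i. \<alpha> \<in> P \<and> i \<ge> -1}"
  then obtain \<alpha> i where e: "e = cls (Poly_Mapping.single [L \<alpha> i] 1)" "\<alpha> \<in> P" "i \<ge> -1"
    by (auto simp: env_emb_cls tensor_emb_lin)
  then have "L \<alpha> i \<in> borel" "\<alpha> \<noteq> 0" "set [L \<alpha> i] \<subseteq> block_index G" using P_G by (auto simp: borel_def)
  then have "Poly_Mapping.single [L \<alpha> i] 1 \<in> {q \<in> carrier TA. lin nf q = 0}"
    using TA_single[of "[L \<alpha> i]" 1] by (simp add: nf_T)
  then show "e \<in> nf_kernel" unfolding nf_kernel_def e(1) by (rule imageI)
next
  fix e assume "e \<in> {env_emb G h \<ominus>\<^bsub>E\<^esub> env_scalar G (\<Lambda> h) | h. h \<in> block_grade 0}"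
  then obtain h where h: "h \<in> block_grade 0" and e: "e = cls (tensor_emb h - Poly_Mapping.single [] (\<Lambda> h))"
    using verma_gen_cls(1) by auto
  have "lin nf (tensor_emb h) = lin (\<lambda>b. nf [b]) h" by (simp add: tensor_emb_lin lin_lin)
  also have "\<dots> = lin (\<lambda>b. eigenvalue \<Lambda> b \<cdot> vac) h"
    using h by (intro lin_cong nf_T) (auto simp: block_grade_0 borel_def)
  also have "\<dots> = \<Lambda> h \<cdot> vac"
    unfolding weight_expand[OF weights h] by (simp add: lin_def pm.scale_sum_left del: map_single)
  finally have "tensor_emb h - Poly_Mapping.single [] (\<Lambda> h) \<in> {q \<in> carrier TA. lin nf q = 0}"
    using verma_gen_cls(2)[OF h] by (simp add: lin_diff)
  then show "e \<in> nf_kernel" unfolding nf_kernel_def e by (rule imageI)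
qed

lemma VI_subset: "VI \<subseteq> nf_kernel"
  unfolding verma_ideal_def generated_left_ideal_def
  using left_ideal_nf_kernel verma_gens_nf_kernel by blast

lemma left_ideal_E: "left_ideal (carrier E) E"
proof -
  interpret E: ring E by (rule E_ring)
  show ?thesis
    by (intro left_ideal.intro additive_subgroup.intro E_ring left_ideal_axioms.intro E.add.subgroup_self) simp
qed

lemma VI_gens: "verma_gens \<subseteq> VI"
  by (auto simp: verma_ideal_def generated_left_ideal_def)

lemma VI_left_ideal: "left_ideal VI E"
proof -
  interpret E: ring E by (rule E_ring)
  let ?I = "{I. left_ideal I E \<and> verma_gens \<subseteq> I}"
  have VI: "VI = \<Inter>?I" by (simp add: verma_ideal_def generated_left_ideal_def)
  have E: "carrier E \<in> ?I" using left_ideal_E verma_gens_closed by blast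
  have sub: "subgroup I (add_monoid E)" if "I \<in> ?I" for I
    using that by (auto simp: left_ideal_def additive_subgroup_def)
  have "subgroup VI (add_monoid E)"
    unfolding VI using E sub by (intro E.add.subgroups_Inter) auto
  then show ?thesis
  proof (intro left_ideal.intro additive_subgroup.intro E_ring left_ideal_axioms.intro)
    fix a x assume "a \<in> VI" "x \<in> carrier E"
    then show "x \<otimes>\<^bsub>E\<^esub> a \<in> VI" unfolding VI by (auto intro: left_ideal.left_closed)
  qed
qed

lemma VI_submodule: "block_submodule G VI (env_module G)"
proof -
  interpret M: block_module G "env_module G" by (rule block_module_env)
  interpret I: left_ideal VI E by (rule VI_left_ideal)
  show ?thesis
  proof (rule M.block_submoduleI)
    fix a x v assume v: "v \<in> VI"
    have "env_scalar G a \<in> carrier E" by (simp add: env_scalar_cls cls_closed)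
    then show "a \<odot>\<^bsub>env_module G\<^esub> v \<in> VI" using I.left_closed[OF v] by (simp add: env_module_def)
    assume "x \<in> block_algebra G"
    then have "env_emb G x \<in> carrier E" by (simp add: env_emb_cls cls_closed tensor_emb_closed)
    then show "act (env_module G) x v \<in> VI" using I.left_closed[OF v] by (simp add: env_module_def)
  qed (use I.a_subset I.a_closed I.zero_closed in auto)
qed

abbreviation "VM \<equiv> verma G gt \<Lambda>"
abbreviation "vvec \<equiv> verma_vec G gt \<Lambda>"
abbreviation "vcls \<equiv> \<lambda>u. VI +>\<^bsub>env_module G\<^esub> u"

lemma verma_hom: "block_hom G (env_module G) VM vcls"
  and verma_carrier: "carrier VM = vcls ` carrier E"
  and verma_block_module: "block_module G VM"
  using block_module.quotient_hom[OF block_module_env VI_submodule]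
    block_module.quotient_block_module[OF block_module_env G VI_submodule]
  by (simp_all add: verma_def)

lemma verma_vec_cls: "vvec = vcls (cls 1)"
  by (simp add: verma_vec_def cls_simps(4))

lemma verma_eigen:
  assumes "t \<in> borel"
  shows "act VM (Poly_Mapping.single t 1) vvec = eigenvalue \<Lambda> t \<odot>\<^bsub>VM\<^esub> vvec"
proof -
  interpret H: block_homomorphism G "env_module G" VM vcls
    by (intro block_homomorphism.intro block_module_env verma_block_module block_homomorphism_axioms.intro verma_hom)
  have t: "Poly_Mapping.single t 1 \<in> block_algebra G" using assms by (auto simp: borel_def)
  have one: "cls 1 \<in> carrier (env_module G)" using cls_closed[of 1] by simp
  let ?a = "cls (Poly_Mapping.single [t] 1)" and ?b = "cls (Poly_Mapping.single [] (eigenvalue \<Lambda> t))"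
  have ab: "Poly_Mapping.single [t] 1 \<in> carrier TA" "Poly_Mapping.single [] (eigenvalue \<Lambda> t) \<in> carrier TA"
    using assms by (simp_all add: borel_def)
  have ab': "?a \<in> carrier (env_module G)" "?b \<in> carrier (env_module G)" using ab cls_closed by simp_all
  have e: "act (env_module G) (Poly_Mapping.single t 1) (cls 1) = ?a"
    "eigenvalue \<Lambda> t \<odot>\<^bsub>env_module G\<^esub> cls 1 = ?b"
    using env_module_act[of 1 "Poly_Mapping.single t 1"] t env_module_smult[of 1 "eigenvalue \<Lambda> t"]
    by (simp_all add: tensor_emb_lin) (simp add: tensor_one)
  have "cls (Poly_Mapping.single [t] 1 - Poly_Mapping.single [] (eigenvalue \<Lambda> t)) \<in> verma_gens"
  proof (cases "grade t = 0")
    case True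
    then have h: "Poly_Mapping.single t 1 \<in> block_grade 0" and "eigenvalue \<Lambda> t = \<Lambda> (Poly_Mapping.single t 1)"
      using assms by (cases t; auto simp: borel_def block_grade_0)+
    then show ?thesis using verma_gen_cls(1)[OF h] by (auto simp: tensor_emb_lin)
  next
    case False
    then obtain \<alpha> i where t: "t = L \<alpha> i" "\<alpha> \<in> P" "i \<ge> -1" using assms by (cases t) (auto simp: borel_def)
    then have "\<alpha> \<noteq> 0" by auto
    then have "cls (Poly_Mapping.single [t] 1 - Poly_Mapping.single [] (eigenvalue \<Lambda> t)) = env_emb G (basis_L \<alpha> i)"
      using t by (simp add: env_emb_cls tensor_emb_lin)
    then show ?thesis using t by blast
  qed
  moreover have "cls (Poly_Mapping.single [t] 1 - Poly_Mapping.single [] (eigenvalue \<Lambda> t)) = ?a \<ominus>\<^bsub>env_module G\<^esub> ?b"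
    using cls_simps(2)[OF ab(1), of "- Poly_Mapping.single [] (eigenvalue \<Lambda> t)"] ab env_a_inv[OF ab(2)]
    by (simp add: a_minus_def)
  ultimately have "?a \<ominus>\<^bsub>env_module G\<^esub> ?b \<in> VI" using VI_gens by auto
  then have "vcls ?a = vcls ?b"
    using block_module.coset_eq_iff[OF block_module_env VI_submodule ab'] by simp
  then show ?thesis
    using H.hom_simps(4)[OF t one] H.hom_simps(3)[OF one, of "eigenvalue \<Lambda> t"] e by (simp add: verma_vec_cls)
qed

lemma vvec_carrier: "vvec \<in> carrier VM"
  unfolding verma_carrier verma_vec_cls by (intro imageI cls_closed) simp

sublocale VM: block_pbw_target G borel "eigenvalue \<Lambda>" VM vvec
  by (intro block_pbw_target.intro block_pbw_axioms verma_block_module block_pbw_target_axioms.intro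
      vvec_carrier verma_eigen)

sublocale VH: block_homomorphism G model VM VM.univ_map
  by (intro block_homomorphism.intro block_module_model verma_block_module block_homomorphism_axioms.intro VM.univ_map_hom)

lemma word_vec_cls:
  "set w \<subseteq> block_index G \<Longrightarrow> VM.word_vec w = vcls (cls (Poly_Mapping.single w 1))"
proof (induction w)
  case Nil
  have "VM.word_vec [] = vvec" by (simp add: VM.word_vec_def)
  also have "\<dots> = vcls (cls (Poly_Mapping.single [] 1))" by (simp only: verma_vec_cls tensor_one)
  finally show ?case .
next
  case (Cons x w)
  interpret H: block_homomorphism G "env_module G" VM vcls
    by (intro block_homomorphism.intro block_module_env verma_block_module block_homomorphism_axioms.intro verma_hom)
  have w: "Poly_Mapping.single w 1 \<in> carrier TA" using Cons by simp
  then have c: "cls (Poly_Mapping.single w 1) \<in> carrier (env_module G)" using cls_closed by simp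
  have x: "Poly_Mapping.single x 1 \<in> block_algebra G" using Cons by simp
  have "VM.word_vec (x # w) = act VM (Poly_Mapping.single x 1) (VM.word_vec w)"
    using Cons VM.word_vec_carrier[of w] by (simp add: VM.word_vec_def VM.V.act_basis_def)
  also have "\<dots> = vcls (cls (Poly_Mapping.single (x # w) 1))"
    using Cons H.hom_simps(4)[OF x c] env_module_act[OF w x] by (simp add: tensor_emb_lin mult_single)
  finally show ?case .
qed

lemma univ_map_cls:
  assumes "p \<in> carr"
  shows "VM.univ_map p = vcls (cls (lin (\<lambda>m. Poly_Mapping.single (word m) 1) p))"
    and "lin (\<lambda>m. Poly_Mapping.single (word m) 1) p \<in> carrier TA"
    and "lin nf (lin (\<lambda>m. Poly_Mapping.single (word m) 1) p) = p"
proof -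
  interpret H: block_homomorphism G "env_module G" VM vcls
    by (intro block_homomorphism.intro block_module_env verma_block_module block_homomorphism_axioms.intro verma_hom)
  let ?f = "lin (\<lambda>m. Poly_Mapping.single (word m) (1 :: 'f))"
  have w: "set (word m) \<subseteq> block_index G" if "m \<in> Poly_Mapping.keys p" for m
    using carr_subset[OF assms that] by auto
  show TA: "?f p \<in> carrier TA"
    by (rule lin_closed[OF subspace_TA]) (use w in auto)
  show "lin nf (?f p) = p"
    using carr_subset[OF assms] by (simp add: lin_lin nf_word cong: lin_cong)
  have "Poly_Mapping.keys p \<subseteq> {m. set_mset m \<subseteq> block_index G}" using w by auto
  then have "VM.univ_map p = vcls (cls (?f p)) \<and> ?f p \<in> carrier TA"
  proof (induction p rule: pm_induct)
    case zero
    then show ?case using H.hom_zero by (simp add: VM.univ_map_zero cls_simps(5))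
  next
    case (add p q)
    then have c: "cls (?f p) \<in> carrier (env_module G)" "cls (?f q) \<in> carrier (env_module G)" using cls_closed by simp_all
    show ?case using add H.hom_simps(2)[OF c] cls_simps(2) by (simp add: VM.univ_map_add lin_add)
  next
    case (single m a)
    then have w: "set (word m) \<subseteq> block_index G" by simp
    then have t: "Poly_Mapping.single (word m) 1 \<in> carrier TA" by simp
    then have c: "cls (Poly_Mapping.single (word m) 1) \<in> carrier (env_module G)" using cls_closed by simp
    have "VM.univ_map (Poly_Mapping.single m a) = a \<odot>\<^bsub>VM\<^esub> VM.word_vec (word m)"
      using VM.V.vlin_single[OF VM.range_word_vec(1)] by (simp add: VM.univ_map_def)
    then show ?case using H.hom_simps(3)[OF c, of a] env_module_smult[OF t, of a] word_vec_cls[OF w] w by simp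
  qed
  then show "VM.univ_map p = vcls (cls (?f p))" by blast
qed

text \<open>The PBW theorem for Verma modules. If \<open>p\<close> is mapped to zero, the
  corresponding combination of sorted words lies in the Verma ideal and so annihilates the generator
  of the model; but it sends that generator to \<open>p\<close>.\<close>

lemma univ_map_inj: "inj_on VM.univ_map carr"
proof -
  have "p = 0" if p: "p \<in> carr" and 0: "VM.univ_map p = \<zero>\<^bsub>VM\<^esub>" for p
  proof -
    let ?q = "lin (\<lambda>m. Poly_Mapping.single (word m) (1 :: 'f)) p"
    note q = univ_map_cls[OF p]
    have "cls ?q \<in> carrier (env_module G)" using cls_closed[OF q(2)] by simp
    moreover have "vcls (cls ?q) = \<zero>\<^bsub>quotient_module (env_module G) VI\<^esub>"
      using 0 q(1) by (metis verma_def)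
    ultimately have "cls ?q \<in> VI"
      using block_module.quotient_zero_iff[OF block_module_env VI_submodule] by blast
    then have "cls ?q \<in> nf_kernel" using VI_subset by blast
    then obtain r where r: "r \<in> carrier TA" "lin nf r = 0" "cls ?q = cls r" by (auto simp: nf_kernel_def)
    then have "?q - r \<in> EI" using cls_eq_iff q(2) by blast
    then have "lin nf (?q - r) = 0" using env_ideal_nf[of "?q - r" "[]" "[]"] by simp
    then show "p = 0" using r(2) q(3) by (simp add: lin_diff)
  qed
  then show ?thesis using VH.inj_if_kernel by simp
qed

text \<open>A class is the image of the normal form of any of its representatives.\<close>

lemma univ_map_surj: "VM.univ_map ` carr = carrier VM"
proof
  show "VM.univ_map ` carr \<subseteq> carrier VM" by auto
  show "carrier VM \<subseteq> VM.univ_map ` carr"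
  proof
    fix y assume "y \<in> carrier VM"
    then obtain q where q: "q \<in> carrier TA" and y: "y = vcls (cls q)" by (auto simp: verma_carrier cls_simps(1))
    interpret H: block_homomorphism G "env_module G" VM vcls
      by (intro block_homomorphism.intro block_module_env verma_block_module block_homomorphism_axioms.intro verma_hom)
    have "Poly_Mapping.keys q \<subseteq> {w. set w \<subseteq> block_index G}" using q by (auto simp: TA_carrier)
    then have "q \<in> carrier TA \<and> vcls (cls q) = VM.univ_map (lin nf q) \<and> lin nf q \<in> carr"
    proof (induction q rule: pm_induct)
      case zero
      then show ?case using H.hom_zero by (simp add: VM.univ_map_zero cls_simps(5) pm.subspace_0[OF subspace_carr])
    next
      case (add p q)
      then have c: "cls p \<in> carrier (env_module G)" "cls q \<in> carrier (env_module G)" using cls_closed by simp_all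
      show ?case using add H.hom_simps(2)[OF c] cls_simps(2)
        by (simp add: VM.univ_map_add lin_add pm.subspace_add[OF subspace_carr])
    next
      case (single w a)
      then have w: "set w \<subseteq> block_index G" by simp
      then have t: "Poly_Mapping.single w 1 \<in> carrier TA" by simp
      then have c: "cls (Poly_Mapping.single w 1) \<in> carrier (env_module G)" using cls_closed by simp
      show ?case using H.hom_simps(3)[OF c, of a] env_module_smult[OF t, of a] word_vec_cls[OF w] w
        by (simp add: VM.univ_map_scale VM.univ_map_nf pm.subspace_scale[OF subspace_carr] nf_carr)
    qed
    then show "y \<in> VM.univ_map ` carr" using y by blast
  qed
qed

end

fun idx :: "'f block_basis \<Rightarrow> int" where
  "idx (L \<alpha> i) = i"
| "idx C = 0"

section \<open>Irreducibility and weight spaces in the model\<close>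

context verma_weight
begin

abbreviation BI :: "'f block_basis set" where
  "BI \<equiv> block_index G"

lemma mono_index: "G' \<subseteq> G \<Longrightarrow> block_index G' \<subseteq> BI"
  by (auto simp: block_index_def)

text \<open>Transfers irreducibility along the isomorphism \<open>univ_map\<close>. In the
  applications \<open>A\<close> is the whole model or corresponds to M'(0) or to M_a.\<close>

lemma irreducible_image_iff:
  assumes G': "G' \<subseteq> G" and A: "stable (block_index G') A"
  shows "irreducible_module G' (VM\<lparr>carrier := VM.univ_map ` A\<rparr>) \<longleftrightarrow>
    A \<noteq> {0} \<and> (\<forall>N. stable (block_index G') N \<and> N \<subseteq> A \<longrightarrow> N = {0} \<or> N = A)"
proof -
  let ?\<phi> = VM.univ_map
  interpret V': block_module G' VM by (rule VM.V.block_module_mono[OF G'])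
  have Ac: "A \<subseteq> carr" using stableD(2)[OF A] .
  have im: "block_submodule G' (?\<phi> ` N) VM" if "stable (block_index G') N" for N
    using VH.image_submodule[OF _ G'] block_submodule_model[OF G'] that by blast
  have vim: "stable (block_index G') {p \<in> carr. ?\<phi> p \<in> N}" if "block_submodule G' N VM" for N
    using VH.vimage_submodule[OF that G'] block_submodule_model[OF G'] by simp
  have zero: "?\<phi> ` {0} = {\<zero>\<^bsub>VM\<^esub>}" by (simp add: VM.univ_map_zero)
  have inj: "?\<phi> ` N = ?\<phi> ` M \<longleftrightarrow> N = M" if "N \<subseteq> carr" "M \<subseteq> carr" for N M
    using inj_on_image_eq_iff[OF univ_map_inj] that by blast
  have c0: "{0} \<subseteq> carr" using pm.subspace_0[OF subspace_carr] by simp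
  have ims: "N = ?\<phi> ` {p \<in> carr. ?\<phi> p \<in> N}" if "N \<subseteq> carrier VM" for N
  proof (intro equalityI subsetI)
    fix x assume x: "x \<in> N"
    then have "x \<in> ?\<phi> ` carr" using that univ_map_surj by auto
    then show "x \<in> ?\<phi> ` {p \<in> carr. ?\<phi> p \<in> N}" using x by auto
  qed auto
  have z: "?\<phi> ` A = {\<zero>\<^bsub>VM\<^esub>} \<longleftrightarrow> A = {0}" using inj[OF Ac c0] zero by simp
  have "(\<forall>N. block_submodule G' N VM \<and> N \<subseteq> ?\<phi> ` A \<longrightarrow> N = {\<zero>\<^bsub>VM\<^esub>} \<or> N = ?\<phi> ` A) \<longleftrightarrow>
    (\<forall>N. stable (block_index G') N \<and> N \<subseteq> A \<longrightarrow> N = {0} \<or> N = A)"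
  proof (rule iffI; rule allI; rule impI)
    fix N assume all: "\<forall>N. block_submodule G' N VM \<and> N \<subseteq> ?\<phi> ` A \<longrightarrow> N = {\<zero>\<^bsub>VM\<^esub>} \<or> N = ?\<phi> ` A"
      and N: "stable (block_index G') N \<and> N \<subseteq> A"
    have "block_submodule G' (?\<phi> ` N) VM \<and> ?\<phi> ` N \<subseteq> ?\<phi> ` A" using im N by (simp add: image_mono)
    then have d: "?\<phi> ` N = ?\<phi> ` {0} \<or> ?\<phi> ` N = ?\<phi> ` A" unfolding zero using all by simp
    have "N \<subseteq> carr" using N Ac by (meson subset_trans)
    then show "N = {0} \<or> N = A" using inj[of N "{0}"] inj[of N A] c0 Ac d by simp
  next
    fix N assume all: "\<forall>N. stable (block_index G') N \<and> N \<subseteq> A \<longrightarrow> N = {0} \<or> N = A"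
      and N: "block_submodule G' N VM \<and> N \<subseteq> ?\<phi> ` A"
    let ?N = "{p \<in> carr. ?\<phi> p \<in> N}"
    have "?N \<subseteq> A"
    proof
      fix p assume p: "p \<in> ?N"
      then obtain q where "q \<in> A" "?\<phi> p = ?\<phi> q" using N by blast
      then show "p \<in> A" using inj_onD[OF univ_map_inj, of p q] p Ac by auto
    qed
    then have "?N = {0} \<or> ?N = A" using all vim N by simp
    moreover have "N = ?\<phi> ` ?N" using ims[OF V'.block_submoduleD(1)[of G' N]] N by simp
    ultimately show "N = {\<zero>\<^bsub>VM\<^esub>} \<or> N = ?\<phi> ` A" unfolding zero[symmetric] by (elim disjE) simp_all
  qed
  then show ?thesis unfolding V'.irreducible_restrict[OF im[OF A]] z by simp
qed

lemma vac_nonzero: "vac \<noteq> 0"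
  by (metis lookup_single_eq lookup_zero zero_neq_one)

lemma irreducible_verma_iff:
  "irreducible_module G VM \<longleftrightarrow> (\<forall>N. stable BI N \<longrightarrow> N = {0} \<or> N = carr)"
proof -
  have "irreducible_module G VM \<longleftrightarrow> irreducible_module G (VM\<lparr>carrier := VM.univ_map ` carr\<rparr>)"
    by (simp add: univ_map_surj)
  also have "\<dots> \<longleftrightarrow> (\<forall>N. stable BI N \<longrightarrow> N = {0} \<or> N = carr)"
  proof -
    have "carr \<noteq> {0}" using vac_nonzero vac_carr by blast
    then show ?thesis unfolding irreducible_image_iff[OF order_refl stable_carr] using stableD(2) by metis
  qed
  finally show ?thesis .
qed

lemma carr_if_vac:
  assumes "stable BI N" "vac \<in> N"
  shows "N = carr"
proof
  show "N \<subseteq> carr" by (rule stableD(2)[OF assms(1)])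
  show "carr \<subseteq> N"
  proof
    fix p assume "p \<in> carr"
    then show "p \<in> N"
    proof (induction rule: carr_induct)
      case (nf w a)
      then have w: "set w \<subseteq> BI" by auto
      then have "nf w = act_word w vac" using act_word_nf[of w "[]"] by simp
      also have "\<dots> \<in> N" using act_word_stable[OF assms(1) w assms(2)] .
      finally show ?case using pm.subspace_scale[OF stableD(1)[OF assms(1)]] by blast
    qed (use stableD(1)[OF assms(1)] in \<open>auto simp: pm.subspace_0 pm.subspace_add\<close>)
  qed
qed

subsection \<open>Weights\<close>

definition wt :: "'f block_basis multiset \<Rightarrow> 'f" where
  "wt m = (\<Sum>x\<in>#m. grade x)"

lemma wt_simps [simp]: "wt {#} = 0" "wt (add_mset x m) = grade x + wt m"
  by (simp_all add: wt_def)

definition homog :: "'f \<Rightarrow> ('f block_basis multiset \<Rightarrow>\<^sub>0 'f) set" where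
  "homog \<gamma> = {p \<in> carr. \<forall>m\<in>Poly_Mapping.keys p. wt m = \<gamma>}"

lemma nf_wt: "set w \<subseteq> BI \<Longrightarrow> m \<in> Poly_Mapping.keys (nf w) \<Longrightarrow> wt m = (\<Sum>x\<leftarrow>w. grade x)"
  unfolding wt_def by (rule nf_weight) (auto dest: grade_bracket eigenvalue_grade)

lemma wt_word: "(\<Sum>x\<leftarrow>word m. grade x) = wt m"
  unfolding wt_def by (metis mset_map mset_word sum_mset_sum_list)

lemma subspace_homog: "pm.subspace (homog \<gamma>)"
proof -
  have "homog \<gamma> = carr \<inter> {p. \<forall>m\<in>Poly_Mapping.keys p. wt m = \<gamma>}" by (auto simp: homog_def)
  then show ?thesis using pm.subspace_inter[OF subspace_carr subspace_keys] by simp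
qed

lemma nf_homog: "set w \<subseteq> BI \<Longrightarrow> nf w \<in> homog (\<Sum>x\<leftarrow>w. grade x)"
  using nf_carr nf_wt by (auto simp: homog_def)

lemma act1_homog:
  assumes "x \<in> BI" "p \<in> homog \<gamma>"
  shows "act1 x p \<in> homog (grade x + \<gamma>)"
  unfolding act1_def
proof (rule lin_closed[OF subspace_homog])
  fix m assume m: "m \<in> Poly_Mapping.keys p"
  then have "set_mset m \<subseteq> BI" "wt m = \<gamma>" using assms(2) carr_subset by (fastforce simp: homog_def)+
  then show "nf (x # word m) \<in> homog (grade x + \<gamma>)"
    using nf_homog[of "x # word m"] assms(1) by (simp add: wt_word)
qed

definition comp :: "'f \<Rightarrow> ('f block_basis multiset \<Rightarrow>\<^sub>0 'f) \<Rightarrow> ('f block_basis multiset \<Rightarrow>\<^sub>0 'f)" where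
  "comp \<gamma> p = lin (\<lambda>m. if wt m = \<gamma> then Poly_Mapping.single m 1 else 0) p"

lemma lookup_comp: "Poly_Mapping.lookup (comp \<gamma> p) m = (if wt m = \<gamma> then Poly_Mapping.lookup p m else 0)"
proof -
  have "Poly_Mapping.lookup (comp \<gamma> p) m =
    (\<Sum>z\<in>Poly_Mapping.keys p. if z = m then (if wt m = \<gamma> then Poly_Mapping.lookup p m else 0) else 0)"
    unfolding comp_def lookup_lin by (rule sum.cong) (auto simp: lookup_single when_def)
  then show ?thesis by (simp add: in_keys_iff)
qed

lemma keys_comp: "Poly_Mapping.keys (comp \<gamma> p) = {m \<in> Poly_Mapping.keys p. wt m = \<gamma>}"
  by (auto simp: in_keys_iff lookup_comp split: if_splits)

lemma comp_homog: "p \<in> carr \<Longrightarrow> comp \<gamma> p \<in> homog \<gamma>"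
  by (auto simp: homog_def carr_def keys_comp)

lemma comp_eq_self: "p \<in> homog \<gamma> \<Longrightarrow> comp \<gamma> p = p"
  by (rule poly_mapping_eqI) (auto simp: lookup_comp homog_def in_keys_iff)

lemma comp_other: "p \<in> homog \<beta> \<Longrightarrow> \<gamma> \<noteq> \<beta> \<Longrightarrow> comp \<gamma> p = 0"
  by (rule poly_mapping_eqI) (auto simp: lookup_comp homog_def in_keys_iff)

lemma comp_add: "comp \<gamma> (p + q) = comp \<gamma> p + comp \<gamma> q"
  and comp_scale: "comp \<gamma> (a \<cdot> p) = a \<cdot> comp \<gamma> p"
  and comp_diff: "comp \<gamma> (p - q) = comp \<gamma> p - comp \<gamma> q"
  by (simp_all add: comp_def lin_add lin_scale lin_diff)

lemma sum_comp: "p = (\<Sum>\<gamma>\<in>wt ` Poly_Mapping.keys p. comp \<gamma> p)"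
proof (rule poly_mapping_eqI)
  fix m
  have "Poly_Mapping.lookup (\<Sum>\<gamma>\<in>wt ` Poly_Mapping.keys p. comp \<gamma> p) m =
     (\<Sum>\<gamma>\<in>wt ` Poly_Mapping.keys p. if \<gamma> = wt m then Poly_Mapping.lookup p m else 0)"
    by (simp add: lookup_sum lookup_comp eq_commute)
  also have "\<dots> = Poly_Mapping.lookup p m" by (auto simp: in_keys_iff)
  finally show "Poly_Mapping.lookup p m = Poly_Mapping.lookup (\<Sum>\<gamma>\<in>wt ` Poly_Mapping.keys p. comp \<gamma> p) m" ..
qed

text \<open>\<open>L 0 0\<close> is the degree operator: its bracket with a letter is the grade
  times that letter.\<close>

lemma nf_L00:
  "set w \<subseteq> BI \<Longrightarrow> nf (L 0 0 # w) = (eigenvalue \<Lambda> (L 0 0) + (\<Sum>x\<leftarrow>w. grade x)) \<cdot> nf w"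
proof (induction w)
  case Nil
  have "L 0 0 \<in> borel" by (simp add: borel_def)
  then show ?case using nf_T by simp
next
  case (Cons y w)
  then have w: "set w \<subseteq> BI" by simp
  have "nf (L 0 0 # y # w) = nf (y # L 0 0 # w) + lin (\<lambda>z. nf (z # w)) (basis_bracket (L 0 0) y)"
    using exchange[of "[]" "L 0 0" y w] by simp
  also have "nf (y # L 0 0 # w) = act1 y (nf (L 0 0 # w))" using act1_nf[of "L 0 0 # w" y] w by simp
  also have "lin (\<lambda>z. nf (z # w)) (basis_bracket (L 0 0) y) = grade y \<cdot> nf (y # w)"
    by (cases y) (simp_all add: lin_add)
  finally show ?case using Cons.IH[OF w] w by (simp add: act1_add act1_scale act1_nf pm.scale_left_distrib add_ac)
qed

lemma act1_L00:
  assumes "p \<in> carr"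
  shows "act1 (L 0 0) p = lin (\<lambda>m. (eigenvalue \<Lambda> (L 0 0) + wt m) \<cdot> Poly_Mapping.single m 1) p"
  unfolding act1_def
proof (rule lin_cong)
  fix m assume "m \<in> Poly_Mapping.keys p"
  then have m: "set_mset m \<subseteq> BI - borel" using carr_subset[OF assms] by blast
  then show "nf (L 0 0 # word m) = (eigenvalue \<Lambda> (L 0 0) + wt m) \<cdot> Poly_Mapping.single m 1"
    using nf_L00[of "word m"] nf_word[OF m] by (auto simp: wt_word)
qed

lemma lookup_act1_L00:
  assumes "p \<in> carr"
  shows "Poly_Mapping.lookup (act1 (L 0 0) p) m = (eigenvalue \<Lambda> (L 0 0) + wt m) * Poly_Mapping.lookup p m"
proof -
  have "Poly_Mapping.lookup (act1 (L 0 0) p) m =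
    (\<Sum>z\<in>Poly_Mapping.keys p. if z = m then (eigenvalue \<Lambda> (L 0 0) + wt m) * Poly_Mapping.lookup p m else 0)"
    unfolding act1_L00[OF assms] lookup_lin by (rule sum.cong) (auto simp: lookup_single when_def)
  then show ?thesis by (simp add: in_keys_iff)
qed

text \<open>Weight spaces are eigenspaces of \<open>L 0 0\<close> with distinct eigenvalues.
  Subtracting the eigenvalue of a weight \<beta> removes that component and multiplies the one of
  weight \<gamma> by \<gamma> - \<beta>; induction on the number of weights isolates a single
  component.\<close>

lemma comp_stable:
  assumes N: "stable U N" and U: "L 0 0 \<in> U" and "p \<in> N"
  shows "comp \<gamma> p \<in> N"
proof -
  note sub = stableD(1)[OF N]
  have "\<forall>p\<in>N. card (wt ` Poly_Mapping.keys p) \<le> n \<longrightarrow> (\<forall>\<gamma>. comp \<gamma> p \<in> N)" for n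
  proof (induction n)
    case 0
    show ?case
    proof (intro ballI impI allI)
      fix p :: "'f block_basis multiset \<Rightarrow>\<^sub>0 'f" and \<gamma> assume "card (wt ` Poly_Mapping.keys p) \<le> 0"
      then have "p = 0" by auto
      then show "comp \<gamma> p \<in> N" using pm.subspace_0[OF sub] by (simp add: comp_def)
    qed
  next
    case (Suc n)
    show ?case
    proof (intro ballI impI allI)
      fix p :: "'f block_basis multiset \<Rightarrow>\<^sub>0 'f" and \<gamma> assume p: "p \<in> N" and card: "card (wt ` Poly_Mapping.keys p) \<le> Suc n"
      have pc: "p \<in> carr" using p stableD(2)[OF N] by blast
      show "comp \<gamma> p \<in> N"
      proof (cases "wt ` Poly_Mapping.keys p \<subseteq> {\<gamma>}")
        case True
        then have "p \<in> homog \<gamma>" using pc by (auto simp: homog_def)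
        then show ?thesis using p comp_eq_self by simp
      next
        case False
        then obtain \<beta> where \<beta>: "\<beta> \<in> wt ` Poly_Mapping.keys p" "\<beta> \<noteq> \<gamma>" by blast
        define q where "q = act1 (L 0 0) p - (eigenvalue \<Lambda> (L 0 0) + \<beta>) \<cdot> p"
        have "act1 (L 0 0) p \<in> N" by (rule stableD(3)[OF N U p])
        then have q: "q \<in> N"
          unfolding q_def using p by (intro pm.subspace_diff[OF sub] pm.subspace_scale[OF sub])
        have lq: "Poly_Mapping.lookup q m = (wt m - \<beta>) * Poly_Mapping.lookup p m" for m
          by (simp add: q_def lookup_minus lookup_add lookup_act1_L00[OF pc] algebra_simps)
        have "wt ` Poly_Mapping.keys q \<subseteq> wt ` Poly_Mapping.keys p - {\<beta>}"
          by (auto simp: in_keys_iff lq)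
        then have "card (wt ` Poly_Mapping.keys q) \<le> card (wt ` Poly_Mapping.keys p - {\<beta>})"
          by (intro card_mono) auto
        then have "card (wt ` Poly_Mapping.keys q) \<le> n" using card \<beta>(1) by simp
        then have "comp \<gamma> q \<in> N" using Suc q by blast
        moreover have "comp \<gamma> q = (\<gamma> - \<beta>) \<cdot> comp \<gamma> p"
          by (rule poly_mapping_eqI) (auto simp: lookup_comp lq)
        ultimately have "inverse (\<gamma> - \<beta>) \<cdot> (\<gamma> - \<beta>) \<cdot> comp \<gamma> p \<in> N" using pm.subspace_scale[OF sub] by metis
        then show ?thesis using \<beta>(2) by (simp add: pm.scale_scale)
      qed
    qed
  qed
  then show ?thesis using assms(3) by blast
qed

lemma Y_iff: "y \<in> BI - borel \<longleftrightarrow> (\<exists>\<alpha> i. y = L (- \<alpha>) i \<and> \<alpha> \<in> P \<and> i \<ge> -1)"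
proof
  assume y: "y \<in> BI - borel"
  then obtain \<gamma> i where yi: "y = L \<gamma> i" by (cases y) (auto simp: borel_def)
  then have "- \<gamma> \<in> P" using y P_total[of \<gamma>] by (auto simp: borel_def)
  then show "\<exists>\<alpha> i. y = L (- \<alpha>) i \<and> \<alpha> \<in> P \<and> i \<ge> -1" using y yi by (intro exI[of _ "- \<gamma>"]) auto
next
  assume "\<exists>\<alpha> i. y = L (- \<alpha>) i \<and> \<alpha> \<in> P \<and> i \<ge> -1"
  then show "y \<in> BI - borel" using P_G P_neg by (auto simp: borel_def)
qed

lemma carr_letter:
  assumes "p \<in> carr" "m \<in> Poly_Mapping.keys p" "y \<in># m"
  shows "y = L (grade y) (idx y)" "- grade y \<in> P" "idx y \<ge> -1" "grade y \<in> G"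
proof -
  have "y \<in> BI - borel" using carr_subset[OF assms(1,2)] assms(3) by blast
  then obtain \<alpha> i where "y = L (- \<alpha>) i" "\<alpha> \<in> P" "i \<ge> -1" using Y_iff by blast
  then show "y = L (grade y) (idx y)" "- grade y \<in> P" "idx y \<ge> -1" "grade y \<in> G" using P_G by simp_all
qed

lemma wt_P:
  assumes "p \<in> carr" "m \<in> Poly_Mapping.keys p" "m \<noteq> {#}"
  shows "- wt m \<in> P"
proof -
  have "- wt m = (\<Sum>x\<in>#m. - grade x)" unfolding wt_def by (induction m) auto
  then show ?thesis using P_sum_mset[of m "\<lambda>x. - grade x"] carr_letter(2)[OF assms(1,2)] assms(3) by auto
qed

lemma homog_0: "p \<in> homog 0 \<Longrightarrow> p = Poly_Mapping.lookup p {#} \<cdot> vac"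
proof (rule poly_mapping_eqI)
  fix m assume p: "p \<in> homog 0"
  show "Poly_Mapping.lookup p m = Poly_Mapping.lookup (Poly_Mapping.lookup p {#} \<cdot> vac) m"
  proof (cases "m = {#} \<or> m \<notin> Poly_Mapping.keys p")
    case False
    then have "- wt m \<in> P" "wt m = 0" using p wt_P[of p m] by (auto simp: homog_def)
    then show ?thesis by simp
  qed (auto simp: lookup_single when_def in_keys_iff)
qed

lemma homog_pos: "\<gamma> \<in> P \<Longrightarrow> p \<in> homog \<gamma> \<Longrightarrow> p = 0"
proof (rule ccontr)
  assume g: "\<gamma> \<in> P" and p: "p \<in> homog \<gamma>" and "p \<noteq> 0"
  then obtain m where m: "m \<in> Poly_Mapping.keys p" by fastforce
  then have w: "wt m = \<gamma>" "p \<in> carr" using p by (auto simp: homog_def)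
  then show False using wt_P[OF w(2) m] P_neg[OF g] g by (cases "m = {#}") auto
qed

section \<open>Action of positive letters on monomials of top degree\<close>

subsection \<open>Leading terms\<close>

text \<open>The letter of the bracket of \<open>L \<beta> j\<close> with \<open>y\<close>, apart
  from the central term; \<open>shift_coeff\<close> is its coefficient.\<close>

definition shift :: "'f \<Rightarrow> int \<Rightarrow> 'f block_basis \<Rightarrow> 'f block_basis" where
  "shift \<beta> j y = L (\<beta> + grade y) (idx y + j)"

definition shift_coeff :: "'f \<Rightarrow> int \<Rightarrow> 'f block_basis \<Rightarrow> 'f" where
  "shift_coeff \<beta> j y = of_int (j + 1) * grade y - of_int (idx y + 1) * \<beta>"

lemma deriv_L:
  assumes "\<And>y. y \<in># m \<Longrightarrow> y = L (grade y) (idx y)"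
  shows "deriv (L \<beta> j) m = (\<Sum>y\<in>#m. if shift \<beta> j y \<in> borel then 0
    else Poly_Mapping.single (add_mset (shift \<beta> j y) (m - {#y#})) (shift_coeff \<beta> j y))"
proof -
  have C: "C \<in> borel" by (simp add: borel_def)
  have *: "lin (\<lambda>z. if z \<in> borel then 0 else Poly_Mapping.single (add_mset z M) 1) (basis_bracket (L \<beta> j) (L \<gamma> i)) =
     (if L (\<beta> + \<gamma>) (i + j) \<in> borel then 0 else Poly_Mapping.single (add_mset (L (\<beta> + \<gamma>) (i + j)) M)
        (of_int (j + 1) * \<gamma> - of_int (i + 1) * \<beta>))" for M \<gamma> i
    using C by (simp add: lin_add add.commute)
  have e: "lin (\<lambda>z. if z \<in> borel then 0 else Poly_Mapping.single (add_mset z M) 1) (basis_bracket (L \<beta> j) y) =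
     (if shift \<beta> j y \<in> borel then 0 else Poly_Mapping.single (add_mset (shift \<beta> j y) M) (shift_coeff \<beta> j y))"
    if y: "y = L (grade y) (idx y)" for M y
    using * [of M "grade y" "idx y"] unfolding shift_def shift_coeff_def by (simp only: y[symmetric])
  show ?thesis unfolding deriv_def by (intro arg_cong[where f = sum_mset] image_mset_cong e assms)
qed

lemma lookup_sum_mset: "Poly_Mapping.lookup (\<Sum>y\<in>#m. f y) k = (\<Sum>y\<in>#m. Poly_Mapping.lookup (f y) k)"
  by (induction m) (auto simp: lookup_add)

definition top_keys :: "nat \<Rightarrow> ('f block_basis multiset \<Rightarrow>\<^sub>0 'f) \<Rightarrow> 'f block_basis multiset set" where
  "top_keys k u = {m \<in> Poly_Mapping.keys u. size m = k}"

lemma finite_top_keys [simp]: "finite (top_keys k u)"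
  by (simp add: top_keys_def)

lemma lower_iff: "u \<in> lower n \<longleftrightarrow> u \<in> carr \<and> (\<forall>m\<in>Poly_Mapping.keys u. size m < n)"
  by (auto simp: lower_def carr_def)

text \<open>In top degree only the derivation \<open>deriv\<close> is visible: the scalar of
  \<open>L \<beta> j\<close> is zero, and a letter that is moved into the Borel part contributes in
  lower degree only.\<close>

lemma lookup_act1_top:
  assumes u: "u \<in> lower (Suc k)" and \<beta>: "\<beta> \<in> P" and j: "j \<ge> -1" and k: "size m' = k"
  shows "Poly_Mapping.lookup (act1 (L \<beta> j) u) m' = (\<Sum>m\<in>top_keys k u. Poly_Mapping.lookup u m *
    (\<Sum>y\<in>#m. if shift \<beta> j y \<notin> borel \<and> m' = add_mset (shift \<beta> j y) (m - {#y#}) then shift_coeff \<beta> j y else 0))"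
proof -
  have x: "L \<beta> j \<in> borel" "eigenvalue \<Lambda> (L \<beta> j) = 0" using \<beta> j P_G by (auto simp: borel_def)
  have xX: "L \<beta> j \<in> BI" using x by (simp add: borel_def)
  have uc: "u \<in> carr" using u by (simp add: lower_iff)
  define g where "g m = (if size m = k then deriv (L \<beta> j) m else 0)" for m
  have "nf (L \<beta> j # word m) - g m \<in> lower k" if m: "m \<in> Poly_Mapping.keys u" for m
  proof (cases "size m = k")
    case True
    then show ?thesis using nf_cons_leading[OF x(1), of "word m"] carr_subset[OF uc m] x(2) by (simp add: g_def)
  next
    case False
    then have "size m < k" using u m by (auto simp: lower_iff)
    then have "Poly_Mapping.single m 1 \<in> lower k" using carr_subset[OF uc m] by (auto simp: lower_iff)
    then show ?thesis using act1_lower[OF xX] x(1) False by (fastforce simp: g_def act1_single)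
  qed
  then have "act1 (L \<beta> j) u - lin g u \<in> lower k"
    unfolding act1_def lin_fun_diff[symmetric] by (rule lin_closed[OF subspace_lower])
  then have "Poly_Mapping.lookup (act1 (L \<beta> j) u - lin g u) m' = 0"
    using k by (auto simp: lower_iff in_keys_iff)
  then have "Poly_Mapping.lookup (act1 (L \<beta> j) u) m' = Poly_Mapping.lookup (lin g u) m'" by (simp add: lookup_minus)
  also have "\<dots> = (\<Sum>m\<in>top_keys k u. Poly_Mapping.lookup u m * Poly_Mapping.lookup (deriv (L \<beta> j) m) m')"
    unfolding lookup_lin top_keys_def by (rule sum.mono_neutral_cong_right) (auto simp: g_def)
  also have "\<dots> = (\<Sum>m\<in>top_keys k u. Poly_Mapping.lookup u m *
    (\<Sum>y\<in>#m. if shift \<beta> j y \<notin> borel \<and> m' = add_mset (shift \<beta> j y) (m - {#y#}) then shift_coeff \<beta> j y else 0))"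
  proof (intro sum.cong refl arg_cong2[where f = "(*)"])
    fix m assume "m \<in> top_keys k u"
    then have m: "m \<in> Poly_Mapping.keys u" by (simp add: top_keys_def)
    have l: "y = L (grade y) (idx y)" if "y \<in># m" for y
      by (rule carr_letter(1)[OF uc m that])
    have d: "deriv (L \<beta> j) m = (\<Sum>y\<in>#m. if shift \<beta> j y \<in> borel then 0
        else Poly_Mapping.single (add_mset (shift \<beta> j y) (m - {#y#})) (shift_coeff \<beta> j y))"
      by (rule deriv_L) (rule l)
    show "Poly_Mapping.lookup (deriv (L \<beta> j) m) m' = (\<Sum>y\<in>#m. if shift \<beta> j y \<notin> borel \<and> m' = add_mset (shift \<beta> j y) (m - {#y#}) then shift_coeff \<beta> j y else 0)"
      unfolding d lookup_sum_mset
      by (intro arg_cong[where f = sum_mset] image_mset_cong) (auto simp: lookup_single when_def)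
  qed
  finally show ?thesis .
qed

lemma top_keys_act1:
  assumes u: "u \<in> lower (Suc k)" and \<beta>: "\<beta> \<in> P" and j: "j \<ge> -1" and m': "m' \<in> top_keys k (act1 (L \<beta> j) u)"
  obtains m y where "m \<in> top_keys k u" "y \<in># m" "shift \<beta> j y \<notin> borel" "shift_coeff \<beta> j y \<noteq> 0"
    "m' = add_mset (shift \<beta> j y) (m - {#y#})"
proof -
  define g where "g m y = (if shift \<beta> j y \<notin> borel \<and> m' = add_mset (shift \<beta> j y) (m - {#y#})
    then shift_coeff \<beta> j y else 0)" for m y
  have k: "size m' = k" and nz: "Poly_Mapping.lookup (act1 (L \<beta> j) u) m' \<noteq> 0"
    using m' by (auto simp: top_keys_def in_keys_iff)
  have "(\<Sum>m\<in>top_keys k u. Poly_Mapping.lookup u m * (\<Sum>y\<in>#m. g m y)) \<noteq> 0"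
    using nz unfolding lookup_act1_top[OF u \<beta> j k] g_def .
  then obtain m where m: "m \<in> top_keys k u" "(\<Sum>y\<in>#m. g m y) \<noteq> 0"
    by (rule sum.not_neutral_contains_not_neutral) auto
  have "(\<Sum>y\<in>#m. f y) = 0" if "\<And>y. y \<in># m \<Longrightarrow> f y = 0" for f :: "'f block_basis \<Rightarrow> 'f" and m
    using that by (induction m) auto
  then obtain y where y: "y \<in># m" "g m y \<noteq> 0" using m(2) by blast
  then show thesis using that[OF m(1), of y] by (auto simp: g_def split: if_splits)
qed

text \<open>A letter that is moved to a position not occupied so far gives a new monomial, which
  cannot cancel.\<close>

lemma new_top_key:
  assumes u: "u \<in> lower (Suc k)" and \<beta>: "\<beta> \<in> P" and j: "j \<ge> -1"
    and m0: "m0 \<in> top_keys k u" and y0: "y0 \<in># m0"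
    and z0: "shift \<beta> j y0 \<notin> borel" "shift_coeff \<beta> j y0 \<noteq> 0"
    and new: "\<And>m. m \<in> top_keys k u \<Longrightarrow> shift \<beta> j y0 \<notin># m"
  shows "add_mset (shift \<beta> j y0) (m0 - {#y0#}) \<in> top_keys k (act1 (L \<beta> j) u)"
proof -
  let ?m' = "add_mset (shift \<beta> j y0) (m0 - {#y0#})"
  have uc: "u \<in> carr" using u by (simp add: lower_iff)
  have k: "size ?m' = k" using m0 size_Suc_Diff1[OF y0] by (simp add: top_keys_def)
  \<comment> \<open>The new letter occurs in no old top monomial, so it must be the moved one. This
    determines \<open>y\<close> and then \<open>m\<close>, and nothing can cancel.\<close>
  have e: "shift \<beta> j y \<notin> borel \<and> ?m' = add_mset (shift \<beta> j y) (m - {#y#}) \<longleftrightarrow> m = m0 \<and> y = y0"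
    if m: "m \<in> top_keys k u" and y: "y \<in># m" for m y
  proof
    assume a: "shift \<beta> j y \<notin> borel \<and> ?m' = add_mset (shift \<beta> j y) (m - {#y#})"
    have "shift \<beta> j y0 \<in># ?m'" by simp
    then have "shift \<beta> j y0 \<in># add_mset (shift \<beta> j y) (m - {#y#})" using a by simp
    then have "shift \<beta> j y0 = shift \<beta> j y \<or> shift \<beta> j y0 \<in># m - {#y#}" by simp
    then have s: "shift \<beta> j y0 = shift \<beta> j y" using new[OF m] in_diffD by fast
    have mk: "m \<in> Poly_Mapping.keys u" "m0 \<in> Poly_Mapping.keys u" using m m0 by (simp_all add: top_keys_def)
    have l: "y = L (grade y) (idx y)" "y0 = L (grade y0) (idx y0)"
      by (rule carr_letter(1)[OF uc mk(1) y], rule carr_letter(1)[OF uc mk(2) y0])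
    have gi: "grade y = grade y0" "idx y = idx y0" using s by (simp_all add: shift_def)
    have yy: "y = y0" using l(1)[unfolded gi] l(2)[symmetric] by (rule trans)
    have "add_mset (shift \<beta> j y0) (m0 - {#y0#}) = add_mset (shift \<beta> j y0) (m - {#y0#})"
      using conjunct2[OF a] unfolding yy .
    then have "m0 - {#y0#} = m - {#y0#}" by (rule add_mset_add_mset_same_iff[THEN iffD1])
    then have "add_mset y0 (m0 - {#y0#}) = add_mset y0 (m - {#y0#})" by (rule arg_cong)
    then have "m0 = m" unfolding insert_DiffM[OF y[unfolded yy]] insert_DiffM[OF y0] .
    then show "m = m0 \<and> y = y0" using yy by blast
  next
    assume "m = m0 \<and> y = y0"
    then show "shift \<beta> j y \<notin> borel \<and> ?m' = add_mset (shift \<beta> j y) (m - {#y#})" using z0 by simp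
  qed
  have "Poly_Mapping.lookup (act1 (L \<beta> j) u) ?m' =
    (\<Sum>m\<in>top_keys k u. Poly_Mapping.lookup u m * (\<Sum>y\<in>#m. if m = m0 \<and> y = y0 then shift_coeff \<beta> j y else 0))"
    unfolding lookup_act1_top[OF u \<beta> j k]
  proof (rule sum.cong[OF refl])
    fix m assume m: "m \<in> top_keys k u"
    have "image_mset (\<lambda>y. if shift \<beta> j y \<notin> borel \<and> ?m' = add_mset (shift \<beta> j y) (m - {#y#}) then shift_coeff \<beta> j y else 0) m
        = image_mset (\<lambda>y. if m = m0 \<and> y = y0 then shift_coeff \<beta> j y else 0) m"
      by (rule image_mset_cong) (simp only: e[OF m])
    then show "Poly_Mapping.lookup u m * (\<Sum>y\<in>#m. if shift \<beta> j y \<notin> borel \<and> ?m' = add_mset (shift \<beta> j y) (m - {#y#}) then shift_coeff \<beta> j y else 0)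
        = Poly_Mapping.lookup u m * (\<Sum>y\<in>#m. if m = m0 \<and> y = y0 then shift_coeff \<beta> j y else 0)"
      by (simp only:)
  qed
  also have "\<dots> = (\<Sum>m\<in>top_keys k u. if m = m0 then Poly_Mapping.lookup u m0 * (\<Sum>y\<in>#m0. if y = y0 then shift_coeff \<beta> j y0 else 0) else 0)"
  proof (intro sum.cong refl)
    fix m
    have "(\<lambda>y. if y = y0 then shift_coeff \<beta> j y else 0) = (\<lambda>y. if y = y0 then shift_coeff \<beta> j y0 else 0)" by auto
    then show "Poly_Mapping.lookup u m * (\<Sum>y\<in>#m. if m = m0 \<and> y = y0 then shift_coeff \<beta> j y else 0) =
      (if m = m0 then Poly_Mapping.lookup u m0 * (\<Sum>y\<in>#m0. if y = y0 then shift_coeff \<beta> j y0 else 0) else 0)" by (cases "m = m0") simp_all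
  qed
  also have "\<dots> = Poly_Mapping.lookup u m0 * (\<Sum>y\<in>#m0. if y = y0 then shift_coeff \<beta> j y0 else 0)" using m0 by simp
  \<comment> \<open>Equal letters contribute equally; in characteristic zero the multiplicity of
    \<open>y0\<close> is a nonzero factor.\<close>
  also have "(\<Sum>y\<in>#m0. if y = y0 then shift_coeff \<beta> j y0 else 0) = of_nat (count m0 y0) * shift_coeff \<beta> j y0"
    by (induction m0) (auto simp: algebra_simps)
  finally have "Poly_Mapping.lookup (act1 (L \<beta> j) u) ?m' \<noteq> 0"
    using m0 y0 z0 by (auto simp: top_keys_def in_keys_iff)
  then show ?thesis using k by (simp add: top_keys_def in_keys_iff)
qed

text \<open>The negated coefficient is a sum of positive elements with non-negative integer
  multipliers, and not both multipliers are zero.\<close>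

lemma shift_coeff_nonzero:
  assumes "\<beta> \<in> P" "- grade y \<in> P" "j \<ge> -1" "idx y \<ge> -1" "j \<ge> 0 \<or> idx y \<ge> 0"
  shows "shift_coeff \<beta> j y \<noteq> 0"
proof
  have nonneg: "of_int n * a \<in> P \<or> of_int n * a = 0" if "n \<ge> 0" "a \<in> P" for n a
    using P_scale_int[OF that(2), of n] that(1) by (cases "n = 0") auto
  assume "shift_coeff \<beta> j y = 0"
  then have "of_int (j + 1) * (- grade y) + of_int (idx y + 1) * \<beta> = 0"
    by (simp add: shift_coeff_def algebra_simps)
  moreover have "of_int (j + 1) * (- grade y) + of_int (idx y + 1) * \<beta> \<in> P"
  proof (cases "j \<ge> 0")
    case True
    have 1: "of_int (j + 1) * (- grade y) \<in> P" by (rule P_scale_int[OF assms(2)]) (use True in simp)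
    from nonneg[of "idx y + 1" \<beta>] show ?thesis
    proof
      show ?thesis if "of_int (idx y + 1) * \<beta> = 0" using 1 unfolding that by simp
    qed (use assms P_add[OF 1] in auto)
  next
    case False
    then have "j + 1 = 0" "0 < idx y + 1" using assms by auto
    then show ?thesis using P_scale_int[OF assms(1), of "idx y + 1"] by simp
  qed
  ultimately show False by simp
qed

text \<open>Exact degree \<open>k\<close> and a single weight. Homogeneity is carried along because
  weights later control the monomials below the top degree as well.\<close>

definition good :: "('f block_basis multiset \<Rightarrow>\<^sub>0 'f) set \<Rightarrow> nat \<Rightarrow> ('f block_basis multiset \<Rightarrow>\<^sub>0 'f) \<Rightarrow> bool" where
  "good N k u \<longleftrightarrow> u \<in> N \<and> (\<exists>\<gamma>. u \<in> homog \<gamma>) \<and> u \<in> lower (Suc k) \<and> top_keys k u \<noteq> {}"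

lemma goodD:
  assumes "good N k u"
  shows "u \<in> N" "u \<in> lower (Suc k)" "u \<in> carr" "top_keys k u \<noteq> {}"
  using assms by (auto simp: good_def lower_iff)

lemma good_act1:
  assumes N: "stable BI N" and u: "good N k u" and \<beta>: "\<beta> \<in> P" and j: "j \<ge> -1"
    and top: "top_keys k (act1 (L \<beta> j) u) \<noteq> {}"
  shows "good N k (act1 (L \<beta> j) u)"
proof -
  have x: "L \<beta> j \<in> BI" "L \<beta> j \<in> borel" using \<beta> j P_G by (auto simp: borel_def)
  obtain \<gamma> where "u \<in> homog \<gamma>" using u by (auto simp: good_def)
  then have "act1 (L \<beta> j) u \<in> homog (\<beta> + \<gamma>)" using act1_homog[OF x(1)] by fastforce
  then show ?thesis
    using stableD(3)[OF N x(1)] act1_lower[OF x(1), of u "Suc k"] u x(2) top by (auto simp: good_def)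
qed

lemma good_exists:
  assumes N: "stable BI N" and "N \<noteq> {0}"
  obtains k u where "good N k u"
proof -
  have "0 \<in> N" using pm.subspace_0[OF stableD(1)[OF N]] .
  then obtain p where p: "p \<in> N" "p \<noteq> 0" using assms(2) by blast
  then obtain m where m: "m \<in> Poly_Mapping.keys p" by fastforce
  let ?u = "comp (wt m) p"
  have pc: "p \<in> carr" using p stableD(2)[OF N] by blast
  have u: "?u \<in> N" using comp_stable[OF N _ p(1)] by simp
  have mu: "m \<in> Poly_Mapping.keys ?u" using m by (simp add: keys_comp)
  define k where "k = Max (size ` Poly_Mapping.keys ?u)"
  have fin: "finite (size ` Poly_Mapping.keys ?u)" "size ` Poly_Mapping.keys ?u \<noteq> {}" using mu by auto
  have "k \<in> size ` Poly_Mapping.keys ?u" unfolding k_def by (rule Max_in[OF fin])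
  moreover have "size m' \<le> k" if "m' \<in> Poly_Mapping.keys ?u" for m' unfolding k_def using fin(1) that by simp
  ultimately have "good N k ?u"
    using u comp_homog[OF pc] by (auto simp: good_def lower_iff top_keys_def less_Suc_eq_le homog_def)
  then show thesis by (rule that)
qed

lemma finite_gt_max:
  "finite D \<Longrightarrow> D \<noteq> {} \<Longrightarrow> D \<subseteq> G \<Longrightarrow> \<exists>A\<in>D. \<forall>x\<in>D. x = A \<or> A - x \<in> P"
proof (induction D rule: finite_ne_induct)
  case (insert x D)
  then obtain A where A: "A \<in> D" "\<forall>x\<in>D. x = A \<or> A - x \<in> P" by blast
  have "A \<in> G" "x \<in> G" using A insert by auto
  then consider "A - x \<in> P" | "A = x" | "x - A \<in> P" using P_total[of "A - x"] by auto
  then show ?case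
  proof cases
    case 3
    have "x - y \<in> P" if "y \<in> D" "y \<noteq> A" for y
      using P_add[OF 3, of "A - y"] A that by auto
    then show ?thesis using 3 A by (intro bexI[of _ x]) auto
  qed (use A in auto)
qed simp

end

context verma_weight
begin

lemma top_letter:
  assumes "good N k u" "m \<in> top_keys k u" "y \<in># m"
  shows "- grade y \<in> P" "idx y \<ge> -1" "grade y \<in> G"
  using carr_letter(2-4)[OF goodD(3)[OF assms(1)] _ assms(3)] assms(2) by (auto simp: top_keys_def)

lemma shift_not_borel:
  assumes "\<beta> \<in> G" "grade y \<in> G" "idx y + j \<ge> -1" "shift \<beta> j y \<notin> borel"
  shows "- grade y - \<beta> \<in> P"
proof -
  have "shift \<beta> j y \<in> BI" using assms by (simp add: shift_def)
  then have "\<not> (\<beta> + grade y = 0 \<or> \<beta> + grade y \<in> P)" using assms(4) by (auto simp: borel_def shift_def)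
  then have "- (\<beta> + grade y) \<in> P" using P_total[of "\<beta> + grade y"] assms(1,2) by auto
  moreover have "- grade y - \<beta> = - (\<beta> + grade y)" by simp
  ultimately show ?thesis by (simp only:)
qed

lemma not_borel_if: "- grade z \<in> P \<Longrightarrow> z \<notin> borel"
  using P_neg[of "- grade z"] by (auto simp: borel_def)

section \<open>Minimal positive element: moving all top letters to grade -a\<close>

subsection \<open>Discrete orders\<close>

lemma discrete_minimal:
  assumes "a \<in> P" "pos_below G gt a = {}" "x \<in> P"
  shows "x = a \<or> x - a \<in> P"
proof -
  have G: "a \<in> G" "x \<in> G" using assms P_G by auto
  have "\<not> gt a x" using assms G by (auto simp: pos_below_def pos_part_def)
  then have "a - x \<notin> P" using gt_iff_P G by blast
  then show ?thesis using P_total[of "x - a"] G by auto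
qed

text \<open>Let A be the largest negated grade other than a among the top letters. Raising by A - a
  keeps only letters of grade -A outside the Borel part, since by minimality of a every other
  negated grade is at most A - a, and these letters arrive at grade -a. So every surviving top
  monomial has one letter fewer of the wrong grade, which is the measure of the induction.\<close>

lemma discrete_reduction:
  assumes a: "a \<in> P" "pos_below G gt a = {}" and N: "stable BI N" and "good N k u"
  obtains v where "good N k v" "\<And>m y. m \<in> top_keys k v \<Longrightarrow> y \<in># m \<Longrightarrow> grade y = - a"
proof -
  define b where "b m = size (filter_mset (\<lambda>y. grade y \<noteq> - a) m)" for m :: "'f block_basis multiset"
  have aG: "a \<in> G" using a P_G by blast
  have "\<forall>u. good N k u \<and> (\<forall>m\<in>top_keys k u. b m \<le> n) \<longrightarrow>
      (\<exists>v. good N k v \<and> (\<forall>m\<in>top_keys k v. \<forall>y\<in>#m. grade y = - a))" for n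
  proof (induction n)
    case 0
    then show ?case by (force simp: b_def filter_mset_eq_conv)
  next
    case (Suc n)
    show ?case
    proof (intro allI impI, elim conjE)
      fix u assume u: "good N k u" and bu: "\<forall>m\<in>top_keys k u. b m \<le> Suc n"
      define D where "D = {- grade y | m y. m \<in> top_keys k u \<and> y \<in># m \<and> grade y \<noteq> - a}"
      have "D \<subseteq> (\<lambda>y. - grade y) ` (\<Union>m\<in>top_keys k u. set_mset m)" unfolding D_def by auto
      then have finD: "finite D" by (rule finite_subset) auto
      have DG: "D \<subseteq> G" and DP: "D \<subseteq> P" using top_letter[OF u] by (auto simp: D_def)
      show "\<exists>v. good N k v \<and> (\<forall>m\<in>top_keys k v. \<forall>y\<in>#m. grade y = - a)"
      proof (cases "D = {}")
        case True
        then show ?thesis using u by (auto simp: D_def)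
      next
        case False
        then obtain A where A: "A \<in> D" "\<forall>x\<in>D. x = A \<or> A - x \<in> P"
          using finite_gt_max[OF finD False DG] by blast
        then obtain m0 y0 where m0: "m0 \<in> top_keys k u" "y0 \<in># m0" "grade y0 = - A" "A \<noteq> a"
          by (force simp: D_def)
        have AP: "A \<in> P" "A \<in> G" using A DP DG by auto
        define \<beta> where "\<beta> = A - a"
        have \<beta>: "\<beta> \<in> P" "\<beta> \<in> G" using discrete_minimal[OF a AP(1)] m0(4) P_G by (auto simp: \<beta>_def)
        define J where "J = idx ` (\<Union>m\<in>top_keys k u. set_mset m)"
        have finJ: "finite J" by (simp add: J_def)
        \<comment> \<open>Large enough that the moved letter has an index not in use, even if the
          index of \<open>y0\<close> is -1.\<close>
        define j where "j = Max (insert 0 J) + 2"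
        have j: "j \<ge> 2" "\<And>i. i \<in> J \<Longrightarrow> i + 2 \<le> j" using finJ by (simp_all add: j_def)
        have sy0: "shift \<beta> j y0 = L (- a) (idx y0 + j)" by (simp add: shift_def \<beta>_def m0(3))
        note l0 = top_letter[OF u m0(1,2)]
        have jm: "j \<ge> -1" using j by simp
        have ne: "add_mset (shift \<beta> j y0) (m0 - {#y0#}) \<in> top_keys k (act1 (L \<beta> j) u)"
        proof (rule new_top_key[OF goodD(2)[OF u] \<beta>(1) _ m0(1,2)])
          show "j \<ge> -1" using j by simp
          show "shift \<beta> j y0 \<notin> borel" using a by (intro not_borel_if) (simp add: sy0)
          show "shift_coeff \<beta> j y0 \<noteq> 0" using l0 j \<beta> by (intro shift_coeff_nonzero) auto
          fix m assume m: "m \<in> top_keys k u"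
          show "shift \<beta> j y0 \<notin># m"
          proof
            assume "shift \<beta> j y0 \<in># m"
            then have "idx y0 + j \<in> J" unfolding sy0 J_def using m by (force intro: rev_image_eqI)
            then show False using j(2) l0(2) by fastforce
          qed
        qed
        then have gv: "good N k (act1 (L \<beta> j) u)" using j by (intro good_act1[OF N u \<beta>(1)]) auto
        have "b m' \<le> n" if m': "m' \<in> top_keys k (act1 (L \<beta> j) u)" for m'
        proof -
          obtain m y where m: "m \<in> top_keys k u" "y \<in># m" "shift \<beta> j y \<notin> borel"
            "m' = add_mset (shift \<beta> j y) (m - {#y#})"
            using top_keys_act1[OF goodD(2)[OF u] \<beta>(1) jm m'] by blast
          note ly = top_letter[OF u m(1,2)]
          define \<alpha> where "\<alpha> = - grade y"
          have \<alpha>: "\<alpha> \<in> P" "\<alpha> - \<beta> \<in> P" using shift_not_borel[OF \<beta>(2) ly(3) _ m(3)] ly j by (simp_all add: \<alpha>_def)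
          have "\<alpha> = A"
          proof (rule ccontr)
            assume ne: "\<alpha> \<noteq> A"
            have "A - \<alpha> - a \<in> P \<or> A - \<alpha> - a = 0"
            \<comment> \<open>The value a is excluded from \<open>D\<close>, so the maximality of A
              says nothing about it; here minimality of a is used directly.\<close>
            proof (cases "\<alpha> = a")
              case True
              have "A - a \<in> P" using \<beta> by (simp add: \<beta>_def)
              moreover have "2 * a - A \<in> P" using \<alpha>(2) True by (simp add: \<beta>_def)
              ultimately show ?thesis using discrete_minimal[OF a, of "2 * a - A"] P_neg[of "A - a"] m0(4) by auto
            next
              case False
              then have "grade y \<noteq> - a" by (auto simp: \<alpha>_def)
              then have "\<alpha> \<in> D" unfolding D_def \<alpha>_def using m(1,2) by blast
              then have "A - \<alpha> \<in> P" using A(2) ne by auto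
              then show ?thesis using discrete_minimal[OF a] by auto
            qed
            moreover have "A - \<alpha> - a = - (\<alpha> - \<beta>)" by (simp add: \<beta>_def)
            ultimately show False using P_neg[OF \<alpha>(2)] \<alpha>(2) by auto
          qed
          then have gy: "grade y \<noteq> - a" "grade (shift \<beta> j y) = - a"
            using m0(4) by (auto simp: \<alpha>_def shift_def \<beta>_def)
          then have "filter_mset (\<lambda>y. grade y \<noteq> - a) m' = filter_mset (\<lambda>y. grade y \<noteq> - a) m - {#y#}"
            by (simp add: m(4))
          moreover have "y \<in># filter_mset (\<lambda>y. grade y \<noteq> - a) m" using gy m(2) by simp
          ultimately have "Suc (b m') = b m" using size_Suc_Diff1 unfolding b_def by metis
          then show ?thesis using bu m(1) by fastforce
        qed
        then show ?thesis using Suc gv by blast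
      qed
    qed
  qed
  moreover have "\<forall>m\<in>top_keys k u. b m \<le> k"
    using size_filter_mset_lesseq by (fastforce simp: b_def top_keys_def)
  ultimately show thesis using assms(4) that by blast
qed

section \<open>Dense orders: reduction to one leading monomial with all indices -1\<close>

subsection \<open>Dense orders\<close>

lemma dense_below_finite:
  assumes dense: "\<And>x. x \<in> P \<Longrightarrow> pos_below G gt x \<noteq> {}" and F: "finite F" "F \<noteq> {}" "F \<subseteq> P"
  obtains d where "d \<in> P" "\<And>x. x \<in> F \<Longrightarrow> x - d \<in> P"
proof -
  have below: "\<exists>d\<in>P. x - d \<in> P" if x: "x \<in> P" for x
  proof -
    obtain d where "d \<in> G" "gt d 0" "gt x d" using dense[OF x] by (auto simp: pos_below_def)
    then show ?thesis using gt_iff_P[of x d] P_G[OF x] by (intro bexI[of _ d]) (auto simp: pos_part_def)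
  qed
  have "\<exists>d\<in>P. \<forall>x\<in>F. x - d \<in> P"
    using F
  proof (induction F rule: finite_ne_induct)
    case (insert x F)
    then obtain d where d: "d \<in> P" "\<forall>x\<in>F. x - d \<in> P" by auto
    have x: "x \<in> P" using insert by simp
    consider "x - d \<in> P" | "x = d \<or> d - x \<in> P" using P_total[of "x - d"] d(1) x P_G by auto
    then show ?case
    proof cases
      case 2
      obtain e where e: "e \<in> P" "x - e \<in> P" using below[OF x] by blast
      have de: "d - e \<in> P" using 2 e P_add[of "d - x" "x - e"] by auto
      have "y - e \<in> P" if "y \<in> F" for y using P_add[of "y - d" "d - e"] d(2) that de by auto
      then show ?thesis using e by auto
    qed (use d in auto)
  qed (use below in auto)
  then show thesis using that by blast
qed

text \<open>Start with an element for which the bound on the sum of all \<open>idx y + 1\<close> in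
  its top monomials is least. Let A be the largest negated grade and let \<delta> be smaller than
  all negated grades and all their gaps to A. Then \<open>L (A - \<delta>) j\<close> moves only
  letters of grade -A, namely to grade -\<delta>. With j = -1 it would lower the bound if one of
  these had an index above -1; so all have index -1, and j = 0 turns one of them into
  \<open>L (-\<delta>) (-1)\<close>. After k rounds all letters have been replaced, in the same way
  in every top monomial.\<close>

lemma dense_reduction:
  assumes dense: "\<And>x. x \<in> P \<Longrightarrow> pos_below G gt x \<noteq> {}" and N: "stable BI N" and "good N k u0"
  obtains u D where "good N k u" "top_keys k u = {D}" "\<And>y. y \<in># D \<Longrightarrow> idx y = -1"
proof -
  define isum where "isum m = (\<Sum>y\<in>#m. nat (idx y + 1))" for m :: "'f block_basis multiset"
  define Q where "Q n \<longleftrightarrow> (\<exists>u. good N k u \<and> (\<forall>m\<in>top_keys k u. isum m \<le> n))" for n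
  have "Q (Max (isum ` top_keys k u0))" unfolding Q_def using assms(3) by (intro exI[of _ u0]) auto
  then have Q0: "Q (LEAST n. Q n)" by (rule LeastI)
  define n0 where "n0 = (LEAST n. Q n)"
  have Qn0: "Q n0" unfolding n0_def by (rule Q0)
  have least: "\<not> Q n" if "n < n0" for n using that not_less_Least unfolding n0_def by blast
  \<comment> \<open>\<open>D\<close> collects the letters produced so far. They are common to all
    top monomials, and their negated grades are smaller than those of all remaining letters, so
    later rounds leave them alone.\<close>
  define state where "state s u D \<longleftrightarrow> good N k u \<and> (\<forall>m\<in>top_keys k u. isum m \<le> n0) \<and> size D = s \<and>
    (\<forall>y\<in>#D. idx y = -1) \<and> (\<forall>m\<in>top_keys k u. D \<subseteq># m \<and> (\<forall>y\<in>#m - D. \<forall>d\<in>#D. grade d - grade y \<in> P))"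
    for s u and D :: "'f block_basis multiset"
  have "\<exists>u D. state s u D" if "s \<le> k" for s
    using that
  proof (induction s)
    case 0
    obtain u where "good N k u" "\<forall>m\<in>top_keys k u. isum m \<le> n0" using Qn0 unfolding Q_def by blast
    then have "state 0 u {#}" by (simp add: state_def)
    then show ?case by blast
  next
    case (Suc s)
    then obtain u D where st: "state s u D" by auto
    then have u: "good N k u" and iu: "\<And>m. m \<in> top_keys k u \<Longrightarrow> isum m \<le> n0" and sD: "size D = s"
      and iD: "\<And>y. y \<in># D \<Longrightarrow> idx y = -1" and Dm: "\<And>m. m \<in> top_keys k u \<Longrightarrow> D \<subseteq># m"
      and mD: "\<And>m y d. m \<in> top_keys k u \<Longrightarrow> y \<in># m - D \<Longrightarrow> d \<in># D \<Longrightarrow> grade d - grade y \<in> P"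
      by (auto simp: state_def)
    define K where "K = {- grade y | m y. m \<in> top_keys k u \<and> y \<in># m}"
    have "K \<subseteq> (\<lambda>y. - grade y) ` (\<Union>m\<in>top_keys k u. set_mset m)" unfolding K_def by auto
    then have finK: "finite K" by (rule finite_subset) auto
    have KP: "K \<subseteq> P" and KG: "K \<subseteq> G" using top_letter[OF u] by (auto simp: K_def)
    have rest: "\<exists>y. y \<in># m - D" if m: "m \<in> top_keys k u" for m
    proof -
      have "size (m - D) = k - s" using size_Diff_submset[OF Dm[OF m]] m sD by (simp add: top_keys_def)
      then show ?thesis using Suc.prems by (metis Suc_le_eq multiset_nonemptyE size_empty zero_less_diff less_irrefl)
    qed
    obtain m1 where m1: "m1 \<in> top_keys k u" using goodD(4)[OF u] by blast
    have "K \<noteq> {}" using rest[OF m1] m1 by (auto simp: K_def dest: in_diffD)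
    then obtain A where A: "A \<in> K" "\<forall>x\<in>K. x = A \<or> A - x \<in> P" using finite_gt_max[OF finK _ KG] by blast
    have AP: "A \<in> P" "A \<in> G" using A KP KG by auto
    have AD: "A + grade d \<in> P" if d: "d \<in># D" for d
    proof -
      obtain y where y: "y \<in># m1 - D" using rest[OF m1] by blast
      then have "- grade y \<in> K" using m1 by (auto simp: K_def dest: in_diffD)
      then have "- grade y = A \<or> A - (- grade y) \<in> P" using A(2) by blast
      then show ?thesis
        using mD[OF m1 y d] P_add[of "grade d - grade y" "A + grade y"] by (auto simp: algebra_simps)
    qed
    \<comment> \<open>Being below the values makes the produced letter new; being below the gaps
      makes \<beta> exceed every value other than \<open>A\<close>.\<close>
    define F where "F = K \<union> (\<lambda>x. A - x) ` (K - {A})"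
    have "finite F" "F \<noteq> {}" "F \<subseteq> P" using finK A KP by (auto simp: F_def)
    then obtain \<delta> where \<delta>: "\<delta> \<in> P" "\<And>x. x \<in> F \<Longrightarrow> x - \<delta> \<in> P" using dense_below_finite[OF dense] by metis
    have \<delta>G: "\<delta> \<in> G" using \<delta> P_G by blast
    define \<beta> where "\<beta> = A - \<delta>"
    have \<beta>: "\<beta> \<in> P" "\<beta> \<in> G" using \<delta>(2)[of A] A AP \<delta>G by (auto simp: F_def \<beta>_def)
    have activeA: "grade y = - A"
      if m: "m \<in> top_keys k u" "y \<in># m" and s: "shift \<beta> j y \<notin> borel" "idx y + j \<ge> -1" for m y j
    proof (rule ccontr)
      assume "grade y \<noteq> - A"
      then have "- grade y \<noteq> A" by auto
      moreover have "- grade y \<in> K" using m by (auto simp: K_def)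
      ultimately have "A - (- grade y) \<in> F" unfolding F_def by blast
      then have "A + grade y - \<delta> \<in> P" using \<delta>(2) by fastforce
      moreover have "- grade y - \<beta> \<in> P" using shift_not_borel[OF \<beta>(2) top_letter(3)[OF u m] s(2,1)] .
      moreover have "- grade y - \<beta> = - (A + grade y - \<delta>)" by (simp add: \<beta>_def)
      ultimately show False using P_neg by metis
    qed
    have new: "good N k (act1 (L \<beta> j) u)"
      if m: "m \<in> top_keys k u" "y \<in># m" and y: "grade y = - A" and j: "j = -1 \<and> idx y \<ge> 0 \<or> j = 0" for m y j
    proof -
      have sy: "shift \<beta> j y = L (- \<delta>) (idx y + j)" by (simp add: shift_def \<beta>_def y)
      have "add_mset (shift \<beta> j y) (m - {#y#}) \<in> top_keys k (act1 (L \<beta> j) u)"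
      proof (rule new_top_key[OF goodD(2)[OF u] \<beta>(1) _ m])
        show "j \<ge> -1" using j by auto
        show "shift \<beta> j y \<notin> borel" using \<delta>(1) by (intro not_borel_if) (simp add: sy)
        show "shift_coeff \<beta> j y \<noteq> 0" using top_letter[OF u m] j \<beta> by (intro shift_coeff_nonzero) auto
        fix m' assume m': "m' \<in> top_keys k u"
        show "shift \<beta> j y \<notin># m'"
        proof
          assume "shift \<beta> j y \<in># m'"
          then have "\<exists>y'. \<delta> = - grade y' \<and> y' \<in># m'" unfolding sy by (intro exI[of _ "L (- \<delta>) (idx y + j)"]) simp
          then have "\<delta> \<in> F" using m' by (auto simp: F_def K_def)
          then have "\<delta> - \<delta> \<in> P" by (rule \<delta>(2))
          then show False by simp
        qed
      qed
      then show ?thesis using j by (intro good_act1[OF N u \<beta>(1)]) auto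
    qed
    obtain m2 y2 where m2: "m2 \<in> top_keys k u" "y2 \<in># m2" "grade y2 = - A" using A(1) by (force simp: K_def)
    have idxA: "idx y = -1" if m: "m \<in> top_keys k u" "y \<in># m" and y: "grade y = - A" for m y
    proof (rule ccontr)
      assume "idx y \<noteq> -1"
      then have i: "idx y \<ge> 0" using top_letter(2)[OF u m] by simp
      let ?v = "act1 (L \<beta> (-1)) u"
      have gv: "good N k ?v" using new[OF m y] i by blast
      have "Suc (isum m') \<le> n0" if m': "m' \<in> top_keys k ?v" for m'
      proof -
        obtain p z where p: "p \<in> top_keys k u" "z \<in># p" "shift_coeff \<beta> (-1) z \<noteq> 0"
          "m' = add_mset (shift \<beta> (-1) z) (p - {#z#})"
          using top_keys_act1[OF goodD(2)[OF u] \<beta>(1) order_refl m'] by blast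
        \<comment> \<open>For j = -1 the coefficient is a multiple of \<open>idx z + 1\<close>, so
          letters of index -1 are killed and each surviving term has a smaller index sum.\<close>
        have "idx z \<noteq> -1" using p(3) by (auto simp: shift_coeff_def)
        then have "idx z \<ge> 0" using top_letter(2)[OF u p(1,2)] by simp
        then have "nat (idx z + 1) = Suc (nat (idx (shift \<beta> (-1) z) + 1))" by (simp add: shift_def)
        moreover have "isum p = nat (idx z + 1) + isum (p - {#z#})"
          using arg_cong[OF insert_DiffM[OF p(2)], of isum] unfolding isum_def by simp
        moreover have "isum m' = nat (idx (shift \<beta> (-1) z) + 1) + isum (p - {#z#})" by (simp add: p(4) isum_def)
        ultimately have "isum p = Suc (isum m')" by simp
        then show ?thesis using iu[OF p(1)] by simp
      qed
      then have "Q (n0 - 1)" unfolding Q_def using gv by (intro exI[of _ ?v]) fastforce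
      moreover have "n0 > 0"
      proof -
        obtain m' where "m' \<in> top_keys k ?v" using goodD(4)[OF gv] by blast
        then show ?thesis using \<open>\<And>m'. m' \<in> top_keys k ?v \<Longrightarrow> Suc (isum m') \<le> n0\<close> by fastforce
      qed
      ultimately show False using least[of "n0 - 1"] by simp
    qed
    let ?v = "act1 (L \<beta> 0) u" and ?z = "L (- \<delta>) (-1)"
    have gv: "good N k ?v" using new[OF m2] by blast
    have "state (Suc s) ?v (add_mset ?z D)"
      unfolding state_def
    proof (intro conjI ballI gv)
      fix m' assume m': "m' \<in> top_keys k ?v"
      obtain p y where p: "p \<in> top_keys k u" "y \<in># p" "shift \<beta> 0 y \<notin> borel"
        "m' = add_mset (shift \<beta> 0 y) (p - {#y#})"
        using top_keys_act1[OF goodD(2)[OF u] \<beta>(1) _ m'] by (metis neg_le_0_iff_le zero_le_one)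
      have y: "grade y = - A" using activeA[OF p(1-3)] top_letter(2)[OF u p(1,2)] by simp
      have iy: "idx y = -1" by (rule idxA[OF p(1,2) y])
      have z: "shift \<beta> 0 y = ?z" by (simp add: shift_def \<beta>_def y iy)
      have "isum p = nat (idx y + 1) + isum (p - {#y#})"
        using arg_cong[OF insert_DiffM[OF p(2)], of isum] unfolding isum_def by simp
      then show "isum m' \<le> n0" using iu[OF p(1)] by (simp add: p(4) z isum_def)
      have yD: "y \<notin># D"
      proof
        assume "y \<in># D"
        from AD[OF this] show False by (simp add: y)
      qed
      have "D \<subseteq># p - {#y#}"
        unfolding subseteq_mset_def
      proof
        fix x
        show "count D x \<le> count (p - {#y#}) x"
          using mset_subset_eq_count[OF Dm[OF p(1)], of x] yD by (cases "x = y") (auto simp: not_in_iff)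
      qed
      then show "add_mset ?z D \<subseteq># m'" by (simp add: p(4) z)
      fix y' d assume y': "y' \<in># m' - add_mset ?z D" and d: "d \<in># add_mset ?z D"
      have "y' \<in># p - {#y#} - D" using y' by (simp add: p(4) z)
      then have y'2: "y' \<in># p - D" "y' \<in># p" by (metis diff_right_commute in_diffD, metis in_diffD)
      show "grade d - grade y' \<in> P"
      proof (cases "d = ?z")
        case True
        have "- grade y' \<in> F" using y'2 p(1) by (auto simp: F_def K_def)
        then show ?thesis using \<delta>(2)[of "- grade y'"] True by (simp add: minus_diff_commute)
      next
        case False
        then show ?thesis using mD[OF p(1) y'2(1)] d by simp
      qed
    qed (use sD iD in auto)
    then show ?case by blast
  qed
  then obtain u D where st: "state k u D" by blast
  have "m = D" if m: "m \<in> top_keys k u" for m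
  proof -
    have "D \<subseteq># m" "size D = size m" using st m by (auto simp: state_def top_keys_def)
    then show ?thesis by (metis mset_subset_size subset_mset.le_imp_less_or_eq less_irrefl)
  qed
  moreover have "top_keys k u \<noteq> {}" using st goodD(4) by (auto simp: state_def)
  ultimately have "top_keys k u = {D}" by blast
  then show thesis using that[of u D] st by (auto simp: state_def)
qed

end

section \<open>Dense orders: from arbitrary degree down to one letter, and irreducibility\<close>

context verma_weight
begin

lemma wt_G: "set_mset m \<subseteq> BI \<Longrightarrow> wt m \<in> G"
  unfolding wt_def by (rule G_sum_mset) (auto intro: grade_index)

lemma nf_Y: "y \<in> BI - borel \<Longrightarrow> nf [y] = Poly_Mapping.single {#y#} 1"
  using nf_sorted[of "[y]"] by simp

lemma neg_letter: "\<alpha> \<in> P \<Longrightarrow> i \<ge> -1 \<Longrightarrow> L (- \<alpha>) i \<in> BI - borel"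
  using Y_iff by blast

text \<open>If the weight of \<open>L \<beta> j\<close> leaves room for only one more letter, then \<open>L \<beta> j\<close> is
  absorbed by all letters of a word in turn.\<close>

fun absorb_poly :: "'f block_basis list \<Rightarrow> 'f \<Rightarrow> int \<Rightarrow> 'f poly" where
  "absorb_poly [] \<beta> e = 1"
| "absorb_poly (y # w) \<beta> e =
    [: of_int (e + 1) * grade y - of_int (idx y + 1) * \<beta>, grade y :] * absorb_poly w (\<beta> + grade y) (e + idx y)"

text \<open>The variable enters each linear factor with coefficient \<open>grade y\<close>, so the
  degree counts the letters.\<close>

lemma degree_absorb_poly:
  "(\<And>y. y \<in> set w \<Longrightarrow> grade y \<noteq> 0) \<Longrightarrow> absorb_poly w \<beta> e \<noteq> 0 \<and> degree (absorb_poly w \<beta> e) = length w"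
proof (induction w arbitrary: \<beta> e)
  case (Cons y w)
  then have "absorb_poly w (\<beta> + grade y) (e + idx y) \<noteq> 0"
    "degree (absorb_poly w (\<beta> + grade y) (e + idx y)) = length w" "grade y \<noteq> 0" by auto
  then show ?case by (simp add: degree_mult_eq del: mult_pCons_left)
qed simp

text \<open>When \<open>L \<beta> j\<close> is exchanged with \<open>y\<close>, the word starting
  with \<open>y\<close> vanishes, because the rest of it has the positive weight
  \<open>- grade y - \<epsilon>\<close>; only the bracket survives. The parameter \<open>e\<close>
  moves along with the index, so that all factors are evaluated at the same point
  \<open>j - e\<close>. Each letter lowers the index by at most one, and the bound on
  \<open>j\<close> keeps central terms away.\<close>

lemma nf_absorb:
  assumes "set w \<subseteq> BI - borel" "\<epsilon> \<in> P" "\<And>y. y \<in> set w \<Longrightarrow> - grade y - \<epsilon> \<in> P"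
    "\<beta> = - (\<Sum>y\<leftarrow>w. grade y) - \<epsilon>" "j \<ge> int (length w)"
  shows "nf (L \<beta> j # w) = poly (absorb_poly w \<beta> e) (of_int (j - e)) \<cdot>
    Poly_Mapping.single {#L (- \<epsilon>) (j + (\<Sum>y\<leftarrow>w. idx y))#} 1"
  using assms
proof (induction w arbitrary: \<beta> j e)
  case Nil
  have "nf [L (- \<epsilon>) j] = Poly_Mapping.single {#L (- \<epsilon>) j#} 1"
    using Nil by (intro nf_Y neg_letter) auto
  then show ?case using Nil(4) by simp
next
  case (Cons y w)
  have y: "y \<in> BI - borel" and w: "set w \<subseteq> BI - borel" using Cons.prems(1) by auto
  obtain \<alpha> i where yi: "y = L (- \<alpha>) i" "\<alpha> \<in> P" "i \<ge> -1" using Y_iff y by blast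
  have wG: "(\<Sum>y\<leftarrow>w. grade y) \<in> G"
  proof -
    have "wt (mset w) = (\<Sum>y\<leftarrow>w. grade y)" by (induction w) simp_all
    moreover have "set_mset (mset w) \<subseteq> BI" using w by auto
    ultimately show ?thesis using wt_G[of "mset w"] by simp
  qed
  have \<beta>G: "\<beta> \<in> G" using Cons.prems(2,4) yi wG P_G by simp
  have g: "- grade y - \<epsilon> \<in> P" using Cons.prems(3) by simp
  have jj: "j \<ge> 1" using Cons.prems(5) by simp
  have LI: "set (L \<beta> j # w) \<subseteq> BI" using \<beta>G jj w by auto
  have "(\<Sum>x\<leftarrow>L \<beta> j # w. grade x) = - grade y - \<epsilon>" using Cons.prems(4) by simp
  then have "nf (L \<beta> j # w) \<in> homog (- grade y - \<epsilon>)" using nf_homog[OF LI] by simp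
  then have "nf (L \<beta> j # w) = 0" by (rule homog_pos[OF g])
  then have 1: "nf (y # L \<beta> j # w) = 0" using act1_nf[OF LI, of y] by simp
  have br: "basis_bracket (L \<beta> j) y = Poly_Mapping.single (L (\<beta> + grade y) (j + idx y)) (shift_coeff \<beta> j y)"
    using yi jj by (simp add: shift_coeff_def)
  have "nf (L \<beta> j # y # w) = shift_coeff \<beta> j y \<cdot> nf (L (\<beta> + grade y) (j + idx y) # w)"
    using exchange[of "[]" "L \<beta> j" y w] 1 by (simp add: br)
  also have "nf (L (\<beta> + grade y) (j + idx y) # w) =
     poly (absorb_poly w (\<beta> + grade y) (e + idx y)) (of_int (j + idx y - (e + idx y))) \<cdot>
       Poly_Mapping.single {#L (- \<epsilon>) (j + idx y + (\<Sum>y\<leftarrow>w. idx y))#} 1"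
  proof (rule Cons.IH[OF w Cons.prems(2)])
    show "- grade y' - \<epsilon> \<in> P" if "y' \<in> set w" for y' using Cons.prems(3) that by simp
    show "\<beta> + grade y = - (\<Sum>y\<leftarrow>w. grade y) - \<epsilon>" unfolding Cons.prems(4) by simp
    show "int (length w) \<le> j + idx y" using Cons.prems(5) yi by simp
  qed
  also have "shift_coeff \<beta> j y \<cdot> \<dots> = poly (absorb_poly (y # w) \<beta> e) (of_int (j - e)) \<cdot>
    Poly_Mapping.single {#L (- \<epsilon>) (j + (\<Sum>y\<leftarrow>y # w. idx y))#} 1"
  proof -
    have "j + idx y - (e + idx y) = j - e" "j + idx y + (\<Sum>y\<leftarrow>w. idx y) = j + (\<Sum>y\<leftarrow>y # w. idx y)" by simp_all
    moreover have "shift_coeff \<beta> j y = poly [: of_int (e + 1) * grade y - of_int (idx y + 1) * \<beta>, grade y :] (of_int (j - e))"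
      by (simp add: shift_coeff_def algebra_simps)
    ultimately show ?thesis by (simp only: absorb_poly.simps poly_mult pm.scale_scale)
  qed
  finally show ?case .
qed

text \<open>The grade \<beta> is chosen such that the result has weight -\<epsilon> with \<epsilon>
  below all letters, so every monomial collapses to a single letter. The coefficient at the letter
  coming from \<open>D\<close> is a polynomial in \<open>j\<close>. Its coefficient in degree k is
  due to \<open>D\<close> alone, the only monomial with k letters, so the polynomial is nonzero and
  some large \<open>j\<close> avoids its roots.\<close>

lemma dense_lowering:
  assumes dense: "\<And>x. x \<in> P \<Longrightarrow> pos_below G gt x \<noteq> {}" and N: "stable BI N" and u: "good N k u"
    and D: "top_keys k u = {D}" and k: "k \<ge> 1"
  obtains v where "good N 1 v"
proof -
  have uc: "u \<in> carr" and uN: "u \<in> N" and ul: "u \<in> lower (Suc k)" using goodD[OF u] by auto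
  have Dk: "D \<in> Poly_Mapping.keys u" "size D = k" using D by (auto simp: top_keys_def)
  obtain \<gamma> where \<gamma>: "u \<in> homog \<gamma>" using u by (auto simp: good_def)
  then have wtm: "wt m = \<gamma>" if "m \<in> Poly_Mapping.keys u" for m using that by (simp add: homog_def)
  define F where "F = (\<lambda>y. - grade y) ` (\<Union>m\<in>Poly_Mapping.keys u. set_mset m)"
  obtain d where d: "d \<in># D" using Dk k by (metis One_nat_def multiset_nonemptyE not_one_le_zero size_empty)
  have "- grade d \<in> F" unfolding F_def using d Dk(1) by blast
  then have F: "F \<noteq> {}" by blast
  have "finite F" "F \<subseteq> P" using carr_letter(2)[OF uc] by (auto simp: F_def)
  then obtain \<epsilon> where \<epsilon>: "\<epsilon> \<in> P" "\<And>x. x \<in> F \<Longrightarrow> x - \<epsilon> \<in> P" using dense_below_finite[OF dense] F by metis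
  have \<gamma>P: "- \<gamma> - \<epsilon> \<in> P"
  proof -
    have e: "- \<gamma> = - grade d + - wt (D - {#d#})"
      using wtm[OF Dk(1)] arg_cong[OF insert_DiffM[OF d], of wt] by (simp add: algebra_simps)
    have d\<epsilon>: "- grade d - \<epsilon> \<in> P" using \<epsilon>(2) d Dk(1) by (force simp: F_def)
    have "- wt (D - {#d#}) \<in> P \<or> D - {#d#} = {#}"
    proof (cases "D - {#d#} = {#}")
      case False
      have "Poly_Mapping.single (D - {#d#}) 1 \<in> carr"
        using carr_subset[OF uc Dk(1)] by (intro single_carr) (auto dest: in_diffD)
      then show ?thesis using wt_P[OF _ _ False] by (auto simp del: single_carr)
    qed simp
    then show ?thesis
    proof
      assume "- wt (D - {#d#}) \<in> P"
      from P_add[OF d\<epsilon> this] show ?thesis unfolding e by (simp add: algebra_simps)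
    qed (use d\<epsilon> e in simp)
  qed
  define \<beta> where "\<beta> = - \<gamma> - \<epsilon>"
  have \<beta>: "\<beta> \<in> P" "\<beta> \<in> G" using \<gamma>P P_G by (auto simp: \<beta>_def)
  define I where "I m = (\<Sum>y\<leftarrow>word m. idx y)" for m
  define R where "R m = absorb_poly (word m) \<beta> 0" for m
  have R: "nf (L \<beta> j # word m) = poly (R m) (of_int j) \<cdot> Poly_Mapping.single {#L (- \<epsilon>) (j + I m)#} 1"
    if m: "m \<in> Poly_Mapping.keys u" and j: "j \<ge> int k" for m j
  proof -
    have "nf (L \<beta> j # word m) = poly (absorb_poly (word m) \<beta> 0) (of_int (j - 0)) \<cdot> Poly_Mapping.single {#L (- \<epsilon>) (j + (\<Sum>y\<leftarrow>word m. idx y))#} 1"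
    proof (rule nf_absorb[OF _ \<epsilon>(1)])
      show "set (word m) \<subseteq> BI - borel" using carr_subset[OF uc m] by simp
      show "- grade y - \<epsilon> \<in> P" if "y \<in> set (word m)" for y using \<epsilon>(2) that m by (force simp: F_def)
      show "\<beta> = - (\<Sum>y\<leftarrow>word m. grade y) - \<epsilon>" using wtm[OF m] by (simp add: \<beta>_def wt_word)
      show "j \<ge> int (length (word m))" using ul m j by (fastforce simp: lower_iff)
    qed
    then show ?thesis by (simp add: R_def I_def)
  qed
  have degR: "R m \<noteq> 0 \<and> degree (R m) = size m" if m: "m \<in> Poly_Mapping.keys u" for m
    unfolding R_def length_word[symmetric]
    by (rule degree_absorb_poly) (use carr_letter(2)[OF uc m] in force)
  \<comment> \<open>The monomials that collapse to the same letter as \<open>D\<close>.\<close>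
  define M where "M = {m \<in> Poly_Mapping.keys u. I m = I D}"
  have finM: "finite M" and DM: "D \<in> M" using Dk by (auto simp: M_def)
  define q where "q = (\<Sum>m\<in>M. smult (Poly_Mapping.lookup u m) (R m))"
  have "coeff q k \<noteq> 0"
  proof -
    have "coeff (R m) k = 0" if "m \<in> M - {D}" for m
    proof -
      have m: "m \<in> Poly_Mapping.keys u" "m \<noteq> D" using that by (auto simp: M_def)
      then have "size m \<noteq> k" using D by (auto simp: top_keys_def)
      moreover have "size m < Suc k" using ul m by (auto simp: lower_iff)
      ultimately show ?thesis using degR[OF m(1)] by (intro coeff_eq_0) simp
    qed
    then have "coeff q k = Poly_Mapping.lookup u D * coeff (R D) k"
      unfolding q_def coeff_sum by (subst sum.remove[OF finM DM]) simp
    moreover have "coeff (R D) k \<noteq> 0" using degR[OF Dk(1)] Dk(2) leading_coeff_neq_0[of "R D"] by simp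
    ultimately show ?thesis using Dk(1) by (auto simp: in_keys_iff)
  qed
  then have "q \<noteq> 0" by auto
  then have "finite {x. poly q x = 0}" by (rule poly_roots_finite)
  moreover have "infinite ((of_nat :: nat \<Rightarrow> 'f) ` {k..})"
    using finite_imageD[of "of_nat :: nat \<Rightarrow> 'f" "{k..}"] infinite_Ici by (auto simp: inj_on_def)
  ultimately obtain j :: nat where j: "j \<ge> k" "poly q (of_nat j) \<noteq> 0"
    by (metis (mono_tags, lifting) finite_subset image_subsetI atLeast_iff mem_Collect_eq)
  have jk: "int j \<ge> int k" "int j \<ge> -1" using j(1) by simp_all
  define v where "v = act1 (L \<beta> (int j)) u"
  have xBI: "L \<beta> (int j) \<in> BI" using \<beta> by simp
  have v: "v = lin (\<lambda>m. poly (R m) (of_int (int j)) \<cdot> Poly_Mapping.single {#L (- \<epsilon>) (int j + I m)#} 1) u"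
    unfolding v_def act1_def by (rule lin_cong) (rule R[OF _ jk(1)])
  have "Poly_Mapping.lookup v {#L (- \<epsilon>) (int j + I D)#} =
     (\<Sum>m\<in>Poly_Mapping.keys u. if I m = I D then Poly_Mapping.lookup u m * poly (R m) (of_nat j) else 0)"
    unfolding v lookup_lin by (rule sum.cong) (auto simp: lookup_single when_def)
  also have "\<dots> = poly q (of_nat j)"
    unfolding q_def poly_sum M_def by (subst sum.inter_filter[symmetric]) simp_all
  finally have lv: "{#L (- \<epsilon>) (int j + I D)#} \<in> Poly_Mapping.keys v" using j(2) by (simp add: in_keys_iff)
  have "size m' = 1" if km: "m' \<in> Poly_Mapping.keys v" for m'
  proof -
    obtain m where "m' \<in> Poly_Mapping.keys (poly (R m) (of_int (int j)) \<cdot> Poly_Mapping.single {#L (- \<epsilon>) (int j + I m)#} 1)"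
      using subsetD[OF keys_lin km[unfolded v]] by (elim UN_E)
    then have "m' = {#L (- \<epsilon>) (int j + I m)#}" by (auto split: if_splits)
    then show ?thesis by simp
  qed
  moreover have "v \<in> N" unfolding v_def by (rule stableD(3)[OF N xBI uN])
  moreover have "v \<in> homog (\<beta> + \<gamma>)" using act1_homog[OF xBI \<gamma>] by (simp add: v_def)
  ultimately have "good N 1 v" using lv by (fastforce simp: good_def lower_iff top_keys_def homog_def)
  then show thesis by (rule that)
qed

lemma good_0_vac:
  assumes N: "stable BI N" and u: "good N 0 u"
  shows "vac \<in> N"
proof -
  have "m = {#}" if "m \<in> Poly_Mapping.keys u" for m using goodD(2)[OF u] that by (auto simp: lower_iff)
  then have "u = Poly_Mapping.lookup u {#} \<cdot> vac"
    by (intro poly_mapping_eqI) (auto simp: lookup_single when_def in_keys_iff)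
  moreover have "Poly_Mapping.lookup u {#} \<noteq> 0" using goodD(4)[OF u] by (auto simp: top_keys_def in_keys_iff)
  ultimately have "vac = inverse (Poly_Mapping.lookup u {#}) \<cdot> u"
    by (metis left_inverse pm.scale_one pm.scale_scale)
  then show ?thesis using pm.subspace_scale[OF stableD(1)[OF N] goodD(1)[OF u]] by metis
qed

text \<open>Reduce, lower to degree one, and reduce again. In degree one a homogeneous element of
  nonzero weight has no constant term, so it is a multiple of one letter.\<close>

lemma dense_singular:
  assumes dense: "\<And>x. x \<in> P \<Longrightarrow> pos_below G gt x \<noteq> {}" and N: "stable BI N" "N \<noteq> {0}" and v: "vac \<notin> N"
  obtains \<delta> where "\<delta> \<in> P" "Poly_Mapping.single {#L (- \<delta>) (-1)#} 1 \<in> N"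
proof -
  obtain k u0 where u0: "good N k u0" using good_exists[OF N] by blast
  then have "k \<noteq> 0" using good_0_vac[OF N(1)] v by metis
  then have k1: "k \<ge> 1" by simp
  obtain u D where u: "good N k u" "top_keys k u = {D}" using dense_reduction[OF dense N(1) u0] by metis
  obtain u1 where "good N 1 u1" using dense_lowering[OF dense N(1) u k1] by blast
  then obtain w E where w: "good N 1 w" "top_keys 1 w = {E}" "\<And>y. y \<in># E \<Longrightarrow> idx y = -1"
    using dense_reduction[OF dense N(1)] by metis
  have wc: "w \<in> carr" and wN: "w \<in> N" using goodD[OF w(1)] by auto
  have E: "E \<in> Poly_Mapping.keys w" "size E = 1" using w(2) by (auto simp: top_keys_def)
  obtain y where y: "E = {#y#}" using E(2) size_1_singleton_mset by metis
  have ly: "y = L (grade y) (idx y)" "- grade y \<in> P" using carr_letter(1,2)[OF wc E(1)] y by simp_all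
  have iy: "idx y = -1" using w(3) y by simp
  define \<delta> where "\<delta> = - grade y"
  have yd: "y = L (- \<delta>) (-1)" using ly(1) unfolding iy \<delta>_def minus_minus .
  have "m = E" if m: "m \<in> Poly_Mapping.keys w" for m
  proof (rule ccontr)
    assume ne: "m \<noteq> E"
    then have "size m \<noteq> 1" using m w(2) by (auto simp: top_keys_def)
    moreover have "size m < Suc 1" using goodD(2)[OF w(1)] m unfolding lower_iff by blast
    ultimately have "size m = 0" by linarith
    then have "wt m = 0" by simp
    moreover obtain \<gamma> where "w \<in> homog \<gamma>" using w(1) by (auto simp: good_def)
    ultimately have "wt E = 0" using m E(1) by (auto simp: homog_def)
    then show False using ly(2) y by simp
  qed
  then have we: "w = Poly_Mapping.lookup w E \<cdot> Poly_Mapping.single E 1"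
    by (intro poly_mapping_eqI) (auto simp: lookup_single when_def in_keys_iff)
  have "inverse (Poly_Mapping.lookup w E) \<cdot> w = (inverse (Poly_Mapping.lookup w E) * Poly_Mapping.lookup w E) \<cdot> Poly_Mapping.single E 1"
    by (subst (2) we) (rule pm.scale_scale)
  also have "\<dots> = Poly_Mapping.single E 1" using E(1) by (simp add: in_keys_iff)
  finally have "Poly_Mapping.single E 1 \<in> N" using pm.subspace_scale[OF stableD(1)[OF N(1)] wN] by metis
  then show thesis using that[of \<delta>] ly(2) by (simp add: y yd[symmetric] \<delta>_def[symmetric])
qed

lemma nf_borel_Y:
  assumes "x \<in> borel" "y \<in> BI - borel"
  shows "act1 x (Poly_Mapping.single {#y#} 1) = eigenvalue \<Lambda> x \<cdot> Poly_Mapping.single {#y#} 1 + lin (\<lambda>z. nf [z]) (basis_bracket x y)"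
proof -
  have n: "nf [y] = Poly_Mapping.single {#y#} 1" using nf_sorted[of "[y]"] assms(2) by simp
  have "act1 x (Poly_Mapping.single {#y#} 1) = nf [x, y]" using act1_nf[of "[y]" x] assms(2) n by simp
  also have "\<dots> = nf [y, x] + lin (\<lambda>z. nf [z]) (basis_bracket x y)" using exchange[of "[]" x y "[]"] by simp
  also have "nf [y, x] = eigenvalue \<Lambda> x \<cdot> nf [y]" using nf_snoc_T[OF assms(1), of "[y]"] by simp
  finally show ?thesis by (simp add: n)
qed

text \<open>Up to the nonzero factors \<delta> and \<open>- (j + 1) \<delta>\<close>, these are the
  values of \<Lambda> on all basis vectors of grade zero. So the vector
  \<open>L (-\<delta>) (-1)\<close> v can lie in a proper submodule only if \<Lambda> = 0.\<close>

lemma act1_raise: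
  assumes "\<delta> \<in> P" "j \<ge> -1"
  shows "act1 (L \<delta> j) (Poly_Mapping.single {#L (- \<delta>) (-1)#} 1) =
    (if j = -1 then \<delta> * \<Lambda> (Poly_Mapping.single C 1) else - of_int (j + 1) * \<delta> * \<Lambda> (basis_L 0 (j - 1))) \<cdot> vac"
proof -
  have b: "L \<delta> j \<in> borel" "eigenvalue \<Lambda> (L \<delta> j) = 0" "C \<in> borel" and d0: "\<delta> \<noteq> 0"
    using assms P_G by (auto simp: borel_def)
  have C: "nf [C] = \<Lambda> (Poly_Mapping.single C 1) \<cdot> vac" using nf_T[OF b(3)] by simp
  have "nf [L 0 (j - 1)] = \<Lambda> (basis_L 0 (j - 1)) \<cdot> vac" if "j \<ge> 0"
    using nf_T[of "L 0 (j - 1)"] that by (simp add: borel_def)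
  then show ?thesis
    unfolding nf_borel_Y[OF b(1) neg_letter[OF assms(1) order_refl]] using assms(2) b(2)
    by (cases "j = -1") (simp_all add: lin_add C single_uminus[symmetric] algebra_simps)
qed

lemma dense_irreducible:
  assumes dense: "\<And>x. x \<in> P \<Longrightarrow> pos_below G gt x \<noteq> {}" and \<Lambda>: "h \<in> block_grade 0" "\<Lambda> h \<noteq> 0"
  shows "irreducible_module G VM"
  unfolding irreducible_verma_iff
proof (intro allI impI)
  fix N assume N: "stable BI N"
  have "N = carr" if nz: "N \<noteq> {0}"
  proof (rule ccontr)
    assume "N \<noteq> carr"
    then have v: "vac \<notin> N" using carr_if_vac[OF N] by blast
    obtain \<delta> where \<delta>: "\<delta> \<in> P" "Poly_Mapping.single {#L (- \<delta>) (-1)#} 1 \<in> N"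
      using dense_singular[OF dense N nz v] by metis
    have zero: "c = 0" if "c \<cdot> vac \<in> N" for c
    proof (rule ccontr)
      assume "c \<noteq> 0"
      then have "vac = inverse c \<cdot> c \<cdot> vac" by (simp add: pm.scale_scale del: map_single)
      then show False using pm.subspace_scale[OF stableD(1)[OF N] that] v by metis
    qed
    have z: "(if j = -1 then \<delta> * \<Lambda> (Poly_Mapping.single C 1) else - of_int (j + 1) * \<delta> * \<Lambda> (basis_L 0 (j - 1))) = 0"
      if j: "j \<ge> -1" for j
    proof (rule zero)
      have "L \<delta> j \<in> BI" using \<delta>(1) j P_G by simp
      then show "(if j = -1 then \<delta> * \<Lambda> (Poly_Mapping.single C 1) else - of_int (j + 1) * \<delta> * \<Lambda> (basis_L 0 (j - 1))) \<cdot> vac \<in> N"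
        using act1_raise[OF \<delta>(1) j] stableD(3)[OF N _ \<delta>(2)] by metis
    qed
    have d0: "\<delta> \<noteq> 0" using \<delta>(1) by auto
    have "\<Lambda> (Poly_Mapping.single C 1) = 0" using z[of "-1"] d0 by simp
    moreover have "\<Lambda> (basis_L 0 i) = 0" if "i \<ge> -1" for i
    proof -
      have "of_int (i + 1 + 1) \<noteq> (0 :: 'f)" using that by (simp del: of_int_add)
      then show ?thesis using z[of "i + 1"] that d0 by auto
    qed
    ultimately have "eigenvalue \<Lambda> b = 0" if "b \<in> Poly_Mapping.keys h" for b
      using \<Lambda>(1) that by (auto simp: block_grade_0)
    then have "\<Lambda> h = 0" using weight_expand[OF weights \<Lambda>(1)] by simp
    then show False using \<Lambda>(2) by simp
  qed
  then show "N = {0} \<or> N = carr" by blast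
qed

section \<open>The submodule M'(0) and the archimedean property\<close>

subsection \<open>Weight zero\<close>

text \<open>The model of M'(0), by \<open>verma_prime_image\<close>. It is a submodule once the
  Borel part acts by zero on the generator.\<close>

definition aug :: "('f block_basis multiset \<Rightarrow>\<^sub>0 'f) set" where
  "aug = {p \<in> carr. Poly_Mapping.lookup p {#} = 0}"

text \<open>With all scalars zero, a letter that reaches the generator gives zero, so a nonempty
  word never produces a constant term.\<close>

lemma nf_aug:
  assumes triv: "\<And>x. x \<in> borel \<Longrightarrow> eigenvalue \<Lambda> x = 0" and "set w \<subseteq> BI" "w \<noteq> []"
  shows "nf w \<in> aug"
proof -
  have "w \<noteq> [] \<longrightarrow> Poly_Mapping.lookup (nf w) {#} = 0"
    using assms(2)
  proof (induction w rule: word_induct)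
    case (sorted w)
    then show ?case by (simp add: nf_sorted lookup_single when_def)
  next
    case (descent u x y v)
    then show ?case by (simp add: exchange[of u x y v] lookup_add lookup_lin)
  qed (simp add: triv)
  then show ?thesis using assms nf_carr by (simp add: aug_def)
qed

lemma subspace_aug: "pm.subspace aug"
  unfolding aug_def using subspace_carr by (auto simp: pm.subspace_def lookup_add)

lemma stable_aug:
  assumes triv: "\<And>x. x \<in> borel \<Longrightarrow> eigenvalue \<Lambda> x = 0"
  shows "stable BI aug"
  unfolding stable_def
proof (intro conjI ballI subspace_aug)
  show "aug \<subseteq> carr" by (auto simp: aug_def)
  fix x p assume x: "x \<in> BI" and p: "p \<in> aug"
  show "act1 x p \<in> aug"
    unfolding act1_def
  proof (rule lin_closed[OF subspace_aug])
    fix m assume "m \<in> Poly_Mapping.keys p"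
    then have "set_mset m \<subseteq> BI - borel" using p carr_subset by (auto simp: aug_def)
    then show "nf (x # word m) \<in> aug" using x by (intro nf_aug triv) auto
  qed
qed

lemma vac_not_aug: "vac \<notin> aug"
  by (simp add: aug_def)

lemma letter_aug: "y \<in> BI - borel \<Longrightarrow> Poly_Mapping.single {#y#} 1 \<in> aug"
  by (simp add: aug_def lookup_single when_def)

lemma single_letter_nonzero: "Poly_Mapping.single m (1 :: 'f) \<noteq> 0"
  by (metis lookup_single_eq lookup_zero zero_neq_one)

lemma aug_subset_if_letters:
  assumes N: "stable BI N" and y: "\<And>y. y \<in> BI - borel \<Longrightarrow> Poly_Mapping.single {#y#} 1 \<in> N"
  shows "aug \<subseteq> N"
proof
  fix p assume p: "p \<in> aug"
  have "lin (\<lambda>m. nf (word m)) p \<in> N"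
  proof (rule lin_closed[OF stableD(1)[OF N]])
    fix m assume m: "m \<in> Poly_Mapping.keys p"
    have mY: "set_mset m \<subseteq> BI - borel" using p carr_subset m by (auto simp: aug_def)
    have "m \<noteq> {#}" using p m by (auto simp: aug_def in_keys_iff)
    then have "length (word m) \<noteq> 0" by simp
    then obtain w y where w: "word m = w @ [y]" by (metis list.size(3) rev_exhaust)
    then have wy: "set w \<subseteq> BI - borel" "y \<in> BI - borel" using mY set_word[of m] by auto
    then have "set w \<subseteq> BI" "set [y] \<subseteq> BI" by auto
    then have "nf (word m) = act_word w (nf [y])" using act_word_nf[of w "[y]"] w by simp
    then show "nf (word m) \<in> N" using act_word_stable[OF N, of w] wy y[OF wy(2)] nf_Y[OF wy(2)] by auto
  qed
  moreover have "lin (\<lambda>m. nf (word m)) p = lin (\<lambda>m. Poly_Mapping.single m 1) p"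
    by (rule lin_cong, rule nf_word) (use p carr_subset in \<open>auto simp: aug_def\<close>)
  ultimately show "p \<in> N" by simp
qed

text \<open>Consider the positive x for which all \<open>L (-x) i\<close> v lie in \<open>N\<close>.
  Some \<delta> is among them; they are closed downwards, by raising with grade y - x, and under
  sums, by bracketing two negative letters. In the archimedean case this gives every x, and the
  single letters generate \<open>aug\<close>.\<close>

lemma archimedean_aug:
  assumes dense: "\<And>x. x \<in> P \<Longrightarrow> pos_below G gt x \<noteq> {}"
    and triv: "\<And>x. x \<in> borel \<Longrightarrow> eigenvalue \<Lambda> x = 0"
    and arch: "\<And>x y. x \<in> P \<Longrightarrow> y \<in> P \<Longrightarrow> \<exists>n::nat. n > 0 \<and> gt (of_nat n * x) y"
    and N: "stable BI N" "N \<subseteq> aug" "N \<noteq> {0}"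
  shows "N = aug"
proof -
  have "vac \<notin> N" using vac_not_aug N by blast
  then obtain \<delta> where \<delta>: "\<delta> \<in> P" "Poly_Mapping.single {#L (- \<delta>) (-1)#} 1 \<in> N"
    using dense_singular[OF dense N(1,3)] by metis
  define R where "R x \<longleftrightarrow> (\<forall>i\<ge>-1. Poly_Mapping.single {#L (- x) i#} 1 \<in> N)" for x
  note sub = stableD(1)[OF N(1)]
  have scale: "p \<in> N" if "c \<cdot> p \<in> N" "c \<noteq> 0" for c p
    using pm.subspace_scale[OF sub that(1), of "inverse c"] that(2) by (simp add: pm.scale_scale)
  have down: "R x" if x: "x \<in> P" and y: "y \<in> P" "Poly_Mapping.single {#L (- y) (-1)#} 1 \<in> N" and xy: "y - x \<in> P \<or> y = x" for x y
    unfolding R_def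
  proof (intro allI impI)
    fix i :: int assume i: "i \<ge> -1"
    have "y - x \<in> G" using x y P_G by simp
    then have b: "L (y - x) (i + 1) \<in> borel" "L (y - x) (i + 1) \<in> BI" using xy i unfolding borel_def by auto
    have "x \<noteq> 0" using x by auto
    \<comment> \<open>With index -1 in the second argument the coefficient is
      \<open>- (i + 2) y\<close>, nonzero for all i \<ge> -1; thus one letter of index -1 yields all
      indices.\<close>
    then have br: "basis_bracket (L (y - x) (i + 1)) (L (- y) (-1)) = Poly_Mapping.single (L (- x) i) (of_int (i + 2) * - y)"
      using i by (simp add: algebra_simps)
    have "act1 (L (y - x) (i + 1)) (Poly_Mapping.single {#L (- y) (-1)#} 1) = (of_int (i + 2) * - y) \<cdot> nf [L (- x) i]"
      unfolding nf_borel_Y[OF b(1) neg_letter[OF y(1) order_refl]] br triv[OF b(1)] by simp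
    then have s: "(of_int (i + 2) * - y) \<cdot> Poly_Mapping.single {#L (- x) i#} 1 \<in> N"
      using stableD(3)[OF N(1) b(2) y(2)] by (simp only: nf_Y[OF neg_letter[OF x i]])
    have "y \<noteq> 0" "of_int (i + 2) \<noteq> (0 :: 'f)" using y i by (auto simp del: of_int_add)
    then show "Poly_Mapping.single {#L (- x) i#} 1 \<in> N"
      by (intro scale[OF s]) (simp del: of_int_add)
  qed
  have add: "R (x + y)" if x: "x \<in> P" "R x" and y: "y \<in> P" "R y" for x y
    unfolding R_def
  proof (intro allI impI)
    fix k :: int assume k: "k \<ge> -1"
    have xy: "x + y \<in> P" by (rule P_add[OF x(1) y(1)])
    then have ne: "- x \<noteq> y" by auto
    have br: "basis_bracket (L (- x) (k + 1)) (L (- y) (-1)) = Poly_Mapping.single (L (- (x + y)) k) (of_int (k + 2) * - y)"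
      using ne k by (simp add: algebra_simps)
    have X: "L (- x) (k + 1) \<in> BI - borel" and Y: "L (- y) (-1) \<in> BI - borel" using neg_letter x y k by auto
    have sY: "Poly_Mapping.single {#L (- y) (-1)#} 1 \<in> N" using y(2) unfolding R_def by simp
    have sX: "Poly_Mapping.single {#L (- x) (k + 1)#} 1 \<in> N" using x(2) k unfolding R_def by simp
    have aXY: "act1 (L (- x) (k + 1)) (Poly_Mapping.single {#L (- y) (-1)#} 1) = nf [L (- x) (k + 1), L (- y) (-1)]"
      using act1_nf[of "[L (- y) (-1)]" "L (- x) (k + 1)"] Y by (simp add: nf_Y[OF Y])
    have aYX: "act1 (L (- y) (-1)) (Poly_Mapping.single {#L (- x) (k + 1)#} 1) = nf [L (- y) (-1), L (- x) (k + 1)]"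
      using act1_nf[of "[L (- x) (k + 1)]" "L (- y) (-1)"] X by (simp add: nf_Y[OF X])
    have "nf [L (- x) (k + 1), L (- y) (-1)] - nf [L (- y) (-1), L (- x) (k + 1)] \<in> N"
      unfolding aXY[symmetric] aYX[symmetric]
      by (intro pm.subspace_diff[OF sub] stableD(3)[OF N(1) DiffD1[OF X] sY] stableD(3)[OF N(1) DiffD1[OF Y] sX])
    moreover have "nf [L (- x) (k + 1), L (- y) (-1)] - nf [L (- y) (-1), L (- x) (k + 1)] = (of_int (k + 2) * - y) \<cdot> nf [L (- (x + y)) k]"
      using exchange[of "[]" "L (- x) (k + 1)" "L (- y) (-1)" "[]"] unfolding br by simp
    ultimately have s: "(of_int (k + 2) * - y) \<cdot> Poly_Mapping.single {#L (- (x + y)) k#} 1 \<in> N"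
      by (simp only: nf_Y[OF neg_letter[OF xy k]])
    have "y \<noteq> 0" "of_int (k + 2) \<noteq> (0 :: 'f)" using y k by (auto simp del: of_int_add)
    then show "Poly_Mapping.single {#L (- (x + y)) k#} 1 \<in> N"
      by (intro scale[OF s]) (simp del: of_int_add)
  qed
  have R\<delta>: "R \<delta>" using down[OF \<delta>(1) \<delta>] by simp
  have Rn: "R (of_nat (Suc n) * \<delta>)" for n
  proof (induction n)
    case (Suc n)
    have "of_nat (Suc (Suc n)) * \<delta> = of_nat (Suc n) * \<delta> + \<delta>" by (simp add: algebra_simps)
    then show ?case using add[OF P_scale[OF \<delta>(1) zero_less_Suc] Suc \<delta>(1) R\<delta>] by (simp only:)
  qed (use R\<delta> in simp)
  have Rall: "R x" if x: "x \<in> P" for x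
  proof -
    obtain n where n: "n > 0" "gt (of_nat n * \<delta>) x" using arch[OF \<delta>(1) x] by blast
    have nP: "of_nat n * \<delta> \<in> P" using P_scale[OF \<delta>(1) n(1)] .
    then have "of_nat n * \<delta> - x \<in> P" using gt_iff_P[of "of_nat n * \<delta>" x] n(2) x P_G by blast
    moreover have "R (of_nat n * \<delta>)" using Rn[of "n - 1"] n(1) by simp
    ultimately show ?thesis using down[OF x nP] by (simp add: R_def)
  qed
  have "aug \<subseteq> N"
  proof (rule aug_subset_if_letters[OF N(1)])
    fix y assume "y \<in> BI - borel"
    then obtain \<alpha> i where "y = L (- \<alpha>) i" "\<alpha> \<in> P" "i \<ge> -1" using Y_iff by blast
    then show "Poly_Mapping.single {#y#} 1 \<in> N" using Rall[of \<alpha>] by (simp add: R_def)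
  qed
  then show ?thesis using N(2) by blast
qed

text \<open>In the non-archimedean case, inducing from the larger subalgebra that also contains the
  \<open>L (- x) i\<close> with \<open>x\<close> infinitely smaller than \<open>y\<close> gives a proper quotient.\<close>

lemma nonarchimedean_aug:
  assumes triv: "\<And>x. x \<in> borel \<Longrightarrow> eigenvalue \<Lambda> x = 0"
    and xy: "x \<in> P" "y \<in> P" and nonarch: "\<And>n::nat. n > 0 \<Longrightarrow> \<not> gt (of_nat n * x) y"
  obtains N where "stable BI N" "N \<subseteq> aug" "N \<noteq> {0}" "N \<noteq> aug"
proof -
  have nG: "of_nat n * z \<in> G" if "z \<in> G" for n and z
    using that by (induction n) (auto simp: algebra_simps)
  have yG: "y \<in> G" "x \<in> G" using xy P_G by auto
  \<comment> \<open>The elements that are not negative on the scale of y: it contains all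
    non-negative elements and -x, but not -y.\<close>
  define H where "H = {\<alpha> \<in> G. \<forall>n::nat. y + of_nat n * \<alpha> \<in> P}"
  define TH where "TH = {z \<in> BI. grade z \<in> H}"
  have ge: "of_nat n * z \<in> P \<or> of_nat n * z = 0" if "z \<in> P \<or> z = 0" for n and z
    using that P_scale[of z n] by (cases "n = 0") auto
  have addge: "z + z' \<in> P" if "z \<in> P" "z' \<in> P \<or> z' = 0" for z z'
    using that P_add by auto
  have H_le: "\<alpha> + \<alpha>' \<in> H" if "\<alpha> \<in> H" "\<alpha>' - \<alpha> \<in> P \<or> \<alpha>' - \<alpha> = 0" "\<alpha>' \<in> G" for \<alpha> \<alpha>'
    unfolding H_def
  proof (safe)
    show "\<alpha> + \<alpha>' \<in> G" using that by (auto simp: H_def)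
    fix n :: nat
    \<comment> \<open>n copies of the sum are at least 2 n copies of the smaller summand
      \<alpha>.\<close>
    have "y + of_nat (2 * n) * \<alpha> \<in> P" using that(1) unfolding H_def by blast
    moreover have "y + of_nat n * (\<alpha> + \<alpha>') = (y + of_nat (2 * n) * \<alpha>) + of_nat n * (\<alpha>' - \<alpha>)"
      by (simp add: algebra_simps)
    ultimately show "y + of_nat n * (\<alpha> + \<alpha>') \<in> P" using addge[OF _ ge[OF that(2)]] by (simp only:)
  qed
  have H_add: "\<alpha> + \<alpha>' \<in> H" if "\<alpha> \<in> H" "\<alpha>' \<in> H" for \<alpha> \<alpha>'
  proof -
    have G: "\<alpha> \<in> G" "\<alpha>' \<in> G" using that by (auto simp: H_def)
    consider "\<alpha>' - \<alpha> \<in> P \<or> \<alpha>' - \<alpha> = 0" | "\<alpha> - \<alpha>' \<in> P" using P_total[of "\<alpha>' - \<alpha>"] G by auto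
    then show ?thesis using H_le[OF that(1) _ G(2)] H_le[OF that(2) _ G(1)] by cases (auto simp: add.commute)
  qed
  have PH: "\<alpha> \<in> H" if "\<alpha> \<in> P \<or> \<alpha> = 0" for \<alpha>
  proof -
    have "y + of_nat n * \<alpha> \<in> P" for n by (rule addge[OF xy(2) ge[OF that]])
    then show ?thesis using that P_G by (auto simp: H_def)
  qed
  have xH: "- x \<in> H"
  proof -
    have "y - of_nat n * x \<in> P" for n :: nat
    proof (cases "n = 0")
      case False
      have "\<not> gt (of_nat n * x) y" using nonarch False by simp
      then have 1: "of_nat n * x - y \<notin> P" using gt_iff_P nG yG by blast
      have "of_nat n * x - y \<noteq> 0"
      proof
        assume "of_nat n * x - y = 0"
        then have "of_nat (Suc n) * x - y = x" by (simp add: algebra_simps)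
        then have "gt (of_nat (Suc n) * x) y" using gt_iff_P[of "of_nat (Suc n) * x" y] nG[OF yG(2), of "Suc n"] yG xy(1) by simp
        then show False using nonarch by blast
      qed
      then show ?thesis using 1 P_total[of "of_nat n * x - y"] nG yG by auto
    qed (use xy in simp)
    then show ?thesis using yG by (simp add: H_def)
  qed
  have yH: "- y \<notin> H" proof
    assume "- y \<in> H"
    then have "y + of_nat 1 * - y \<in> P" unfolding H_def by blast
    then show False by simp
  qed
  interpret H: block_pbw G TH "\<lambda>_. 0"
  proof (rule block_pbw.intro[OF G])
    show "Poly_Mapping.keys (basis_bracket z z') \<subseteq> TH" if "z \<in> TH" "z' \<in> TH" for z z'
    proof
      fix t assume t: "t \<in> Poly_Mapping.keys (basis_bracket z z')"
      have "grade t \<in> H" using grade_bracket[OF t] H_add that by (simp add: TH_def)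
      moreover have "t \<in> BI" using basis_bracket_index[OF G, of z z'] t that by (auto simp: TH_def)
      ultimately show "t \<in> TH" by (simp add: TH_def)
    qed
  qed (auto simp: TH_def)
  have bTH: "borel \<subseteq> TH" using PH by (auto simp: borel_def TH_def)
  \<comment> \<open>The module induced from the trivial representation of the larger subalgebra
    contains a highest weight vector of weight zero, so the universal property maps the Verma model
    to it. The kernel supplies the submodule.\<close>
  interpret U: block_pbw_target G borel "eigenvalue \<Lambda>" H.model "Poly_Mapping.single {#} 1"
  proof (intro block_pbw_target.intro block_pbw_axioms H.block_module_model block_pbw_target_axioms.intro)
    show "Poly_Mapping.single {#} 1 \<in> carrier H.model" by simp
    fix t assume t: "t \<in> borel"
    then have "H.act1 t (Poly_Mapping.single {#} 1) = 0 \<cdot> Poly_Mapping.single {#} 1" using H.act1_vac_T bTH by blast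
    then show "act H.model (Poly_Mapping.single t 1) (Poly_Mapping.single {#} 1) = eigenvalue \<Lambda> t \<odot>\<^bsub>H.model\<^esub> Poly_Mapping.single {#} 1"
      using triv[OF t] by simp
  qed
  interpret UH: block_homomorphism G model H.model U.univ_map
    by (intro block_homomorphism.intro block_module_model H.block_module_model block_homomorphism_axioms.intro U.univ_map_hom)
  define K where "K = {p \<in> carr. U.univ_map p = 0}"
  have K: "stable BI K"
    using UH.kernel_submodule unfolding block_submodule_model[OF order_refl] K_def by simp
  have img: "U.univ_map (Poly_Mapping.single {#z#} 1) = H.nf [z]" if z: "z \<in> BI - borel" for z
  proof -
    have "U.univ_map (nf [z]) = U.word_vec [z]" by (rule U.univ_map_nf) (use z in simp)
    also have "\<dots> = U.V.act_basis z (Poly_Mapping.single {#} 1)" by (simp add: U.word_vec_def)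
    also have "\<dots> = H.act1 z (Poly_Mapping.single {#} 1)" using z by (simp add: U.V.act_basis_def)
    also have "\<dots> = H.nf [z]" by (simp add: H.act1_single)
    finally show ?thesis using nf_Y[OF z] by simp
  qed
  have X: "L (- x) (-1) \<in> BI - borel" and Y: "L (- y) (-1) \<in> BI - borel" using neg_letter xy by auto
  have "L (- x) (-1) \<in> TH" using xH yG by (simp add: TH_def)
  then have "H.nf [L (- x) (-1)] = 0" using H.nf_snoc_T[of "L (- x) (-1)" "[]"] by simp
  then have 1: "Poly_Mapping.single {#L (- x) (-1)#} 1 \<in> K" using img[OF X] X by (simp add: K_def)
  have "H.nf [L (- y) (-1)] = Poly_Mapping.single {#L (- y) (-1)#} 1"
    using H.nf_sorted[of "[L (- y) (-1)]"] Y yH by (simp add: TH_def)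
  then have 2: "Poly_Mapping.single {#L (- y) (-1)#} 1 \<notin> K" using img[OF Y] by (simp add: K_def single_letter_nonzero)
  have "stable BI (K \<inter> aug)"
    unfolding stable_def
  proof (intro conjI ballI)
    show "pm.subspace (K \<inter> aug)" by (rule pm.subspace_inter[OF stableD(1)[OF K] subspace_aug])
    show "K \<inter> aug \<subseteq> carr" using stableD(2)[OF K] by blast
    fix z p assume z: "z \<in> BI" and p: "p \<in> K \<inter> aug"
    have "act1 z p \<in> K" by (rule stableD(3)[OF K z]) (use p in blast)
    moreover have "act1 z p \<in> aug" by (rule stableD(3)[OF stable_aug[OF triv] z]) (use p in blast)+
    ultimately show "act1 z p \<in> K \<inter> aug" by blast
  qed
  moreover have "K \<inter> aug \<noteq> {0}"
  proof
    assume "K \<inter> aug = {0}"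
    then have "Poly_Mapping.single {#L (- x) (-1)#} (1 :: 'f) \<in> {0}" using 1 letter_aug[OF X] by blast
    then show False by (simp add: single_letter_nonzero)
  qed
  moreover have "K \<inter> aug \<noteq> aug" using 2 letter_aug[OF Y] by blast
  ultimately show thesis using that by blast
qed

end

section \<open>Comparison of M(\<Lambda>) with M_a for a minimal positive element\<close>

context verma_weight
begin

subsection \<open>The subalgebra of a minimal positive element\<close>

abbreviation Z where
  "Z \<equiv> int_multiples :: 'f \<Rightarrow> 'f set"

lemma int_multiples_closed: "0 \<in> Z a" "x \<in> Z a \<Longrightarrow> y \<in> Z a \<Longrightarrow> x + y \<in> Z a" "x \<in> Z a \<Longrightarrow> - x \<in> Z a"
  "x \<in> Z a \<Longrightarrow> y \<in> Z a \<Longrightarrow> x - y \<in> Z a" "a \<in> Z a"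
proof -
  show "0 \<in> Z a" unfolding int_multiples_def by (force intro: exI[of _ 0])
  show "a \<in> Z a" unfolding int_multiples_def by (force intro: exI[of _ 1])
  fix x y assume "x \<in> Z a" "y \<in> Z a"
  then obtain m n where m: "x = of_int m * a" "y = of_int n * a" by (auto simp: int_multiples_def)
  have "x + y = of_int (m + n) * a" "- x = of_int (- m) * a" "x - y = of_int (m - n) * a"
    using m by (simp_all add: algebra_simps)
  then show "x + y \<in> Z a" "- x \<in> Z a" "x - y \<in> Z a" unfolding int_multiples_def by blast+
qed

lemma int_multiples_G: "a \<in> G \<Longrightarrow> Z a \<subseteq> G"
proof
  fix x assume a: "a \<in> G" and "x \<in> Z a"
  then obtain n where x: "x = of_int n * a" by (auto simp: int_multiples_def)
  have "of_nat n * a \<in> G" for n using a by (induction n) (auto simp: algebra_simps)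
  then have "of_nat (nat n) * a \<in> G" "- (of_nat (nat (- n)) * a) \<in> G" by auto
  then show "x \<in> G" unfolding x by (cases "n \<ge> 0") simp_all
qed

lemma int_multiples_subgroup: "additive_subgroup (Z a) base_field"
  unfolding additive_subgroup_base_field using int_multiples_closed by blast

text \<open>A positive element is either a or exceeds it, so a can be subtracted until a is reached;
  the multiple of a above x bounds the number of steps.\<close>

lemma int_multiples_convex:
  assumes a: "a \<in> P" "pos_below G gt a = {}" and x: "x \<in> P" and z: "z \<in> Z a" "z - x \<in> P \<or> z - x = 0"
  shows "x \<in> Z a"
proof -
  have c: "\<forall>x. x \<in> P \<and> (of_nat n * a - x \<in> P \<or> of_nat n * a - x = 0) \<longrightarrow> x \<in> Z a" for n
  proof (induction n)
    case 0
    then show ?case using P_neg by auto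
  next
    case (Suc n)
    show ?case
    proof (intro allI impI, elim conjE)
      fix x assume x: "x \<in> P" and d: "of_nat (Suc n) * a - x \<in> P \<or> of_nat (Suc n) * a - x = 0"
      show "x \<in> Z a"
      proof (cases "x = a")
        case True
        then show ?thesis using int_multiples_closed(5) by simp
      next
        case False
        then have "x - a \<in> P" using discrete_minimal[OF a x] by blast
        moreover have "of_nat (Suc n) * a - x = of_nat n * a - (x - a)" by (simp add: algebra_simps)
        ultimately have "x - a \<in> Z a" using Suc d by metis
        then have "(x - a) + a \<in> Z a" by (rule int_multiples_closed(2)[OF _ int_multiples_closed(5)])
        then show ?thesis by simp
      qed
    qed
  qed
  obtain n where n: "z = of_int n * a" using z(1) by (auto simp: int_multiples_def)
  have "z \<in> P" using z(2) x P_add[of "z - x" x] by auto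
  have "n > 0"
  proof (rule ccontr)
    assume "\<not> n > 0"
    then have "n = 0 \<or> of_int (- n) * a \<in> P" using P_scale_int[OF a(1), of "- n"] by (cases "n = 0") simp_all
    then show False using \<open>z \<in> P\<close> P_neg[of z] by (auto simp: n)
  qed
  then have "z = of_nat (nat n) * a" by (simp add: n)
  then show ?thesis using c[of "nat n"] x z(2) by blast
qed

text \<open>The model of M_a; see \<open>verma_sub_carrier\<close>.\<close>

definition sub_carr :: "'f \<Rightarrow> ('f block_basis multiset \<Rightarrow>\<^sub>0 'f) set" where
  "sub_carr a = {p \<in> carr. \<forall>m\<in>Poly_Mapping.keys p. set_mset m \<subseteq> block_index (Z a)}"

lemma subspace_sub_carr: "pm.subspace (sub_carr a)"
proof -
  have "sub_carr a = carr \<inter> {p. \<forall>m\<in>Poly_Mapping.keys p. set_mset m \<subseteq> block_index (Z a)}" by (auto simp: sub_carr_def)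
  then show ?thesis using pm.subspace_inter[OF subspace_carr subspace_keys] by simp
qed

lemma nf_sub_carr:
  assumes "a \<in> G" "set w \<subseteq> block_index (Z a)"
  shows "nf w \<in> sub_carr a"
proof -
  have S: "block_index (Z a) \<subseteq> BI" by (rule mono_index[OF int_multiples_G[OF assms(1)]])
  then have w: "set w \<subseteq> BI" using assms(2) by blast
  have "set_mset m \<subseteq> block_index (Z a)" if "m \<in> Poly_Mapping.keys (nf w)" for m
    by (rule nf_closed[OF assms(2) S basis_bracket_index[OF int_multiples_subgroup] that])
  then show ?thesis using nf_carr[OF w] by (simp add: sub_carr_def)
qed

lemma stable_sub_carr:
  assumes "a \<in> G"
  shows "stable (block_index (Z a)) (sub_carr a)"
  unfolding stable_def
proof (intro conjI ballI subspace_sub_carr)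
  show "sub_carr a \<subseteq> carr" by (auto simp: sub_carr_def)
  fix x p assume x: "x \<in> block_index (Z a)" and p: "p \<in> sub_carr a"
  show "act1 x p \<in> sub_carr a"
    unfolding act1_def
  proof (rule lin_closed[OF subspace_sub_carr])
    fix m assume "m \<in> Poly_Mapping.keys p"
    then have "set_mset m \<subseteq> block_index (Z a)" using p by (simp add: sub_carr_def)
    then show "nf (x # word m) \<in> sub_carr a" using x by (intro nf_sub_carr[OF assms]) simp
  qed
qed

lemma vac_sub_carr: "vac \<in> sub_carr a"
  by (simp add: sub_carr_def)

lemma sub_carr_generated:
  assumes a: "a \<in> G" and N: "stable (block_index (Z a)) N" "vac \<in> N"
  shows "sub_carr a \<subseteq> N"
proof
  have S: "block_index (Z a) \<subseteq> BI" by (rule mono_index[OF int_multiples_G[OF a]])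
  fix p assume p: "p \<in> sub_carr a"
  have "lin (\<lambda>m. nf (word m)) p \<in> N"
  proof (rule lin_closed[OF stableD(1)[OF N(1)]])
    fix m assume "m \<in> Poly_Mapping.keys p"
    then have m: "set (word m) \<subseteq> block_index (Z a)" using p by (simp add: sub_carr_def)
    then have "nf (word m) = act_word (word m) vac" using act_word_nf[of "word m" "[]"] S by simp
    then show "nf (word m) \<in> N" using act_word_stable[OF N(1) m N(2)] by simp
  qed
  moreover have "lin (\<lambda>m. nf (word m)) p = lin (\<lambda>m. Poly_Mapping.single m 1) p"
    by (rule lin_cong, rule nf_word) (use p carr_subset in \<open>auto simp: sub_carr_def\<close>)
  ultimately show "p \<in> N" by simp
qed

lemma verma_sub_carrier:
  assumes a: "a \<in> G"
  shows "generated_submodule (Z a) VM {vvec} = VM.univ_map ` sub_carr a"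
proof
  have ZG: "Z a \<subseteq> G" by (rule int_multiples_G[OF a])
  interpret V': block_module "Z a" VM by (rule VM.V.block_module_mono[OF ZG])
  have "block_submodule (Z a) (sub_carr a) model"
    using stable_sub_carr[OF a] block_submodule_model[OF ZG] by simp
  then have "block_submodule (Z a) (VM.univ_map ` sub_carr a) VM" by (rule VH.image_submodule[OF _ ZG])
  moreover have "vvec \<in> VM.univ_map ` sub_carr a"
    by (rule image_eqI[where x = vac]) (simp_all only: VM.univ_map_vac vac_sub_carr)
  ultimately show "generated_submodule (Z a) VM {vvec} \<subseteq> VM.univ_map ` sub_carr a"
    by (intro V'.generated_submodule_least) simp_all
  show "VM.univ_map ` sub_carr a \<subseteq> generated_submodule (Z a) VM {vvec}"
    unfolding generated_submodule_def
  proof (rule Inter_greatest)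
    fix N assume "N \<in> {N. block_submodule (Z a) N VM \<and> {vvec} \<subseteq> N}"
    then have N: "block_submodule (Z a) N VM" "vvec \<in> N" by simp_all
    have "stable (block_index (Z a)) {p \<in> carr. VM.univ_map p \<in> N}"
      using VH.vimage_submodule[OF N(1) ZG] block_submodule_model[OF ZG] by simp
    then have "sub_carr a \<subseteq> {p \<in> carr. VM.univ_map p \<in> N}"
      by (rule sub_carr_generated[OF a]) (simp add: VM.univ_map_vac N(2))
    then show "VM.univ_map ` sub_carr a \<subseteq> N" by blast
  qed
qed

text \<open>A monomial whose weight is a multiple of the minimal element \<open>a\<close> involves only such letters.\<close>

lemma letters_multiples:
  assumes a: "a \<in> P" "pos_below G gt a = {}" and m: "set_mset m \<subseteq> BI - borel" "wt m \<in> Z a"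
  shows "set_mset m \<subseteq> block_index (Z a)"
proof
  fix y assume y: "y \<in># m"
  then obtain \<alpha> i where yi: "y = L (- \<alpha>) i" "\<alpha> \<in> P" "i \<ge> -1" using m(1) Y_iff by blast
  have "wt m = grade y + wt (m - {#y#})" using arg_cong[OF insert_DiffM[OF y], of wt] by (simp only: wt_simps)
  then have "- wt m - \<alpha> = - wt (m - {#y#})" by (simp add: yi(1))
  moreover have "- wt (m - {#y#}) \<in> P \<or> m - {#y#} = {#}"
  proof (cases "m - {#y#} = {#}")
    case False
    have s: "Poly_Mapping.single (m - {#y#}) 1 \<in> carr" using m(1) by (intro single_carr) (auto dest: in_diffD)
    then show ?thesis using wt_P[OF s _ False] by simp
  qed simp
  ultimately have "- wt m - \<alpha> \<in> P \<or> - wt m - \<alpha> = 0" by auto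
  then have "\<alpha> \<in> Z a" using int_multiples_convex[OF a yi(2)] int_multiples_closed(3)[OF m(2)] by blast
  then show "y \<in> block_index (Z a)" using yi int_multiples_closed(3) by simp
qed

text \<open>By \<open>discrete_reduction\<close> a nonzero submodule contains a homogeneous element
  whose weight is a multiple of a. Convexity puts all of its monomials, not only the top ones, into
  M_a. So the submodule meets M_a, and irreducibility of M_a puts v into it.\<close>

lemma discrete_irreducible_if:
  assumes a: "a \<in> P" "pos_below G gt a = {}"
    and irr: "\<And>N. stable (block_index (Z a)) N \<Longrightarrow> N \<subseteq> sub_carr a \<Longrightarrow> N = {0} \<or> N = sub_carr a"
    and N: "stable BI N"
  shows "N = {0} \<or> N = carr"
proof (cases "N = {0}")
  case False
  have aG: "a \<in> G" using a P_G by blast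
  obtain k u0 where "good N k u0" using good_exists[OF N False] by blast
  then obtain u where u: "good N k u" "\<And>m y. m \<in> top_keys k u \<Longrightarrow> y \<in># m \<Longrightarrow> grade y = - a"
    using discrete_reduction[OF a N] by metis
  obtain m0 where m0: "m0 \<in> top_keys k u" using goodD(4)[OF u(1)] by blast
  have "(\<Sum>y\<in>#M. grade y) \<in> Z a" if "\<And>y. y \<in># M \<Longrightarrow> grade y = - a" for M
    using that by (induction M) (auto intro!: int_multiples_closed)
  then have wZ: "wt m0 \<in> Z a" unfolding wt_def using u(2)[OF m0] by blast
  obtain \<gamma> where \<gamma>: "u \<in> homog \<gamma>" using u(1) by (auto simp: good_def)
  have uc: "u \<in> sub_carr a"
  proof -
    have "set_mset m \<subseteq> block_index (Z a)" if m: "m \<in> Poly_Mapping.keys u" for m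
    proof (rule letters_multiples[OF a carr_subset[OF goodD(3)[OF u(1)] m]])
      have "wt m = wt m0" using \<gamma> m m0 by (simp add: homog_def top_keys_def)
      then show "wt m \<in> Z a" using wZ by simp
    qed
    then show ?thesis using goodD(3)[OF u(1)] by (simp add: sub_carr_def)
  qed
  have S: "block_index (Z a) \<subseteq> BI" by (rule mono_index[OF int_multiples_G[OF aG]])
  have "stable (block_index (Z a)) (N \<inter> sub_carr a)"
    unfolding stable_def
  proof (intro conjI ballI)
    show "pm.subspace (N \<inter> sub_carr a)" by (rule pm.subspace_inter[OF stableD(1)[OF N] subspace_sub_carr])
    show "N \<inter> sub_carr a \<subseteq> carr" using stableD(2)[OF N] by blast
    fix x p assume x: "x \<in> block_index (Z a)" and p: "p \<in> N \<inter> sub_carr a"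
    have "act1 x p \<in> N" by (rule stableD(3)[OF N]) (use x S p in auto)
    moreover have "act1 x p \<in> sub_carr a" by (rule stableD(3)[OF stable_sub_carr[OF aG] x]) (use p in blast)
    ultimately show "act1 x p \<in> N \<inter> sub_carr a" by blast
  qed
  then have "N \<inter> sub_carr a = {0} \<or> N \<inter> sub_carr a = sub_carr a" by (rule irr) blast
  moreover have "u \<in> N \<inter> sub_carr a" "u \<noteq> 0" using uc goodD(1)[OF u(1)] m0 by (auto simp: top_keys_def)
  ultimately have "vac \<in> N" using vac_sub_carr by blast
  then show ?thesis using carr_if_vac[OF N] by blast
qed blast

text \<open>A submodule \<open>N\<close> of M_a is stable under the whole Borel part, since positive
  letters whose grade is not a multiple of a raise every weight of M_a to a positive one. Hence
  \<open>N\<close> induces a submodule of M(\<Lambda>), and the projection \<open>pr\<close> onto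
  M_a maps that back into \<open>N\<close>.\<close>

lemma discrete_irreducible_only_if:
  assumes a: "a \<in> P" "pos_below G gt a = {}"
    and irr: "\<And>N. stable BI N \<Longrightarrow> N = {0} \<or> N = carr"
    and N: "stable (block_index (Z a)) N" "N \<subseteq> sub_carr a"
  shows "N = {0} \<or> N = sub_carr a"
proof (cases "N = {0}")
  case False
  have aG: "a \<in> G" using a P_G by blast
  have S: "block_index (Z a) \<subseteq> BI" by (rule mono_index[OF int_multiples_G[OF aG]])
  note sub = stableD(1)[OF N(1)]
  have wtZ: "wt m \<in> Z a" if "set_mset m \<subseteq> block_index (Z a)" for m
    using that unfolding wt_def
    by (induction m) (auto intro!: int_multiples_closed(1,2) simp: grade_index[OF int_multiples_closed(1)])
  have "act1 x p \<in> N" if x: "x \<in> borel" and p: "p \<in> N" for x p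
  proof (cases "x \<in> block_index (Z a)")
    case True
    then show ?thesis by (rule stableD(3)[OF N(1) _ p])
  next
    case xZ: False
    obtain \<alpha> i where xi: "x = L \<alpha> i" "\<alpha> \<in> G" "i \<ge> -1" using x xZ by (cases x) (auto simp: borel_def)
    then have "\<alpha> \<notin> Z a" using xZ by simp
    then have \<alpha>: "\<alpha> \<in> P" "\<alpha> \<notin> Z a" using x xi int_multiples_closed(1) by (auto simp: borel_def)
    have "act1 x p = lin (\<lambda>m. 0) p"
      unfolding act1_def
    proof (rule lin_cong)
      fix m assume m: "m \<in> Poly_Mapping.keys p"
      have pc: "p \<in> sub_carr a" using p N(2) by blast
      have mZ: "set_mset m \<subseteq> block_index (Z a)" using pc m by (simp add: sub_carr_def)
      have w: "wt m \<in> Z a" by (rule wtZ[OF mZ])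
      \<comment> \<open>Otherwise \<alpha> would be positive and at most \<open>- wt m\<close>, a
        multiple of a, against convexity.\<close>
      have "\<alpha> + wt m \<in> P"
      proof (rule ccontr)
        assume "\<alpha> + wt m \<notin> P"
        moreover have "wt m \<in> G" using w int_multiples_G[OF aG] by blast
        ultimately have "- (\<alpha> + wt m) \<in> P \<or> \<alpha> + wt m = 0"
          using P_total[OF G_closed(2)[OF xi(2)]] by blast
        moreover have "- (\<alpha> + wt m) = - wt m - \<alpha>" by simp
        ultimately have "- wt m - \<alpha> \<in> P \<or> - wt m - \<alpha> = 0" by (metis neg_equal_0_iff_equal)
        then show False using int_multiples_convex[OF a \<alpha>(1) int_multiples_closed(3)[OF w]] \<alpha>(2) by blast
      qed
      moreover have "nf (x # word m) \<in> homog (\<alpha> + wt m)"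
      proof -
        have "x \<in> BI" using x by (simp add: borel_def)
        then have "set (x # word m) \<subseteq> BI" using mZ S by auto
        from nf_homog[OF this] show ?thesis by (simp add: wt_word xi(1))
      qed
      ultimately show "nf (x # word m) = 0" by (rule homog_pos)
    qed
    then show ?thesis using pm.subspace_0[OF sub] by simp
  qed
  then have "stable borel N" using stableD(1,2)[OF N(1)] by (simp add: stable_def)
  then have "stable BI (induced N)" by (rule stable_induced)
  then have "induced N = {0} \<or> induced N = carr" by (rule irr)
  moreover have "induced N \<noteq> {0}" using False induced_superset[of N] pm.subspace_0[OF sub] by blast
  ultimately have vi: "vac \<in> induced N" by simp
  define pr where "pr p = lin (\<lambda>m. if set_mset m \<subseteq> block_index (Z a) then Poly_Mapping.single m 1 else 0) p"
    for p :: "'f block_basis multiset \<Rightarrow>\<^sub>0 'f"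
  have pr_id: "pr p = p" if "p \<in> sub_carr a" for p
  proof -
    have "pr p = lin (\<lambda>m. Poly_Mapping.single m 1) p"
      unfolding pr_def by (rule lin_cong) (use that in \<open>auto simp: sub_carr_def\<close>)
    then show ?thesis by simp
  qed
  \<comment> \<open>A word inside the subalgebra keeps \<open>p\<close> in \<open>N\<close>, where
    \<open>pr\<close> is the identity. If some letter of \<open>w\<close> is outside, the weight of
    \<open>w\<close> is not a multiple of a, so no monomial of the result lies in M_a and
    \<open>pr\<close> gives zero.\<close>
  have "pr (act_word w p) \<in> N" if w: "set w \<subseteq> BI - borel" and p: "p \<in> N" for w p
  proof (cases "set w \<subseteq> block_index (Z a)")
    case True
    then have "act_word w p \<in> N" by (rule act_word_stable[OF N(1) _ p])
    then show ?thesis using pr_id N(2) by auto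
  next
    case False
    have pc: "p \<in> sub_carr a" using p N(2) by blast
    have "act_word w p = act_word w (lin (\<lambda>m. nf (word m)) p)"
    proof -
      have "lin (\<lambda>m. nf (word m)) p = lin (\<lambda>m. Poly_Mapping.single m 1) p"
        by (rule lin_cong, rule nf_word) (use pc carr_subset in \<open>auto simp: sub_carr_def\<close>)
      then show ?thesis by simp
    qed
    also have "\<dots> = lin (\<lambda>m. act_word w (nf (word m))) p" by (induction w) (simp_all add: act1_lin)
    also have "pr \<dots> = lin (\<lambda>m. pr (act_word w (nf (word m)))) p" by (simp add: pr_def lin_lin)
    also have "\<dots> = lin (\<lambda>m. 0) p"
    proof (rule lin_cong)
      fix m assume m: "m \<in> Poly_Mapping.keys p"
      have mZ: "set_mset m \<subseteq> block_index (Z a)" using pc m by (simp add: sub_carr_def)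
      have wm: "set (w @ word m) \<subseteq> BI" using w mZ S by auto
      have "\<not> set_mset m' \<subseteq> block_index (Z a)" if m': "m' \<in> Poly_Mapping.keys (nf (w @ word m))" for m'
      proof
        assume "set_mset m' \<subseteq> block_index (Z a)"
        then have "wt m' \<in> Z a" by (rule wtZ)
        moreover have "wt m' = (\<Sum>x\<leftarrow>w. grade x) + wt m" using nf_wt[OF wm m'] by (simp add: wt_word)
        ultimately have "(\<Sum>x\<leftarrow>w. grade x) + wt m - wt m \<in> Z a"
          using wtZ[OF mZ] int_multiples_closed(4) by metis
        moreover have "(\<Sum>x\<leftarrow>w. grade x) = wt (mset w)" by (induction w) simp_all
        ultimately have "wt (mset w) \<in> Z a" by simp
        then have "set_mset (mset w) \<subseteq> block_index (Z a)" using w by (intro letters_multiples[OF a]) simp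
        then show False using False by simp
      qed
      then have "pr (nf (w @ word m)) = lin (\<lambda>m. 0) (nf (w @ word m))" unfolding pr_def by (intro lin_cong) simp
      then show "pr (act_word w (nf (word m))) = 0" using act_word_nf[of w "word m"] wm by simp
    qed
    finally show ?thesis using pm.subspace_0[OF sub] by simp
  qed
  then have gen: "\<forall>q\<in>{act_word w p | w p. set w \<subseteq> BI - borel \<and> p \<in> N}. pr q \<in> N" by blast
  have "pr q \<in> N" if "q \<in> induced N" for q
    using that unfolding induced_def
  proof (induction rule: pm.span_induct_alt)
    case base
    then show ?case using pm.subspace_0[OF sub] by (simp add: pr_def)
  next
    case (step c x y)
    have "pr (c \<cdot> x + y) = c \<cdot> pr x + pr y" by (simp add: pr_def lin_add lin_scale)
    then show ?case using step gen pm.subspace_add[OF sub] pm.subspace_scale[OF sub] by simp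
  qed
  then have "vac \<in> N" using vi pr_id[OF vac_sub_carr] by metis
  then show ?thesis using sub_carr_generated[OF aG N(1)] N(2) by blast
qed blast

lemma verma_discrete:
  assumes a: "a \<in> P" "pos_below G gt a = {}"
  shows "irreducible_module G VM \<longleftrightarrow> irreducible_module (int_multiples a) (verma_sub G gt a \<Lambda>)"
proof -
  have aG: "a \<in> G" using a P_G by blast
  have ne: "sub_carr a \<noteq> {0}" using vac_sub_carr vac_nonzero by blast
  have "irreducible_module (Z a) (verma_sub G gt a \<Lambda>) \<longleftrightarrow>
      (\<forall>N. stable (block_index (Z a)) N \<and> N \<subseteq> sub_carr a \<longrightarrow> N = {0} \<or> N = sub_carr a)"
    unfolding verma_sub_def verma_sub_carrier[OF aG]
      irreducible_image_iff[OF int_multiples_G[OF aG] stable_sub_carr[OF aG]] using ne by simp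
  moreover have "irreducible_module G VM \<longleftrightarrow>
      (\<forall>N. stable (block_index (Z a)) N \<and> N \<subseteq> sub_carr a \<longrightarrow> N = {0} \<or> N = sub_carr a)"
    unfolding irreducible_verma_iff
  proof (rule iffI; intro allI impI)
    fix N assume "\<forall>N. stable BI N \<longrightarrow> N = {0} \<or> N = carr"
      "stable (block_index (Z a)) N \<and> N \<subseteq> sub_carr a"
    then show "N = {0} \<or> N = sub_carr a" by (intro discrete_irreducible_only_if[OF a]) simp_all
  next
    fix N assume "\<forall>N. stable (block_index (Z a)) N \<and> N \<subseteq> sub_carr a \<longrightarrow> N = {0} \<or> N = sub_carr a" "stable BI N"
    then show "N = {0} \<or> N = carr" by (intro discrete_irreducible_if[OF a]) simp_all
  qed
  ultimately show ?thesis by simp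
qed

section \<open>M'(0) as the vectors without constant term\<close>

subsection \<open>The augmentation submodule\<close>

text \<open>A nonempty word of negative letters has nonzero weight, so its normal form has no
  constant term; conversely the sorted words give all nonempty monomials.\<close>

lemma verma_prime_image:
  "linear_span VM {foldr (\<lambda>(\<alpha>, i). act VM (basis_L (- \<alpha>) i)) xs vvec | xs.
        xs \<noteq> [] \<and> (\<forall>(\<alpha>, i)\<in>set xs. \<alpha> \<in> P \<and> i \<ge> -1)} = VM.univ_map ` aug"
proof -
  define wd where "wd xs = map (\<lambda>(\<alpha>, i). L (- \<alpha> :: 'f) i) xs" for xs
  have wd: "foldr (\<lambda>(\<alpha>, i). act VM (basis_L (- \<alpha>) i)) xs vvec = VM.univ_map (nf (wd xs)) \<and> set (wd xs) \<subseteq> BI - borel"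
    if "\<forall>(\<alpha>, i)\<in>set xs. \<alpha> \<in> P \<and> i \<ge> -1" for xs
    using that
  proof (induction xs)
    case Nil
    then show ?case by (simp add: wd_def VM.univ_map_vac)
  next
    case (Cons x xs)
    obtain \<alpha> i where x: "x = (\<alpha>, i)" by (cases x)
    have L: "L (- \<alpha>) i \<in> BI - borel" using Cons.prems x by (intro neg_letter) auto
    have IH: "foldr (\<lambda>(\<alpha>, i). act VM (basis_L (- \<alpha>) i)) xs vvec = VM.univ_map (nf (wd xs))" "set (wd xs) \<subseteq> BI - borel"
      using Cons by auto
    then have w: "set (wd xs) \<subseteq> BI" by blast
    have "act VM (basis_L (- \<alpha>) i) (VM.univ_map (nf (wd xs))) = VM.univ_map (act1 (L (- \<alpha>) i) (nf (wd xs)))"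
      using VH.hom_simps(4)[of "basis_L (- \<alpha>) i" "nf (wd xs)"] nf_carr[OF w] L by simp
    also have "act1 (L (- \<alpha>) i) (nf (wd xs)) = nf (wd (x # xs))" using act1_nf[OF w] by (simp add: wd_def x)
    finally show ?case using IH L by (simp add: x wd_def)
  qed
  have wd_surj: "\<exists>xs. w = wd xs \<and> (\<forall>(\<alpha>, i)\<in>set xs. \<alpha> \<in> P \<and> i \<ge> -1)" if "set w \<subseteq> BI - borel" for w
    using that
  proof (induction w)
    case (Cons y w)
    then obtain xs where xs: "w = wd xs" "\<forall>(\<alpha>, i)\<in>set xs. \<alpha> \<in> P \<and> i \<ge> -1" by auto
    obtain \<alpha> i where "y = L (- \<alpha>) i" "\<alpha> \<in> P" "i \<ge> -1" using Cons.prems Y_iff[of y] by auto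
    then show ?case using xs by (intro exI[of _ "(\<alpha>, i) # xs"]) (simp add: wd_def)
  qed (simp add: wd_def)
  let ?S = "{foldr (\<lambda>(\<alpha>, i). act VM (basis_L (- \<alpha>) i)) xs vvec | xs. xs \<noteq> [] \<and> (\<forall>(\<alpha>, i)\<in>set xs. \<alpha> \<in> P \<and> i \<ge> -1)}"
  have S: "?S = (\<lambda>w. VM.univ_map (nf w)) ` {w. w \<noteq> [] \<and> set w \<subseteq> BI - borel}" (is "_ = ?T")
  proof
    show "?S \<subseteq> ?T"
    proof
      fix y assume "y \<in> ?S"
      then obtain xs where xs: "y = foldr (\<lambda>(\<alpha>, i). act VM (basis_L (- \<alpha>) i)) xs vvec" "xs \<noteq> []" "\<forall>(\<alpha>, i)\<in>set xs. \<alpha> \<in> P \<and> i \<ge> -1" by blast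
      have "y = VM.univ_map (nf (wd xs))" "wd xs \<in> {w. w \<noteq> [] \<and> set w \<subseteq> BI - borel}"
        using wd[OF xs(3)] xs(1,2) by (simp_all add: wd_def)
      then show "y \<in> ?T" by (rule image_eqI)
    qed
    show "?T \<subseteq> ?S"
    proof
      fix y assume "y \<in> ?T"
      then obtain w where w: "y = VM.univ_map (nf w)" "w \<noteq> []" "set w \<subseteq> BI - borel" by blast
      obtain xs where xs: "w = wd xs" "\<forall>(\<alpha>, i)\<in>set xs. \<alpha> \<in> P \<and> i \<ge> -1" using wd_surj[OF w(3)] by blast
      have "xs \<noteq> []" using w(2) xs(1) by (auto simp: wd_def)
      then show "y \<in> ?S" using wd[OF xs(2)] xs w(1) by (intro CollectI exI[of _ xs]) simp
    qed
  qed
  have subm: "submodule (VM.univ_map ` aug) base_field VM"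
  proof -
    have m: "submodule aug base_field model" unfolding model_submodule using subspace_aug by (auto simp: aug_def)
    have E: "block_algebra {} \<noteq> {}" by (auto intro: block_algebra_zero)
    show ?thesis
    proof (rule VM.V.submoduleI)
      show "VM.univ_map ` aug \<subseteq> carrier VM" by auto
      show "\<zero>\<^bsub>VM\<^esub> \<in> VM.univ_map ` aug" using pm.subspace_0[OF subspace_aug] VM.univ_map_zero by (metis image_eqI)
      fix b c assume b: "b \<in> VM.univ_map ` aug"
      then obtain p where p: "p \<in> aug" "b = VM.univ_map p" by blast
      show s: "r \<odot>\<^bsub>VM\<^esub> b \<in> VM.univ_map ` aug" if "r \<in> carrier base_field" for r
        using VM.univ_map_scale[of r p] pm.subspace_scale[OF subspace_aug p(1), of r] p(2) by (metis image_eqI)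
      show "\<ominus>\<^bsub>VM\<^esub> b \<in> VM.univ_map ` aug"
        using VM.V.smult_minus_one[of b] s[of "-1"] p(2) by simp
      assume "c \<in> VM.univ_map ` aug"
      then obtain q where q: "q \<in> aug" "c = VM.univ_map q" by blast
      show "b \<oplus>\<^bsub>VM\<^esub> c \<in> VM.univ_map ` aug"
        using VM.univ_map_add[of p q] pm.subspace_add[OF subspace_aug p(1) q(1)] p(2) q(2) by (metis image_eqI)
    qed
  qed
  show ?thesis
  proof
    have lead: "Poly_Mapping.lookup (nf w) {#} = 0" if w: "w \<noteq> []" "set w \<subseteq> BI - borel" for w
    proof (rule ccontr)
      assume "Poly_Mapping.lookup (nf w) {#} \<noteq> 0"
      then have "wt {#} = (\<Sum>x\<leftarrow>w. grade x)" using w by (intro nf_wt) (auto simp: in_keys_iff)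
      moreover have "(\<Sum>x\<leftarrow>w. grade x) = wt (mset w)" by (induction w) simp_all
      moreover have "- wt (mset w) \<in> P"
        by (rule wt_P[of "Poly_Mapping.single (mset w) 1"]) (use w in auto)
      ultimately show False by simp
    qed
    have "?T \<subseteq> VM.univ_map ` aug"
    proof
      fix y assume "y \<in> ?T"
      then obtain w where w: "y = VM.univ_map (nf w)" "w \<noteq> []" "set w \<subseteq> BI - borel" by blast
      have "nf w \<in> aug" using lead[OF w(2,3)] nf_carr[of w] w(3) by (auto simp: aug_def)
      then show "y \<in> VM.univ_map ` aug" using w(1) by blast
    qed
    then show "linear_span VM ?S \<subseteq> VM.univ_map ` aug" unfolding S linear_span_def using subm by blast
    show "VM.univ_map ` aug \<subseteq> linear_span VM ?S"
      unfolding S linear_span_def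
    proof (rule Inter_greatest)
      fix M assume "M \<in> {N. submodule N base_field VM \<and> ?T \<subseteq> N}"
      then have M: "submodule M base_field VM" "?T \<subseteq> M" by simp_all
      show "VM.univ_map ` aug \<subseteq> M"
      proof (rule image_subsetI)
        fix p assume p: "p \<in> aug"
        have "Poly_Mapping.keys p \<subseteq> {m. m \<noteq> {#} \<and> set_mset m \<subseteq> BI - borel}"
          using p carr_subset by (auto simp: aug_def in_keys_iff)
        then show "VM.univ_map p \<in> M"
        proof (induction p rule: pm_induct)
          case zero
          then show ?case using submodule_zero[OF M(1)] by (simp add: VM.univ_map_zero)
        next
          case (add p q)
          then show ?case using VM.V.submoduleE(5)[OF M(1)] by (simp add: VM.univ_map_add)
        next
          case (single m c)
          then have m: "m \<noteq> {#}" "set_mset m \<subseteq> BI - borel" by auto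
          then have "word m \<noteq> []" by (metis length_word list.size(3) size_eq_0_iff_empty)
          then have "VM.univ_map (nf (word m)) \<in> M" using M(2) m(2) by auto
          then have "c \<odot>\<^bsub>VM\<^esub> VM.univ_map (nf (word m)) \<in> M" using VM.V.submoduleE(4)[OF M(1)] by simp
          then show ?case using VM.univ_map_scale[of c "nf (word m)"] nf_word[OF m(2)] by simp
        qed
      qed
    qed
  qed
qed

end

section \<open>Integer grading: a vector of weight -1 in a nonzero maximal submodule\<close>

section \<open>Quasifinite modules over the integers\<close>

lemma additive_subgroup_Ints: "additive_subgroup \<int> (base_field :: 'f::field_char_0 ring)"
  unfolding additive_subgroup_base_field by auto

lemma compatible_order_Ints: "compatible_order (\<int> :: 'f::field_char_0 set) int_gt"
  unfolding compatible_order_def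
proof (intro conjI ballI impI)
  show "irreflp_on (\<int> :: 'f set) int_gt" "transp_on (\<int> :: 'f set) int_gt"
    by (auto simp: irreflp_on_def transp_on_def int_gt_def) (metis less_trans)?
  show "totalp_on (\<int> :: 'f set) int_gt"
  proof (rule totalp_onI)
    fix x y :: 'f assume "x \<in> \<int>" "y \<in> \<int>" "x \<noteq> y"
    then obtain m n where "x = of_int m" "y = of_int n" "m \<noteq> n" by (auto elim!: Ints_cases)
    then show "int_gt x y \<or> int_gt y x" unfolding int_gt_def by (metis linorder_neqE)
  qed
  fix x y z :: 'f assume "z \<in> \<int>" "int_gt x y"
  then obtain k m n where e: "z = of_int k" "x = of_int m" "y = of_int n" "m > n" by (auto simp: int_gt_def elim!: Ints_cases)
  then have "x + z = of_int (m + k)" "y + z = of_int (n + k)" "m + k > n + k" by simp_all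
  then show "int_gt (x + z) (y + z)" unfolding int_gt_def by blast
qed

locale verma_int = verma_weight "\<int>" int_gt \<Lambda> for \<Lambda> :: "'f::field_char_0 block_vec \<Rightarrow> 'f"
begin

lemma P_int: "x \<in> P \<longleftrightarrow> (\<exists>n>0. x = of_int n)"
  unfolding pos_part_def int_gt_def
  by (auto simp: of_int_eq_0_iff[symmetric] simp del: of_int_eq_0_iff)

lemma one_P: "1 \<in> P"
  unfolding P_int by (intro exI[of _ 1]) simp

lemma below_one: "pos_below (\<int> :: 'f set) int_gt 1 = {}"
proof -
  have False if b: "int_gt \<beta> 0" "int_gt 1 \<beta>" for \<beta> :: 'f
  proof -
    obtain m n where mn: "\<beta> = of_int m" "(0 :: 'f) = of_int n" "m > n" using b(1) unfolding int_gt_def by blast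
    obtain k l where kl: "(1 :: 'f) = of_int k" "\<beta> = of_int l" "k > l" using b(2) unfolding int_gt_def by blast
    have "n = 0" "k = 1" using mn(2) kl(1) by (metis of_int_eq_0_iff, metis of_int_eq_1_iff)
    moreover have "m = l" using mn(1) kl(2) by simp
    ultimately show False using mn kl by simp
  qed
  then show ?thesis unfolding pos_below_def by blast
qed

lemma neg_one_letter: "i \<ge> -1 \<Longrightarrow> L (-1) i \<in> BI - borel"
  using neg_letter[OF one_P] by simp

lemma diff_letters: "set_mset m \<subseteq> A \<Longrightarrow> set_mset (m - n) \<subseteq> A"
  by (auto dest: in_diffD)

text \<open>Remainders that do not affect the coefficient of a monomial with l - 1 letters all of
  whose indices are below \<open>J\<close>.\<close>

definition big_rest :: "int \<Rightarrow> nat \<Rightarrow> ('f block_basis multiset \<Rightarrow>\<^sub>0 'f) set" where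
  "big_rest J l = {p. \<forall>m\<in>Poly_Mapping.keys p. set_mset m \<subseteq> BI - borel \<and>
    (Suc (size m) < l \<or> Suc (size m) = l \<and> (\<exists>y\<in>#m. idx y \<ge> J))}"

lemma subspace_big_rest: "pm.subspace (big_rest J l)"
  unfolding big_rest_def by (rule subspace_keys)

lemma lower_big_rest: "p \<in> lower l \<Longrightarrow> p \<in> big_rest J (Suc l)"
  by (auto simp: big_rest_def lower_def)

lemma act1_big_rest:
  assumes y: "y \<in> BI - borel" and p: "p \<in> big_rest J l"
  shows "act1 y p \<in> big_rest J (Suc l)"
  unfolding act1_def
proof (rule lin_closed[OF subspace_big_rest])
  fix m assume "m \<in> Poly_Mapping.keys p"
  then have mY: "set_mset m \<subseteq> BI - borel" and m: "Suc (size m) < l \<or> Suc (size m) = l \<and> (\<exists>y\<in>#m. idx y \<ge> J)"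
    using p by (auto simp: big_rest_def)
  have yw: "set (y # word m) \<subseteq> BI - borel" using y mY by simp
  from m show "nf (y # word m) \<in> big_rest J (Suc l)"
  proof
    assume l: "Suc (size m) < l"
    have "length (filter (\<lambda>x. x \<notin> borel) (y # word m)) \<le> length (y # word m)" by (rule length_filter_le)
    then have "nf (y # word m) \<in> lower l" using l yw by (intro nf_lower) auto
    then show ?thesis by (rule lower_big_rest)
  next
    assume l: "Suc (size m) = l \<and> (\<exists>y\<in>#m. idx y \<ge> J)"
    have "nf (y # word m) - Poly_Mapping.single (add_mset y m) 1 \<in> lower l"
      using nf_leading[OF yw] l by simp
    then have "nf (y # word m) - Poly_Mapping.single (add_mset y m) 1 \<in> big_rest J (Suc l)" by (rule lower_big_rest)
    moreover have "Poly_Mapping.single (add_mset y m) 1 \<in> big_rest J (Suc l)"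
      using l yw by (auto simp: big_rest_def)
    ultimately show ?thesis using pm.subspace_add[OF subspace_big_rest] by fastforce
  qed
qed

text \<open>The derivation part of \<open>L 0 s\<close> pushes the index of a letter to at least
  \<open>J\<close>, so only the scalar part is seen.\<close>

lemma nf_L0:
  assumes w: "set w \<subseteq> BI - borel" and s: "s \<ge> J + 1" "s \<ge> -1"
  shows "nf (L 0 s # w) - \<Lambda> (basis_L 0 s) \<cdot> Poly_Mapping.single (mset w) 1 \<in> big_rest J (Suc (length w))"
proof -
  have b: "L 0 s \<in> borel" using s by (simp add: borel_def)
  have l: "y = L (grade y) (idx y)" if "y \<in># mset w" for y
  proof -
    have "y \<in> BI - borel" using w that by auto
    then obtain \<alpha> i where "y = L (- \<alpha>) i" using Y_iff by blast
    then show ?thesis by simp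
  qed
  have d: "deriv (L 0 s) (mset w) = (\<Sum>y\<in>#mset w. if shift 0 s y \<in> borel then 0
      else Poly_Mapping.single (add_mset (shift 0 s y) (mset w - {#y#})) (shift_coeff 0 s y))"
    by (rule deriv_L) (rule l)
  have "deriv (L 0 s) (mset w) \<in> big_rest J (Suc (length w))"
    unfolding d
  proof (rule sum_mset_closed[OF subspace_big_rest])
    fix y assume y: "y \<in># mset w"
    have "y \<in> BI - borel" using w y by auto
    then obtain \<alpha> i where yi: "y = L (- \<alpha>) i" "\<alpha> \<in> P" "i \<ge> -1" using Y_iff by blast
    have "size (mset w) = Suc (size (mset w - {#y#}))" using size_Suc_Diff1[OF y] by simp
    moreover have "set_mset (mset w - {#y#}) \<subseteq> BI - borel" by (rule diff_letters) (use w in simp)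
    moreover have "shift 0 s y \<in> BI" if "shift_coeff 0 s y \<noteq> 0"
    proof -
      have "s \<noteq> -1" using that by (auto simp: shift_coeff_def)
      then have "i + s \<ge> -1" using yi(3) s(2) by simp
      then show ?thesis using yi P_G by (simp add: shift_def)
    qed
    moreover have "idx (shift 0 s y) \<ge> J" using yi s by (simp add: shift_def)
    ultimately show "(if shift 0 s y \<in> borel then 0
      else Poly_Mapping.single (add_mset (shift 0 s y) (mset w - {#y#})) (shift_coeff 0 s y)) \<in> big_rest J (Suc (length w))"
      by (cases "shift_coeff 0 s y = 0") (auto simp: big_rest_def)
  qed
  moreover have "nf (L 0 s # w) - eigenvalue \<Lambda> (L 0 s) \<cdot> Poly_Mapping.single (mset w) 1 - deriv (L 0 s) (mset w) \<in> big_rest J (Suc (length w))"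
    by (rule lower_big_rest[OF nf_cons_leading[OF b w]])
  ultimately have "(nf (L 0 s # w) - eigenvalue \<Lambda> (L 0 s) \<cdot> Poly_Mapping.single (mset w) 1 - deriv (L 0 s) (mset w)) + deriv (L 0 s) (mset w) \<in> big_rest J (Suc (length w))"
    by (intro pm.subspace_add[OF subspace_big_rest])
  then show ?thesis by simp
qed

text \<open>The part of \<open>L 1 j\<close> that removes a letter: its bracket with
  \<open>y\<close> of grade -1 is a multiple of \<open>L 0 (idx y + j)\<close>, which then acts by
  its scalar.\<close>

definition contract :: "int \<Rightarrow> 'f block_basis multiset \<Rightarrow> 'f block_basis multiset \<Rightarrow>\<^sub>0 'f" where
  "contract j m = (\<Sum>y\<in>#m. (shift_coeff 1 j y * \<Lambda> (basis_L 0 (idx y + j))) \<cdot> Poly_Mapping.single (m - {#y#}) 1)"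

text \<open>On its way to the right \<open>L 1 j\<close> meets each letter once, and
  \<open>nf_L0\<close> evaluates the letter of grade zero that arises.\<close>

lemma nf_L1:
  assumes "set w \<subseteq> BI - borel" "\<And>y. y \<in> set w \<Longrightarrow> grade y = -1" "j \<ge> J + 2" "j \<ge> 2"
  shows "nf (L 1 j # w) - contract j (mset w) \<in> big_rest J (length w)"
  using assms(1,2)
proof (induction w)
  case Nil
  have b: "L 1 j \<in> borel" using assms(4) one_P by (simp add: borel_def)
  have "nf [L 1 j] = 0" using nf_T[OF b] by simp
  then show ?case by (simp add: contract_def pm.subspace_0[OF subspace_big_rest])
next
  case (Cons y w)
  let ?m = "mset w" and ?l = "Suc (length w)"
  note B = subspace_big_rest[of J ?l]
  have y: "y \<in> BI - borel" and w: "set w \<subseteq> BI - borel" "set w \<subseteq> BI" using Cons.prems(1) by auto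
  obtain \<alpha> i where ai: "y = L (- \<alpha>) i" "i \<ge> -1" using y Y_iff by blast
  have "grade y = -1" using Cons.prems(2) by simp
  then have yi: "y = L (-1) i" "i \<ge> -1" using ai by simp_all
  have L1: "L 1 j \<in> BI" using assms(4) by simp
  have br: "basis_bracket (L 1 j) y = Poly_Mapping.single (L 0 (idx y + j)) (shift_coeff 1 j y)"
    using yi assms(4) by (simp add: shift_coeff_def algebra_simps)
  define r where "r = nf (L 1 j # w) - contract j ?m"
  have r: "r \<in> big_rest J (length w)" unfolding r_def using Cons by simp
  have "nf (L 1 j # y # w) = nf (y # L 1 j # w) + shift_coeff 1 j y \<cdot> nf (L 0 (idx y + j) # w)"
    using exchange[of "[]" "L 1 j" y w] by (simp add: br)
  also have "nf (y # L 1 j # w) = act1 y (nf (L 1 j # w))" using act1_nf[of "L 1 j # w" y] w L1 by simp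
  also have "nf (L 1 j # w) = r + contract j ?m" by (simp add: r_def)
  finally have e: "nf (L 1 j # y # w) = act1 y r + act1 y (contract j ?m) + shift_coeff 1 j y \<cdot> nf (L 0 (idx y + j) # w)"
    by (simp add: act1_add)
  define s where "s y' = shift_coeff 1 j y' * \<Lambda> (basis_L 0 (idx y' + j))" for y'
  have c: "contract j (mset (y # w)) = s y \<cdot> Poly_Mapping.single ?m 1 + (\<Sum>y'\<in>#?m. s y' \<cdot> Poly_Mapping.single (add_mset y ?m - {#y'#}) 1)"
    by (simp add: contract_def s_def)
  have a1: "act1 y r \<in> big_rest J ?l" by (rule act1_big_rest[OF y r])
  have am: "act1 y (\<Sum>y'\<in>#M. f y') = (\<Sum>y'\<in>#M. act1 y (f y'))" for M and f :: "'f block_basis \<Rightarrow> 'f block_basis multiset \<Rightarrow>\<^sub>0 'f"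
    by (induction M) (auto simp: act1_add)
  have dm: "(\<Sum>y'\<in>#M. f y') - (\<Sum>y'\<in>#M. g y') = (\<Sum>y'\<in>#M. f y' - g y')" for M and f g :: "'f block_basis \<Rightarrow> 'f block_basis multiset \<Rightarrow>\<^sub>0 'f"
    by (induction M) auto
  have a2: "act1 y (contract j ?m) - (\<Sum>y'\<in>#?m. s y' \<cdot> Poly_Mapping.single (add_mset y ?m - {#y'#}) 1) \<in> big_rest J ?l"
    unfolding contract_def s_def[symmetric] am dm
  proof (rule sum_mset_closed[OF B])
    fix y' assume y': "y' \<in># ?m"
    have sz: "Suc (size (?m - {#y'#})) = length w" using size_Suc_Diff1[OF y'] by simp
    have e': "add_mset y ?m - {#y'#} = add_mset y (?m - {#y'#})" using y' by simp
    have "set_mset (?m - {#y'#}) \<subseteq> BI - borel" by (rule diff_letters) (use w in simp)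
    from act1_Y_single[OF y this, of 1]
    have "act1 y (Poly_Mapping.single (?m - {#y'#}) 1) - Poly_Mapping.single (add_mset y ?m - {#y'#}) 1 \<in> lower (length w)"
      unfolding e' sz .
    from pm.subspace_scale[OF B lower_big_rest[OF this], of "s y'"]
    show "act1 y (s y' \<cdot> Poly_Mapping.single (?m - {#y'#}) 1) - s y' \<cdot> Poly_Mapping.single (add_mset y ?m - {#y'#}) 1 \<in> big_rest J ?l"
      unfolding act1_scale pm.scale_right_diff_distrib .
  qed
  have "nf (L 0 (idx y + j) # w) - \<Lambda> (basis_L 0 (idx y + j)) \<cdot> Poly_Mapping.single ?m 1 \<in> big_rest J ?l"
    using yi assms(3,4) by (intro nf_L0[OF w(1)]) auto
  from pm.subspace_scale[OF B this, of "shift_coeff 1 j y"]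
  have a3: "shift_coeff 1 j y \<cdot> nf (L 0 (idx y + j) # w) - s y \<cdot> Poly_Mapping.single ?m 1 \<in> big_rest J ?l"
    unfolding s_def pm.scale_right_diff_distrib pm.scale_scale .
  have "nf (L 1 j # y # w) - contract j (mset (y # w)) = act1 y r +
    (act1 y (contract j ?m) - (\<Sum>y'\<in>#?m. s y' \<cdot> Poly_Mapping.single (add_mset y ?m - {#y'#}) 1)) +
    (shift_coeff 1 j y \<cdot> nf (L 0 (idx y + j) # w) - s y \<cdot> Poly_Mapping.single ?m 1)"
    unfolding e c by (simp only: diff_conv_add_uminus minus_add add_ac)
  also have "\<dots> \<in> big_rest J ?l" by (intro pm.subspace_add[OF B] a1 a2 a3)
  finally show ?case by simp
qed

lemma act1_L1_single:
  assumes "j \<ge> -1" "i \<ge> -1" "i + j \<ge> 0"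
  shows "act1 (L 1 j) (Poly_Mapping.single {#L (-1) i#} 1) = (- of_int (i + j + 2) * \<Lambda> (basis_L 0 (i + j))) \<cdot> vac"
proof -
  have b: "L 1 j \<in> borel" "eigenvalue \<Lambda> (L 1 j) = 0" "L 0 (i + j) \<in> borel"
    using assms one_P by (auto simp: borel_def)
  have br: "basis_bracket (L 1 j) (L (-1) i) = Poly_Mapping.single (L 0 (i + j)) (- of_int (i + j + 2))"
    using assms by (simp add: algebra_simps)
  show ?thesis
    unfolding nf_borel_Y[OF b(1) neg_one_letter[OF assms(2)]] b(2) br
    using nf_T[OF b(3)] by simp
qed

definition singular :: "('f block_basis multiset \<Rightarrow>\<^sub>0 'f) set" where
  "singular = {p \<in> homog (-1). \<forall>j\<ge>-1. act1 (L 1 j) p = 0}"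

text \<open>Letters of grade above 1 kill weight -1 because no positive weights occur, and the
  bracket of \<open>L 1 j\<close> with a letter of grade zero is again of grade 1.\<close>

lemma stable_singular: "stable borel singular"
  unfolding stable_def
proof (intro conjI ballI)
  show "pm.subspace singular"
    unfolding singular_def
    by (rule pm.subspaceI)
       (use subspace_homog[of "-1"] in \<open>auto simp: pm.subspace_0 pm.subspace_add pm.subspace_scale act1_add act1_scale\<close>)
  show "singular \<subseteq> carr" by (auto simp: singular_def homog_def)
  fix x p assume x: "x \<in> borel" and p: "p \<in> singular"
  have ph: "p \<in> homog (-1)" and p1: "\<And>j. j \<ge> -1 \<Longrightarrow> act1 (L 1 j) p = 0" and pc: "p \<in> carr"
    using p by (auto simp: singular_def homog_def)
  have zero: "0 \<in> singular" using pm.subspace_0[OF subspace_homog] by (simp add: singular_def)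
  have xBI: "x \<in> BI" using x by (simp add: borel_def)
  show "act1 x p \<in> singular"
  proof (cases "grade x = 0")
    case True
    have h: "act1 x p \<in> homog (-1)" using act1_homog[OF xBI ph] True by simp
    have "act1 (L 1 j) (act1 x p) = 0" if j: "j \<ge> -1" for j
    proof -
      have "act1 (L 1 j) (act1 x p) = act1 x (act1 (L 1 j) p) + lin (\<lambda>z. act1 z p) (basis_bracket (L 1 j) x)"
        by (rule act1_br[OF pc _ xBI]) (use j in simp)
      also have "act1 x (act1 (L 1 j) p) = 0" using p1[OF j] by simp
      also have "lin (\<lambda>z. act1 z p) (basis_bracket (L 1 j) x) = 0"
      proof (cases x)
        case (L \<alpha> k)
        then have a: "\<alpha> = 0" "k \<ge> -1" using True xBI by simp_all
        have br: "basis_bracket (L 1 j) x = Poly_Mapping.single (L 1 (j + k)) (- of_int (k + 1))"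
          using L a by simp
        show ?thesis
        proof (cases "k = -1")
          case False
          then have "act1 (L 1 (j + k)) p = 0" using a j by (intro p1) simp
          then show ?thesis unfolding br by simp
        qed (simp add: br)
      qed simp
      finally show ?thesis by simp
    qed
    then show ?thesis using h by (simp add: singular_def)
  next
    case False
    then have gP: "grade x \<in> P" using x by (simp add: borel_def)
    then obtain i where xi: "x = L (grade x) i" "i \<ge> -1" using False xBI by (cases x) auto
    show ?thesis
    proof (cases "grade x = 1")
      case True
      then have "act1 x p = 0" using p1[OF xi(2)] xi(1) by metis
      then show ?thesis using zero by simp
    next
      case False
      then have "grade x + -1 \<in> P" using discrete_minimal[OF one_P below_one gP] by simp
      then have "act1 x p = 0" by (rule homog_pos[OF _ act1_homog[OF xBI ph]])
      then show ?thesis using zero by simp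
    qed
  qed
qed

text \<open>All weights of the induced subspace are negative, so the generator is not
  reached.\<close>

lemma induced_singular_aug: "induced singular \<subseteq> aug"
  unfolding induced_def
proof (rule pm.span_minimal[OF _ subspace_aug], safe)
  fix w p assume w: "set w \<subseteq> BI - borel" and p: "p \<in> singular"
  then have ph: "p \<in> homog (-1)" by (simp add: singular_def)
  have "act_word w p \<in> homog ((\<Sum>x\<leftarrow>w. grade x) + -1) \<and> - ((\<Sum>x\<leftarrow>w. grade x) + -1) \<in> P"
    using w
  proof (induction w)
    case Nil
    then show ?case using ph one_P by simp
  next
    case (Cons y w)
    then have IH: "act_word w p \<in> homog ((\<Sum>x\<leftarrow>w. grade x) + -1)" "- ((\<Sum>x\<leftarrow>w. grade x) + -1) \<in> P"
      and y: "y \<in> BI" "y \<in> BI - borel" by auto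
    then obtain \<alpha> i where "y = L (- \<alpha>) i" "\<alpha> \<in> P" using Y_iff by blast
    then have g: "- grade y \<in> P" by simp
    have "act1 y (act_word w p) \<in> homog (grade y + ((\<Sum>x\<leftarrow>w. grade x) + -1))" by (rule act1_homog[OF y(1) IH(1)])
    moreover have "- (grade y + ((\<Sum>x\<leftarrow>w. grade x) + -1)) \<in> P" using P_add[OF g IH(2)] by simp
    moreover have "(\<Sum>x\<leftarrow>y # w. grade x) + -1 = grade y + ((\<Sum>x\<leftarrow>w. grade x) + -1)" by simp
    ultimately show ?case unfolding act_word_simps by (simp only:)
  qed
  then have h: "act_word w p \<in> homog ((\<Sum>x\<leftarrow>w. grade x) + -1)" "(\<Sum>x\<leftarrow>w. grade x) + -1 \<noteq> 0" by auto
  have "{#} \<notin> Poly_Mapping.keys (act_word w p)" using h unfolding homog_def by force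
  then show "act_word w p \<in> aug" using h(1) by (simp add: aug_def homog_def in_keys_iff)
qed

text \<open>An element of degree \<open>k \<ge> 2\<close> of a maximal submodule can be lowered by some \<open>L 1 j\<close>; otherwise
  the coefficients of the contractions for large \<open>j\<close> yield a singular vector of weight \<open>-1\<close>.\<close>

lemma weight_minus_one_exists:
  assumes K: "stable BI K" "K \<noteq> {0}" "vac \<notin> K"
    and max: "\<And>N. stable BI N \<Longrightarrow> N \<subseteq> aug \<Longrightarrow> N \<subseteq> K"
  obtains z where "z \<in> K" "z \<noteq> 0" "z \<in> homog (-1)"
proof -
  have ex: "\<exists>k. \<exists>u. good K k u" using good_exists[OF K(1,2)] by metis
  \<comment> \<open>The least degree of a homogeneous element of \<open>K\<close>, so that
    \<open>K\<close> has none of smaller degree.\<close>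
  define k where "k = (LEAST k. \<exists>u. good K k u)"
  have "\<exists>u. good K k u" unfolding k_def using ex by (rule LeastI_ex)
  then obtain u0 where "good K k u0" by blast
  then obtain u where u: "good K k u" and gu: "\<And>m y. m \<in> top_keys k u \<Longrightarrow> y \<in># m \<Longrightarrow> grade y = - 1"
    using discrete_reduction[OF one_P below_one K(1)] by metis
  have least: "\<not> good K k' v" if "k' < k" for k' v using not_less_Least[of k' "\<lambda>k. \<exists>u. good K k u"] that unfolding k_def by blast
  have k0: "k \<noteq> 0" using good_0_vac[OF K(1)] u K(3) by metis
  have uc: "u \<in> carr" and uK: "u \<in> K" and ul: "u \<in> lower (Suc k)" using goodD[OF u] by auto
  obtain m0 where m0: "m0 \<in> top_keys k u" using goodD(4)[OF u] by blast
  then have m0k: "m0 \<in> Poly_Mapping.keys u" "size m0 = k" by (auto simp: top_keys_def)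
  obtain \<gamma> where \<gamma>: "u \<in> homog \<gamma>" using u by (auto simp: good_def)
  obtain y0 where y0: "y0 \<in># m0" using m0k k0 by (metis multiset_nonemptyE size_empty)
  show thesis
  proof (cases "k = 1")
    case True
    then have "m0 = {#y0#}" using m0k y0 by (metis size_1_singleton_mset insert_noteq_member single_eq_single set_mset_single singletonD)
    then have "wt m0 = -1" using gu[OF m0 y0] by simp
    then have "\<gamma> = -1" using \<gamma> m0k by (simp add: homog_def)
    moreover have "u \<noteq> 0"
    proof
      assume "u = 0"
      then have "Poly_Mapping.keys u = {}" by simp
      then show False using m0k by blast
    qed
    ultimately show thesis using that[OF uK] \<gamma> by simp
  next
    case False
    then have k2: "k - 1 < k" "Suc (k - 1) = k" using k0 by auto
    define LS where "LS = (\<Union>m\<in>top_keys k u. set_mset m)"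
    define I where "I = idx ` LS"
    have fin: "finite LS" "finite I" by (simp_all add: LS_def I_def)
    define J where "J = Max (insert 0 I) + 1"
    have "i \<le> Max (insert 0 I)" if "i \<in> insert 0 I" for i using fin that by (intro Max_ge) auto
    from this[of 0] this have J: "J \<ge> 1" "\<And>i. i \<in> I \<Longrightarrow> i < J" by (force simp: J_def)+
    \<comment> \<open>The monomial whose coefficient in \<open>L 1 j u\<close> is followed as
      \<open>j\<close> varies: a top monomial with one letter taken away.\<close>
    define q where "q = m0 - {#y0#}"
    have sq: "Suc (size q) = k" using size_Suc_Diff1[OF y0] m0k by (simp add: q_def)
    have qJ: "idx y < J" if "y \<in># q" for y
      using J(2)[of "idx y"] that m0 in_diffD[of y m0 "{#y0#}"] by (auto simp: q_def I_def LS_def)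
    \<comment> \<open>The weighted number of ways to get \<open>q\<close> from a top monomial of
      \<open>u\<close> by taking away a letter of index \<open>i\<close>.\<close>
    define c where "c i = (\<Sum>m\<in>top_keys k u. Poly_Mapping.lookup u m * (\<Sum>y\<in>#m. if idx y = i \<and> m - {#y#} = q then 1 else 0))" for i
    have letter: "y = L (-1) (idx y)" "idx y \<ge> -1" if "m \<in> top_keys k u" "y \<in># m" for m y
    proof -
      have mk: "m \<in> Poly_Mapping.keys u" using that by (simp add: top_keys_def)
      have "y = L (grade y) (idx y)" by (rule carr_letter(1)[OF uc mk that(2)])
      then show "y = L (-1) (idx y)" unfolding gu[OF that] .
      show "idx y \<ge> -1" by (rule carr_letter(3)[OF uc mk that(2)])
    qed
    have c0: "c (idx y0) \<noteq> 0"
    proof -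
      have e: "idx y = idx y0 \<and> m - {#y#} = q \<longleftrightarrow> m = m0 \<and> y = y0" if "m \<in> top_keys k u" "y \<in># m" for m y
      proof
        assume a: "idx y = idx y0 \<and> m - {#y#} = q"
        have "y = L (-1) (idx y0)" using letter(1)[OF that] unfolding conjunct1[OF a] .
        then have yy: "y = y0" using letter(1)[OF m0 y0] by (rule trans[OF _ sym])
        have "add_mset y (m - {#y#}) = add_mset y0 (m0 - {#y0#})" using a yy by (simp add: q_def)
        then have "m = m0" unfolding insert_DiffM[OF that(2)] insert_DiffM[OF y0] .
        then show "m = m0 \<and> y = y0" using yy by blast
      qed (simp add: q_def)
      have "c (idx y0) = (\<Sum>m\<in>top_keys k u. if m = m0 then Poly_Mapping.lookup u m0 * of_nat (count m0 y0) else 0)"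
        unfolding c_def
      proof (rule sum.cong[OF refl])
        fix m assume m: "m \<in> top_keys k u"
        have "image_mset (\<lambda>y. if idx y = idx y0 \<and> m - {#y#} = q then 1 else 0 :: 'f) m
          = image_mset (\<lambda>y. if m = m0 \<and> y = y0 then 1 else 0) m"
          by (rule image_mset_cong) (simp only: e[OF m])
        moreover have "(\<Sum>y\<in>#M. if y = y0 then 1 else 0 :: 'f) = of_nat (count M y0)" for M
          by (induction M) auto
        ultimately show "Poly_Mapping.lookup u m * (\<Sum>y\<in>#m. if idx y = idx y0 \<and> m - {#y#} = q then 1 else 0) =
          (if m = m0 then Poly_Mapping.lookup u m0 * of_nat (count m0 y0) else 0)"
          by (cases "m = m0") simp_all
      qed
      also have "\<dots> = Poly_Mapping.lookup u m0 * of_nat (count m0 y0)" using m0 by simp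
      finally show ?thesis using m0k y0 by (simp add: in_keys_iff)
    qed
    \<comment> \<open>\<open>L 1 j\<close> moves top letters of grade -1 to grade zero, so the image
      has degree below k, and minimality of k removes the part of degree k - 1 too. The left-hand
      side is the coefficient at \<open>q\<close>; the other contributions lie in
      \<open>big_rest\<close> because \<open>j\<close> is large.\<close>
    have rel: "(\<Sum>i\<in>I. c i * (- of_int (i + j + 2) * \<Lambda> (basis_L 0 (i + j)))) = 0" if j: "j \<ge> J + 2" for j
    proof -
      define v where "v = act1 (L 1 j) u"
      have j2: "j \<ge> 2" "j \<ge> -1" using j J(1) by auto
      have b: "L 1 j \<in> borel" "L 1 j \<in> BI" "eigenvalue \<Lambda> (L 1 j) = 0" using j2 one_P by (auto simp: borel_def)
      have vK: "v \<in> K" unfolding v_def by (rule stableD(3)[OF K(1) b(2) uK])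
      have vh: "v \<in> homog (1 + \<gamma>)" using act1_homog[OF b(2) \<gamma>] by (simp add: v_def)
      have "v \<in> lower (Suc k)" using act1_lower[OF b(2) ul] b(1) by (simp add: v_def)
      moreover have "top_keys k v = {}"
      proof (rule equals0I)
        fix m' assume "m' \<in> top_keys k v"
        then obtain m y where m: "m \<in> top_keys k u" "y \<in># m" "shift 1 j y \<notin> borel"
          using top_keys_act1[OF ul one_P j2(2)] unfolding v_def by metis
        have "idx y + j \<ge> -1" using letter(2)[OF m(1,2)] j2 by simp
        then have "shift 1 j y \<in> borel" using gu[OF m(1,2)] by (simp add: shift_def borel_def)
        then show False using m(3) by blast
      qed
      ultimately have vl: "v \<in> lower k" unfolding lower_iff top_keys_def by (auto simp: less_Suc_eq)
      have "top_keys (k - 1) v = {}"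
      proof (rule ccontr)
        assume "top_keys (k - 1) v \<noteq> {}"
        then have "good K (k - 1) v" using vK vh vl unfolding good_def k2(2) by blast
        then show False using least k2(1) by blast
      qed
      then have v0: "Poly_Mapping.lookup v q = 0" using sq k2 by (auto simp: top_keys_def in_keys_iff)
      have zero: "Poly_Mapping.lookup p q = 0" if "p \<in> big_rest J k" for p
      proof (rule ccontr)
        assume "Poly_Mapping.lookup p q \<noteq> 0"
        then have "q \<in> Poly_Mapping.keys p" by (simp add: in_keys_iff)
        then have "\<exists>y\<in>#q. idx y \<ge> J" using that sq by (auto simp: big_rest_def)
        then show False using qJ by fastforce
      qed
      have low: "Poly_Mapping.lookup (nf (L 1 j # word m)) q = 0" if m: "m \<in> Poly_Mapping.keys u" "size m \<noteq> k" for m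
      proof -
        have mY: "set_mset m \<subseteq> BI - borel" by (rule carr_subset[OF uc m(1)])
        have sm: "size m < k" using ul m by (fastforce simp: lower_iff)
        have "nf (L 1 j # word m) - eigenvalue \<Lambda> (L 1 j) \<cdot> Poly_Mapping.single (mset (word m)) 1 - deriv (L 1 j) (mset (word m)) \<in> lower (length (word m))"
          by (rule nf_cons_leading[OF b(1)]) (use mY in simp)
        then have "nf (L 1 j # word m) - deriv (L 1 j) m \<in> lower (size m)" using b(3) by simp
        then have "nf (L 1 j # word m) - deriv (L 1 j) m \<in> lower (k - 1)" by (rule lower_mono[rotated]) (use sm in simp)
        then have "nf (L 1 j # word m) - deriv (L 1 j) m \<in> big_rest J k" using lower_big_rest k2(2) by metis
        moreover have "deriv (L 1 j) m \<in> big_rest J k"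
        proof -
          have "y = L (grade y) (idx y)" if "y \<in># m" for y by (rule carr_letter(1)[OF uc m(1) that])
          then have d: "deriv (L 1 j) m = (\<Sum>y\<in>#m. if shift 1 j y \<in> borel then 0
              else Poly_Mapping.single (add_mset (shift 1 j y) (m - {#y#})) (shift_coeff 1 j y))" by (rule deriv_L)
          show ?thesis
            unfolding d
          proof (rule sum_mset_closed[OF subspace_big_rest])
            fix y assume y: "y \<in># m"
            have "idx y \<ge> -1" "grade y \<in> \<int>" using carr_letter(3,4)[OF uc m(1) y] by auto
            then have "shift 1 j y \<in> BI" "idx (shift 1 j y) \<ge> J" using j j2 by (auto simp: shift_def)
            moreover have "set_mset (m - {#y#}) \<subseteq> BI - borel" by (rule diff_letters[OF mY])
            moreover have "Suc (size (m - {#y#})) = size m" by (rule size_Suc_Diff1[OF y])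
            ultimately show "(if shift 1 j y \<in> borel then 0
              else Poly_Mapping.single (add_mset (shift 1 j y) (m - {#y#})) (shift_coeff 1 j y)) \<in> big_rest J k"
              using sm by (cases "shift_coeff 1 j y = 0") (auto simp: big_rest_def)
          qed
        qed
        ultimately have "(nf (L 1 j # word m) - deriv (L 1 j) m) + deriv (L 1 j) m \<in> big_rest J k"
          by (rule pm.subspace_add[OF subspace_big_rest])
        then show ?thesis using zero by simp
      qed
      define g where "g i = - of_int (i + j + 2) * \<Lambda> (basis_L 0 (i + j))" for i
      have top: "Poly_Mapping.lookup (nf (L 1 j # word m)) q = (\<Sum>i\<in>I. (\<Sum>y\<in>#m. if idx y = i \<and> m - {#y#} = q then 1 else 0) * g i)"
        if m: "m \<in> top_keys k u" for m
      proof -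
        have mk: "m \<in> Poly_Mapping.keys u" "size m = k" using m by (auto simp: top_keys_def)
        have "nf (L 1 j # word m) - contract j (mset (word m)) \<in> big_rest J (length (word m))"
          using carr_subset[OF uc mk(1)] gu[OF m] j j2 by (intro nf_L1) auto
        then have "nf (L 1 j # word m) - contract j m \<in> big_rest J k" using mk(2) by simp
        then have "Poly_Mapping.lookup (nf (L 1 j # word m)) q = Poly_Mapping.lookup (contract j m) q"
          using zero[of "nf (L 1 j # word m) - contract j m"] by (simp add: lookup_minus)
        also have "\<dots> = (\<Sum>y\<in>#m. if m - {#y#} = q then g (idx y) else 0)"
          unfolding contract_def lookup_sum_mset
        proof (intro arg_cong[where f = sum_mset] image_mset_cong)
          fix y assume y: "y \<in># m"
          have "shift_coeff 1 j y = - of_int (idx y + j + 2)" using gu[OF m y] by (simp add: shift_coeff_def)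
          then show "Poly_Mapping.lookup ((shift_coeff 1 j y * \<Lambda> (basis_L 0 (idx y + j))) \<cdot> Poly_Mapping.single (m - {#y#}) 1) q =
            (if m - {#y#} = q then g (idx y) else 0)"
            by (simp add: g_def lookup_single when_def)
        qed
        also have "\<dots> = (\<Sum>y\<in>#m. \<Sum>i\<in>I. (if idx y = i \<and> m - {#y#} = q then 1 else 0) * g i)"
        proof (intro arg_cong[where f = sum_mset] image_mset_cong)
          fix y assume y: "y \<in># m"
          have yI: "idx y \<in> I" using y m by (auto simp: I_def LS_def)
          have "(\<Sum>i\<in>I. (if idx y = i \<and> m - {#y#} = q then 1 else 0) * g i) = (\<Sum>i\<in>I. if i = idx y then (if m - {#y#} = q then g (idx y) else 0) else 0)"
            by (rule sum.cong) auto
          then show "(if m - {#y#} = q then g (idx y) else 0) = (\<Sum>i\<in>I. (if idx y = i \<and> m - {#y#} = q then 1 else 0) * g i)"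
            using yI fin by simp
        qed
        also have "\<dots> = (\<Sum>i\<in>I. (\<Sum>y\<in>#m. if idx y = i \<and> m - {#y#} = q then 1 else 0) * g i)"
        proof -
          have "(\<Sum>y\<in>#M. \<Sum>i\<in>I. f y i * g i) = (\<Sum>i\<in>I. (\<Sum>y\<in>#M. f y i) * g i)" for f M
            by (induction M) (simp_all add: sum.distrib distrib_right)
          then show ?thesis .
        qed
        finally show ?thesis .
      qed
      have "Poly_Mapping.lookup v q = (\<Sum>m\<in>Poly_Mapping.keys u. Poly_Mapping.lookup u m * Poly_Mapping.lookup (nf (L 1 j # word m)) q)"
        unfolding v_def act1_def lookup_lin ..
      also have "\<dots> = (\<Sum>m\<in>top_keys k u. Poly_Mapping.lookup u m * Poly_Mapping.lookup (nf (L 1 j # word m)) q)"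
        using low by (intro sum.mono_neutral_right) (auto simp: top_keys_def)
      also have "\<dots> = (\<Sum>m\<in>top_keys k u. \<Sum>i\<in>I. Poly_Mapping.lookup u m * (\<Sum>y\<in>#m. if idx y = i \<and> m - {#y#} = q then 1 else 0) * g i)"
        by (rule sum.cong[OF refl]) (simp only: top sum_distrib_left mult.assoc)
      also have "\<dots> = (\<Sum>i\<in>I. c i * g i)"
        unfolding c_def sum_distrib_right by (rule sum.swap)
      finally show ?thesis using v0 by (simp only: g_def)
    qed
    \<comment> \<open>For every j \<ge> -1 the number \<open>s + j\<close> is at least
      \<open>J + 2\<close>, so \<open>rel\<close> shows that each \<open>L 1 j\<close> kills
      \<open>z\<close>.\<close>
    define s where "s = J + 3"
    define z where "z = (\<Sum>i\<in>I. c i \<cdot> Poly_Mapping.single {#L (-1 :: 'f) (i + s)#} 1)"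
    have I1: "i \<ge> -1" if "i \<in> I" for i using that letter(2) by (auto simp: I_def LS_def)
    have sing: "z \<in> singular"
      unfolding singular_def
    proof (intro CollectI conjI allI impI)
      show "z \<in> homog (-1)"
        unfolding z_def
      proof (intro pm.subspace_sum[OF subspace_homog] pm.subspace_scale[OF subspace_homog])
        fix i assume "i \<in> I"
        then have "L (-1) (i + s) \<in> BI - borel" using I1 J(1) by (intro neg_one_letter) (force simp: s_def)
        then show "Poly_Mapping.single {#L (-1) (i + s)#} 1 \<in> homog (-1)" by (simp add: homog_def)
      qed
      fix j :: int assume j: "j \<ge> -1"
      have "act1 (L 1 j) z = (\<Sum>i\<in>I. (c i * (- of_int (i + (s + j) + 2) * \<Lambda> (basis_L 0 (i + (s + j))))) \<cdot> vac)"
        unfolding z_def act1_sum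
      proof (rule sum.cong[OF refl])
        fix i assume "i \<in> I"
        then have i: "i + s \<ge> -1" "i + s + j \<ge> 0" using I1[of i] J(1) j by (simp_all add: s_def)
        have "act1 (L 1 j) (c i \<cdot> Poly_Mapping.single {#L (-1) (i + s)#} 1) = c i \<cdot> (- of_int (i + s + j + 2) * \<Lambda> (basis_L 0 (i + s + j))) \<cdot> vac"
          unfolding act1_scale act1_L1_single[OF j i] ..
        then show "act1 (L 1 j) (c i \<cdot> Poly_Mapping.single {#L (-1) (i + s)#} 1) = (c i * (- of_int (i + (s + j) + 2) * \<Lambda> (basis_L 0 (i + (s + j))))) \<cdot> vac"
          unfolding pm.scale_scale add.assoc .
      qed
      also have "\<dots> = (\<Sum>i\<in>I. c i * (- of_int (i + (s + j) + 2) * \<Lambda> (basis_L 0 (i + (s + j))))) \<cdot> vac"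
        by (rule pm.scale_sum_left[symmetric])
      also have "\<dots> = 0" using rel[of "s + j"] j by (simp only: s_def pm.scale_zero_left)
      finally show "act1 (L 1 j) z = 0" .
    qed
    have y0I: "idx y0 \<in> I" using m0 y0 by (auto simp: I_def LS_def)
    have "Poly_Mapping.lookup z {#L (-1) (idx y0 + s)#} = (\<Sum>i\<in>I. if i = idx y0 then c i else 0)"
      unfolding z_def lookup_sum by (rule sum.cong) (auto simp: lookup_single when_def)
    also have "\<dots> = c (idx y0)" using y0I fin by simp
    finally have "z \<noteq> 0" using c0 by auto
    moreover have "z \<in> K"
      using max[OF stable_induced[OF stable_singular] induced_singular_aug] induced_superset sing by blast
    ultimately show thesis using that[of z] sing by (simp add: singular_def)
  qed
qed

end

section \<open>Generating polynomials for the letters of one grade\<close>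

subsection \<open>Polynomial generating elements\<close>

text \<open>\<open>ell \<alpha> f\<close> is \<open>\<Sum>\<^sub>n f\<^sub>n L \<alpha> (n - 1)\<close>; in this notation the bracket of the
  \<open>L\<close>-parts is \<open>[f, g] = \<beta> f' g - \<alpha> f g'\<close>.\<close>

definition ell :: "'f::field_char_0 \<Rightarrow> 'f poly \<Rightarrow> 'f block_vec" where
  "ell \<alpha> f = (\<Sum>n\<le>degree f. Poly_Mapping.single (L \<alpha> (int n - 1)) (coeff f n))"

lemma ell_superset: "degree f \<le> N \<Longrightarrow> ell \<alpha> f = (\<Sum>n\<le>N. Poly_Mapping.single (L \<alpha> (int n - 1)) (coeff f n))"
  unfolding ell_def by (rule sum.mono_neutral_left) (auto simp: coeff_eq_0)

lemma ell_add: "ell \<alpha> (f + g) = ell \<alpha> f + ell \<alpha> g"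
proof -
  let ?N = "max (degree f) (degree g)"
  have "degree (f + g) \<le> ?N" by (rule degree_add_le_max)
  then show ?thesis by (simp add: ell_superset[of _ ?N] single_add sum.distrib)
qed

lemma ell_zero [simp]: "ell \<alpha> 0 = 0"
  by (simp add: ell_def)

lemma ell_smult: "ell \<alpha> (smult c f) = c \<cdot> ell \<alpha> f"
  by (simp add: ell_superset[OF degree_smult_le] pm.scale_sum_right) (simp add: ell_def pm.scale_sum_right)

lemma ell_monom [simp]: "ell \<alpha> (monom c n) = Poly_Mapping.single (L \<alpha> (int n - 1)) c"
proof (cases "c = 0")
  case False
  have "ell \<alpha> (monom c n) = (\<Sum>k\<le>n. if k = n then Poly_Mapping.single (L \<alpha> (int n - 1)) c else 0)"
    unfolding ell_superset[OF degree_monom_le] by (rule sum.cong) auto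
  then show ?thesis by simp
qed simp

lemma poly_induct_monom [case_names monom add]:
  assumes "\<And>c n. Q (monom c n)" "\<And>f g. Q f \<Longrightarrow> Q g \<Longrightarrow> Q (f + g)"
  shows "Q f"
proof -
  have "Q (\<Sum>i\<in>I. monom (coeff f i) i)" if "finite I" for I
    using that
  proof (induction I rule: finite_induct)
    case empty
    then show ?case using assms(1)[of 0 0] by simp
  qed (simp add: assms)
  from this[of "{..degree f}"] show ?thesis by (simp add: poly_as_sum_of_monoms)
qed

lemma bracket_add: "bracket (x + x') y = bracket x y + bracket x' y" "bracket x (y + y') = bracket x y + bracket x y'"
  by (simp_all add: bracket_lin lin_add lin_fun_add)

text \<open>Matching \<open>L \<alpha> (n - 1)\<close> with t^n turns the factors i + 1 and j + 1 of
  the bracket into derivatives. The assumption excludes the central term.\<close>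

lemma bracket_ell:
  assumes "\<alpha> + \<beta> \<noteq> 0"
  shows "bracket (ell \<alpha> f) (ell \<beta> g) = ell (\<alpha> + \<beta>) (smult \<beta> (pderiv f * g) - smult \<alpha> (f * pderiv g))"
proof (induction f rule: poly_induct_monom)
  case (add f f')
  have "smult \<beta> (pderiv (f + f') * g) - smult \<alpha> ((f + f') * pderiv g) =
    (smult \<beta> (pderiv f * g) - smult \<alpha> (f * pderiv g)) + (smult \<beta> (pderiv f' * g) - smult \<alpha> (f' * pderiv g))"
    by (simp add: pderiv_add distrib_right smult_add_right)
  then show ?case using add by (simp only: ell_add bracket_add)
next
  case (monom a m)
  show ?case
  proof (induction g rule: poly_induct_monom)
    case (add g g')
    have "smult \<beta> (pderiv (monom a m) * (g + g')) - smult \<alpha> (monom a m * pderiv (g + g')) =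
      (smult \<beta> (pderiv (monom a m) * g) - smult \<alpha> (monom a m * pderiv g)) + (smult \<beta> (pderiv (monom a m) * g') - smult \<alpha> (monom a m * pderiv g'))"
      by (simp add: pderiv_add distrib_left smult_add_right)
    then show ?case using add by (simp only: ell_add bracket_add)
  next
    case (monom b n)
    have "\<alpha> \<noteq> - \<beta>" using assms by (metis add.left_inverse)
    then have l: "bracket (ell \<alpha> (monom a m)) (ell \<beta> (monom b n)) =
      Poly_Mapping.single (L (\<alpha> + \<beta>) (int m + int n - 2)) (a * b * (of_nat m * \<beta> - of_nat n * \<alpha>))"
      by (simp add: bracket_lin lin_fun_scale algebra_simps)
    have e: "smult \<beta> (pderiv (monom a m) * monom b n) - smult \<alpha> (monom a m * pderiv (monom b n)) =
      monom (a * b * (of_nat m * \<beta> - of_nat n * \<alpha>)) (m + n - 1)"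
    proof -
      have "monom (of_nat m * a) (m - 1) * monom b n = monom (of_nat m * a * b) (m + n - 1)"
        by (cases m) (simp_all add: mult_monom)
      moreover have "monom a m * monom (of_nat n * b) (n - 1) = monom (of_nat n * a * b) (m + n - 1)"
        by (cases n) (simp_all add: mult_monom algebra_simps)
      ultimately show ?thesis
        by (simp add: pderiv_monom smult_monom diff_monom algebra_simps)
    qed
    show ?case
    proof (cases "m + n = 0")
      case True
      then show ?thesis unfolding l e by simp
    next
      case False
      then have eq: "int (m + n - 1) - 1 = int m + int n - 2" by linarith
      show ?thesis unfolding l e by (simp only: ell_monom eq)
    qed
  qed
qed

section \<open>Ideals of relations in each weight and finite-dimensional weight spaces\<close>

context verma_int
begin

definition gen :: "int \<Rightarrow> 'f poly \<Rightarrow> 'f block_basis multiset \<Rightarrow>\<^sub>0 'f" where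
  "gen m f = lin (\<lambda>x. act1 x vac) (ell (of_int (- m)) f)"

lemma gen_add: "gen m (f + g) = gen m f + gen m g" and gen_smult: "gen m (smult c f) = c \<cdot> gen m f"
  and gen_zero [simp]: "gen m 0 = 0"
  by (simp_all add: gen_def ell_add ell_smult lin_add lin_scale)

lemma gen_monom: "gen m (monom c n) = c \<cdot> act1 (L (of_int (- m)) (int n - 1)) vac"
  by (simp add: gen_def)

lemma gen_sum: "gen m (\<Sum>i\<in>I. g i) = (\<Sum>i\<in>I. gen m (g i))"
  by (induction I rule: infinite_finite_induct) (simp_all add: gen_add)

lemma ell_block_algebra: "ell (of_int m) f \<in> block_algebra \<int>"
proof (induction f rule: poly_induct_monom)
  case (add f g)
  then show ?case by (simp add: ell_add block_algebra_add)
qed simp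

lemma model_act_stable: "stable BI K \<Longrightarrow> u \<in> block_algebra \<int> \<Longrightarrow> p \<in> K \<Longrightarrow> lin (\<lambda>x. act1 x p) u \<in> K"
  by (rule lin_closed[OF stableD(1)]) (auto simp: block_algebra_def intro: stableD(3))

lemma model_act_bracket:
  assumes "x \<in> block_algebra \<int>" "y \<in> block_algebra \<int>" "p \<in> carr"
  shows "lin (\<lambda>s. act1 s p) (bracket x y) =
    lin (\<lambda>s. act1 s (lin (\<lambda>t. act1 t p) y)) x - lin (\<lambda>s. act1 s (lin (\<lambda>t. act1 t p) x)) y"
  using block_module.act_bracket[OF block_module_model, of x y p] assms
  by (simp add: a_minus_def model_a_inv model_act_closed)

text \<open>On \<open>gen m g\<close> the letter \<open>L 0 n\<close> acts as a scalar plus the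
  passage from g to \<open>- m (n + 1) t^n g\<close>. So the polynomials that \<open>gen m\<close>
  sends into \<open>K\<close> form an ideal.\<close>

lemma gen_mult_closed:
  assumes K: "stable BI K" and m: "m \<ge> 1" and g: "gen m g \<in> K"
  shows "gen m (g * h) \<in> K"
proof -
  note sub = stableD(1)[OF K]
  have mono: "gen m (g * monom 1 n) \<in> K" for n
  proof -
    have b: "L 0 (int n) \<in> borel" "L 0 (int n) \<in> BI" by (simp_all add: borel_def)
    have x: "x \<in> BI" if "x \<in> Poly_Mapping.keys (ell (of_int (- m)) g)" for x
      using ell_block_algebra[of "- m" g] that by (auto simp: block_algebra_def)
    have "act1 (L 0 (int n)) (gen m g) = lin (\<lambda>x. act1 (L 0 (int n)) (act1 x vac)) (ell (of_int (- m)) g)"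
      by (simp add: gen_def act1_lin)
    also have "\<dots> = lin (\<lambda>x. eigenvalue \<Lambda> (L 0 (int n)) \<cdot> act1 x vac + lin (\<lambda>z. act1 z vac) (basis_bracket (L 0 (int n)) x)) (ell (of_int (- m)) g)"
    proof (rule lin_cong)
      fix x assume "x \<in> Poly_Mapping.keys (ell (of_int (- m)) g)"
      then have xB: "x \<in> BI" by (rule x)
      show "act1 (L 0 (int n)) (act1 x vac) = eigenvalue \<Lambda> (L 0 (int n)) \<cdot> act1 x vac + lin (\<lambda>z. act1 z vac) (basis_bracket (L 0 (int n)) x)"
        unfolding act1_br[OF vac_carr b(2) xB] act1_vac_T[OF b(1)] act1_scale ..
    qed
    also have "\<dots> = eigenvalue \<Lambda> (L 0 (int n)) \<cdot> gen m g + lin (\<lambda>z. act1 z vac) (bracket (ell 0 (monom 1 (Suc n))) (ell (of_int (- m)) g))"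
      unfolding lin_fun_add lin_fun_scale gen_def[symmetric] ell_monom bracket_lin by (simp add: lin_lin)
    also have "bracket (ell 0 (monom 1 (Suc n))) (ell (of_int (- m)) g) = ell (of_int (- m)) (smult (- of_int m * of_nat (Suc n)) (g * monom 1 n))"
    proof -
      have d: "pderiv (monom 1 (Suc n)) = smult (of_nat (Suc n)) (monom (1 :: 'f) n)"
        by (simp add: pderiv_monom smult_monom)
      have ne: "0 + of_int (- m) \<noteq> (0 :: 'f)" using m by simp
      show ?thesis
        unfolding bracket_ell[OF ne]
        unfolding d mult_smult_left smult_smult smult_0_left diff_zero add_0_left of_int_minus
        by (simp only: mult.commute[of g])
    qed
    also have "lin (\<lambda>z. act1 z vac) \<dots> = (- of_int m * of_nat (Suc n)) \<cdot> gen m (g * monom 1 n)"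
      by (simp only: gen_smult flip: gen_def)
    finally have "(- of_int m * of_nat (Suc n)) \<cdot> gen m (g * monom 1 n) = act1 (L 0 (int n)) (gen m g) - eigenvalue \<Lambda> (L 0 (int n)) \<cdot> gen m g"
      by simp
    also have "\<dots> \<in> K" using stableD(3)[OF K b(2) g] g by (intro pm.subspace_diff[OF sub] pm.subspace_scale[OF sub])
    finally have s: "(- of_int m * of_nat (Suc n)) \<cdot> gen m (g * monom 1 n) \<in> K" .
    have c: "- of_int m * of_nat (Suc n) \<noteq> (0 :: 'f)" using m by (simp del: of_nat_Suc)
    from pm.subspace_scale[OF sub s, of "inverse (- of_int m * of_nat (Suc n))"]
    show ?thesis unfolding pm.scale_scale left_inverse[OF c] pm.scale_one .
  qed
  show ?thesis
  proof (induction h rule: poly_induct_monom)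
    case (monom c n)
    have "g * monom c n = smult c (g * monom 1 n)" by (simp add: smult_monom flip: mult_smult_right)
    then show ?case using pm.subspace_scale[OF sub mono] by (simp only: gen_smult)
  next
    case (add h h')
    then show ?case using pm.subspace_add[OF sub] by (simp add: distrib_left gen_add)
  qed
qed

text \<open>The ideals of relations in the weights \<open>-1\<close> and \<open>-m\<close> multiply into the one of weight
  \<open>-(m + 1)\<close>: compare \<open>[f t, g]\<close> and \<open>[f, g t]\<close>.\<close>

lemma gen_step:
  assumes K: "stable BI K" and m: "m \<ge> 1" and f: "gen 1 f \<in> K" and g: "gen m g \<in> K"
  shows "gen (m + 1) (f * g) \<in> K"
proof -
  note sub = stableD(1)[OF K]
  have R: "gen (m + 1) (smult (of_int (- m)) (pderiv (f * a) * (g * b)) + f * a * pderiv (g * b)) \<in> K" for a b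
  proof -
    let ?x = "ell (of_int (- 1)) (f * a)" and ?y = "ell (of_int (- m)) (g * b)"
    have fa: "gen 1 (f * a) \<in> K" by (rule gen_mult_closed[OF K order_refl f])
    have gb: "gen m (g * b) \<in> K" by (rule gen_mult_closed[OF K m g])
    have ne: "of_int (- 1) + of_int (- m) \<noteq> (0 :: 'f)" using m unfolding of_int_add[symmetric] of_int_eq_0_iff by simp
    have e: "of_int (- 1) + of_int (- m) = (of_int (- (m + 1)) :: 'f)" by simp
    have "lin (\<lambda>s. act1 s vac) (bracket ?x ?y) = lin (\<lambda>s. act1 s (gen m (g * b))) ?x - lin (\<lambda>s. act1 s (gen 1 (f * a))) ?y"
      unfolding gen_def by (rule model_act_bracket[OF ell_block_algebra ell_block_algebra vac_carr])
    also have "\<dots> \<in> K"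
      by (intro pm.subspace_diff[OF sub] model_act_stable[OF K ell_block_algebra] fa gb)
    also have "bracket ?x ?y = ell (of_int (- (m + 1))) (smult (of_int (- m)) (pderiv (f * a) * (g * b)) - smult (of_int (- 1)) (f * a * pderiv (g * b)))"
      unfolding bracket_ell[OF ne] e ..
    also have "smult (of_int (- m)) (pderiv (f * a) * (g * b)) - smult (of_int (- 1)) (f * a * pderiv (g * b)) =
        smult (of_int (- m)) (pderiv (f * a) * (g * b)) + f * a * pderiv (g * b)" by simp
    finally show ?thesis unfolding gen_def .
  qed
  let ?X = "[:0, 1:] :: 'f poly"
  have X: "pderiv ?X = 1" by (simp add: pderiv_pCons)
  \<comment> \<open>\<open>A\<close> gives the factor t to \<open>g\<close> and \<open>B\<close>
    gives it to \<open>f\<close>. In the difference the derivatives of \<open>f\<close> and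
    \<open>g\<close> cancel and \<open>(m + 1) f g\<close> is left.\<close>
  define A where "A = smult (of_int (- m)) (pderiv (f * 1) * (g * ?X)) + f * 1 * pderiv (g * ?X)"
  define B where "B = smult (of_int (- m)) (pderiv (f * ?X) * (g * 1)) + f * ?X * pderiv (g * 1)"
  have "A + smult (- 1) B = smult (of_int (m + 1)) (f * g)"
  proof -
    have c: "smult (of_int (- m)) q = - of_int m * q" for q :: "'f poly" by (simp add: of_int_poly)
    have d: "smult (of_int (m + 1)) q = (of_int m + 1) * q" for q :: "'f poly" by (simp add: of_int_poly smult_add_left distrib_right)
    have n: "smult (- 1) q = - q" for q :: "'f poly" by simp
    show ?thesis unfolding A_def B_def c d n pderiv_mult X by (simp add: algebra_simps del: mult_pCons_left mult_pCons_right)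
  qed
  moreover have "gen (m + 1) (A + smult (- 1) B) \<in> K"
    unfolding gen_add gen_smult by (intro pm.subspace_add[OF sub] pm.subspace_scale[OF sub]) (simp_all only: A_def B_def R)
  ultimately have "of_int (m + 1) \<cdot> gen (m + 1) (f * g) \<in> K" by (simp only: gen_smult)
  then have s: "inverse (of_int (m + 1)) \<cdot> of_int (m + 1) \<cdot> gen (m + 1) (f * g) \<in> K" by (rule pm.subspace_scale[OF sub])
  have c: "of_int (m + 1) \<noteq> (0 :: 'f)" using m unfolding of_int_eq_0_iff by simp
  show ?thesis using s unfolding pm.scale_scale left_inverse[OF c] pm.scale_one .
qed

lemma gen_power:
  assumes "stable BI K" "gen 1 f \<in> K"
  shows "gen (int (Suc n)) (f ^ Suc n) \<in> K"
proof (induction n)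
  case (Suc n)
  from gen_step[OF assms(1) _ assms(2) Suc] show ?case by (simp add: add.commute)
qed (use assms in simp)

text \<open>As 1 is the least positive integer, a monomial of weight -1 consists of one
  letter.\<close>

lemma weight_minus_one_gen:
  assumes z: "z \<in> homog (-1)"
  obtains f where "gen 1 f = z"
proof -
  define I where "I = {i. {#L (-1 :: 'f) i#} \<in> Poly_Mapping.keys z}"
  have inj: "inj (\<lambda>i. {#L (-1 :: 'f) i#})" by (auto simp: inj_def)
  have fin: "finite I" unfolding I_def using finite_vimageI[OF finite_keys inj, of z] by (simp add: vimage_def)
  have zc: "z \<in> carr" using z by (simp add: homog_def)
  have keys: "Poly_Mapping.keys z = (\<lambda>i. {#L (-1) i#}) ` I"
  proof
    show "Poly_Mapping.keys z \<subseteq> (\<lambda>i. {#L (-1) i#}) ` I"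
    proof
      fix m assume m: "m \<in> Poly_Mapping.keys z"
      have w: "wt m = -1" using z m by (simp add: homog_def)
      then have "m \<noteq> {#}" by auto
      then obtain y where y: "y \<in># m" by blast
      have l: "y = L (grade y) (idx y)" "- grade y \<in> P" by (rule carr_letter[OF zc m y])+
      have e: "- wt (m - {#y#}) = 1 - - grade y"
      proof -
        have "grade y + wt (m - {#y#}) = -1" using arg_cong[OF insert_DiffM[OF y], of wt] w by simp
        then show ?thesis by (simp add: eq_neg_iff_add_eq_0 neg_eq_iff_add_eq_0 add_ac)
      qed
      have "m - {#y#} = {#}"
      proof (rule ccontr)
        assume ne: "m - {#y#} \<noteq> {#}"
        have s: "Poly_Mapping.single (m - {#y#}) 1 \<in> carr"
          using diff_letters[OF carr_subset[OF zc m]] by (rule single_carr)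
        have "- wt (m - {#y#}) \<in> P" by (rule wt_P[OF s _ ne]) simp
        then have p: "1 - - grade y \<in> P" unfolding e .
        then show False
        proof (cases "- grade y = 1")
          case True
          then show False using p P_0 by simp
        next
          case False
          then have "- grade y - 1 \<in> P" using discrete_minimal[OF one_P below_one l(2)] by blast
          moreover have eq: "- (1 - - grade y) = - grade y - 1" by simp
          ultimately show False using P_neg[OF p] unfolding eq by blast
        qed
      qed
      then have m': "m = {#y#}" using insert_DiffM[OF y] by simp
      then have g: "grade y = -1" using w by simp
      define i where "i = idx y"
      have "y = L (-1) i" unfolding i_def by (rule l(1)[unfolded g])
      then have mi: "m = {#L (-1) i#}" unfolding m' by (rule arg_cong)
      then show "m \<in> (\<lambda>i. {#L (-1) i#}) ` I" using m unfolding I_def mi by blast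
    qed
  qed (auto simp: I_def)
  define f where "f = (\<Sum>i\<in>I. monom (Poly_Mapping.lookup z {#L (-1) i#}) (nat (i + 1)))"
  have "gen 1 f = (\<Sum>i\<in>I. Poly_Mapping.lookup z {#L (-1) i#} \<cdot> Poly_Mapping.single {#L (-1) i#} 1)"
    unfolding f_def gen_sum
  proof (rule sum.cong[OF refl])
    fix i assume "i \<in> I"
    then have "{#L (-1) i#} \<in> Poly_Mapping.keys z" by (simp add: I_def)
    then have i: "i \<ge> -1" using carr_letter(3)[OF zc, of _ "L (-1) i"] by simp
    then have "int (nat (i + 1)) - 1 = i" by simp
    then have "gen 1 (monom (Poly_Mapping.lookup z {#L (-1) i#}) (nat (i + 1))) = Poly_Mapping.lookup z {#L (-1) i#} \<cdot> act1 (L (-1) i) vac"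
      unfolding gen_monom by simp
    also have "act1 (L (-1) i) vac = nf [L (-1) i]" using act1_nf[of "[]" "L (-1) i"] by simp
    also have "\<dots> = Poly_Mapping.single {#L (-1) i#} 1" by (rule nf_Y[OF neg_one_letter[OF i]])
    finally show "gen 1 (monom (Poly_Mapping.lookup z {#L (-1) i#}) (nat (i + 1))) = Poly_Mapping.lookup z {#L (-1) i#} \<cdot> Poly_Mapping.single {#L (-1) i#} 1" .
  qed
  also have "\<dots> = (\<Sum>m\<in>Poly_Mapping.keys z. Poly_Mapping.lookup z m \<cdot> Poly_Mapping.single m 1)"
    unfolding keys by (subst sum.reindex[OF inj_on_subset[OF inj]]) simp_all
  also have "\<dots> = z" using lin_id[of z] unfolding lin_def .
  finally show thesis by (rule that)
qed

text \<open>Finite dimension modulo \<open>K\<close> is phrased by spanning together with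
  \<open>K\<close>, without forming the quotient.\<close>

definition finite_type :: "('f block_basis multiset \<Rightarrow>\<^sub>0 'f) set \<Rightarrow> ('f block_basis multiset \<Rightarrow>\<^sub>0 'f) \<Rightarrow> bool" where
  "finite_type K p \<longleftrightarrow> (\<forall>m\<ge>1. \<exists>B. finite B \<and> B \<subseteq> carr \<and> (\<forall>i\<ge>-1. act1 (L (of_int (- m)) i) p \<in> pm.span (B \<union> K)))"

lemma finite_type_add:
  assumes "finite_type K p" "finite_type K q"
  shows "finite_type K (p + q)"
  unfolding finite_type_def
proof (intro allI impI)
  fix m :: int assume "m \<ge> 1"
  then obtain B C where B: "finite B" "B \<subseteq> carr" "\<forall>i\<ge>-1. act1 (L (of_int (- m)) i) p \<in> pm.span (B \<union> K)"
    and C: "finite C" "C \<subseteq> carr" "\<forall>i\<ge>-1. act1 (L (of_int (- m)) i) q \<in> pm.span (C \<union> K)"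
    using assms unfolding finite_type_def by metis
  have "pm.span (B \<union> K) \<subseteq> pm.span (B \<union> C \<union> K)" "pm.span (C \<union> K) \<subseteq> pm.span (B \<union> C \<union> K)"
    by (rule pm.span_mono; blast)+
  then have "\<forall>i\<ge>-1. act1 (L (of_int (- m)) i) (p + q) \<in> pm.span (B \<union> C \<union> K)"
    unfolding act1_add using B(3) C(3) by (blast intro: pm.span_add)
  then show "\<exists>B. finite B \<and> B \<subseteq> carr \<and> (\<forall>i\<ge>-1. act1 (L (of_int (- m)) i) (p + q) \<in> pm.span (B \<union> K))"
    using B C by (intro exI[of _ "B \<union> C"]) simp
qed

lemma finite_type_scale:
  assumes "finite_type K p"
  shows "finite_type K (a \<cdot> p)"
  unfolding finite_type_def
proof (intro allI impI)
  fix m :: int assume "m \<ge> 1"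
  then obtain B where B: "finite B" "B \<subseteq> carr" "\<And>i. i \<ge> -1 \<Longrightarrow> act1 (L (of_int (- m)) i) p \<in> pm.span (B \<union> K)"
    using assms unfolding finite_type_def by metis
  show "\<exists>B. finite B \<and> B \<subseteq> carr \<and> (\<forall>i\<ge>-1. act1 (L (of_int (- m)) i) (a \<cdot> p) \<in> pm.span (B \<union> K))"
    unfolding act1_scale by (intro exI[of _ B] conjI allI impI pm.span_scale B)
qed

lemma finite_type_zero: "finite_type K 0"
  unfolding finite_type_def by (intro allI impI exI[of _ "{}"]) (simp add: pm.span_zero)

text \<open>Division with remainder by f^m: multiples of f^m give vectors of \<open>K\<close>, and
  the remainders have bounded degree.\<close>

lemma finite_type_vac:
  assumes K: "stable BI K" and f: "gen 1 f \<in> K" "f \<noteq> 0"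
  shows "finite_type K vac"
  unfolding finite_type_def
proof (intro allI impI)
  fix m :: int assume m: "m \<ge> 1"
  define F where "F = f ^ nat m"
  have "gen m F \<in> K" using gen_power[OF K f(1), of "nat m - 1"] m by (simp add: F_def)
  then have FK: "gen m (F * h) \<in> K" for h by (rule gen_mult_closed[OF K m])
  have F0: "F \<noteq> 0" using f(2) by (simp add: F_def)
  define B where "B = (\<lambda>n. gen m (monom 1 n)) ` {..degree F}"
  have "act1 (L (of_int (- m)) i) vac \<in> pm.span (B \<union> K)" if i: "i \<ge> -1" for i
  proof -
    let ?t = "monom 1 (nat (i + 1)) :: 'f poly"
    have "int (nat (i + 1)) - 1 = i" using i by simp
    then have "act1 (L (of_int (- m)) i) vac = gen m ?t" unfolding gen_monom by simp
    also have "?t = F * (?t div F) + ?t mod F" by simp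
    also have "gen m \<dots> = gen m (F * (?t div F)) + gen m (?t mod F)" by (rule gen_add)
    also have "\<dots> \<in> pm.span (B \<union> K)"
    proof (rule pm.span_add)
      show "gen m (F * (?t div F)) \<in> pm.span (B \<union> K)" using FK by (intro pm.span_base) simp
      have d: "degree (?t mod F) \<le> degree F" using degree_mod_less[OF F0, of ?t] by auto
      have "gen m (?t mod F) = gen m (\<Sum>k\<le>degree (?t mod F). monom (coeff (?t mod F) k) k)"
        by (simp only: poly_as_sum_of_monoms)
      also have "\<dots> = (\<Sum>k\<le>degree (?t mod F). coeff (?t mod F) k \<cdot> gen m (monom 1 k))"
        unfolding gen_sum by (rule sum.cong) (simp_all add: gen_monom)
      also have "\<dots> \<in> pm.span (B \<union> K)"
        by (intro pm.span_sum pm.span_scale pm.span_base) (use d in \<open>auto simp: B_def\<close>)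
      finally show "gen m (?t mod F) \<in> pm.span (B \<union> K)" .
    qed
    finally show ?thesis .
  qed
  moreover have "B \<subseteq> carr"
  proof
    fix b assume "b \<in> B"
    then obtain n where b: "b = gen m (monom 1 n)" by (auto simp: B_def)
    show "b \<in> carr" unfolding b gen_monom pm.scale_one by (rule act1_carr[OF _ vac_carr]) simp
  qed
  ultimately show "\<exists>B. finite B \<and> B \<subseteq> carr \<and> (\<forall>i\<ge>-1. act1 (L (of_int (- m)) i) vac \<in> pm.span (B \<union> K))"
    by (intro exI[of _ B]) (simp add: B_def)
qed

lemma act1_span:
  assumes K: "stable BI K" and y: "y \<in> BI" and B: "\<And>b. b \<in> B \<Longrightarrow> act1 y b \<in> pm.span (B' \<union> K)"
    and p: "p \<in> pm.span (B \<union> K)"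
  shows "act1 y p \<in> pm.span (B' \<union> K)"
proof (rule span_act1_closed[OF _ p])
  fix q assume "q \<in> B \<union> K"
  then show "act1 y q \<in> pm.span (B' \<union> K)"
    using B stableD(3)[OF K y] by (auto intro: pm.span_base)
qed

text \<open>Commuting \<open>L (-m) i\<close> past \<open>L (-l) j\<close> leaves one fixed letter
  acting on a space that is finite-dimensional modulo \<open>K\<close>, and a bracket of grade -(m +
  l) applied to \<open>p\<close>, to which the assumption on \<open>p\<close> applies again.\<close>

lemma finite_type_act1:
  assumes K: "stable BI K" and p: "p \<in> carr" "finite_type K p" and l: "l \<ge> 1" and j: "j \<ge> -1"
  shows "finite_type K (act1 (L (of_int (- l)) j) p)"
  unfolding finite_type_def
proof (intro allI impI)
  fix m :: int assume m: "m \<ge> 1"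
  obtain B where B: "finite B" "B \<subseteq> carr" "\<And>i. i \<ge> -1 \<Longrightarrow> act1 (L (of_int (- m)) i) p \<in> pm.span (B \<union> K)"
    using p(2) m unfolding finite_type_def by metis
  have "m + l \<ge> 1" using m l by simp
  then obtain C where C: "finite C" "C \<subseteq> carr" "\<And>i. i \<ge> -1 \<Longrightarrow> act1 (L (of_int (- (m + l))) i) p \<in> pm.span (C \<union> K)"
    using p(2) unfolding finite_type_def by metis
  let ?y = "L (of_int (- l)) j :: 'f block_basis"
  define E where "E = act1 ?y ` B \<union> C"
  have y: "?y \<in> BI" using j by simp
  have sub: "pm.span (C \<union> K) \<subseteq> pm.span (E \<union> K)" by (rule pm.span_mono) (auto simp: E_def)
  have "act1 (L (of_int (- m)) i) (act1 ?y p) \<in> pm.span (E \<union> K)" if i: "i \<ge> -1" for i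
  proof -
    let ?x = "L (of_int (- m)) i :: 'f block_basis"
    have x: "?x \<in> BI" using i by simp
    have ne: "of_int (- m) \<noteq> - (of_int (- l) :: 'f)"
    proof
      assume "of_int (- m) = - (of_int (- l) :: 'f)"
      then have "of_int (- m) = (of_int l :: 'f)" by simp
      then have "- m = l" by (simp only: of_int_eq_iff)
      then show False using m l by simp
    qed
    define c where "c = of_int (i + 1) * of_int (- l) - of_int (j + 1) * (of_int (- m) :: 'f)"
    have "of_int (- m) + of_int (- l) = (of_int (- (m + l)) :: 'f)" by simp
    then have br: "basis_bracket ?x ?y = Poly_Mapping.single (L (of_int (- (m + l))) (i + j)) c"
      using ne unfolding basis_bracket.simps c_def by (simp only: if_False simp_thms single_zero add_0_right)
    have "act1 ?x (act1 ?y p) = act1 ?y (act1 ?x p) + lin (\<lambda>z. act1 z p) (basis_bracket ?x ?y)"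
      by (rule act1_br[OF p(1) x y])
    also have "lin (\<lambda>z. act1 z p) (basis_bracket ?x ?y) = c \<cdot> act1 (L (of_int (- (m + l))) (i + j)) p"
      unfolding br by simp
    also have "act1 ?y (act1 ?x p) + \<dots> \<in> pm.span (E \<union> K)"
    proof (rule pm.span_add)
      show "act1 ?y (act1 ?x p) \<in> pm.span (E \<union> K)"
        by (rule act1_span[OF K y _ B(3)[OF i]]) (auto simp: E_def intro: pm.span_base)
      show "c \<cdot> act1 (L (of_int (- (m + l))) (i + j)) p \<in> pm.span (E \<union> K)"
      proof (cases "i + j \<ge> -1")
        case True
        then show ?thesis using C(3)[OF True] sub by (blast intro: pm.span_scale)
      next
        \<comment> \<open>Index -2 comes only from two indices -1, where the coefficient
          vanishes.\<close>
        case False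
        then have "i = -1" "j = -1" using i j by simp_all
        then have "c = 0" by (simp add: c_def)
        then show ?thesis by (simp add: pm.span_zero)
      qed
    qed
    finally show ?thesis .
  qed
  moreover have "E \<subseteq> carr" using B(2) C(2) act1_carr[OF y] by (auto simp: E_def)
  moreover have "finite E" using B(1) C(1) by (simp add: E_def)
  ultimately show "\<exists>B. finite B \<and> B \<subseteq> carr \<and> (\<forall>i\<ge>-1. act1 (L (of_int (- m)) i) (act1 ?y p) \<in> pm.span (B \<union> K))"
    by blast
qed

lemma letter_int:
  assumes "y \<in> BI - borel"
  obtains m i where "y = L (of_int (- m)) i" "m \<ge> 1" "i \<ge> -1"
proof -
  obtain \<alpha> i where y: "y = L (- \<alpha>) i" "\<alpha> \<in> P" "i \<ge> -1" using assms Y_iff by blast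
  then obtain m where "m > 0" "\<alpha> = of_int m" using P_int by blast
  then show thesis using that[of m i] y by simp
qed

lemma finite_type_all:
  assumes K: "stable BI K" and f: "gen 1 f \<in> K" "f \<noteq> 0" and p: "p \<in> carr"
  shows "finite_type K p"
  using p
proof (induction rule: carr_induct)
  case (nf w a)
  then have "finite_type K (nf w)"
  proof (induction w)
    case Nil
    then show ?case using finite_type_vac[OF K f] by simp
  next
    case (Cons y w)
    then have w: "set w \<subseteq> BI" and y: "y \<in> BI - borel" by auto
    obtain m i where yi: "y = L (of_int (- m)) i" "m \<ge> 1" "i \<ge> -1" by (rule letter_int[OF y])
    have "nf (y # w) = act1 y (nf w)" by (rule act1_nf[OF w, symmetric])
    then show ?case using finite_type_act1[OF K nf_carr[OF w] _ yi(2,3)] Cons yi(1) by simp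
  qed
  then show ?case by (rule finite_type_scale)
qed (auto intro: finite_type_add finite_type_zero)

text \<open>Strip the first letter, of grade -m. The rest has weight m - n, which by induction is
  spanned modulo \<open>K\<close> by finitely many vectors, and on each of these the letters of
  grade -m have finite type. Only finitely many m occur, since for m > n the rest has positive
  weight and vanishes.\<close>

lemma weight_space_finite_nat:
  assumes K: "stable BI K" and f: "gen 1 f \<in> K" "f \<noteq> 0"
  shows "\<exists>B. finite B \<and> B \<subseteq> carr \<and> homog (- of_nat n) \<subseteq> pm.span (B \<union> K)"
proof (induction n rule: less_induct)
  case (less n)
  show ?case
  proof (cases "n = 0")
    case True
    have "p \<in> pm.span ({vac} \<union> K)" if "p \<in> homog 0" for p
      by (subst homog_0[OF that]) (intro pm.span_scale pm.span_base, simp)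
    then show ?thesis using True by (intro exI[of _ "{vac}"]) auto
  next
    case False
    obtain D where D: "\<And>k. k < n \<Longrightarrow> finite (D k) \<and> D k \<subseteq> carr \<and> homog (- of_nat k) \<subseteq> pm.span (D k \<union> K)"
      using less by metis
    have "\<exists>B. b \<in> carr \<and> m \<ge> (1::int) \<longrightarrow> finite B \<and> B \<subseteq> carr \<and> (\<forall>i\<ge>-1. act1 (L (of_int (- m)) i) b \<in> pm.span (B \<union> K))" for b m
      using finite_type_all[OF K f, of b] unfolding finite_type_def by blast
    then have "\<exists>E. \<forall>b m. b \<in> carr \<and> m \<ge> (1::int) \<longrightarrow> finite (E b m) \<and> E b m \<subseteq> carr \<and> (\<forall>i\<ge>-1. act1 (L (of_int (- m)) i) b \<in> pm.span (E b m \<union> K))"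
      by (intro choice allI)
    then obtain E where E: "\<And>b m. b \<in> carr \<Longrightarrow> m \<ge> (1::int) \<Longrightarrow> finite (E b m) \<and> E b m \<subseteq> carr \<and> (\<forall>i\<ge>-1. act1 (L (of_int (- m)) i) b \<in> pm.span (E b m \<union> K))"
      by blast
    define B where "B = (\<Union>m\<in>{1..n}. \<Union>b\<in>D (n - m). E b (int m))"
    have Dn: "finite (D (n - m))" "D (n - m) \<subseteq> carr" "homog (- of_nat (n - m)) \<subseteq> pm.span (D (n - m) \<union> K)" if "m \<in> {1..n}" for m
      using D[of "n - m"] that by auto
    have Em: "finite (E b (int m))" "E b (int m) \<subseteq> carr" if "m \<in> {1..n}" "b \<in> D (n - m)" for m b
      using E[of b "int m"] Dn(2)[OF that(1)] that by auto
    have fin: "finite B" unfolding B_def using Dn(1) Em(1) by (intro finite_UN_I) auto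
    have Bc: "B \<subseteq> carr" unfolding B_def using Em(2) by blast
    have "p \<in> pm.span (B \<union> K)" if p: "p \<in> homog (- of_nat n)" for p
    proof -
      have pc: "p \<in> carr" using p by (simp add: homog_def)
      have "lin (\<lambda>M. nf (word M)) p \<in> pm.span (B \<union> K)"
      proof (rule lin_closed[OF pm.subspace_span])
        fix M assume M: "M \<in> Poly_Mapping.keys p"
        have wM: "wt M = - of_nat n" using p M by (simp add: homog_def)
        then have "M \<noteq> {#}" using False by auto
        then have "word M \<noteq> []" by (metis length_word list.size(3) size_eq_0_iff_empty)
        then obtain y w where yw: "word M = y # w" by (meson neq_Nil_conv)
        have "set (y # w) \<subseteq> BI - borel" using carr_subset[OF pc M] unfolding yw[symmetric] by simp
        then have y: "y \<in> BI - borel" and w: "set w \<subseteq> BI" by auto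
        obtain m i where yi: "y = L (of_int (- m)) i" "m \<ge> 1" "i \<ge> -1" by (rule letter_int[OF y])
        have nfy: "nf (word M) = act1 y (nf w)" unfolding yw by (rule act1_nf[OF w, symmetric])
        have "grade y + (\<Sum>x\<leftarrow>w. grade x) = - of_nat n" using wM unfolding wt_word[of M, symmetric] yw by simp
        then have sw: "(\<Sum>x\<leftarrow>w. grade x) = of_int (m - int n)" using yi(1) by (simp add: algebra_simps)
        have hw: "nf w \<in> homog (of_int (m - int n))" using nf_homog[OF w] unfolding sw .
        show "nf (word M) \<in> pm.span (B \<union> K)"
        proof (cases "m \<le> int n")
          case True
          define k where "k = nat m"
          have k: "k \<in> {1..n}" "m = int k" using True yi(2) by (auto simp: k_def)
          have "of_int (m - int n) = (- of_nat (n - k) :: 'f)" using k by (simp add: of_nat_diff)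
          then have "nf w \<in> pm.span (D (n - k) \<union> K)" using hw Dn(3)[OF k(1)] by auto
          then show ?thesis
            unfolding nfy
          proof (rule act1_span[OF K DiffD1[OF y], rotated])
            fix b assume b: "b \<in> D (n - k)"
            have "b \<in> carr" using Dn(2)[OF k(1)] b by blast
            then have "act1 y b \<in> pm.span (E b (int k) \<union> K)" using E[of b m] yi k(2) by simp
            moreover have "pm.span (E b (int k) \<union> K) \<subseteq> pm.span (B \<union> K)"
              by (rule pm.span_mono) (use k b in \<open>auto simp: B_def\<close>)
            ultimately show "act1 y b \<in> pm.span (B \<union> K)" by blast
          qed
        next
          case gt: False
          then have "of_int (m - int n) \<in> P" unfolding P_int by (intro exI[of _ "m - int n"]) simp
          then have "nf w = 0" using homog_pos hw by blast
          then show ?thesis unfolding nfy by (simp add: pm.span_zero)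
        qed
      qed
      moreover have "lin (\<lambda>M. nf (word M)) p = lin (\<lambda>M. Poly_Mapping.single M 1) p"
        by (rule lin_cong, rule nf_word, rule carr_subset[OF pc])
      ultimately show ?thesis by simp
    qed
    then show ?thesis using fin Bc by blast
  qed
qed

text \<open>\<open>K\<close> is closed under weight components, so the spanning vectors may be
  projected into the weight space itself.\<close>

lemma weight_space_finite:
  assumes K: "stable BI K" and f: "gen 1 f \<in> K" "f \<noteq> 0" and \<alpha>: "\<alpha> \<in> \<int>"
  shows "\<exists>B. finite B \<and> B \<subseteq> homog \<alpha> \<and> homog \<alpha> \<subseteq> pm.span (B \<union> K)"
proof (cases "\<alpha> \<in> P")
  case True
  then have "homog \<alpha> \<subseteq> {0}" using homog_pos by blast
  then have "homog \<alpha> \<subseteq> pm.span ({} \<union> K)" using pm.span_zero by blast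
  then show ?thesis by (intro exI[of _ "{}"]) simp
next
  case False
  obtain k where k: "\<alpha> = of_int k" using \<alpha> by (auto elim: Ints_cases)
  have "k \<le> 0"
  proof (rule ccontr)
    assume "\<not> k \<le> 0"
    then have "\<alpha> \<in> P" unfolding k P_int by (intro exI[of _ k]) simp
    then show False using False by contradiction
  qed
  then have a: "\<alpha> = - of_nat (nat (- k))" using \<open>k \<le> 0\<close> unfolding k by simp
  obtain B where B: "finite B" "B \<subseteq> carr" "homog \<alpha> \<subseteq> pm.span (B \<union> K)"
    using weight_space_finite_nat[OF K f, of "nat (- k)"] unfolding a[symmetric] by (elim exE conjE)
  have L: "L 0 0 \<in> BI" by simp
  have "comp \<alpha> p \<in> pm.span (comp \<alpha> ` B \<union> K)" if "p \<in> pm.span (B \<union> K)" for p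
    using that
  proof (induction rule: pm.span_induct_alt)
    case base
    then show ?case by (simp add: comp_def pm.span_zero)
  next
    case (step c x y)
    have "comp \<alpha> x \<in> pm.span (comp \<alpha> ` B \<union> K)"
    proof (rule pm.span_base)
      show "comp \<alpha> x \<in> comp \<alpha> ` B \<union> K" using step.hyps(1) comp_stable[OF K L, of x \<alpha>] by blast
    qed
    then show ?case using step by (simp add: comp_add comp_scale pm.span_add pm.span_scale)
  qed
  note span = this
  have "homog \<alpha> \<subseteq> pm.span (comp \<alpha> ` B \<union> K)"
  proof
    fix p assume p: "p \<in> homog \<alpha>"
    then have "p \<in> pm.span (B \<union> K)" using B(3) by blast
    from span[OF this] show "p \<in> pm.span (comp \<alpha> ` B \<union> K)" unfolding comp_eq_self[OF p] .
  qed
  moreover have "comp \<alpha> ` B \<subseteq> homog \<alpha>" using B(2) comp_homog by blast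
  ultimately show ?thesis using B(1) by blast
qed

end

section \<open>Irreducible images of the model: quasifinite exactly when the kernel is
  nonzero\<close>

section \<open>Quasifinite highest weight modules\<close>

lemma additive_finsum:
  assumes A: "abelian_monoid A" and B: "abelian_monoid B"
    and h: "\<And>u. u \<in> carrier A \<Longrightarrow> h u \<in> carrier B" "h \<zero>\<^bsub>A\<^esub> = \<zero>\<^bsub>B\<^esub>"
      "\<And>u v. u \<in> carrier A \<Longrightarrow> v \<in> carrier A \<Longrightarrow> h (u \<oplus>\<^bsub>A\<^esub> v) = h u \<oplus>\<^bsub>B\<^esub> h v"
    and I: "finite I" "f \<in> I \<rightarrow> carrier A"
  shows "h (finsum A f I) = finsum B (\<lambda>i. h (f i)) I"
  using I
proof (induction I rule: finite_induct)
  case empty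
  show ?case using h(2) by (simp add: abelian_monoid.finsum_empty[OF A] abelian_monoid.finsum_empty[OF B])
next
  case (insert x F)
  then have "f x \<in> carrier A" "f \<in> F \<rightarrow> carrier A" "(\<lambda>i. h (f i)) \<in> F \<rightarrow> carrier B" "h (f x) \<in> carrier B"
    using h(1) by auto
  then show ?case using insert h(3) abelian_monoid.finsum_closed[OF A, of f F]
    by (simp add: abelian_monoid.finsum_insert[OF A] abelian_monoid.finsum_insert[OF B])
qed

lemma (in abelian_monoid) finsum_support:
  assumes "finite A" "{i \<in> I. w i \<noteq> \<zero>} \<subseteq> A" "A \<subseteq> I" "w \<in> I \<rightarrow> carrier G"
  shows "(\<Oplus>i\<in>{i \<in> I. w i \<noteq> \<zero>}. w i) = (\<Oplus>i\<in>A. w i)"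
  by (rule add.finprod_mono_neutral_cong_left) (use assms in auto)

lemma block_hom_compose:
  assumes "block_hom G U V f" "block_hom G V W g"
  shows "block_hom G U W (g \<circ> f)"
  using assms by (auto simp: block_hom_def Pi_iff)

lemma isomorphic_modules_inverse:
  assumes V: "block_module G V" and iso: "isomorphic_modules G V W"
  obtains \<psi> where "block_hom G W V \<psi>" "\<psi> ` carrier W = carrier V"
proof -
  interpret V: block_module G V by (rule V)
  obtain \<phi> where bij: "bij_betw \<phi> (carrier V) (carrier W)"
    and \<phi>: "\<forall>u\<in>carrier V. \<forall>v\<in>carrier V. \<phi> (u \<oplus>\<^bsub>V\<^esub> v) = \<phi> u \<oplus>\<^bsub>W\<^esub> \<phi> v"
      "\<forall>a. \<forall>v\<in>carrier V. \<phi> (a \<odot>\<^bsub>V\<^esub> v) = a \<odot>\<^bsub>W\<^esub> \<phi> v"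
      "\<forall>x\<in>block_algebra G. \<forall>v\<in>carrier V. \<phi> (act V x v) = act W x (\<phi> v)"
    using iso unfolding isomorphic_modules_def by auto
  define \<psi> where "\<psi> = inv_into (carrier V) \<phi>"
  have inj: "inj_on \<phi> (carrier V)" and surj: "\<phi> ` carrier V = carrier W"
    using bij by (auto simp: bij_betw_def)
  have \<psi>c: "\<psi> w \<in> carrier V" and \<phi>\<psi>: "\<phi> (\<psi> w) = w" if "w \<in> carrier W" for w
    using that surj unfolding \<psi>_def by (auto intro: inv_into_into f_inv_into_f)
  have \<psi>\<phi>: "\<psi> (\<phi> v) = v" if "v \<in> carrier V" for v
    using that inj unfolding \<psi>_def by simp
  have hom: "block_hom G W V \<psi>"
    unfolding block_hom_def
  proof (intro conjI ballI allI funcsetI)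
    fix u v assume u: "u \<in> carrier W" and v: "v \<in> carrier W"
    show "\<psi> (u \<oplus>\<^bsub>W\<^esub> v) = \<psi> u \<oplus>\<^bsub>V\<^esub> \<psi> v"
      using \<psi>\<phi>[of "\<psi> u \<oplus>\<^bsub>V\<^esub> \<psi> v"] \<phi>(1) \<psi>c \<phi>\<psi> u v by simp
  next
    fix a v assume v: "v \<in> carrier W"
    show "\<psi> (a \<odot>\<^bsub>W\<^esub> v) = a \<odot>\<^bsub>V\<^esub> \<psi> v"
      using \<psi>\<phi>[of "a \<odot>\<^bsub>V\<^esub> \<psi> v"] \<phi>(2) \<psi>c \<phi>\<psi> v by simp
  next
    fix x v assume x: "x \<in> block_algebra G" and v: "v \<in> carrier W"
    show "\<psi> (act W x v) = act V x (\<psi> v)"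
      using \<psi>\<phi>[of "act V x (\<psi> v)"] \<phi>(3) \<psi>c \<phi>\<psi> v x V.act_closed by simp
  qed (rule \<psi>c)
  have sj: "\<psi> ` carrier W = carrier V"
  proof
    show "\<psi> ` carrier W \<subseteq> carrier V" using \<psi>c by blast
    show "carrier V \<subseteq> \<psi> ` carrier W" using \<psi>\<phi> surj by (metis image_eqI subsetI)
  qed
  show thesis by (rule that[OF hom sj])
qed

text \<open>The homomorphism theorem for two surjections with the same kernel: any choice of
  preimages gives the same image under the other map.\<close>

lemma isomorphic_modules_if_kernels_eq:
  assumes V: "block_homomorphism G M V \<theta>" and W: "block_homomorphism G M W \<eta>"
    and surj: "\<theta> ` carrier M = carrier V" "\<eta> ` carrier M = carrier W"
    and ker: "\<And>p. p \<in> carrier M \<Longrightarrow> \<theta> p = \<zero>\<^bsub>V\<^esub> \<longleftrightarrow> \<eta> p = \<zero>\<^bsub>W\<^esub>"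
  shows "isomorphic_modules G V W"
proof -
  interpret V: block_homomorphism G M V \<theta> by (rule V)
  interpret W: block_homomorphism G M W \<eta> by (rule W)
  have eq: "\<theta> p = \<theta> q \<longleftrightarrow> \<eta> p = \<eta> q" if "p \<in> carrier M" "q \<in> carrier M" for p q
  proof -
    have "\<theta> p = \<theta> q \<longleftrightarrow> \<theta> p \<ominus>\<^bsub>V\<^esub> \<theta> q = \<zero>\<^bsub>V\<^esub>"
      using V.hom_simps(1) that V.W.eq_if_minus_zero[of "\<theta> p" "\<theta> q"] by (auto simp: V.W.M.minus_eq V.W.M.r_neg)
    also have "\<dots> \<longleftrightarrow> \<eta> p \<ominus>\<^bsub>W\<^esub> \<eta> q = \<zero>\<^bsub>W\<^esub>"
      using ker[of "p \<ominus>\<^bsub>M\<^esub> q"] that V.hom_minus W.hom_minus by simp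
    also have "\<dots> \<longleftrightarrow> \<eta> p = \<eta> q"
      using W.hom_simps(1) that W.W.eq_if_minus_zero[of "\<eta> p" "\<eta> q"] by (auto simp: W.W.M.minus_eq W.W.M.r_neg)
    finally show ?thesis .
  qed
  define \<phi> where "\<phi> v = \<eta> (inv_into (carrier M) \<theta> v)" for v
  have \<phi>: "\<phi> (\<theta> p) = \<eta> p" if "p \<in> carrier M" for p
  proof -
    have "\<theta> p \<in> \<theta> ` carrier M" using that by blast
    then show ?thesis unfolding \<phi>_def using eq[of "inv_into (carrier M) \<theta> (\<theta> p)" p] that
      by (simp add: inv_into_into f_inv_into_f)
  qed
  have rep: "\<exists>p\<in>carrier M. v = \<theta> p" if "v \<in> carrier V" for v using that surj(1) by blast
  have inj: "inj_on \<phi> (carrier V)"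
    using rep eq \<phi> by (intro inj_onI) metis
  have "\<phi> ` carrier V = carrier W" unfolding surj[symmetric] using \<phi> by (auto simp: image_iff)
  with inj have bij: "bij_betw \<phi> (carrier V) (carrier W)" by (simp add: bij_betw_def)
  show ?thesis
    unfolding isomorphic_modules_def
  proof (intro exI[of _ \<phi>] conjI bij ballI allI)
    fix u v assume "u \<in> carrier V" "v \<in> carrier V"
    then obtain p q where "p \<in> carrier M" "q \<in> carrier M" "u = \<theta> p" "v = \<theta> q" using rep by blast
    then show "\<phi> (u \<oplus>\<^bsub>V\<^esub> v) = \<phi> u \<oplus>\<^bsub>W\<^esub> \<phi> v"
      using \<phi>[of "p \<oplus>\<^bsub>M\<^esub> q"] \<phi> V.hom_simps(2) W.hom_simps(2) by simp
  next
    fix a v assume "v \<in> carrier V"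
    then obtain q where "q \<in> carrier M" "v = \<theta> q" using rep by blast
    then show "\<phi> (a \<odot>\<^bsub>V\<^esub> v) = a \<odot>\<^bsub>W\<^esub> \<phi> v"
      using \<phi>[of "a \<odot>\<^bsub>M\<^esub> q"] \<phi> V.hom_simps(3) W.hom_simps(3) by simp
  next
    fix x v assume x: "x \<in> block_algebra G" and "v \<in> carrier V"
    then obtain q where "q \<in> carrier M" "v = \<theta> q" using rep by blast
    then show "\<phi> (act V x v) = act W x (\<phi> v)"
      using x \<phi>[of "act M x q"] \<phi> V.hom_simps(4) W.hom_simps(4) V.V.act_closed by simp
  qed
qed

text \<open>An irreducible module presented as an image of the model. A highest weight vector
  provides such a presentation, and so does an isomorphism with a quotient of a Verma
  module.\<close>

locale verma_int_image = verma_int \<Lambda> + W: block_module "\<int>" V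
  for \<Lambda> :: "'f::field_char_0 block_vec \<Rightarrow> 'f" and V :: "('f::field_char_0, 'v, 'm) block_mod_scheme" +
  fixes \<Theta>
  assumes hom_\<Theta>: "block_hom \<int> model V \<Theta>"
    and surj_\<Theta>: "\<Theta> ` carr = carrier V"
    and simple: "irreducible_module \<int> V"
begin

sublocale H: block_homomorphism "\<int>" model V \<Theta>
  by (intro block_homomorphism.intro block_module_model W.block_module_axioms block_homomorphism_axioms.intro hom_\<Theta>)

definition ker :: "('f block_basis multiset \<Rightarrow>\<^sub>0 'f) set" where
  "ker = {p \<in> carr. \<Theta> p = \<zero>\<^bsub>V\<^esub>}"

lemma \<Theta>_simps:
  "p \<in> carr \<Longrightarrow> \<Theta> p \<in> carrier V" "p \<in> carr \<Longrightarrow> q \<in> carr \<Longrightarrow> \<Theta> (p + q) = \<Theta> p \<oplus>\<^bsub>V\<^esub> \<Theta> q"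
  "p \<in> carr \<Longrightarrow> \<Theta> (a \<cdot> p) = a \<odot>\<^bsub>V\<^esub> \<Theta> p" "\<Theta> 0 = \<zero>\<^bsub>V\<^esub>"
  "p \<in> carr \<Longrightarrow> u \<in> block_algebra \<int> \<Longrightarrow> \<Theta> (lin (\<lambda>x. act1 x p) u) = act V u (\<Theta> p)"
  using H.hom_simps(1,3)[of p] H.hom_simps(2)[of p q] H.hom_simps(4)[of _ p] H.hom_zero by simp_all

lemma stable_ker: "stable BI ker"
  using H.kernel_submodule block_submodule_model[OF order_refl] by (simp add: ker_def)

lemma \<Theta>_diff_ker: "p \<in> carr \<Longrightarrow> q \<in> carr \<Longrightarrow> p - q \<in> ker \<longleftrightarrow> \<Theta> p = \<Theta> q"
proof -
  assume pq: "p \<in> carr" "q \<in> carr"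
  have m: "p - q \<in> carr" using pm.subspace_diff[OF subspace_carr pq] .
  have "\<Theta> p = \<Theta> (p - q) \<oplus>\<^bsub>V\<^esub> \<Theta> q" using \<Theta>_simps(2)[OF m pq(2)] by simp
  then show ?thesis using m \<Theta>_simps(1)[OF pq(1)] \<Theta>_simps(1)[OF pq(2)] \<Theta>_simps(1)[OF m]
    by (auto simp: ker_def W.M.add.r_cancel_one' W.M.add.l_cancel_one)
qed

lemma vac_ker: "vac \<notin> ker"
proof
  assume "vac \<in> ker"
  then have "ker = carr" by (rule carr_if_vac[OF stable_ker])
  then have "carrier V \<subseteq> {\<zero>\<^bsub>V\<^esub>}" unfolding surj_\<Theta>[symmetric] by (auto simp: ker_def)
  then show False using simple W.M.zero_closed unfolding irreducible_module_def by blast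
qed

text \<open>Otherwise \<Theta> maps \<open>N\<close> onto \<open>V\<close>, so
  \<open>vac - z\<close> lies in the kernel for some \<open>z\<close> in \<open>N\<close>. Its
  component of weight zero is \<open>vac\<close>, because \<open>z\<close> has no constant term; but
  \<open>vac\<close> is not in the kernel.\<close>

lemma ker_maximal:
  assumes N: "stable BI N" "N \<subseteq> aug"
  shows "N \<subseteq> ker"
proof -
  have Nc: "N \<subseteq> carr" by (rule stableD(2)[OF N(1)])
  have "block_submodule \<int> (\<Theta> ` N) V"
    by (rule H.image_submodule[OF _ order_refl]) (use N in \<open>simp add: block_submodule_model\<close>)
  then consider "\<Theta> ` N = {\<zero>\<^bsub>V\<^esub>}" | "\<Theta> ` N = carrier V"
    using simple unfolding irreducible_module_def by blast
  then show ?thesis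
  proof cases
    case 1
    then show ?thesis using Nc by (auto simp: ker_def)
  next
    case 2
    then obtain z where z: "z \<in> N" "\<Theta> vac = \<Theta> z" using \<Theta>_simps(1)[OF vac_carr] by (metis imageE)
    have zc: "z \<in> carr" using z Nc by blast
    have vz: "vac - z \<in> ker" using \<Theta>_diff_ker[OF vac_carr zc] z(2) by blast
    have "comp 0 (vac - z) \<in> ker" by (rule comp_stable[OF stable_ker _ vz]) simp
    moreover have "comp 0 z = Poly_Mapping.lookup (comp 0 z) {#} \<cdot> vac" by (rule homog_0[OF comp_homog[OF zc]])
    then have "comp 0 z = 0" using z(1) N(2) by (auto simp: lookup_comp aug_def)
    moreover have "comp 0 vac = vac" by (rule comp_eq_self) (simp add: homog_def)
    ultimately show ?thesis using vac_ker by (simp add: comp_diff)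
  qed
qed

lemma \<Theta>_sum: "finite A \<Longrightarrow> f ` A \<subseteq> carr \<Longrightarrow> \<Theta> (\<Sum>a\<in>A. f a) = (\<Oplus>\<^bsub>V\<^esub>a\<in>A. \<Theta> (f a))"
proof (induction A rule: finite_induct)
  case (insert x F)
  have "(\<Sum>a\<in>F. f a) \<in> carr" using insert.prems by (intro pm.subspace_sum[OF subspace_carr]) auto
  then show ?case using insert \<Theta>_simps(1) by (simp add: \<Theta>_simps(2) image_subset_iff Pi_iff)
qed (simp add: \<Theta>_simps(4))

lemma image_subspace:
  assumes "pm.subspace N" "N \<subseteq> carr"
  shows "submodule (\<Theta> ` N) base_field V"
proof -
  have N: "p \<in> carr" if "p \<in> N" for p using that assms by blast
  have add: "u \<oplus>\<^bsub>V\<^esub> v \<in> \<Theta> ` N" if "u \<in> \<Theta> ` N" "v \<in> \<Theta> ` N" for u v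
  proof -
    obtain p q where pq: "p \<in> N" "q \<in> N" "u = \<Theta> p" "v = \<Theta> q" using \<open>u \<in> \<Theta> ` N\<close> \<open>v \<in> \<Theta> ` N\<close> by blast
    then show ?thesis using pm.subspace_add[OF assms(1) pq(1,2)] \<Theta>_simps(2)[OF N N, of p q] by (metis image_eqI)
  qed
  have scale: "a \<odot>\<^bsub>V\<^esub> u \<in> \<Theta> ` N" if "u \<in> \<Theta> ` N" for a u
  proof -
    obtain p where pq: "p \<in> N" "u = \<Theta> p" using \<open>u \<in> \<Theta> ` N\<close> by blast
    then show ?thesis using pm.subspace_scale[OF assms(1) pq(1), of a] \<Theta>_simps(3)[OF N, of p a] by (metis image_eqI)
  qed
  show ?thesis
  proof (rule W.submoduleI)
    show "\<Theta> ` N \<subseteq> carrier V" using N \<Theta>_simps(1) by blast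
    show "\<zero>\<^bsub>V\<^esub> \<in> \<Theta> ` N" using pm.subspace_0[OF assms(1)] \<Theta>_simps(4) by (metis image_eqI)
    show "\<ominus>\<^bsub>V\<^esub> u \<in> \<Theta> ` N" if "u \<in> \<Theta> ` N" for u
    proof -
      have "u \<in> carrier V" using that N \<Theta>_simps(1) by blast
      then show ?thesis using scale[OF that, of "-1"] W.smult_minus_one by simp
    qed
  qed (use add scale in auto)
qed

lemma wt_int: "p \<in> carr \<Longrightarrow> m \<in> Poly_Mapping.keys p \<Longrightarrow> wt m \<in> \<int>"
  unfolding wt_def using carr_letter(4) by (intro G_sum_mset) blast

lemma comp_sum: "comp \<gamma> (\<Sum>i\<in>I. f i) = (\<Sum>i\<in>I. comp \<gamma> (f i))"
  by (simp add: comp_def lin_sum)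

text \<open>Two lifts of the same vector differ by an element of the kernel, which is closed under
  weight components.\<close>

lemma decomposition_unique:
  assumes w: "\<And>\<alpha>. \<alpha> \<in> \<int> \<Longrightarrow> w \<alpha> \<in> \<Theta> ` homog \<alpha>" and fin: "finite {\<alpha> \<in> \<int>. w \<alpha> \<noteq> \<zero>\<^bsub>V\<^esub>}"
    and p: "p \<in> carr" "\<Theta> p = (\<Oplus>\<^bsub>V\<^esub>\<alpha>\<in>{\<alpha> \<in> \<int>. w \<alpha> \<noteq> \<zero>\<^bsub>V\<^esub>}. w \<alpha>)" and \<beta>: "\<beta> \<in> \<int>"
  shows "w \<beta> = \<Theta> (comp \<beta> p)"
proof -
  let ?S = "{\<alpha> \<in> \<int>. w \<alpha> \<noteq> \<zero>\<^bsub>V\<^esub>}"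
  have "\<forall>\<alpha>\<in>\<int>. \<exists>q. q \<in> homog \<alpha> \<and> w \<alpha> = \<Theta> q" using w by blast
  then obtain q where q: "\<And>\<alpha>. \<alpha> \<in> \<int> \<Longrightarrow> q \<alpha> \<in> homog \<alpha>" "\<And>\<alpha>. \<alpha> \<in> \<int> \<Longrightarrow> w \<alpha> = \<Theta> (q \<alpha>)" by metis
  have qc: "q \<alpha> \<in> carr" if "\<alpha> \<in> \<int>" for \<alpha> using q(1)[OF that] by (simp add: homog_def)
  have sc: "(\<Sum>\<alpha>\<in>?S. q \<alpha>) \<in> carr" by (intro pm.subspace_sum[OF subspace_carr]) (use qc in auto)
  have "\<Theta> (\<Sum>\<alpha>\<in>?S. q \<alpha>) = (\<Oplus>\<^bsub>V\<^esub>\<alpha>\<in>?S. \<Theta> (q \<alpha>))" by (rule \<Theta>_sum[OF fin]) (use qc in auto)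
  also have "\<dots> = (\<Oplus>\<^bsub>V\<^esub>\<alpha>\<in>?S. w \<alpha>)"
    by (rule W.M.finsum_cong') (use q(2) qc \<Theta>_simps(1) in auto)
  finally have pq: "p - (\<Sum>\<alpha>\<in>?S. q \<alpha>) \<in> ker" using \<Theta>_diff_ker[OF p(1) sc] p(2) by simp
  have "comp \<beta> (p - (\<Sum>\<alpha>\<in>?S. q \<alpha>)) \<in> ker" by (rule comp_stable[OF stable_ker _ pq]) simp
  moreover have "comp \<beta> (\<Sum>\<alpha>\<in>?S. q \<alpha>) = (\<Sum>\<alpha>\<in>?S. if \<alpha> = \<beta> then q \<beta> else 0)"
    unfolding comp_sum
  proof (rule sum.cong[OF refl])
    fix \<alpha> assume "\<alpha> \<in> ?S"
    then have h: "q \<alpha> \<in> homog \<alpha>" using q(1) by blast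
    show "comp \<beta> (q \<alpha>) = (if \<alpha> = \<beta> then q \<beta> else 0)"
      using comp_eq_self[OF h] comp_other[OF h, of \<beta>] by auto
  qed
  ultimately have "comp \<beta> p - (if \<beta> \<in> ?S then q \<beta> else 0) \<in> ker" using fin by (simp add: comp_diff)
  moreover have "comp \<beta> p \<in> carr" using comp_homog[OF p(1)] by (simp add: homog_def)
  moreover have "(if \<beta> \<in> ?S then q \<beta> else 0) \<in> carr" using qc[OF \<beta>] by (simp add: pm.subspace_0[OF subspace_carr])
  ultimately have "\<Theta> (comp \<beta> p) = \<Theta> (if \<beta> \<in> ?S then q \<beta> else 0)" using \<Theta>_diff_ker by blast
  also have "\<dots> = w \<beta>" using q(2)[OF \<beta>] \<beta> \<Theta>_simps(4) by auto
  finally show ?thesis ..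
qed

lemma decomposition_exists:
  assumes p: "p \<in> carr"
  shows "finite {\<alpha> \<in> \<int>. \<Theta> (comp \<alpha> p) \<noteq> \<zero>\<^bsub>V\<^esub>}"
    "\<Theta> p = (\<Oplus>\<^bsub>V\<^esub>\<alpha>\<in>{\<alpha> \<in> \<int>. \<Theta> (comp \<alpha> p) \<noteq> \<zero>\<^bsub>V\<^esub>}. \<Theta> (comp \<alpha> p))"
proof -
  let ?A = "wt ` Poly_Mapping.keys p"
  have c: "comp \<alpha> p \<in> carr" for \<alpha> using comp_homog[OF p] by (simp add: homog_def)
  have sub: "{\<alpha> \<in> \<int>. \<Theta> (comp \<alpha> p) \<noteq> \<zero>\<^bsub>V\<^esub>} \<subseteq> ?A"
  proof
    fix \<alpha> assume "\<alpha> \<in> {\<alpha> \<in> \<int>. \<Theta> (comp \<alpha> p) \<noteq> \<zero>\<^bsub>V\<^esub>}"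
    then have "comp \<alpha> p \<noteq> 0" using \<Theta>_simps(4) by auto
    then have "Poly_Mapping.keys (comp \<alpha> p) \<noteq> {}" by simp
    then show "\<alpha> \<in> ?A" unfolding keys_comp by blast
  qed
  then show "finite {\<alpha> \<in> \<int>. \<Theta> (comp \<alpha> p) \<noteq> \<zero>\<^bsub>V\<^esub>}" by (rule finite_subset) simp
  have "\<Theta> p = \<Theta> (\<Sum>\<gamma>\<in>?A. comp \<gamma> p)" using sum_comp[of p] by simp
  also have "\<dots> = (\<Oplus>\<^bsub>V\<^esub>\<alpha>\<in>?A. \<Theta> (comp \<alpha> p))" by (rule \<Theta>_sum) (use c in auto)
  also have "\<dots> = (\<Oplus>\<^bsub>V\<^esub>\<alpha>\<in>{\<alpha> \<in> \<int>. \<Theta> (comp \<alpha> p) \<noteq> \<zero>\<^bsub>V\<^esub>}. \<Theta> (comp \<alpha> p))"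
    by (rule W.M.finsum_support[symmetric, OF _ sub]) (use wt_int[OF p] c \<Theta>_simps(1) in auto)
  finally show "\<Theta> p = \<dots>" .
qed

text \<open>The grading is the one by weights. The vector of weight -1 in the kernel provides the
  nonzero polynomial f from which the finite dimension of all weight spaces follows.\<close>

lemma quasifinite_if_ker:
  assumes "ker \<noteq> {0}"
  shows "quasifinite \<int> V"
proof -
  obtain z where z: "z \<in> ker" "z \<noteq> 0" "z \<in> homog (-1)"
    by (rule weight_minus_one_exists[OF stable_ker assms vac_ker ker_maximal])
  obtain f where gf: "gen 1 f = z" by (rule weight_minus_one_gen[OF z(3)])
  have f: "gen 1 f \<in> ker" "f \<noteq> 0" using z(1,2) gf gen_zero[of 1] by blast+
  define W where "W \<alpha> = \<Theta> ` homog \<alpha>" for \<alpha>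
  have hc: "homog \<alpha> \<subseteq> carr" for \<alpha> by (auto simp: homog_def)
  have sub: "submodule (W \<alpha>) base_field V" for \<alpha>
    unfolding W_def by (rule image_subspace[OF subspace_homog hc])
  have uniq: "\<exists>!w. w \<in> Pi\<^sub>E \<int> W \<and> finite {\<alpha> \<in> \<int>. w \<alpha> \<noteq> \<zero>\<^bsub>V\<^esub>} \<and>
      v = (\<Oplus>\<^bsub>V\<^esub>\<alpha>\<in>{\<alpha> \<in> \<int>. w \<alpha> \<noteq> \<zero>\<^bsub>V\<^esub>}. w \<alpha>)" if "v \<in> carrier V" for v
  proof -
    have "v \<in> \<Theta> ` carr" unfolding surj_\<Theta> by (rule that)
    then obtain p where p: "p \<in> carr" "v = \<Theta> p" by blast
    define w where "w = restrict (\<lambda>\<alpha>. \<Theta> (comp \<alpha> p)) \<int>"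
    have S: "{\<alpha> \<in> \<int>. w \<alpha> \<noteq> \<zero>\<^bsub>V\<^esub>} = {\<alpha> \<in> \<int>. \<Theta> (comp \<alpha> p) \<noteq> \<zero>\<^bsub>V\<^esub>}" by (auto simp: w_def)
    show ?thesis
    proof (intro ex1I[of _ w] conjI)
      show "w \<in> Pi\<^sub>E \<int> W" unfolding w_def W_def using comp_homog[OF p(1)] by (intro restrict_PiE_iff[THEN iffD2] ballI imageI)
      show "finite {\<alpha> \<in> \<int>. w \<alpha> \<noteq> \<zero>\<^bsub>V\<^esub>}" unfolding S by (rule decomposition_exists[OF p(1)])
      have "(\<Oplus>\<^bsub>V\<^esub>\<alpha>\<in>{\<alpha> \<in> \<int>. w \<alpha> \<noteq> \<zero>\<^bsub>V\<^esub>}. w \<alpha>) = (\<Oplus>\<^bsub>V\<^esub>\<alpha>\<in>{\<alpha> \<in> \<int>. \<Theta> (comp \<alpha> p) \<noteq> \<zero>\<^bsub>V\<^esub>}. \<Theta> (comp \<alpha> p))"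
        unfolding S
      proof (rule W.M.finsum_cong'[OF refl])
        show "(\<lambda>\<alpha>. \<Theta> (comp \<alpha> p)) \<in> {\<alpha> \<in> \<int>. \<Theta> (comp \<alpha> p) \<noteq> \<zero>\<^bsub>V\<^esub>} \<rightarrow> carrier V"
          using comp_homog[OF p(1)] hc by (intro funcsetI \<Theta>_simps(1)) blast
      qed (simp add: w_def)
      then show "v = (\<Oplus>\<^bsub>V\<^esub>\<alpha>\<in>{\<alpha> \<in> \<int>. w \<alpha> \<noteq> \<zero>\<^bsub>V\<^esub>}. w \<alpha>)"
        unfolding p(2) decomposition_exists(2)[OF p(1), symmetric] by (rule sym)
      fix u assume u: "u \<in> Pi\<^sub>E \<int> W \<and> finite {\<alpha> \<in> \<int>. u \<alpha> \<noteq> \<zero>\<^bsub>V\<^esub>} \<and>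
        v = (\<Oplus>\<^bsub>V\<^esub>\<alpha>\<in>{\<alpha> \<in> \<int>. u \<alpha> \<noteq> \<zero>\<^bsub>V\<^esub>}. u \<alpha>)"
      have "u \<beta> = \<Theta> (comp \<beta> p)" if "\<beta> \<in> \<int>" for \<beta>
      proof (rule decomposition_unique[OF _ _ p(1) _ that])
        show "u \<alpha> \<in> \<Theta> ` homog \<alpha>" if "\<alpha> \<in> \<int>" for \<alpha>
          using PiE_mem[of u \<int> W \<alpha>] u that unfolding W_def by blast
        show "finite {\<alpha> \<in> \<int>. u \<alpha> \<noteq> \<zero>\<^bsub>V\<^esub>}" using u by blast
        show "\<Theta> p = (\<Oplus>\<^bsub>V\<^esub>\<alpha>\<in>{\<alpha> \<in> \<int>. u \<alpha> \<noteq> \<zero>\<^bsub>V\<^esub>}. u \<alpha>)" using u unfolding p(2)[symmetric] by blast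
      qed
      moreover have "u \<beta> = undefined" if "\<beta> \<notin> \<int>" for \<beta> using u that PiE_arb by metis
      ultimately show "u = w" unfolding w_def by (intro ext) (simp add: restrict_def)
    qed
  qed
  have gr: "act V x v \<in> W (\<alpha> + \<beta>)" if \<alpha>: "\<alpha> \<in> \<int>" and x: "x \<in> block_grade \<alpha>" and v: "v \<in> W \<beta>" for \<alpha> \<beta> x v
  proof -
    obtain p where p: "p \<in> homog \<beta>" "v = \<Theta> p" using v by (auto simp: W_def)
    have k: "s \<in> BI \<and> grade s = \<alpha>" if "s \<in> Poly_Mapping.keys x" for s
      using x that \<alpha> by (auto simp: block_grade_def split: if_splits)
    then have xa: "x \<in> block_algebra \<int>" by (auto simp: block_algebra_def)
    have h: "lin (\<lambda>s. act1 s p) x \<in> homog (\<alpha> + \<beta>)"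
      by (rule lin_closed[OF subspace_homog]) (use k act1_homog[OF _ p(1)] in blast)
    have "p \<in> carr" using p(1) hc by blast
    then show ?thesis using imageI[OF h, of \<Theta>] \<Theta>_simps(5)[OF _ xa, of p] p(2) unfolding W_def by simp
  qed
  have fin: "\<exists>S. finite S \<and> S \<subseteq> W \<alpha> \<and> linear_span V S = W \<alpha>" if \<alpha>: "\<alpha> \<in> \<int>" for \<alpha>
  proof -
    obtain B where B: "finite B" "B \<subseteq> homog \<alpha>" "homog \<alpha> \<subseteq> pm.span (B \<union> ker)"
      using weight_space_finite[OF stable_ker f \<alpha>] by blast
    have "W \<alpha> \<subseteq> N" if N: "submodule N base_field V" "\<Theta> ` B \<subseteq> N" for N
    proof -
      note NE = W.submoduleE[OF N(1)]
      have Nz: "\<zero>\<^bsub>V\<^esub> \<in> N" by (rule submodule_zero[OF N(1)])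
      have "pm.subspace {p \<in> carr. \<Theta> p \<in> N}"
        using NE(4)[unfolded base_field_simps] NE(5) Nz
        by (intro pm.subspaceI) (simp_all add: \<Theta>_simps subspace_carr pm.subspace_0 pm.subspace_add pm.subspace_scale)
      moreover have "B \<union> ker \<subseteq> {p \<in> carr. \<Theta> p \<in> N}" using B(2) N(2) hc Nz by (auto simp: ker_def)
      ultimately have "pm.span (B \<union> ker) \<subseteq> {p \<in> carr. \<Theta> p \<in> N}" by (intro pm.span_minimal)
      then show ?thesis using B(3) by (auto simp: W_def)
    qed
    moreover have "\<Theta> ` B \<subseteq> W \<alpha>" using B(2) by (auto simp: W_def)
    ultimately have "linear_span V (\<Theta> ` B) = W \<alpha>"
      unfolding linear_span_def using sub[of \<alpha>] by (intro equalityI Inter_lower Inter_greatest) auto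
    then show ?thesis using B(1) \<open>\<Theta> ` B \<subseteq> W \<alpha>\<close> by (intro exI[of _ "\<Theta> ` B"]) simp
  qed
  show ?thesis
    unfolding quasifinite_def
  proof (intro conjI exI[of _ W] ballI)
    show "block_module \<int> V" by (rule W.block_module_axioms)
  qed (rule sub, rule uniq, assumption, rule gr, assumption+, rule fin, assumption)
qed

lemma \<Theta>_act1: "p \<in> carr \<Longrightarrow> x \<in> BI \<Longrightarrow> \<Theta> (act1 x p) = act V (Poly_Mapping.single x 1) (\<Theta> p)"
  using \<Theta>_simps(5)[of p "Poly_Mapping.single x 1"] by simp

text \<open>\<open>L 0 0\<close> takes its eigenvalue on \<open>vac\<close> at weight zero only, and
  that weight space is one-dimensional.\<close>

lemma kernel_vector_multiple:
  assumes inj: "ker = {0}" and p: "p \<in> carr"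
    and e: "act V (basis_L 0 0) (\<Theta> p) = eigenvalue \<Lambda> (L 0 0) \<odot>\<^bsub>V\<^esub> \<Theta> p"
  shows "\<Theta> p = Poly_Mapping.lookup p {#} \<odot>\<^bsub>V\<^esub> \<Theta> vac"
proof -
  have L: "L 0 0 \<in> BI" by simp
  have "\<Theta> (act1 (L 0 0) p) = \<Theta> (eigenvalue \<Lambda> (L 0 0) \<cdot> p)"
    unfolding \<Theta>_act1[OF p L] \<Theta>_simps(3)[OF p] by (rule e)
  then have "act1 (L 0 0) p - eigenvalue \<Lambda> (L 0 0) \<cdot> p \<in> ker"
    using \<Theta>_diff_ker[OF act1_carr[OF L p] pm.subspace_scale[OF subspace_carr p]] by blast
  then have eq: "act1 (L 0 0) p = eigenvalue \<Lambda> (L 0 0) \<cdot> p" unfolding inj by simp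
  have "wt m = 0" if m: "m \<in> Poly_Mapping.keys p" for m
    using arg_cong[OF eq, of "\<lambda>q. Poly_Mapping.lookup q m"] m
    unfolding lookup_act1_L00[OF p] by (simp add: in_keys_iff)
  then have "p \<in> homog 0" using p by (simp add: homog_def)
  from arg_cong[OF homog_0[OF this], of \<Theta>] show ?thesis unfolding \<Theta>_simps(3)[OF vac_carr] .
qed

text \<open>The grading is arbitrary, so the highest weight vector must first be shown homogeneous.
  Since \<open>L 0 0\<close> has degree zero, each component of that vector is an eigenvector with
  the same eigenvalue, hence a multiple of the vector itself. Then all \<open>L (-1) i\<close>
  applied to it lie in one piece of the grading, although they are independent.\<close>

lemma not_quasifinite_if_injective:
  assumes inj: "ker = {0}"
  shows "\<not> quasifinite \<int> V"
proof
  assume "quasifinite \<int> V"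
  from conjunct2[OF this[unfolded quasifinite_def]] obtain W where W: "(\<forall>\<alpha>\<in>\<int>. submodule (W \<alpha>) base_field V) \<and>
      (\<forall>v\<in>carrier V. \<exists>!w. w \<in> Pi\<^sub>E \<int> W \<and> finite {\<alpha> \<in> \<int>. w \<alpha> \<noteq> \<zero>\<^bsub>V\<^esub>} \<and>
        v = (\<Oplus>\<^bsub>V\<^esub>\<alpha>\<in>{\<alpha> \<in> \<int>. w \<alpha> \<noteq> \<zero>\<^bsub>V\<^esub>}. w \<alpha>)) \<and>
      (\<forall>\<alpha>\<in>\<int>. \<forall>\<beta>\<in>\<int>. \<forall>x\<in>block_grade \<alpha>. \<forall>v\<in>W \<beta>. act V x v \<in> W (\<alpha> + \<beta>)) \<and>
      (\<forall>\<alpha>\<in>\<int>. \<exists>S. finite S \<and> S \<subseteq> W \<alpha> \<and> linear_span V S = W \<alpha>)" ..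
  note sub = bspec[OF conjunct1[OF W]] and dec = bspec[OF conjunct1[OF conjunct2[OF W]]]
    and gr0 = conjunct1[OF conjunct2[OF conjunct2[OF W]]] and fd = bspec[OF conjunct2[OF conjunct2[OF conjunct2[OF W]]]]
  have gr: "act V x v \<in> W (\<alpha> + \<beta>)" if "\<alpha> \<in> \<int>" "\<beta> \<in> \<int>" "x \<in> block_grade \<alpha>" "v \<in> W \<beta>" for \<alpha> \<beta> x v
    using gr0 that by blast
  let ?c = "eigenvalue \<Lambda> (L 0 0)" and ?v = "\<Theta> vac" and ?e = "basis_L (0 :: 'f) 0"
  have Wc: "u \<in> carrier V" if "\<alpha> \<in> \<int>" "u \<in> W \<alpha>" for u \<alpha>
    using W.submoduleE(1)[OF sub[OF that(1)]] that(2) by blast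
  have vc: "?v \<in> carrier V" by (rule \<Theta>_simps(1)[OF vac_carr])
  have ea: "?e \<in> block_algebra \<int>" by simp
  have eg: "?e \<in> block_grade 0" unfolding block_grade_0 by auto
  have ev: "act V ?e ?v = ?c \<odot>\<^bsub>V\<^esub> ?v"
  proof -
    have L: "L 0 0 \<in> borel" "L 0 0 \<in> BI" by (simp_all add: borel_def)
    show ?thesis unfolding \<Theta>_act1[OF vac_carr L(2), symmetric] act1_vac_T[OF L(1)] by (rule \<Theta>_simps(3)[OF vac_carr])
  qed
  from ex1_implies_ex[OF dec[OF vc]] obtain w where w': "w \<in> Pi\<^sub>E \<int> W \<and> finite {\<alpha> \<in> \<int>. w \<alpha> \<noteq> \<zero>\<^bsub>V\<^esub>} \<and>
      ?v = (\<Oplus>\<^bsub>V\<^esub>\<alpha>\<in>{\<alpha> \<in> \<int>. w \<alpha> \<noteq> \<zero>\<^bsub>V\<^esub>}. w \<alpha>)"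
    ..
  note w = conjunct1[OF w'] conjunct1[OF conjunct2[OF w']] conjunct2[OF conjunct2[OF w']]
  let ?S = "{\<alpha> \<in> \<int>. w \<alpha> \<noteq> \<zero>\<^bsub>V\<^esub>}"
  have wW: "w \<alpha> \<in> W \<alpha>" if "\<alpha> \<in> \<int>" for \<alpha> by (rule PiE_mem[OF w(1) that])
  have wS: "w \<in> ?S \<rightarrow> carrier V" 
  proof (rule funcsetI)
    fix \<alpha> assume "\<alpha> \<in> ?S"
    then have "\<alpha> \<in> \<int>" by simp
    then show "w \<alpha> \<in> carrier V" using Wc wW by metis
  qed
  define Q where "Q r u \<longleftrightarrow> r \<in> Pi\<^sub>E \<int> W \<and> finite {\<alpha> \<in> \<int>. r \<alpha> \<noteq> \<zero>\<^bsub>V\<^esub>} \<and>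
      u = (\<Oplus>\<^bsub>V\<^esub>\<alpha>\<in>{\<alpha> \<in> \<int>. r \<alpha> \<noteq> \<zero>\<^bsub>V\<^esub>}. r \<alpha>)" for r u
  have Q_unique: "\<exists>!r. Q r u" if "u \<in> carrier V" for u
    unfolding Q_def by (rule dec[OF that])
  \<comment> \<open>An additive map that preserves every piece carries the decomposition of
    \<open>?v\<close> to a decomposition of its image. It is applied to \<open>L 0 0\<close> and to
    multiplication by the eigenvalue, which agree on \<open>?v\<close>.\<close>
  have candidate: "Q (restrict (\<lambda>\<alpha>. k (w \<alpha>)) \<int>) (k ?v)"
    if h: "\<And>u. u \<in> carrier V \<Longrightarrow> k u \<in> carrier V" "k \<zero>\<^bsub>V\<^esub> = \<zero>\<^bsub>V\<^esub>"
      "\<And>u v. u \<in> carrier V \<Longrightarrow> v \<in> carrier V \<Longrightarrow> k (u \<oplus>\<^bsub>V\<^esub> v) = k u \<oplus>\<^bsub>V\<^esub> k v"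
      and hW: "\<And>\<alpha> u. \<alpha> \<in> \<int> \<Longrightarrow> u \<in> W \<alpha> \<Longrightarrow> k u \<in> W \<alpha>" for k
  proof -
    let ?r = "restrict (\<lambda>\<alpha>. k (w \<alpha>)) \<int>"
    let ?R = "{\<alpha> \<in> \<int>. ?r \<alpha> \<noteq> \<zero>\<^bsub>V\<^esub>}"
    have m: "?r \<in> Pi\<^sub>E \<int> W" by (intro restrict_PiE_iff[THEN iffD2] ballI hW wW)
    have RS: "?R \<subseteq> ?S" using h(2) by auto
    have rc: "?r \<alpha> \<in> carrier V" if "\<alpha> \<in> \<int>" for \<alpha> by (rule Wc[OF that PiE_mem[OF m that]])
    have "k ?v = (\<Oplus>\<^bsub>V\<^esub>\<alpha>\<in>?S. k (w \<alpha>))"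
      unfolding w(3) by (rule additive_finsum[OF W.M.abelian_monoid_axioms W.M.abelian_monoid_axioms h w(2) wS])
    also have "\<dots> = (\<Oplus>\<^bsub>V\<^esub>\<alpha>\<in>?S. ?r \<alpha>)"
    proof (rule W.M.finsum_cong'[OF refl])
      show "?r \<in> ?S \<rightarrow> carrier V" by (intro funcsetI rc) simp
    qed simp
    also have "\<dots> = (\<Oplus>\<^bsub>V\<^esub>\<alpha>\<in>?R. ?r \<alpha>)"
      by (rule W.M.finsum_support[OF w(2) RS, symmetric]) (simp, intro funcsetI rc)
    finally show ?thesis unfolding Q_def by (intro conjI m finite_subset[OF RS w(2)])
  qed
  have eigen: "act V ?e (w \<alpha>) = ?c \<odot>\<^bsub>V\<^esub> w \<alpha>" if \<alpha>: "\<alpha> \<in> \<int>" for \<alpha>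
  proof -
    let ?a = "restrict (\<lambda>\<alpha>. act V ?e (w \<alpha>)) \<int>" and ?b = "restrict (\<lambda>\<alpha>. ?c \<odot>\<^bsub>V\<^esub> w \<alpha>) \<int>"
    have cv: "?c \<odot>\<^bsub>V\<^esub> ?v \<in> carrier V" using vc by simp
    have a: "Q ?a (?c \<odot>\<^bsub>V\<^esub> ?v)"
      unfolding ev[symmetric]
    proof (rule candidate[of "act V ?e"])
      show "act V ?e u \<in> W \<alpha>" if "\<alpha> \<in> \<int>" "u \<in> W \<alpha>" for \<alpha> u
        using gr[OF Ints_0 that(1) eg that(2)] by simp
    qed (simp_all add: ea W.act_closed W.act_add_right)
    have b: "Q ?b (?c \<odot>\<^bsub>V\<^esub> ?v)"
    proof (rule candidate[of "\<lambda>u. ?c \<odot>\<^bsub>V\<^esub> u"])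
      show "?c \<odot>\<^bsub>V\<^esub> u \<in> W \<alpha>" if "\<alpha> \<in> \<int>" "u \<in> W \<alpha>" for \<alpha> u
        by (rule W.submoduleE(4)[OF sub[OF that(1)] _ that(2)]) simp
    qed (simp_all add: W.smult_distribs)
    have "?a = ?b" using Q_unique[OF cv] a b by blast
    from fun_cong[OF this, of \<alpha>] show ?thesis using \<alpha> by simp
  qed
  have v0: "?v \<noteq> \<zero>\<^bsub>V\<^esub>" using vac_ker vac_carr by (auto simp: ker_def)
  have "?S \<noteq> {}"
  proof
    assume "?S = {}"
    then have "?v = \<zero>\<^bsub>V\<^esub>" using w(3) by (simp only: W.M.finsum_empty)
    then show False using v0 by contradiction
  qed
  then obtain \<alpha> where \<alpha>: "\<alpha> \<in> \<int>" "w \<alpha> \<noteq> \<zero>\<^bsub>V\<^esub>" by blast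
  have "w \<alpha> \<in> \<Theta> ` carr" unfolding surj_\<Theta> by (rule Wc[OF \<alpha>(1) wW[OF \<alpha>(1)]])
  then obtain p where p: "p \<in> carr" "w \<alpha> = \<Theta> p" by blast
  define c where "c = Poly_Mapping.lookup p {#}"
  have wv: "w \<alpha> = c \<odot>\<^bsub>V\<^esub> ?v"
    unfolding c_def p(2) by (rule kernel_vector_multiple[OF inj p(1)]) (use eigen[OF \<alpha>(1)] p(2) in simp)
  have c0: "c \<noteq> 0" using wv \<alpha>(2) vc by auto
  have "inverse c \<odot>\<^bsub>V\<^esub> w \<alpha> = ?v" 
    unfolding wv using W.smult_assoc1[of "inverse c" c ?v] vc c0 by simp
  moreover have "inverse c \<odot>\<^bsub>V\<^esub> w \<alpha> \<in> W \<alpha>"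
    by (rule W.submoduleE(4)[OF sub[OF \<alpha>(1)] _ wW[OF \<alpha>(1)]]) simp
  ultimately have vW: "?v \<in> W \<alpha>" by simp
  have \<alpha>': "-1 + \<alpha> \<in> \<int>" using \<alpha>(1) by (intro Ints_add) simp_all
  from fd[OF \<alpha>'] obtain S where S': "finite S \<and> S \<subseteq> W (-1 + \<alpha>) \<and> linear_span V S = W (-1 + \<alpha>)" ..
  note S = conjunct1[OF S'] conjunct1[OF conjunct2[OF S']] conjunct2[OF conjunct2[OF S']]
  have "S \<subseteq> \<Theta> ` carr" unfolding surj_\<Theta> using S(2) Wc[OF \<alpha>'] by blast
  then obtain B where B: "B \<subseteq> carr" "finite B" "S = \<Theta> ` B" using finite_subset_image[OF S(1)] by metis
  have Bs: "pm.span B \<subseteq> carr" by (rule pm.span_minimal[OF B(1) subspace_carr])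
  have span: "linear_span V S \<subseteq> \<Theta> ` pm.span B"
    unfolding linear_span_def B(3)
    by (intro Inter_lower CollectI conjI image_subspace[OF pm.subspace_span Bs] image_mono pm.span_superset)
  \<comment> \<open>Elements of the span of the finite set \<open>B\<close> involve only these
    finitely many monomials, whereas the letters of grade -1 need infinitely many.\<close>
  define K0 where "K0 = (\<Union>b\<in>B. Poly_Mapping.keys b)"
  have "pm.span B \<subseteq> {p. \<forall>m\<in>Poly_Mapping.keys p. m \<in> K0}"
    by (rule pm.span_minimal[OF _ subspace_keys]) (auto simp: K0_def)
  moreover have "Poly_Mapping.single {#L (-1 :: 'f) i#} 1 \<in> pm.span B" if i: "i \<ge> -1" for i
  proof -
    have L: "L (-1) i \<in> BI" using i by simp
    have "act1 (L (-1) i) vac = nf [L (-1) i]" using act1_nf[of "[]" "L (-1) i"] by simp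
    also have "\<dots> = Poly_Mapping.single {#L (-1) i#} 1" by (rule nf_Y[OF neg_one_letter[OF i]])
    finally have a: "act1 (L (-1) i) vac = Poly_Mapping.single {#L (-1) i#} 1" .
    have "basis_L (-1) i \<in> block_grade (-1 :: 'f)" using i by (simp add: block_grade_def)
    then have "act V (basis_L (-1) i) ?v \<in> W (-1 + \<alpha>)" by (intro gr[OF _ \<alpha>(1) _ vW]) simp
    then have "\<Theta> (act1 (L (-1) i) vac) \<in> \<Theta> ` pm.span B"
      unfolding \<Theta>_act1[OF vac_carr L] S(3)[symmetric] by (rule subsetD[OF span])
    then obtain q where q: "q \<in> pm.span B" "\<Theta> (act1 (L (-1) i) vac) = \<Theta> q" by blast
    then have "act1 (L (-1) i) vac - q \<in> ker"
      using \<Theta>_diff_ker[OF act1_carr[OF L vac_carr], of q] Bs by blast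
    then show ?thesis using q(1) unfolding inj a by simp
  qed
  ultimately have keys: "Poly_Mapping.keys (Poly_Mapping.single {#L (-1 :: 'f) i#} (1 :: 'f)) \<subseteq> K0" if "i \<ge> -1" for i
    using that by blast
  then have "(\<lambda>i. {#L (-1 :: 'f) i#}) ` {-1..} \<subseteq> K0" by (simp add: image_subset_iff)
  moreover have "finite K0" using B(2) by (simp add: K0_def)
  ultimately have "finite ((\<lambda>i. {#L (-1 :: 'f) i#}) ` {-1..})" by (rule finite_subset)
  then have "finite {-1 :: int ..}" by (rule finite_imageD) (auto simp: inj_on_def)
  then show False by (simp add: infinite_Ici)
qed

lemma quasifinite_iff: "quasifinite \<int> V \<longleftrightarrow> ker \<noteq> {0}"
  using quasifinite_if_ker not_quasifinite_if_injective by blast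

end

section \<open>Assembly of the three statements\<close>

section \<open>The theorem\<close>

lemma verma_int_if_weight: "\<Lambda> \<in> weights \<Longrightarrow> verma_int \<Lambda>"
  by (intro verma_int.intro verma_weight.intro block_order.intro verma_weight_axioms.intro
      additive_subgroup_Ints compatible_order_Ints)

text \<open>In both directions \<open>V\<close> is presented as an image of a model and
  \<open>quasifinite_iff\<close> applies. The quotient may belong to a weight other than the given
  one, and then its own model is used.\<close>

theorem quasifinite_iff_proper_quotient:
  fixes V :: "('f::field_char_0, 'v, 'm) block_mod_scheme"
  assumes irr: "irreducible_module \<int> V" and \<Lambda>: "\<Lambda> \<in> weights" and hw: "highest_weight_module \<int> int_gt \<Lambda> V"
  shows "quasifinite \<int> V \<longleftrightarrow>
    (\<exists>\<Lambda>\<in>weights. \<exists>N. block_submodule \<int> N (verma \<int> int_gt \<Lambda>) \<and> N \<noteq> {\<zero>\<^bsub>verma \<int> int_gt \<Lambda>\<^esub>} \<and>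
       isomorphic_modules \<int> V (quotient_module (verma \<int> int_gt \<Lambda>) N))"
proof
  have V: "block_module \<int> V" using irr by (simp add: irreducible_module_def)
  interpret V: block_module "\<int>" V by (rule V)
  {
    assume qf: "quasifinite \<int> V"
    interpret verma_int \<Lambda> by (rule verma_int_if_weight[OF \<Lambda>])
    obtain v where v: "v \<in> carrier V" "generated_submodule \<int> V {v} = carrier V"
        and pos: "\<forall>\<alpha>\<in>P. \<forall>i\<ge>-1. act V (basis_L \<alpha> i) v = \<zero>\<^bsub>V\<^esub>"
        and zero: "\<forall>h\<in>block_grade 0. act V h v = \<Lambda> h \<odot>\<^bsub>V\<^esub> v"
      using hw unfolding highest_weight_module_def by (elim conjE bexE)
    have eigen: "act V (Poly_Mapping.single t 1) v = eigenvalue \<Lambda> t \<odot>\<^bsub>V\<^esub> v" if t: "t \<in> borel" for t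
    proof (cases "grade t = 0")
      case True
      then have "Poly_Mapping.single t 1 \<in> block_grade 0" "eigenvalue \<Lambda> t = \<Lambda> (Poly_Mapping.single t 1)"
        using t by (cases t; auto simp: borel_def block_grade_0)+
      then show ?thesis using zero by simp
    next
      case False
      then obtain \<alpha> i where ti: "t = L \<alpha> i" "\<alpha> \<in> P" "i \<ge> -1" using t by (cases t) (auto simp: borel_def)
      have "eigenvalue \<Lambda> t = 0" using eigenvalue_grade[of \<Lambda> t] False by blast
      then show ?thesis using pos ti v(1) by simp
    qed
    interpret U: block_pbw_target "\<int>" borel "eigenvalue \<Lambda>" V v
      by (intro block_pbw_target.intro block_pbw_axioms V block_pbw_target_axioms.intro v(1) eigen)
    interpret T: block_homomorphism "\<int>" model V U.univ_map
      by (intro block_homomorphism.intro block_module_model V block_homomorphism_axioms.intro U.univ_map_hom)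
    have "block_submodule \<int> (U.univ_map ` carrier model) V"
      by (rule T.image_submodule[OF block_module.submodule_carrier[OF block_module_model] order_refl])
    then have "generated_submodule \<int> V {v} \<subseteq> U.univ_map ` carr"
      using V.generated_submodule_least[of "\<int>" "U.univ_map ` carr" "{v}"] imageI[OF vac_carr, of U.univ_map]
      by (simp add: U.univ_map_vac)
    then have surj: "U.univ_map ` carr = carrier V" unfolding v(2) using T.hom_simps(1) by auto
    interpret I: verma_int_image \<Lambda> V U.univ_map
      by (intro verma_int_image.intro verma_int_axioms V verma_int_image_axioms.intro U.univ_map_hom surj irr)
    have ne: "I.ker \<noteq> {0}" using I.quasifinite_iff qf by blast
    define N where "N = VM.univ_map ` I.ker"
    have kc: "I.ker \<subseteq> carr" by (auto simp: I.ker_def)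
    have k0: "0 \<in> I.ker" by (rule pm.subspace_0[OF stableD(1)[OF I.stable_ker]])
    have N: "block_submodule \<int> N VM"
      unfolding N_def by (rule VH.image_submodule[OF _ order_refl]) (use I.stable_ker in \<open>simp add: block_submodule_model\<close>)
    obtain z where z: "z \<in> I.ker" "z \<noteq> 0" using ne k0 by blast
    have "N \<noteq> {\<zero>\<^bsub>VM\<^esub>}"
    proof
      assume "N = {\<zero>\<^bsub>VM\<^esub>}"
      then have "VM.univ_map z = VM.univ_map 0" using z(1) VM.univ_map_zero unfolding N_def by blast
      then show False using inj_onD[OF univ_map_inj, of z 0] z kc k0 by blast
    qed
    moreover have "isomorphic_modules \<int> V (quotient_module VM N)"
    proof (rule isomorphic_modules_if_kernels_eq)
      let ?q = "\<lambda>u. N +>\<^bsub>VM\<^esub> u"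
      show "block_homomorphism \<int> model V U.univ_map" by (rule T.block_homomorphism_axioms)
      show "block_homomorphism \<int> model (quotient_module VM N) (?q \<circ> VM.univ_map)"
        by (intro block_homomorphism.intro block_module_model VM.V.quotient_block_module[OF G N]
            block_homomorphism_axioms.intro block_hom_compose[OF VM.univ_map_hom VM.V.quotient_hom(1)[OF N]])
      show "U.univ_map ` carrier model = carrier V" using surj by simp
      show "(?q \<circ> VM.univ_map) ` carrier model = carrier (quotient_module VM N)"
        unfolding VM.V.quotient_hom(2)[OF N] image_comp[symmetric] by (simp add: univ_map_surj)
      fix p assume "p \<in> carrier model"
      then have p: "p \<in> carr" by simp
      have "U.univ_map p = \<zero>\<^bsub>V\<^esub> \<longleftrightarrow> p \<in> I.ker" using p by (simp add: I.ker_def)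
      also have "\<dots> \<longleftrightarrow> VM.univ_map p \<in> N"
        unfolding N_def by (rule inj_on_image_mem_iff[OF univ_map_inj p kc, symmetric])
      also have "\<dots> \<longleftrightarrow> (?q \<circ> VM.univ_map) p = \<zero>\<^bsub>quotient_module VM N\<^esub>"
        using VM.V.quotient_zero_iff[OF N VM.univ_map_closed[of p]] by simp
      finally show "U.univ_map p = \<zero>\<^bsub>V\<^esub> \<longleftrightarrow> (?q \<circ> VM.univ_map) p = \<zero>\<^bsub>quotient_module VM N\<^esub>" .
    qed
    ultimately show "\<exists>\<Lambda>\<in>weights. \<exists>N. block_submodule \<int> N (verma \<int> int_gt \<Lambda>) \<and> N \<noteq> {\<zero>\<^bsub>verma \<int> int_gt \<Lambda>\<^esub>} \<and>
       isomorphic_modules \<int> V (quotient_module (verma \<int> int_gt \<Lambda>) N)"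
      using \<Lambda> N by blast
  next
    assume "\<exists>\<Lambda>\<in>weights. \<exists>N. block_submodule \<int> N (verma \<int> int_gt \<Lambda>) \<and> N \<noteq> {\<zero>\<^bsub>verma \<int> int_gt \<Lambda>\<^esub>} \<and>
       isomorphic_modules \<int> V (quotient_module (verma \<int> int_gt \<Lambda>) N)"
    then obtain M N where M: "M \<in> weights" and N: "block_submodule \<int> N (verma \<int> int_gt M)"
      and N0: "N \<noteq> {\<zero>\<^bsub>verma \<int> int_gt M\<^esub>}"
      and iso: "isomorphic_modules \<int> V (quotient_module (verma \<int> int_gt M) N)"
      by (elim bexE exE conjE)
    interpret verma_int M by (rule verma_int_if_weight[OF M])
    let ?q = "\<lambda>u. N +>\<^bsub>VM\<^esub> u"
    have Q: "block_module \<int> (quotient_module VM N)" by (rule VM.V.quotient_block_module[OF G N])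
    obtain \<psi> where \<psi>: "block_hom \<int> (quotient_module VM N) V \<psi>" "\<psi> ` carrier (quotient_module VM N) = carrier V"
      by (rule isomorphic_modules_inverse[OF V iso])
    let ?\<Theta> = "\<psi> \<circ> (?q \<circ> VM.univ_map)"
    have hom: "block_hom \<int> model V ?\<Theta>"
      by (intro block_hom_compose[OF block_hom_compose[OF VM.univ_map_hom VM.V.quotient_hom(1)[OF N]] \<psi>(1)])
    have surj: "?\<Theta> ` carr = carrier V"
      unfolding image_comp[symmetric] univ_map_surj VM.V.quotient_hom(2)[OF N, symmetric] by (rule \<psi>(2))
    interpret I: verma_int_image M V ?\<Theta>
      by (intro verma_int_image.intro verma_int_axioms V verma_int_image_axioms.intro hom surj irr)
    note ND = VM.V.block_submoduleD[OF N]
    obtain y where y: "y \<in> N" "y \<noteq> \<zero>\<^bsub>VM\<^esub>" using N0 ND(2) by blast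
    then have "y \<in> VM.univ_map ` carr" using ND(1) unfolding univ_map_surj by blast
    then obtain p where p: "p \<in> carr" "y = VM.univ_map p" by blast
    interpret \<psi>: block_homomorphism "\<int>" "quotient_module VM N" V \<psi>
      by (intro block_homomorphism.intro Q V block_homomorphism_axioms.intro \<psi>(1))
    have "?q y = \<zero>\<^bsub>quotient_module VM N\<^esub>"
      using VM.V.quotient_zero_iff[OF N VM.univ_map_closed[of p]] y(1) unfolding p(2) by blast
    then have "?\<Theta> p = \<zero>\<^bsub>V\<^esub>" using \<psi>.hom_zero by (simp add: p(2))
    then have "p \<in> I.ker" using p(1) by (simp add: I.ker_def)
    moreover have "p \<noteq> 0" using y(2) VM.univ_map_zero unfolding p(2) by metis
    ultimately show "quasifinite \<int> V" unfolding I.quasifinite_iff by blast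
  }
qed

context verma_weight
begin

lemma verma_trivial:
  assumes zero: "\<And>h. h \<in> block_grade 0 \<Longrightarrow> \<Lambda> h = 0" and x: "x \<in> borel"
  shows "eigenvalue \<Lambda> x = 0"
proof (cases "grade x = 0")
  case True
  then have "Poly_Mapping.single x 1 \<in> block_grade 0" "eigenvalue \<Lambda> x = \<Lambda> (Poly_Mapping.single x 1)"
    using x by (cases x; auto simp: borel_def block_grade_0)+
  then show ?thesis using zero by simp
next
  case False
  then show ?thesis using eigenvalue_grade[of \<Lambda> x] by (rule contrapos_np)
qed

text \<open>A positive grade supplies a negative letter; for G = {0} the model is spanned by
  \<open>vac\<close> and \<open>aug\<close> is zero.\<close>

lemma aug_proper:
  assumes "P \<noteq> {}"
  shows "aug \<noteq> {0}" "aug \<noteq> carr"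
proof -
  obtain \<alpha> where "\<alpha> \<in> P" using assms by blast
  then have "L (- \<alpha>) 0 \<in> BI - borel" unfolding Y_iff by (intro exI[of _ \<alpha>] exI[of _ 0]) simp
  from letter_aug[OF this] show "aug \<noteq> {0}" using single_letter_nonzero by (metis singletonD)
  show "aug \<noteq> carr" using vac_not_aug vac_carr by metis
qed

lemma verma_dense:
  assumes "P \<noteq> {}" "\<And>x. x \<in> P \<Longrightarrow> pos_below G gt x \<noteq> {}"
  shows "irreducible_module G VM \<longleftrightarrow> (\<exists>h\<in>block_grade 0. \<Lambda> h \<noteq> 0)"
proof
  assume irr: "irreducible_module G VM"
  show "\<exists>h\<in>block_grade 0. \<Lambda> h \<noteq> 0"
  proof (rule ccontr)
    assume "\<not> ?thesis"
    then have zero: "\<And>h. h \<in> block_grade 0 \<Longrightarrow> \<Lambda> h = 0" by blast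
    have "stable BI aug" by (rule stable_aug[OF verma_trivial[OF zero]])
    then show False using irr aug_proper[OF assms(1)] unfolding irreducible_verma_iff by metis
  qed
next
  assume "\<exists>h\<in>block_grade 0. \<Lambda> h \<noteq> 0"
  then obtain h where h: "h \<in> block_grade 0" "\<Lambda> h \<noteq> 0" by (rule bexE)
  show "irreducible_module G VM" by (rule dense_irreducible[OF assms(2) h])
qed

lemma verma_aug_dense:
  assumes ne: "P \<noteq> {}" and dense: "\<And>x. x \<in> P \<Longrightarrow> pos_below G gt x \<noteq> {}"
    and zero: "\<And>h. h \<in> block_grade 0 \<Longrightarrow> \<Lambda> h = 0"
  shows "block_submodule G (VM.univ_map ` aug) VM \<and> irreducible_module G (VM\<lparr>carrier := VM.univ_map ` aug\<rparr>) \<longleftrightarrow>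
    (\<forall>x\<in>P. \<forall>y\<in>P. \<exists>n::nat. n > 0 \<and> gt (of_nat n * x) y)"
proof -
  note triv = verma_trivial[OF zero]
  have st: "stable BI aug" by (rule stable_aug[OF triv])
  have "block_submodule G (VM.univ_map ` aug) VM"
    by (rule VH.image_submodule[OF _ order_refl]) (use st in \<open>simp add: block_submodule_model\<close>)
  moreover have "(\<forall>N. stable BI N \<and> N \<subseteq> aug \<longrightarrow> N = {0} \<or> N = aug) \<longleftrightarrow>
    (\<forall>x\<in>P. \<forall>y\<in>P. \<exists>n::nat. n > 0 \<and> gt (of_nat n * x) y)"
  proof
    assume irr: "\<forall>N. stable BI N \<and> N \<subseteq> aug \<longrightarrow> N = {0} \<or> N = aug"
    show "\<forall>x\<in>P. \<forall>y\<in>P. \<exists>n::nat. n > 0 \<and> gt (of_nat n * x) y"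
    proof (rule ccontr)
      assume "\<not> ?thesis"
      then obtain x y where xy: "x \<in> P" "y \<in> P" "\<And>n::nat. n > 0 \<Longrightarrow> \<not> gt (of_nat n * x) y" by blast
      obtain N where "stable BI N" "N \<subseteq> aug" "N \<noteq> {0}" "N \<noteq> aug" by (rule nonarchimedean_aug[OF triv xy])
      then show False using spec[OF irr, of N] by simp
    qed
  next
    assume arch: "\<forall>x\<in>P. \<forall>y\<in>P. \<exists>n::nat. n > 0 \<and> gt (of_nat n * x) y"
    show "\<forall>N. stable BI N \<and> N \<subseteq> aug \<longrightarrow> N = {0} \<or> N = aug"
    proof (intro allI impI)
      fix N assume N: "stable BI N \<and> N \<subseteq> aug"
      have "N = aug" if "N \<noteq> {0}"
      proof (rule archimedean_aug[OF dense triv _ _ _ that])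
        show "\<exists>n::nat. n > 0 \<and> gt (of_nat n * x) y" if "x \<in> P" "y \<in> P" for x y
          using bspec[OF bspec[OF arch that(1)] that(2)] .
      qed (use N in simp_all)
      then show "N = {0} \<or> N = aug" by blast
    qed
  qed
  ultimately show ?thesis
    unfolding irreducible_image_iff[OF order_refl st] using aug_proper(1)[OF ne] by simp
qed

end

theorem theorem1p1:
  fixes G :: "'f::field_char_0 set" and gt :: "'f \<Rightarrow> 'f \<Rightarrow> bool"
  assumes G: "additive_subgroup G base_field"
    and gt: "compatible_order G gt"
  shows
    "(\<forall>V :: ('f, 'v) block_mod.
        irreducible_module \<int> V \<and> (\<exists>\<Lambda>\<in>weights. highest_weight_module \<int> int_gt \<Lambda> V) \<longrightarrow>
        (quasifinite \<int> V \<longleftrightarrow>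
          (\<exists>\<Lambda>\<in>weights. \<exists>N. block_submodule \<int> N (verma \<int> int_gt \<Lambda>) \<and>
             N \<noteq> {\<zero>\<^bsub>verma \<int> int_gt \<Lambda>\<^esub>} \<and>
             isomorphic_modules \<int> V (quotient_module (verma \<int> int_gt \<Lambda>) N))))
     \<and>
     (G \<noteq> {0} \<and> dense_order G gt \<longrightarrow>
        (\<forall>\<Lambda>\<in>weights. irreducible_module G (verma G gt \<Lambda>) \<longleftrightarrow> (\<exists>h\<in>block_grade 0. \<Lambda> h \<noteq> 0)) \<and>
        (block_submodule G (verma0_prime G gt) (verma G gt (\<lambda>_. 0)) \<and>
         irreducible_module G ((verma G gt (\<lambda>_. 0))\<lparr>carrier := verma0_prime G gt\<rparr>) \<longleftrightarrow>
         (\<forall>x\<in>pos_part G gt. \<forall>y\<in>pos_part G gt. \<exists>n::nat. n > 0 \<and> gt (of_nat n * x) y)))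
     \<and>
     (\<forall>a\<in>pos_part G gt. pos_below G gt a = {} \<longrightarrow>
        (\<forall>\<Lambda>\<in>weights. irreducible_module G (verma G gt \<Lambda>) \<longleftrightarrow>
           irreducible_module (int_multiples a) (verma_sub G gt a \<Lambda>)))"
proof (intro conjI allI impI ballI)
  fix V :: "('f, 'v) block_mod"
  assume "irreducible_module \<int> V \<and> (\<exists>\<Lambda>\<in>weights. highest_weight_module \<int> int_gt \<Lambda> V)"
  then obtain \<Lambda> where "irreducible_module \<int> V" "\<Lambda> \<in> weights" "highest_weight_module \<int> int_gt \<Lambda> V" by blast
  then show "quasifinite \<int> V \<longleftrightarrow>
          (\<exists>\<Lambda>\<in>weights. \<exists>N. block_submodule \<int> N (verma \<int> int_gt \<Lambda>) \<and>
             N \<noteq> {\<zero>\<^bsub>verma \<int> int_gt \<Lambda>\<^esub>} \<and>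
             isomorphic_modules \<int> V (quotient_module (verma \<int> int_gt \<Lambda>) N))"
    by (rule quasifinite_iff_proper_quotient)
next
  interpret block_order G gt by (rule block_order.intro[OF G gt])
  {
    assume A: "G \<noteq> {0} \<and> dense_order G gt"
    have dense: "pos_below G gt x \<noteq> {}" if "x \<in> P" for x
      using A that unfolding dense_order_def by (metis finite.emptyI)
    obtain x where x: "x \<in> G" "x \<noteq> 0" using A G_closed(1) by blast
    then have ne: "P \<noteq> {}" using P_total[OF x(1)] by blast
    {
      fix \<Lambda> :: "'f block_vec \<Rightarrow> 'f" assume "\<Lambda> \<in> weights"
      then interpret verma_weight G gt \<Lambda> by unfold_locales
      show "irreducible_module G (verma G gt \<Lambda>) \<longleftrightarrow> (\<exists>h\<in>block_grade 0. \<Lambda> h \<noteq> 0)"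
        by (rule verma_dense[OF ne dense])
    next
      interpret verma_weight G gt "\<lambda>_. 0" by unfold_locales (simp add: weights_def)
      have e: "verma0_prime G gt = VM.univ_map ` aug" unfolding verma0_prime_def by (rule verma_prime_image)
      show "block_submodule G (verma0_prime G gt) (verma G gt (\<lambda>_. 0)) \<and>
         irreducible_module G ((verma G gt (\<lambda>_. 0))\<lparr>carrier := verma0_prime G gt\<rparr>) \<longleftrightarrow>
         (\<forall>x\<in>P. \<forall>y\<in>P. \<exists>n::nat. n > 0 \<and> gt (of_nat n * x) y)"
        unfolding e by (rule verma_aug_dense[OF ne dense]) simp_all
    }
  next
    fix a and \<Lambda> :: "'f block_vec \<Rightarrow> 'f" assume a: "a \<in> P" "pos_below G gt a = {}" and "\<Lambda> \<in> weights"
    then interpret verma_weight G gt \<Lambda> by unfold_locales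
    show "irreducible_module G (verma G gt \<Lambda>) \<longleftrightarrow> irreducible_module (int_multiples a) (verma_sub G gt a \<Lambda>)"
      by (rule verma_discrete[OF a])
  }
qed

end
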